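(* Let $\varepsilon\le\frac13$ and $\delta\in(0,1)$. Suppose that $g(x,A)\le g(x,A')$ for all $x\in\mathcal{P}$ and all $A\subseteq A'$. In the setting $\mathcal{A}=2^U$ with the $L_\infty$ metric, we can compute a solution $\bar x\in\mathcal{P}$ satisfying $h_{p^*}(\bar x)\le(2+O(\varepsilon))\min_{x\in\mathcal{P}}h_{p^*}(x)$ with probability at least $1-\delta$, in time polynomial in $\mathcal{I}$, $\frac{\lambda}{\varepsilon r}$ and $\log(\frac1\delta)$.
   Context: $U$ is a finite ground set and the scenarios are all subsets $A\subseteq U$. $\mathcal{P}\subseteq\mathbb{R}^m_{\ge0}$ is a polytope of fractional first-stage decisions, $X=\mathcal{P}\cap\mathbb{Z}^m$, $c\in\mathbb{R}^m$ the first-stage cost vector, and $g(x,A)\ge0$ the optimal fractional second-stage cost of scenario $A$ given $x\in\mathcal{P}$. For a radius $0<r\le1$ and a central distribution $p^*$ on $2^U$ accessible only via independent samples, $h_{p^*}(x)=c^\top x+\max\{\mathbb{E}_{A\sim q}[g(x,A)]: q\text{ a distribution on }2^U,\ \max_A|p^*_A-q_A|\le r\}$. $\mathcal{I}$ is the input size. Standing assumptions: (P1) $0\in X$, $c\ge0$, $\log|X|$ polynomial in $\mathcal{I}$, $0\le g(x,A)\le g(0,A)$; (P2) $g(0,A)\le g(x,A)+\lambda c^\top x$ for a known $\lambda\ge1$; (P3) known $R$, $V\le1$ with $\mathcal{P}\subseteq\{\|x\|_2\le R\}$, $\mathcal{P}$ contains a ball of radius $V$, $\ln(R/V)$ polynomial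 in $\mathcal{I}$; (P4) $g(\cdot,A)$ is convex on $\mathcal{P}$ and efficiently computable; (P5') for every $x\in\mathcal{P},A$, a subgradient $d^{x,A}$ of $g(\cdot,A)$ at $x$ with $-\lambda c\le d^{x,A}\le0$ can be efficiently computed. *)

theory Defs
  imports
    "HOL-Probability.SPMF"
    "HOL-Computational_Algebra.Polynomial"
    "HOL-Library.Log_Nat"
    "Jordan_Normal_Form.Matrix"
begin

unbundle no inner_syntax
unbundle no vec_syntax

section \<open>Vectors, polytopes and encoding lengths\<close>

abbreviation real_vec :: "rat Matrix.vec \<Rightarrow> real Matrix.vec" where
  "real_vec \<equiv> map_vec real_of_rat"

definition norm2 :: "real Matrix.vec \<Rightarrow> real" where
  "norm2 x = sqrt (x \<bullet> x)"

definition polytope_vec :: "nat \<Rightarrow> real Matrix.vec set \<Rightarrow> bool" where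
  "polytope_vec m P \<longleftrightarrow>
     (\<exists>F. finite F \<and> F \<subseteq> carrier_vec m \<times> UNIV \<and>
          P = {x \<in> carrier_vec m. \<forall>(a, b) \<in> F. a \<bullet> x \<le> b}) \<and>
     (\<exists>B. \<forall>x\<in>P. norm2 x \<le> B)"

definition convex_fun_on :: "real Matrix.vec set \<Rightarrow> (real Matrix.vec \<Rightarrow> real) \<Rightarrow> bool" where
  "convex_fun_on P f \<longleftrightarrow>
     (\<forall>x\<in>P. \<forall>y\<in>P. \<forall>t. 0 \<le> t \<and> t \<le> 1 \<longrightarrow>
        f ((1 - t) \<cdot>\<^sub>v x + t \<cdot>\<^sub>v y) \<le> (1 - t) * f x + t * f y)"

definition subgradient_on ::
    "real Matrix.vec set \<Rightarrow> (real Matrix.vec \<Rightarrow> real) \<Rightarrow> real Matrix.vec \<Rightarrow> real Matrix.vec \<Rightarrow> bool" where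
  "subgradient_on P f x d \<longleftrightarrow> (\<forall>y\<in>P. f y \<ge> f x + d \<bullet> (y - x))"

text \<open>Binary encoding length: sign, numerator and denominator in lowest terms.\<close>

definition rat_size :: "rat \<Rightarrow> nat" where
  "rat_size q = (case quotient_of q of (a, b) \<Rightarrow> 1 + floorlog 2 (nat \<bar>a\<bar>) + floorlog 2 (nat b))"

definition vec_size :: "rat Matrix.vec \<Rightarrow> nat" where
  "vec_size v = (\<Sum>i<dim_vec v. rat_size (v $ i))"


section \<open>Instances\<close>

text \<open>
  The ground set is \<open>{..<usize}\<close>. The numerical data are rational, as they are part of the
  finite input of an algorithm; the polytope, the recourse function and the central distribution
  are arbitrary real objects, which an algorithm reaches only through oracles. \<open>orc_time b\<close> is the
  time needed to answer a query of encoding length \<open>b\<close>. \<open>isize\<close> is the input size; besides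
  the explicit numbers it may account for whatever describes the polytope and the recourse function.
\<close>

record drso =
  mdim :: nat
  usize :: nat
  cost1 :: "rat Matrix.vec"
  lam :: rat
  radius :: rat
  outer_rad :: rat
  inner_rad :: rat
  isize :: nat
  feas :: "real Matrix.vec set"
  recourse :: "real Matrix.vec \<Rightarrow> nat set \<Rightarrow> real"
  center :: "nat set pmf"
  value_orc :: "rat Matrix.vec \<Rightarrow> nat set \<Rightarrow> rat"
  subgrad_orc :: "rat Matrix.vec \<Rightarrow> nat set \<Rightarrow> rat Matrix.vec"
  sep_orc :: "rat Matrix.vec \<Rightarrow> rat Matrix.vec option"
  orc_time :: "nat \<Rightarrow> nat"

definition ground :: "drso \<Rightarrow> nat set" where
  "ground I = {..<usize I}"

definition scenarios :: "drso \<Rightarrow> nat set set" where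
  "scenarios I = Pow (ground I)"

definition int_feas :: "drso \<Rightarrow> real Matrix.vec set" where
  "int_feas I = {x \<in> feas I. \<forall>i<mdim I. x $ i \<in> \<int>}"

definition linf_dist :: "drso \<Rightarrow> nat set pmf \<Rightarrow> nat set pmf \<Rightarrow> real" where
  "linf_dist I p q = (MAX A\<in>scenarios I. \<bar>pmf p A - pmf q A\<bar>)"

definition ambiguity :: "drso \<Rightarrow> nat set pmf set" where
  "ambiguity I = {q. set_pmf q \<subseteq> scenarios I \<and> linf_dist I (center I) q \<le> real_of_rat (radius I)}"

text \<open>
  The supremum is a maximum: the distributions in the ball form a compact set and the expectation
  is linear in the distribution.
\<close>

definition robust_cost :: "drso \<Rightarrow> real Matrix.vec \<Rightarrow> real" where
  "robust_cost I x =
     real_vec (cost1 I) \<bullet> x +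
     (SUP q\<in>ambiguity I. measure_pmf.expectation q (\<lambda>A. recourse I x A))"


section \<open>Standing assumptions\<close>

text \<open>
  \<open>\<pi>\<close> is the polynomial behind all the phrases ``polynomial in the input size'' and
  ``efficiently computable''.
\<close>

definition basic_data :: "drso \<Rightarrow> bool" where
  "basic_data I \<longleftrightarrow>
     cost1 I \<in> carrier_vec (mdim I) \<and>
     0 < radius I \<and> radius I \<le> 1 \<and>
     polytope_vec (mdim I) (feas I) \<and> (\<forall>x\<in>feas I. 0\<^sub>v (mdim I) \<le> x) \<and>
     set_pmf (center I) \<subseteq> scenarios I \<and>
     mdim I + usize I + vec_size (cost1 I) + rat_size (lam I) + rat_size (radius I)
       + rat_size (outer_rad I) + rat_size (inner_rad I) \<le> isize I"

definition nonneg_costs :: "real poly \<Rightarrow> drso \<Rightarrow> bool" where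
  "nonneg_costs \<pi> I \<longleftrightarrow>
     0\<^sub>v (mdim I) \<in> int_feas I \<and> 0\<^sub>v (mdim I) \<le> cost1 I \<and>
     finite (int_feas I) \<and> ln (real (card (int_feas I))) \<le> poly \<pi> (real (isize I)) \<and>
     (\<forall>x\<in>feas I. \<forall>A\<in>scenarios I.
        0 \<le> recourse I x A \<and> recourse I x A \<le> recourse I (0\<^sub>v (mdim I)) A)"

definition bounded_inflation :: "drso \<Rightarrow> bool" where
  "bounded_inflation I \<longleftrightarrow>
     lam I \<ge> 1 \<and>
     (\<forall>x\<in>feas I. \<forall>A\<in>scenarios I.
        recourse I (0\<^sub>v (mdim I)) A
          \<le> recourse I x A + real_of_rat (lam I) * (real_vec (cost1 I) \<bullet> x))"

definition well_rounded :: "real poly \<Rightarrow> drso \<Rightarrow> bool" where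
  "well_rounded \<pi> I \<longleftrightarrow>
     0 < outer_rad I \<and> 0 < inner_rad I \<and> inner_rad I \<le> 1 \<and>
     (\<forall>x\<in>feas I. norm2 x \<le> real_of_rat (outer_rad I)) \<and>
     (\<exists>z\<in>carrier_vec (mdim I).
        {y \<in> carrier_vec (mdim I). norm2 (y - z) \<le> real_of_rat (inner_rad I)} \<subseteq> feas I) \<and>
     ln (real_of_rat (outer_rad I) / real_of_rat (inner_rad I)) \<le> poly \<pi> (real (isize I))"

text \<open>
  Efficient access to the polytope: a strong separation oracle, returning \<open>None\<close> on members
  and the normal of a strictly separating hyperplane on non-members.
\<close>

definition efficient_feas :: "real poly \<Rightarrow> drso \<Rightarrow> bool" where
  "efficient_feas \<pi> I \<longleftrightarrow>
     (\<forall>b. real (orc_time I b) \<le> poly \<pi> (real (isize I + b))) \<and>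
     (\<forall>x\<in>carrier_vec (mdim I).
        (case sep_orc I x of
           None \<Rightarrow> real_vec x \<in> feas I
         | Some a \<Rightarrow> a \<in> carrier_vec (mdim I) \<and>
             (\<forall>y\<in>feas I. real_vec a \<bullet> y < real_vec a \<bullet> real_vec x) \<and>
             vec_size a \<le> orc_time I (vec_size x)))"

definition efficient_convex_recourse :: "drso \<Rightarrow> bool" where
  "efficient_convex_recourse I \<longleftrightarrow>
     (\<forall>A\<in>scenarios I. convex_fun_on (feas I) (\<lambda>x. recourse I x A)) \<and>
     (\<forall>x\<in>carrier_vec (mdim I). \<forall>A\<in>scenarios I. real_vec x \<in> feas I \<longrightarrow>
        real_of_rat (value_orc I x A) = recourse I (real_vec x) A \<and>
        rat_size (value_orc I x A) \<le> orc_time I (vec_size x + usize I))"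

definition good_subgradient :: "drso \<Rightarrow> real Matrix.vec \<Rightarrow> nat set \<Rightarrow> real Matrix.vec \<Rightarrow> bool" where
  "good_subgradient I x A d \<longleftrightarrow>
     d \<in> carrier_vec (mdim I) \<and>
     subgradient_on (feas I) (\<lambda>y. recourse I y A) x d \<and>
     - (real_of_rat (lam I) \<cdot>\<^sub>v real_vec (cost1 I)) \<le> d \<and> d \<le> 0\<^sub>v (mdim I)"

definition efficient_subgradients :: "drso \<Rightarrow> bool" where
  "efficient_subgradients I \<longleftrightarrow>
     (\<forall>x\<in>feas I. \<forall>A\<in>scenarios I. \<exists>d. good_subgradient I x A d) \<and>
     (\<forall>x\<in>carrier_vec (mdim I). \<forall>A\<in>scenarios I. real_vec x \<in> feas I \<longrightarrow>
        good_subgradient I (real_vec x) A (real_vec (subgrad_orc I x A)) \<and>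
        vec_size (subgrad_orc I x A) \<le> orc_time I (vec_size x + usize I))"

definition standing_assumptions :: "real poly \<Rightarrow> drso \<Rightarrow> bool" where
  "standing_assumptions \<pi> I \<longleftrightarrow>
     basic_data I \<and> nonneg_costs \<pi> I \<and> bounded_inflation I \<and> well_rounded \<pi> I \<and>
     efficient_feas \<pi> I \<and> efficient_convex_recourse I \<and> efficient_subgradients I"

definition monotone_recourse :: "drso \<Rightarrow> bool" where
  "monotone_recourse I \<longleftrightarrow>
     (\<forall>x\<in>feas I. \<forall>A\<in>scenarios I. \<forall>A'\<in>scenarios I. A \<subseteq> A' \<longrightarrow> recourse I x A \<le> recourse I x A')"


section \<open>Model of computation\<close>

text \<open>
  A random access machine over the rationals with logarithmic cost: an instruction is charged the
  encoding lengths of the numbers it reads, so that time agrees with Turing machine time up to a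
  polynomial. The memory consists of arrays \<open>M a\<close> of rationals; \<open>M a 0\<close> serves as the scalar
  register \<open>a\<close>. The central distribution is accessible only through \<open>Sample\<close>, each execution
  of which draws a fresh independent scenario.
\<close>

datatype arith = Plus | Minus | Times | Divide

datatype com =
    Const nat rat
  | Arith arith nat nat nat
  | Floor nat nat
  | Load nat nat nat
  | Store nat nat nat
  | Sample nat
  | Value nat nat nat
  | Subgrad nat nat nat
  | Separate nat nat nat
  | Seq com com
  | Cond nat com com
  | While nat com

type_synonym memory = "nat \<Rightarrow> nat \<Rightarrow> rat"
type_synonym config = "memory \<times> nat"

fun arith_op :: "arith \<Rightarrow> rat \<Rightarrow> rat \<Rightarrow> rat" where
  "arith_op Plus p q = p + q"
| "arith_op Minus p q = p - q"
| "arith_op Times p q = p * q"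
| "arith_op Divide p q = p / q"

definition set_cell :: "nat \<Rightarrow> nat \<Rightarrow> rat \<Rightarrow> memory \<Rightarrow> memory" where
  "set_cell a i q M = M(a := (M a)(i := q))"

definition set_vec :: "nat \<Rightarrow> rat Matrix.vec \<Rightarrow> memory \<Rightarrow> memory" where
  "set_vec a v M = M(a := (\<lambda>i. if i < dim_vec v then v $ i else M a i))"

definition get_vec :: "nat \<Rightarrow> nat \<Rightarrow> memory \<Rightarrow> rat Matrix.vec" where
  "get_vec a k M = Matrix.vec k (M a)"

definition get_scenario :: "nat \<Rightarrow> nat \<Rightarrow> memory \<Rightarrow> nat set" where
  "get_scenario a k M = {i. i < k \<and> M a i \<noteq> 0}"

definition index_of :: "rat \<Rightarrow> nat" where
  "index_of q = nat \<lfloor>q\<rfloor>"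

definition oracle_cost :: "drso \<Rightarrow> nat \<Rightarrow> nat" where
  "oracle_cost I b = 1 + b + orc_time I b"

text \<open>
  \<open>exec I k c (M, t)\<close> is the subprobability distribution of the final configuration when \<open>c\<close> is
  started in memory \<open>M\<close> after time \<open>t\<close>; \<open>k\<close> bounds the recursion depth, and the missing
  mass is the probability that this bound is exceeded.
\<close>

fun exec :: "drso \<Rightarrow> nat \<Rightarrow> com \<Rightarrow> config \<Rightarrow> config spmf" where
  "exec I 0 c s = return_pmf None"
| "exec I (Suc k) (Const a q) (M, t) = return_spmf (set_cell a 0 q M, t + 1 + rat_size q)"
| "exec I (Suc k) (Arith f a b c) (M, t) =
     return_spmf (set_cell a 0 (arith_op f (M b 0) (M c 0)) M,
                  t + 1 + rat_size (M b 0) + rat_size (M c 0))"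
| "exec I (Suc k) (Floor a b) (M, t) =
     return_spmf (set_cell a 0 (of_int \<lfloor>M b 0\<rfloor>) M, t + 1 + rat_size (M b 0))"
| "exec I (Suc k) (Load a b c) (M, t) =
     (let q = M b (index_of (M c 0))
      in return_spmf (set_cell a 0 q M, t + 1 + rat_size (M c 0) + rat_size q))"
| "exec I (Suc k) (Store a b c) (M, t) =
     return_spmf (set_cell a (index_of (M b 0)) (M c 0) M,
                  t + 1 + rat_size (M b 0) + rat_size (M c 0))"
| "exec I (Suc k) (Sample a) (M, t) =
     map_spmf (\<lambda>A. (set_vec a (Matrix.vec (usize I) (\<lambda>i. if i \<in> A then 1 else 0)) M,
                    t + 1 + usize I))
       (spmf_of_pmf (center I))"
| "exec I (Suc k) (Value a b c) (M, t) =
     (let x = get_vec b (mdim I) M; A = get_scenario c (usize I) M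
      in return_spmf (set_cell a 0 (value_orc I x A) M,
                      t + oracle_cost I (vec_size x + usize I)))"
| "exec I (Suc k) (Subgrad a b c) (M, t) =
     (let x = get_vec b (mdim I) M; A = get_scenario c (usize I) M
      in return_spmf (set_vec a (subgrad_orc I x A) M,
                      t + oracle_cost I (vec_size x + usize I)))"
| "exec I (Suc k) (Separate a b c) (M, t) =
     (let x = get_vec c (mdim I) M
      in return_spmf
           (case sep_orc I x of
              None \<Rightarrow> set_cell a 0 0 M
            | Some d \<Rightarrow> set_cell a 0 1 (set_vec b d M),
            t + oracle_cost I (vec_size x)))"
| "exec I (Suc k) (Seq c1 c2) s = bind_spmf (exec I k c1 s) (exec I k c2)"
| "exec I (Suc k) (Cond a c1 c2) (M, t) =
     exec I k (if M a 0 > 0 then c1 else c2) (M, t + 1 + rat_size (M a 0))"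
| "exec I (Suc k) (While a c) (M, t) =
     (let t' = t + 1 + rat_size (M a 0)
      in if M a 0 > 0 then bind_spmf (exec I k c (M, t')) (exec I k (While a c))
         else return_spmf (M, t'))"

text \<open>
  Input: array 0 holds the first-stage costs, array 1 the parameters. The accuracy and
  the confidence may be arbitrary reals; the machine is told \<open>\<lceil>1/\<epsilon>\<rceil>\<close> and
  \<open>\<lceil>log 2 (1/\<delta>)\<rceil>\<close>, so that reading them takes no longer than the claimed time bound.
  Output: array 2.
\<close>

definition input_params :: "drso \<Rightarrow> real \<Rightarrow> real \<Rightarrow> rat list" where
  "input_params I \<epsilon> \<delta> =
     [of_nat (mdim I), of_nat (usize I), lam I, radius I, outer_rad I, inner_rad I,
      of_int \<lceil>1 / \<epsilon>\<rceil>, of_int \<lceil>log 2 (1 / \<delta>)\<rceil>]"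

definition initial_config :: "drso \<Rightarrow> real \<Rightarrow> real \<Rightarrow> config" where
  "initial_config I \<epsilon> \<delta> =
     (set_vec 0 (cost1 I) (set_vec 1 (vec_of_list (input_params I \<epsilon> \<delta>)) (\<lambda>a i. 0)), 0)"

definition answer :: "drso \<Rightarrow> config \<Rightarrow> real Matrix.vec" where
  "answer I s = real_vec (get_vec 2 (mdim I) (fst s))"

definition run_time :: "config \<Rightarrow> nat" where
  "run_time s = snd s"

end

theory Submission
  imports Defs "HOL-Probability.Hoeffding" "Jordan_Normal_Form.Determinant" "HOL-Library.Nat_Bijection"
begin

unbundle no vec_syntax
unbundle no inner_syntax

text \<open>
  Write \<open>M\<close> for the mass that the central distribution puts on scenarios after truncating all
  probabilities at \<open>r\<close>. Moving to a distribution in the ball adds at most \<open>r\<close> to every scenario and at most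
  \<open>M\<close> in total, and conversely any such addition is dominated by a distribution in the ball; hence the sum
  of the expected cost under the centre and of the best gain of a shift of mass \<open>M\<close> lies between
  \<open>h\<close> and \<open>2 h\<close>. This sum is estimated from samples. By monotonicity the gain is computed greedily: the
  best scenarios not yet used are found among those obtained from used ones by deleting one element,
  starting from the full scenario. The resulting convex function is minimised by a cutting plane method that
  keeps a simplex with rational vertices: cutting through the centroid and rescaling the simplex about one
  vertex shrinks its volume by a factor that depends only on the dimension, and rounding the scaling
  factors to a fixed grid keeps the numbers short. Only finitely many grid points can occur as queries, so
  a union bound over them makes the estimate uniform.
\<close>

section \<open>Rationals of bounded encoding length\<close>

definition fits :: "nat \<Rightarrow> rat \<Rightarrow> bool" where
  "fits b q \<longleftrightarrow> (\<exists>n d::int. 0 < d \<and> \<bar>n\<bar> \<le> 2 ^ b \<and> d \<le> 2 ^ b \<and> q = of_int n / of_int d)"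

lemma fitsI: "0 < d \<Longrightarrow> \<bar>n\<bar> \<le> 2 ^ b \<Longrightarrow> d \<le> 2 ^ b \<Longrightarrow> q = of_int n / of_int d \<Longrightarrow> fits b q"
  unfolding fits_def by blast

lemma fitsE:
  assumes "fits b q"
  obtains n d :: int where "0 < d" "\<bar>n\<bar> \<le> 2 ^ b" "d \<le> 2 ^ b" "q = of_int n / of_int d"
  using assms unfolding fits_def by blast

lemma fits_mono:
  assumes "fits b q" "b \<le> c"
  shows "fits c q"
proof -
  from assms(1) obtain n d where q: "0 < d" "\<bar>n\<bar> \<le> 2 ^ b" "d \<le> 2 ^ b" "q = of_int n / of_int d" by (rule fitsE)
  have "(2::int) ^ b \<le> 2 ^ c" using assms(2) by (intro power_increasing) auto
  with q show ?thesis by (intro fitsI[of d n]) linarith+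
qed

lemma fits_of_int: "\<bar>n\<bar> \<le> 2 ^ b \<Longrightarrow> fits b (of_int n)"
  by (rule fitsI[of 1 n]) auto

lemma fits_of_nat: "n \<le> 2 ^ b \<Longrightarrow> fits b (of_nat n)"
  using fits_of_int[of "int n" b] by (metis abs_of_nat of_int_of_nat_eq of_nat_le_iff of_nat_numeral of_nat_power)

lemma le_two_power: "n \<le> b \<Longrightarrow> n \<le> (2::nat) ^ b"
  using less_exp[of b] by linarith

lemma fits_of_nat_le: "n \<le> b \<Longrightarrow> fits b (of_nat n)"
  by (intro fits_of_nat le_two_power)

lemma fits_0 [simp]: "fits b 0" and fits_1 [simp]: "fits b 1"
  using fits_of_int[of 0 b] fits_of_int[of 1 b] by auto

lemma fits_mult:
  assumes "fits b x" "fits c y"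
  shows "fits (b + c) (x * y)"
proof -
  from assms(1) obtain n d where x: "0 < d" "\<bar>n\<bar> \<le> 2 ^ b" "d \<le> 2 ^ b" "x = of_int n / of_int d" by (rule fitsE)
  from assms(2) obtain n' d' where y: "0 < d'" "\<bar>n'\<bar> \<le> 2 ^ c" "d' \<le> 2 ^ c" "y = of_int n' / of_int d'"
    by (rule fitsE)
  show ?thesis
    by (rule fitsI[of "d * d'" "n * n'"]) (use x y in \<open>auto simp: power_add abs_mult intro!: mult_mono\<close>)
qed

lemma fits_minus: "fits b x \<Longrightarrow> fits b (- x)"
  unfolding fits_def by (metis abs_minus_cancel minus_divide_left of_int_minus)

lemma fits_inverse:
  assumes "fits b x"
  shows "fits b (inverse x)"
proof -
  from assms obtain n d where x: "0 < d" "\<bar>n\<bar> \<le> 2 ^ b" "d \<le> 2 ^ b" "x = of_int n / of_int d" by (rule fitsE)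
  show ?thesis
  proof (cases "n = 0")
    case False
    have "inverse x = of_int (sgn n * d) / of_int \<bar>n\<bar>"
      using False x by (cases "n > 0") (auto simp: sgn_if)
    then show ?thesis
      by (intro fitsI[of "\<bar>n\<bar>" "sgn n * d"]) (use False x in \<open>auto simp: sgn_if\<close>)
  qed (use x in simp)
qed

lemma fits_divide: "fits b x \<Longrightarrow> fits c y \<Longrightarrow> fits (b + c) (x / y)"
  unfolding divide_inverse by (intro fits_mult fits_inverse)

lemma fits_add:
  assumes "fits b x" "fits c y"
  shows "fits (b + c + 1) (x + y)"
proof -
  from assms(1) obtain n d where x: "0 < d" "\<bar>n\<bar> \<le> 2 ^ b" "d \<le> 2 ^ b" "x = of_int n / of_int d" by (rule fitsE)
  from assms(2) obtain n' d' where y: "0 < d'" "\<bar>n'\<bar> \<le> 2 ^ c" "d' \<le> 2 ^ c" "y = of_int n' / of_int d'"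
    by (rule fitsE)
  have "\<bar>n * d'\<bar> \<le> 2 ^ b * 2 ^ c" "\<bar>n' * d\<bar> \<le> 2 ^ c * 2 ^ b" "d * d' \<le> 2 ^ b * 2 ^ c"
    using x y by (auto simp: abs_mult intro!: mult_mono)
  moreover have "\<bar>n * d' + n' * d\<bar> \<le> \<bar>n * d'\<bar> + \<bar>n' * d\<bar>" by (rule abs_triangle_ineq)
  moreover have "(2::int) ^ b * 2 ^ c > 0" by simp
  ultimately have "\<bar>n * d' + n' * d\<bar> \<le> 2 ^ (b + c + 1)" "d * d' \<le> 2 ^ (b + c + 1)"
    by (simp_all add: power_add mult.commute del: zero_less_power)
  moreover have "x + y = of_int (n * d' + n' * d) / of_int (d * d')"
    using x y by (simp add: add_frac_eq)
  ultimately show ?thesis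
    using x(1) y(1) by (intro fitsI[of "d * d'" "n * d' + n' * d"]) auto
qed

lemma fits_diff: "fits b x \<Longrightarrow> fits c y \<Longrightarrow> fits (b + c + 1) (x - y)"
  using fits_add[of b x c "- y"] by (simp add: fits_minus)

lemma fits_floor:
  assumes "fits b x"
  shows "fits b (of_int \<lfloor>x\<rfloor>)"
proof -
  from assms obtain n d where x: "0 < d" "\<bar>n\<bar> \<le> 2 ^ b" "d \<le> 2 ^ b" "x = of_int n / of_int d" by (rule fitsE)
  have "\<lfloor>x\<rfloor> = n div d" using x by (simp add: floor_divide_of_int_eq)
  moreover have "\<bar>n div d\<bar> \<le> \<bar>n\<bar>"
  proof (cases "n \<ge> 0")
    case True
    then show ?thesis using x(1) zdiv_mono2[of n 1 d] by (simp add: pos_imp_zdiv_nonneg_iff)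
  next
    case False
    then have "n \<le> n div d" using x(1) zdiv_mono2_neg[of n 1 d] by simp
    moreover have "n div d < 0" using False x(1) by (simp add: pos_imp_zdiv_neg_iff)
    ultimately show ?thesis using False by linarith
  qed
  ultimately show ?thesis using x by (intro fits_of_int) linarith
qed

lemma fits_sum:
  assumes "\<And>i. i < n \<Longrightarrow> fits b (f i)"
  shows "fits (n * (b + 1)) (\<Sum>i<n. f i)"
  using assms
proof (induction n)
  case (Suc n)
  then have "fits (n * (b + 1) + b + 1) ((\<Sum>i<n. f i) + f n)" by (intro fits_add) auto
  then show ?case by (simp add: algebra_simps)
qed simp

lemma fits_partial_sum:
  assumes "\<And>i. i < n \<Longrightarrow> fits b (f i)" "j \<le> n"
  shows "fits (n * (b + 1)) (\<Sum>i<j. f i)"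
  using fits_mono[OF fits_sum[of j b f] mult_right_mono[OF assms(2)]] assms by simp

lemma fits_arith_op: "fits b x \<Longrightarrow> fits c y \<Longrightarrow> fits (b + c + 1) (arith_op f x y)"
  using fits_add[of b x c y] fits_diff[of b x c y] fits_mono[OF fits_mult[of b x c y]]
    fits_mono[OF fits_divide[of b x c y]]
  by (cases f) auto

lemma le_of_fits:
  assumes "fits b q"
  shows "q \<le> 2 ^ b"
proof -
  from assms obtain n d where q: "0 < d" "\<bar>n\<bar> \<le> 2 ^ b" "d \<le> 2 ^ b" "q = of_int n / of_int d" by (rule fitsE)
  have "n \<le> 2 ^ b * 1" using q by simp
  also have "\<dots> \<le> 2 ^ b * d" using q by (intro mult_left_mono) auto
  finally have "of_int n \<le> (of_int (2 ^ b * d) :: rat)" by (simp only: of_int_le_iff)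
  then show ?thesis using q by (simp add: divide_le_eq mult.commute)
qed

lemma nat_le_of_fits:
  assumes "fits b (of_nat n)"
  shows "n \<le> 2 ^ b"
proof -
  have "(of_nat n :: rat) \<le> of_nat (2 ^ b)" using le_of_fits[OF assms] by simp
  then show ?thesis by (simp only: of_nat_le_iff)
qed

lemma fits_rat_size: "fits (rat_size q) q"
proof -
  obtain a b where ab: "quotient_of q = (a, b)" by (cases "quotient_of q")
  have floorlog: "n \<le> 2 ^ k" if "floorlog 2 (nat n) \<le> k" for n :: int and k
  proof -
    have "nat n < 2 ^ floorlog 2 (nat n)"
      using floorlog_bounds[of "nat n" 2] by (cases "nat n = 0") (auto simp: floorlog_def)
    also have "\<dots> \<le> 2 ^ k" using that by (intro power_increasing) auto
    finally have "int (nat n) < int (2 ^ k)" by (simp only: of_nat_less_iff)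
    moreover have "n \<le> int (nat n)" "int (2 ^ k) = 2 ^ k" by simp_all
    ultimately show ?thesis by linarith
  qed
  have "rat_size q = 1 + floorlog 2 (nat \<bar>a\<bar>) + floorlog 2 (nat b)" by (simp add: rat_size_def ab)
  then have "floorlog 2 (nat \<bar>a\<bar>) \<le> rat_size q" "floorlog 2 (nat b) \<le> rat_size q" by simp_all
  then have "\<bar>a\<bar> \<le> 2 ^ rat_size q" "b \<le> 2 ^ rat_size q" using floorlog by blast+
  then show ?thesis using quotient_of_denom_pos[OF ab] quotient_of_div[OF ab] by (intro fitsI[of b a])
qed

lemma rat_size_le:
  assumes "fits b q"
  shows "rat_size q \<le> 2 * b + 3"
proof -
  from assms obtain n d where q: "0 < d" "\<bar>n\<bar> \<le> 2 ^ b" "d \<le> 2 ^ b" "q = of_int n / of_int d" by (rule fitsE)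
  have quot: "quotient_of q = (n div gcd n d, d div gcd n d)"
    using q by (simp add: Fract_of_int_quotient[symmetric] quotient_of_Fract normalize_def Let_def)
  have gcd: "1 \<le> gcd n d" using q(1) gcd_pos_int[of n d] by linarith
  have floorlog: "floorlog 2 k \<le> b + 1" if "k \<le> 2 ^ b" for k
  proof (cases "k = 0")
    case False
    then have "2 ^ (floorlog 2 k - 1) \<le> k" using floorlog_bounds[of k 2] by auto
    then have "2 ^ (floorlog 2 k - 1) \<le> (2::nat) ^ b" using that by linarith
    then show ?thesis by (simp add: power_increasing_iff)
  qed (simp add: floorlog_def)
  have "\<bar>n\<bar> = \<bar>n div gcd n d\<bar> * gcd n d" using gcd
    by (metis abs_mult abs_of_nonneg dvd_div_mult_self gcd_dvd1 gcd_ge_0_int)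
  moreover have "\<bar>n div gcd n d\<bar> * 1 \<le> \<bar>n div gcd n d\<bar> * gcd n d" using gcd by (intro mult_left_mono) linarith+
  ultimately have num: "\<bar>n div gcd n d\<bar> \<le> 2 ^ b" using q(2) by linarith
  have den: "d div gcd n d \<le> 2 ^ b" using gcd q(1,3) zdiv_mono2[of d 1 "gcd n d"] by simp
  have "floorlog 2 (nat \<bar>n div gcd n d\<bar>) \<le> b + 1" "floorlog 2 (nat (d div gcd n d)) \<le> b + 1"
    using num den floorlog[of "nat \<bar>n div gcd n d\<bar>"] floorlog[of "nat (d div gcd n d)"]
    by (simp_all add: nat_le_iff)
  then show ?thesis by (simp add: rat_size_def quot)
qed

section \<open>Execution of programs\<close>

text \<open>The randomness of a run is separated from its effect: \<open>w\<close> is the outcome of all draws, and \<open>F w\<close>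
  consists of the final memory and the elapsed time.\<close>

definition runs :: "drso \<Rightarrow> com \<Rightarrow> memory \<Rightarrow> 'w pmf \<Rightarrow> ('w \<Rightarrow> memory \<times> nat) \<Rightarrow> bool" where
  "runs I c M P F \<longleftrightarrow> (\<exists>k0. \<forall>k\<ge>k0. \<forall>t0. exec I k c (M, t0) =
    map_spmf (\<lambda>w. (fst (F w), t0 + snd (F w))) (spmf_of_pmf P))"

abbreviation runs_det :: "drso \<Rightarrow> com \<Rightarrow> memory \<Rightarrow> memory \<Rightarrow> nat \<Rightarrow> bool" where
  "runs_det I c M M' t \<equiv> runs I c M (return_pmf ()) (\<lambda>_. (M', t))"

lemma runs_reindex: "runs I c M (map_pmf f P) F = runs I c M P (F \<circ> f)"
  by (simp add: runs_def pmf.map_comp o_def)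

lemma runs_step:
  assumes "\<And>k t0. fuel \<le> k \<Longrightarrow> exec I (Suc k) c (M, t0) = map_spmf (\<lambda>w. (fst (F w), t0 + snd (F w))) (spmf_of_pmf P)"
  shows "runs I c M P F"
  unfolding runs_def
proof (intro exI[of _ "Suc fuel"] allI impI)
  fix k t0 assume "Suc fuel \<le> k"
  then obtain k' where "k = Suc k'" "fuel \<le> k'" by (cases k) auto
  then show "exec I k c (M, t0) = map_spmf (\<lambda>w. (fst (F w), t0 + snd (F w))) (spmf_of_pmf P)" using assms by simp
qed

lemma runs_detI:
  assumes "\<And>k t0. exec I (Suc k) c (M, t0) = return_spmf (M', t0 + t)"
  shows "runs_det I c M M' t"
  by (rule runs_step[where fuel = 0]) (simp add: assms)

lemma runs_Sample:
  "runs I (Sample a) M (center I)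
    (\<lambda>A. (set_vec a (Matrix.vec (usize I) (\<lambda>i. if i \<in> A then 1 else 0)) M, 1 + usize I))"
  by (rule runs_step[where fuel = 0]) (simp add: add.assoc)

lemma uniform_fuel:
  assumes "finite X" "\<And>w. w \<in> X \<Longrightarrow> \<exists>k0. \<forall>k\<ge>k0. R w k"
  shows "\<exists>k0::nat. \<forall>w\<in>X. \<forall>k\<ge>k0. R w k"
proof -
  from assms(2) obtain K where K: "\<And>w k. w \<in> X \<Longrightarrow> K w \<le> k \<Longrightarrow> R w k" by metis
  have "K w \<le> Max (insert 0 (K ` X))" if "w \<in> X" for w using assms(1) that by (intro Max_ge) auto
  then show ?thesis using K by (intro exI[of _ "Max (insert 0 (K ` X))"]) (meson order_trans)
qed

lemma bind_exec_runs:
  assumes "runs I c1 M P F" "finite (set_pmf P)" "\<And>v. v \<in> set_pmf P \<Longrightarrow> runs I c2 (fst (F v)) P' (F' v)"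
  shows "\<exists>k0. \<forall>k\<ge>k0. \<forall>t0. bind_spmf (exec I k c1 (M, t0)) (exec I k c2) =
    map_spmf (\<lambda>(v, w). (fst (F' v w), t0 + (snd (F v) + snd (F' v w)))) (spmf_of_pmf (pair_pmf P P'))"
proof -
  from assms(1) obtain k1 where first:
    "\<And>k t0. k1 \<le> k \<Longrightarrow> exec I k c1 (M, t0) = map_spmf (\<lambda>w. (fst (F w), t0 + snd (F w))) (spmf_of_pmf P)"
    unfolding runs_def by blast
  have "\<exists>k0. \<forall>v\<in>set_pmf P. \<forall>k\<ge>k0. \<forall>t0. exec I k c2 (fst (F v), t0) =
      map_spmf (\<lambda>w. (fst (F' v w), t0 + snd (F' v w))) (spmf_of_pmf P')"
    using assms(3) by (intro uniform_fuel[OF assms(2)]) (simp add: runs_def)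
  then obtain k2 where second: "\<And>v k t0. v \<in> set_pmf P \<Longrightarrow> k2 \<le> k \<Longrightarrow> exec I k c2 (fst (F v), t0) =
      map_spmf (\<lambda>w. (fst (F' v w), t0 + snd (F' v w))) (spmf_of_pmf P')" by blast
  show ?thesis
  proof (intro exI[of _ "max k1 k2"] allI impI)
    fix k t0 assume k: "max k1 k2 \<le> k"
    have "bind_spmf (exec I k c1 (M, t0)) (exec I k c2) =
        bind_spmf (spmf_of_pmf P) (\<lambda>v. exec I k c2 (fst (F v), t0 + snd (F v)))"
      using k unfolding first[OF max.cobounded1[THEN order_trans, OF k]] bind_map_spmf by (simp only: o_def)
    also have "\<dots> = bind_spmf (spmf_of_pmf P)
      (\<lambda>v. map_spmf (\<lambda>w. (fst (F' v w), t0 + snd (F v) + snd (F' v w))) (spmf_of_pmf P'))"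
      using k second by (intro bind_spmf_cong) auto
    also have "\<dots> = map_spmf (\<lambda>(v, w). (fst (F' v w), t0 + (snd (F v) + snd (F' v w))))
      (spmf_of_pmf (pair_pmf P P'))"
      by (simp add: pair_pmf_def spmf_of_pmf_bind map_bind_pmf pmf.map_comp o_def add.assoc flip: map_pmf_def)
    finally show "bind_spmf (exec I k c1 (M, t0)) (exec I k c2) =
        map_spmf (\<lambda>(v, w). (fst (F' v w), t0 + (snd (F v) + snd (F' v w)))) (spmf_of_pmf (pair_pmf P P'))" .
  qed
qed

lemma runs_Seq:
  assumes "runs I c1 M P F" "finite (set_pmf P)" "\<And>v. v \<in> set_pmf P \<Longrightarrow> runs I c2 (fst (F v)) P' (F' v)"
  shows "runs I (Seq c1 c2) M (pair_pmf P P') (\<lambda>(v, w). (fst (F' v w), snd (F v) + snd (F' v w)))"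
proof -
  obtain k0 where "\<And>k t0. k0 \<le> k \<Longrightarrow> bind_spmf (exec I k c1 (M, t0)) (exec I k c2) =
      map_spmf (\<lambda>(v, w). (fst (F' v w), t0 + (snd (F v) + snd (F' v w)))) (spmf_of_pmf (pair_pmf P P'))"
    using bind_exec_runs[OF assms] by blast
  then show ?thesis by (intro runs_step[where fuel = k0]) (simp add: split_def)
qed

lemma runs_While_True:
  assumes "M a 0 > 0" "runs I c M P F" "finite (set_pmf P)"
    "\<And>v. v \<in> set_pmf P \<Longrightarrow> runs I (While a c) (fst (F v)) P' (F' v)"
  shows "runs I (While a c) M (pair_pmf P P')
    (\<lambda>(v, w). (fst (F' v w), 1 + rat_size (M a 0) + (snd (F v) + snd (F' v w))))"
proof -
  obtain k0 where "\<And>k t0. k0 \<le> k \<Longrightarrow> bind_spmf (exec I k c (M, t0)) (exec I k (While a c)) =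
      map_spmf (\<lambda>(v, w). (fst (F' v w), t0 + (snd (F v) + snd (F' v w)))) (spmf_of_pmf (pair_pmf P P'))"
    using bind_exec_runs[OF assms(2-4)] by blast
  then show ?thesis using assms(1) by (intro runs_step[where fuel = k0]) (simp add: split_def Let_def add.assoc)
qed

lemma runs_While_False: "\<not> M a 0 > 0 \<Longrightarrow> runs_det I (While a c) M M (1 + rat_size (M a 0))"
  by (rule runs_detI) simp

lemma runs_Cond:
  assumes "runs I (if M a 0 > 0 then c1 else c2) M P F"
  shows "runs I (Cond a c1 c2) M P (\<lambda>w. (fst (F w), 1 + rat_size (M a 0) + snd (F w)))"
proof -
  from assms obtain k0 where "\<And>k t0. k0 \<le> k \<Longrightarrow> exec I k (if M a 0 > 0 then c1 else c2) (M, t0) =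
      map_spmf (\<lambda>w. (fst (F w), t0 + snd (F w))) (spmf_of_pmf P)"
    unfolding runs_def by blast
  then show ?thesis by (intro runs_step[where fuel = k0]) (simp only: exec.simps fst_conv snd_conv add.assoc)
qed

primrec writes :: "com \<Rightarrow> nat set" where
  "writes (Const a q) = {a}"
| "writes (Arith f a b c) = {a}"
| "writes (Floor a b) = {a}"
| "writes (Load a b c) = {a}"
| "writes (Store a b c) = {a}"
| "writes (Sample a) = {a}"
| "writes (Value a b c) = {a}"
| "writes (Subgrad a b c) = {a}"
| "writes (Separate a b c) = {a, b}"
| "writes (Seq c1 c2) = writes c1 \<union> writes c2"
| "writes (Cond a c1 c2) = writes c1 \<union> writes c2"
| "writes (While a c) = writes c"

lemma exec_frame:
  "s' \<in> set_spmf (exec I k c s) \<Longrightarrow> a \<notin> writes c \<Longrightarrow> fst s' a = fst s a"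
proof (induction I k c s arbitrary: s' rule: exec.induct)
  case seq: (11 I k c1 c2 s)
  from seq.prems obtain s1 where s1: "s1 \<in> set_spmf (exec I k c1 s)" "s' \<in> set_spmf (exec I k c2 s1)"
    by (auto simp: set_bind_spmf)
  then show ?case using seq.IH(1)[OF s1(1)] seq.IH(2)[OF s1(2)] seq.prems(2) by simp
next
  case cond: (12 I k a b c1 M t)
  then show ?case by (auto split: if_splits)
next
  case loop: (13 I k b c M t)
  show ?case
  proof (cases "M b 0 > 0")
    case True
    with loop.prems obtain s1 where s1: "s1 \<in> set_spmf (exec I k c (M, t + 1 + rat_size (M b 0)))"
      "s' \<in> set_spmf (exec I k (While b c) s1)"
      by (auto simp: set_bind_spmf Let_def)
    show ?thesis using loop.IH(1)[OF refl True s1(1)] loop.IH(2)[OF refl True s1(2)] loop.prems(2) by simp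
  qed (use loop.prems in \<open>auto simp: Let_def\<close>)
qed (auto simp: Let_def set_cell_def set_vec_def split: option.splits)

lemma runs_frame:
  assumes "runs I c M P F" "w \<in> set_pmf P" "a \<notin> writes c"
  shows "fst (F w) a = M a"
proof -
  from assms(1) obtain k where "exec I k c (M, 0) = map_spmf (\<lambda>w. (fst (F w), 0 + snd (F w))) (spmf_of_pmf P)"
    unfolding runs_def by blast
  then have "(fst (F w), snd (F w)) \<in> set_spmf (exec I k c (M, 0))" using assms(2) by auto
  from exec_frame[OF this assms(3)] show ?thesis by simp
qed

section \<open>Expressions\<close>

datatype expr = Reg nat | Num nat | Bin arith expr expr | Flr expr | Cell nat expr

primrec expr_val :: "expr \<Rightarrow> memory \<Rightarrow> rat" where
  "expr_val (Reg a) M = M a 0"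
| "expr_val (Num n) M = of_nat n"
| "expr_val (Bin f e1 e2) M = arith_op f (expr_val e1 M) (expr_val e2 M)"
| "expr_val (Flr e) M = of_int \<lfloor>expr_val e M\<rfloor>"
| "expr_val (Cell a e) M = M a (index_of (expr_val e M))"

primrec nodes :: "expr \<Rightarrow> nat" where
  "nodes (Reg a) = 1"
| "nodes (Num n) = 1"
| "nodes (Bin f e1 e2) = nodes e1 + nodes e2 + 1"
| "nodes (Flr e) = nodes e + 1"
| "nodes (Cell a e) = nodes e + 1"

primrec expr_regs :: "expr \<Rightarrow> nat set" where
  "expr_regs (Reg a) = {a}"
| "expr_regs (Num n) = {}"
| "expr_regs (Bin f e1 e2) = expr_regs e1 \<union> expr_regs e2"
| "expr_regs (Flr e) = expr_regs e"
| "expr_regs (Cell a e) = insert a (expr_regs e)"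

primrec small_nums :: "expr \<Rightarrow> bool" where
  "small_nums (Reg a) = True"
| "small_nums (Num n) = (n \<le> 1024)"
| "small_nums (Bin f e1 e2) = (small_nums e1 \<and> small_nums e2)"
| "small_nums (Flr e) = small_nums e"
| "small_nums (Cell a e) = small_nums e"

text \<open>Registers from 60 on hold intermediate values of expressions; programs only use the registers below.\<close>

definition admissible :: "expr \<Rightarrow> bool" where
  "admissible e \<longleftrightarrow> expr_regs e \<subseteq> {..<60} \<and> nodes e \<le> 40 \<and> small_nums e"

primrec compile :: "expr \<Rightarrow> nat \<Rightarrow> com" where
  "compile (Reg a) r = Seq (Const r 0) (Arith Plus r a r)"
| "compile (Num n) r = Const r (of_nat n)"
| "compile (Bin f e1 e2) r = Seq (compile e1 r) (Seq (compile e2 (Suc r)) (Arith f r r (Suc r)))"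
| "compile (Flr e) r = Seq (compile e r) (Floor r r)"
| "compile (Cell a e) r = Seq (compile e r) (Load r a r)"

definition visible :: "memory \<Rightarrow> memory" where
  "visible M = (\<lambda>a. if a < 60 then M a else (\<lambda>_. 0))"

definition mem_fits :: "nat \<Rightarrow> memory \<Rightarrow> bool" where
  "mem_fits B M \<longleftrightarrow> (\<forall>a<60. \<forall>i. fits B (M a i))"

definition unchanged :: "nat set \<Rightarrow> memory \<Rightarrow> memory \<Rightarrow> bool" where
  "unchanged X L L' \<longleftrightarrow> (\<forall>a<60. a \<notin> X \<longrightarrow> L' a = L a)"

lemma mem_fitsD: "mem_fits B M \<Longrightarrow> a < 60 \<Longrightarrow> fits B (M a i)"
  by (simp add: mem_fits_def)

lemma mem_fits_visible [simp]: "mem_fits B (visible M) = mem_fits B M"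
  by (simp add: mem_fits_def visible_def)

lemma visible_apply [simp]: "a < 60 \<Longrightarrow> visible M a = M a"
  by (simp add: visible_def)

lemma visible_eqI: "(\<And>a. a < 60 \<Longrightarrow> M a = M' a) \<Longrightarrow> visible M = visible M'"
  by (auto simp: visible_def)

lemma unchangedD: "unchanged X L L' \<Longrightarrow> a < 60 \<Longrightarrow> a \<notin> X \<Longrightarrow> L' a = L a"
  by (simp add: unchanged_def)

lemma unchanged_trans: "unchanged X L L' \<Longrightarrow> unchanged Y L' L'' \<Longrightarrow> unchanged (X \<union> Y) L L''"
  by (simp add: unchanged_def)

lemma unchanged_mono: "unchanged X L L' \<Longrightarrow> X \<inter> {..<60} \<subseteq> Y \<Longrightarrow> unchanged Y L L'"
  by (auto simp: unchanged_def)

lemma set_cell_apply: "set_cell a i q M b j = (if b = a \<and> j = i then q else M b j)"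
  by (simp add: set_cell_def)

lemma set_cell_other [simp]: "b \<noteq> a \<Longrightarrow> set_cell a i q M b = M b"
  by (simp add: set_cell_def)

lemma set_cell_same [simp]: "set_cell a i q M a = (M a)(i := q)"
  by (simp add: set_cell_def)

lemma visible_set_cell: "a < 60 \<Longrightarrow> visible (set_cell a i q M) = set_cell a i q (visible M)"
  by (auto simp: visible_def set_cell_def fun_eq_iff)

lemma visible_set_vec: "a < 60 \<Longrightarrow> visible (set_vec a v M) = set_vec a v (visible M)"
  by (auto simp: visible_def set_vec_def fun_eq_iff)

lemma mem_fits_set_cell: "mem_fits B M \<Longrightarrow> fits B q \<Longrightarrow> mem_fits B (set_cell a i q M)"
  by (auto simp: mem_fits_def set_cell_apply)

lemma mem_fits_set_vec: "mem_fits B M \<Longrightarrow> (\<And>i. i < dim_vec v \<Longrightarrow> fits B (v $ i)) \<Longrightarrow> mem_fits B (set_vec a v M)"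
  by (simp add: mem_fits_def set_vec_def)

lemma get_vec_visible: "b < 60 \<Longrightarrow> get_vec b k (visible M) = get_vec b k M"
  and get_scenario_visible: "b < 60 \<Longrightarrow> get_scenario b k (visible M) = get_scenario b k M"
  by (auto simp: get_vec_def get_scenario_def)

lemma expr_val_cong: "(\<And>a. a \<in> expr_regs e \<Longrightarrow> M a = M' a) \<Longrightarrow> expr_val e M = expr_val e M'"
  by (induction e) auto

lemma expr_val_visible: "admissible e \<Longrightarrow> expr_val e (visible M) = expr_val e M"
  by (rule expr_val_cong) (auto simp: admissible_def)

lemma fits_expr_val:
  assumes "mem_fits B M" "10 \<le> B" "expr_regs e \<subseteq> {..<60}" "small_nums e"
  shows "fits (nodes e * (B + 1)) (expr_val e M)"
  using assms(3,4)
proof (induction e)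
  case (Reg a)
  then show ?case using fits_mono[OF mem_fitsD[OF assms(1)], of a "B + 1"] by simp
next
  case (Num n)
  have "n \<le> 2 ^ 10" using Num by simp
  also have "(2::nat) ^ 10 \<le> 2 ^ (B + 1)" using assms(2) by (intro power_increasing) auto
  finally show ?case using fits_of_nat by simp
next
  case (Bin f e1 e2)
  then show ?case by (auto intro!: fits_mono[OF fits_arith_op] simp: algebra_simps)
next
  case (Flr e)
  then show ?case by (auto intro!: fits_mono[OF fits_floor])
next
  case (Cell a e)
  have "fits B (M a (index_of (expr_val e M)))" using mem_fitsD[OF assms(1)] Cell.prems by auto
  then show ?case by (auto intro: fits_mono)
qed

lemma writes_compile_ge: "a \<in> writes (compile e r) \<Longrightarrow> r \<le> a"
  by (induction e arbitrary: r) (auto dest: Suc_leD)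

lemma writes_compile [simp]: "a < r \<Longrightarrow> a \<notin> writes (compile e r)"
  using writes_compile_ge by force

section \<open>A program logic with resource bounds\<close>

definition yields :: "drso \<Rightarrow> com \<Rightarrow> memory \<Rightarrow> 'w pmf \<Rightarrow> nat \<Rightarrow> ('w \<Rightarrow> memory \<Rightarrow> bool) \<Rightarrow> bool" where
  "yields I c M P T Q \<longleftrightarrow> (\<exists>F. runs I c M P F \<and> (\<forall>w\<in>set_pmf P. snd (F w) \<le> T \<and> Q w (fst (F w))))"

abbreviation yields_det :: "drso \<Rightarrow> com \<Rightarrow> memory \<Rightarrow> nat \<Rightarrow> (memory \<Rightarrow> bool) \<Rightarrow> bool" where
  "yields_det I c M T Q \<equiv> yields I c M (return_pmf ()) T (\<lambda>_. Q)"

lemma yieldsI: "runs I c M P F \<Longrightarrow> (\<And>w. w \<in> set_pmf P \<Longrightarrow> snd (F w) \<le> T \<and> Q w (fst (F w))) \<Longrightarrow> yields I c M P T Q"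
  unfolding yields_def by blast

lemma yields_mono:
  assumes "yields I c M P T Q" "T \<le> T'"
    and "\<And>w M'. w \<in> set_pmf P \<Longrightarrow> (\<And>a. a \<notin> writes c \<Longrightarrow> M' a = M a) \<Longrightarrow> Q w M' \<Longrightarrow> Q' w M'"
  shows "yields I c M P T' Q'"
proof -
  from assms(1) obtain F where F: "runs I c M P F" "\<And>w. w \<in> set_pmf P \<Longrightarrow> snd (F w) \<le> T \<and> Q w (fst (F w))"
    unfolding yields_def by blast
  show ?thesis
    by (rule yieldsI[OF F(1)]) (use F(2) assms(2,3) runs_frame[OF F(1)] in \<open>blast intro: order_trans\<close>)
qed

lemma yields_map_inj:
  assumes "inj f" "yields I c M P T (\<lambda>w. Q (f w))"
  shows "yields I c M (map_pmf f P) T Q"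
proof -
  from assms(2) obtain F where F: "runs I c M P F" "\<And>w. w \<in> set_pmf P \<Longrightarrow> snd (F w) \<le> T \<and> Q (f w) (fst (F w))"
    unfolding yields_def by blast
  have "(F \<circ> inv_into UNIV f) \<circ> f = F" using assms(1) by (simp add: fun_eq_iff)
  then have "runs I c M (map_pmf f P) (F \<circ> inv_into UNIV f)" using F(1) by (simp add: runs_reindex)
  then show ?thesis by (rule yieldsI) (use F(2) assms(1) in auto)
qed

lemma yields_unmap:
  assumes "yields I c M (map_pmf f P) T Q"
  shows "yields I c M P T (\<lambda>w. Q (f w))"
proof -
  from assms obtain F where F: "runs I c M (map_pmf f P) F"
    "\<And>w. w \<in> set_pmf (map_pmf f P) \<Longrightarrow> snd (F w) \<le> T \<and> Q w (fst (F w))"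
    unfolding yields_def by blast
  from F(1) have "runs I c M P (F \<circ> f)" by (simp add: runs_reindex)
  then show ?thesis by (rule yieldsI) (use F(2) in auto)
qed

lemma yields_det_return: "yields_det I c M T (Q x) \<Longrightarrow> yields I c M (return_pmf x) T Q"
  using yields_map_inj[of "\<lambda>_::unit. x" I c M "return_pmf ()" T Q] by (simp add: inj_def)

lemma yields_prim:
  assumes "\<And>k t0. exec I (Suc k) c (M, t0) = return_spmf (M', t0 + t)" "t \<le> T" "Q M'"
  shows "yields_det I c M T Q"
  by (rule yieldsI[OF runs_detI]) (use assms in auto)

lemma yields_Seq:
  assumes "yields I c1 M P T1 Q1" "finite (set_pmf P)"
    and "\<And>v M'. v \<in> set_pmf P \<Longrightarrow> Q1 v M' \<Longrightarrow> yields I c2 M' P' T2 (\<lambda>w. Q (v, w))"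
  shows "yields I (Seq c1 c2) M (pair_pmf P P') (T1 + T2) Q"
proof -
  from assms(1) obtain F where F: "runs I c1 M P F" "\<And>v. v \<in> set_pmf P \<Longrightarrow> snd (F v) \<le> T1 \<and> Q1 v (fst (F v))"
    unfolding yields_def by blast
  then have "\<forall>v\<in>set_pmf P. \<exists>F'. runs I c2 (fst (F v)) P' F' \<and>
    (\<forall>w\<in>set_pmf P'. snd (F' w) \<le> T2 \<and> Q (v, w) (fst (F' w)))"
    using assms(3) unfolding yields_def by blast
  then obtain F' where F': "\<And>v. v \<in> set_pmf P \<Longrightarrow> runs I c2 (fst (F v)) P' (F' v)"
    "\<And>v w. v \<in> set_pmf P \<Longrightarrow> w \<in> set_pmf P' \<Longrightarrow> snd (F' v w) \<le> T2 \<and> Q (v, w) (fst (F' v w))" by metis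
  show ?thesis
    by (rule yieldsI[OF runs_Seq[OF F(1) assms(2) F'(1)]]) (use F(2) F'(2) in \<open>auto simp: add_mono\<close>)
qed

lemma yields_While_True:
  assumes "M a 0 > 0" "yields I c M P T1 Q1" "finite (set_pmf P)"
    and "\<And>v M'. v \<in> set_pmf P \<Longrightarrow> Q1 v M' \<Longrightarrow> yields I (While a c) M' P' T2 (\<lambda>w. Q (v, w))"
  shows "yields I (While a c) M (pair_pmf P P') (1 + rat_size (M a 0) + (T1 + T2)) Q"
proof -
  from assms(2) obtain F where F: "runs I c M P F" "\<And>v. v \<in> set_pmf P \<Longrightarrow> snd (F v) \<le> T1 \<and> Q1 v (fst (F v))"
    unfolding yields_def by blast
  then have "\<forall>v\<in>set_pmf P. \<exists>F'. runs I (While a c) (fst (F v)) P' F' \<and>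
    (\<forall>w\<in>set_pmf P'. snd (F' w) \<le> T2 \<and> Q (v, w) (fst (F' w)))"
    using assms(4) unfolding yields_def by blast
  then obtain F' where F': "\<And>v. v \<in> set_pmf P \<Longrightarrow> runs I (While a c) (fst (F v)) P' (F' v)"
    "\<And>v w. v \<in> set_pmf P \<Longrightarrow> w \<in> set_pmf P' \<Longrightarrow> snd (F' v w) \<le> T2 \<and> Q (v, w) (fst (F' v w))" by metis
  show ?thesis
    by (rule yieldsI[OF runs_While_True[OF assms(1) F(1) assms(3) F'(1)]]) (use F(2) F'(2) in \<open>auto simp: add_mono\<close>)
qed

lemma yields_Cond:
  assumes "yields I (if M a 0 > 0 then c1 else c2) M P T Q"
  shows "yields I (Cond a c1 c2) M P (1 + rat_size (M a 0) + T) Q"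
proof -
  from assms obtain F where F: "runs I (if M a 0 > 0 then c1 else c2) M P F"
    "\<And>w. w \<in> set_pmf P \<Longrightarrow> snd (F w) \<le> T \<and> Q w (fst (F w))"
    unfolding yields_def by blast
  show ?thesis by (rule yieldsI[OF runs_Cond[OF F(1)]]) (use F(2) in auto)
qed

lemma yields_det_Seq:
  assumes "yields_det I c1 M T1 Q1" "\<And>M'. Q1 M' \<Longrightarrow> yields I c2 M' P T2 Q"
  shows "yields I (Seq c1 c2) M P (T1 + T2) Q"
proof -
  have "yields I (Seq c1 c2) M (pair_pmf (return_pmf ()) P) (T1 + T2) (\<lambda>(v, w). Q w)"
    by (rule yields_Seq[OF assms(1)]) (use assms(2) in simp_all)
  then show ?thesis by (simp add: pair_return_pmf1 yields_unmap[where f = "Pair ()" and Q = "\<lambda>(v, w). Q w", simplified])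
qed

lemma yields_Seq_det:
  assumes "yields I c1 M P T1 Q1" "finite (set_pmf P)"
    "\<And>v M'. v \<in> set_pmf P \<Longrightarrow> Q1 v M' \<Longrightarrow> yields_det I c2 M' T2 (Q v)"
  shows "yields I (Seq c1 c2) M P (T1 + T2) Q"
proof -
  have "yields I (Seq c1 c2) M (pair_pmf P (return_pmf ())) (T1 + T2) (\<lambda>(v, w). Q v)"
    by (rule yields_Seq[OF assms(1,2)]) (use assms(3) in simp)
  then show ?thesis by (simp add: pair_return_pmf2 yields_unmap[where f = "\<lambda>v. (v, ())" and Q = "\<lambda>(v, w). Q v", simplified])
qed

lemma replicate_pmf_Suc_pair: "replicate_pmf (Suc n) P = map_pmf
  (\<lambda>(v, vs). v # vs) (pair_pmf P (replicate_pmf n P))"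
  by (simp add: pair_pmf_def map_bind_pmf map_return_pmf)

primrec ticks :: "nat \<Rightarrow> com \<Rightarrow> nat" where
  "ticks Z (Const a q) = 1"
| "ticks Z (Arith f a b c) = 1"
| "ticks Z (Floor a b) = 1"
| "ticks Z (Load a b c) = 1"
| "ticks Z (Store a b c) = 1"
| "ticks Z (Sample a) = 1"
| "ticks Z (Value a b c) = 1"
| "ticks Z (Subgrad a b c) = 1"
| "ticks Z (Separate a b c) = 1"
| "ticks Z (Seq c1 c2) = ticks Z c1 + ticks Z c2"
| "ticks Z (Cond a c1 c2) = 1 + ticks Z c1 + ticks Z c2"
| "ticks Z (While a c) = Z * (1 + ticks Z c) + 1"

definition assign :: "nat \<Rightarrow> expr \<Rightarrow> com" (infix \<open>::=\<close> 62) where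
  "a ::= e = Seq (compile e 60) (Seq (Const 61 0) (Arith Plus a 60 61))"

definition store :: "nat \<Rightarrow> expr \<Rightarrow> expr \<Rightarrow> com" (\<open>_ .[_] ::= _\<close> [63, 0, 62] 62) where
  "a .[i] ::= e = Seq (compile i 60) (Seq (compile e 61) (Store a 60 61))"

definition skip :: com where
  "skip = Const 60 0"

definition if_pos :: "expr \<Rightarrow> com \<Rightarrow> com \<Rightarrow> com" (\<open>(IF _/ THEN _/ ELSE _)\<close> [0, 61, 61] 61) where
  "IF e THEN c1 ELSE c2 = Seq (compile e 60) (Cond 60 c1 c2)"

definition while_pos :: "expr \<Rightarrow> com \<Rightarrow> com" (\<open>(WHILE _/ DO _)\<close> [0, 61] 61) where
  "WHILE e DO c = Seq (compile e 60) (While 60 (Seq c (compile e 60)))"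

abbreviation seq :: "com \<Rightarrow> com \<Rightarrow> com" (infixr \<open>;;\<close> 60) where
  "c1 ;; c2 \<equiv> Seq c1 c2"

abbreviation plus_expr (infixl \<open>\<^bold>+\<close> 65) where "e1 \<^bold>+ e2 \<equiv> Bin Plus e1 e2"
abbreviation minus_expr (infixl \<open>\<^bold>-\<close> 65) where "e1 \<^bold>- e2 \<equiv> Bin Minus e1 e2"
abbreviation times_expr (infixl \<open>\<^bold>*\<close> 70) where "e1 \<^bold>* e2 \<equiv> Bin Times e1 e2"
abbreviation divide_expr (infixl \<open>\<^bold>'/\<close> 70) where "e1 \<^bold>/ e2 \<equiv> Bin Divide e1 e2"

definition for_below :: "nat \<Rightarrow> expr \<Rightarrow> com \<Rightarrow> com" (\<open>(FOR _ < _ /DO _)\<close> [63, 0, 61] 61) where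
  "FOR i < n DO c = i ::= Num 0 ;; WHILE n \<^bold>- Reg i DO (c ;; i ::= Reg i \<^bold>+ Num 1)"

definition sum_loop :: "nat \<Rightarrow> nat \<Rightarrow> expr \<Rightarrow> com \<Rightarrow> expr \<Rightarrow> com" where
  "sum_loop acc i n c e = acc ::= Num 0 ;; FOR i < n DO (c ;; acc ::= Reg acc \<^bold>+ e)"

definition tabulate :: "nat \<Rightarrow> nat \<Rightarrow> expr \<Rightarrow> com \<Rightarrow> expr \<Rightarrow> com" where
  "tabulate dst i n c e = FOR i < n DO (c ;; dst .[Reg i] ::= e)"

lemma writes_assign [simp]: "b < 60 \<Longrightarrow> b \<in> writes (a ::= e) \<longleftrightarrow> b = a"
  and writes_store [simp]: "b < 60 \<Longrightarrow> b \<in> writes (a .[i] ::= e) \<longleftrightarrow> b = a"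
  and writes_if_pos [simp]: "b < 60 \<Longrightarrow> b \<in> writes (IF e THEN c1 ELSE c2) \<longleftrightarrow> b \<in> writes c1 \<or> b \<in> writes c2"
  and writes_skip [simp]: "b < 60 \<Longrightarrow> b \<notin> writes skip"
  and writes_while_pos [simp]: "b < 60 \<Longrightarrow> b \<in> writes (WHILE e DO c) \<longleftrightarrow> b \<in> writes c"
  by (auto simp: assign_def store_def if_pos_def skip_def while_pos_def)

lemma writes_for_below [simp]: "b < 60 \<Longrightarrow> b \<in> writes (FOR i < n DO c) \<longleftrightarrow> b = i \<or> b \<in> writes c"
  and writes_sum_loop [simp]: "b < 60 \<Longrightarrow> b \<in> writes (sum_loop acc i n c e) \<longleftrightarrow> b = acc \<or> b = i \<or> b \<in> writes c"
  and writes_tabulate [simp]: "b < 60 \<Longrightarrow> b \<in> writes (tabulate dst i n c e) \<longleftrightarrow> b = dst \<or> b = i \<or> b \<in> writes c"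
  by (auto simp: for_below_def sum_loop_def tabulate_def)

definition loop_regs_ok :: "nat \<Rightarrow> expr \<Rightarrow> com \<Rightarrow> bool" where
  "loop_regs_ok i n c \<longleftrightarrow> i < 60 \<and> expr_regs n \<subseteq> {..<60} \<and> nodes n \<le> 30 \<and> small_nums n \<and>
    i \<notin> writes c \<and> i \<notin> expr_regs n \<and> expr_regs n \<inter> writes c = {}"

text \<open>Every cell of the memory always has a length bounded by \<open>B\<close>, no loop makes more than
  \<open>Z\<close> iterations, and \<open>W\<close> bounds the cost of a single instruction.\<close>

locale bounded_machine =
  fixes I :: drso and B Z W :: nat
  assumes B_ge: "10 \<le> B" and Z_le: "Z \<le> 2 ^ B"
    and W_arith: "2 * (2 * (40 * (B + 1)) + 3) + 1 \<le> W"
    and W_oracle: "\<And>b. b \<le> mdim I * (2 * B + 3) + usize I \<Longrightarrow> oracle_cost I b \<le> W"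
    and W_sample: "1 + usize I \<le> W"
begin

definition "word = 2 * (40 * (B + 1)) + 3"

lemma words_le: "2 * word + 1 \<le> W"
  using W_arith by (simp add: word_def)

lemma expr_size_le:
  assumes "mem_fits B M" "expr_regs e \<subseteq> {..<60}" "small_nums e" "nodes e \<le> 40"
  shows "rat_size (expr_val e M) \<le> word"
proof -
  have "nodes e * (B + 1) \<le> 40 * (B + 1)" using assms(4) by (rule mult_right_mono) simp
  from rat_size_le[OF fits_mono[OF fits_expr_val[OF assms(1) B_ge assms(2,3)] this]] show ?thesis
    by (simp add: word_def)
qed

lemma admissible_size_le: "mem_fits B M \<Longrightarrow> admissible e \<Longrightarrow> rat_size (expr_val e M) \<le> word"
  by (simp add: expr_size_le admissible_def)

lemma cell_size_le: "mem_fits B M \<Longrightarrow> a < 60 \<Longrightarrow> rat_size (M a i) \<le> word"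
  using rat_size_le[OF mem_fitsD, of B M a i] by (auto simp: word_def)

lemma small_size_le: "q \<le> 1024 \<Longrightarrow> rat_size (of_nat q) \<le> word"
  using expr_size_le[of "\<lambda>_ _. 0" "Num q"] by (auto simp: mem_fits_def)

lemma zero_size_le: "1 + rat_size 0 \<le> W"
  using small_size_le[of 0] words_le by simp

lemma yields_compile_Reg:
  assumes "mem_fits B M" "a < 60" "60 \<le> r"
  shows "yields_det I (compile (Reg a) r) M (ticks Z (compile (Reg a) r) * W)
    (\<lambda>M'. (\<forall>b<r. M' b = M b) \<and> M' r 0 = M a 0)"
proof -
  have time: "1 + rat_size (M a 0) + rat_size 0 \<le> W"
    using cell_size_le[of M a 0] small_size_le[of 0] words_le assms by simp
  show ?thesis unfolding compile.simps ticks.simps distrib_right mult_1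
  proof (rule yields_det_Seq[where ?Q1.0 = "\<lambda>M'. M' = set_cell r 0 0 M"])
    show "yields_det I (Const r 0) M W (\<lambda>M'. M' = set_cell r 0 0 M)"
      by (rule yields_prim[where M' = "set_cell r 0 0 M" and t = "1 + rat_size 0"]) (use zero_size_le in auto)
    show "yields_det I (Arith Plus r a r) M1 W (\<lambda>M'. (\<forall>b<r. M' b = M b) \<and> M' r 0 = M a 0)"
      if "M1 = set_cell r 0 0 M" for M1
      by (rule yields_prim[where M' = "set_cell r 0 (M a 0) M1" and t = "1 + rat_size (M a 0) + rat_size 0"])
        (use that time assms in auto)
  qed
qed

lemma yields_compile_Bin:
  assumes M: "mem_fits B M" "60 \<le> r"
    and e: "expr_regs (Bin f e1 e2) \<subseteq> {..<60}" "small_nums (Bin f e1 e2)" "nodes (Bin f e1 e2) \<le> 40"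
    and first: "yields_det I (compile e1 r) M (ticks Z (compile e1 r) * W)
      (\<lambda>M'. (\<forall>a<r. M' a = M a) \<and> M' r 0 = expr_val e1 M)"
    and second: "\<And>M'. mem_fits B M' \<Longrightarrow> yields_det I (compile e2 (Suc r)) M' (ticks Z (compile e2 (Suc r)) * W)
      (\<lambda>M''. (\<forall>a<Suc r. M'' a = M' a) \<and> M'' (Suc r) 0 = expr_val e2 M')"
  shows "yields_det I (compile (Bin f e1 e2) r) M (ticks Z (compile (Bin f e1 e2) r) * W)
    (\<lambda>M'. (\<forall>a<r. M' a = M a) \<and> M' r 0 = expr_val (Bin f e1 e2) M)"
  unfolding compile.simps ticks.simps distrib_right mult_1
proof (rule yields_det_Seq[OF first])
  let ?v = "arith_op f (expr_val e1 M) (expr_val e2 M)"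
    and ?t = "1 + rat_size (expr_val e1 M) + rat_size (expr_val e2 M)"
  have time: "?t \<le> W" using expr_size_le[of M e1] expr_size_le[of M e2] M e words_le by simp
  fix M1 assume M1: "(\<forall>a<r. M1 a = M a) \<and> M1 r 0 = expr_val e1 M"
  then have same: "expr_val e2 M1 = expr_val e2 M" and fits: "mem_fits B M1"
    using M e by (auto intro!: expr_val_cong simp: mem_fits_def)
  show "yields_det I (Seq (compile e2 (Suc r)) (Arith f r r (Suc r))) M1 (ticks Z (compile e2 (Suc r)) * W + W)
      (\<lambda>M'. (\<forall>a<r. M' a = M a) \<and> M' r 0 = expr_val (Bin f e1 e2) M)"
  proof (rule yields_det_Seq[OF second[OF fits]])
    fix M2 assume "(\<forall>a<Suc r. M2 a = M1 a) \<and> M2 (Suc r) 0 = expr_val e2 M1"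
    then show "yields_det I (Arith f r r (Suc r)) M2 W
      (\<lambda>M'. (\<forall>a<r. M' a = M a) \<and> M' r 0 = expr_val (Bin f e1 e2) M)"
      by (intro yields_prim[where M' = "set_cell r 0 ?v M2" and t = ?t]) (use M1 same time in auto)
  qed
qed

lemma yields_compile:
  assumes "mem_fits B M" "expr_regs e \<subseteq> {..<60}" "small_nums e" "nodes e \<le> 40" "60 \<le> r"
  shows "yields_det I (compile e r) M (ticks Z (compile e r) * W)
    (\<lambda>M'. (\<forall>a<r. M' a = M a) \<and> M' r 0 = expr_val e M)"
  using assms
proof (induction e arbitrary: r M)
  case (Reg a)
  then show ?case using yields_compile_Reg[of M a r] by simp
next
  case (Num n)
  have "1 + rat_size (of_nat n) \<le> W" using small_size_le[of n] words_le Num by simp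
  then show ?case unfolding compile.simps ticks.simps mult_1
    by (intro yields_prim[where M' = "set_cell r 0 (of_nat n) M" and t = "1 + rat_size (of_nat n)"]) auto
next
  case (Bin f e1 e2)
  show ?case by (rule yields_compile_Bin) (use Bin in auto)
next
  case (Flr e)
  have time: "1 + rat_size (expr_val e M) \<le> W" using expr_size_le[of M e] Flr.prems words_le by simp
  show ?case unfolding compile.simps ticks.simps distrib_right mult_1
  proof (rule yields_det_Seq[OF Flr.IH], goal_cases)
    case (6 M1)
    then show ?case
      by (intro yields_prim[where M' = "set_cell r 0 (of_int \<lfloor>expr_val e M\<rfloor>) M1" and t = "1 + rat_size (expr_val e M)"])
        (use time in auto)
  qed (use Flr.prems in auto)
next
  case (Cell b e)
  let ?v = "M b (index_of (expr_val e M))"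
  have time: "1 + rat_size (expr_val e M) + rat_size ?v \<le> W"
    using expr_size_le[of M e] cell_size_le[of M b "index_of (expr_val e M)"] Cell.prems words_le by simp
  show ?case unfolding compile.simps ticks.simps distrib_right mult_1
  proof (rule yields_det_Seq[OF Cell.IH], goal_cases)
    case (6 M1)
    then show ?case
      by (intro yields_prim[where M' = "set_cell r 0 ?v M1" and t = "1 + rat_size (expr_val e M) + rat_size ?v"])
        (use time Cell.prems in \<open>auto simp: Let_def\<close>)
  qed (use Cell.prems in auto)
qed

definition draws :: "com \<Rightarrow> memory \<Rightarrow> 'w pmf \<Rightarrow> ('w \<Rightarrow> memory \<Rightarrow> bool) \<Rightarrow> bool" where
  "draws c L P Q \<longleftrightarrow> (\<forall>M. visible M = L \<and> mem_fits B L \<longrightarrow>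
    yields I c M P (ticks Z c * W) (\<lambda>w M'. mem_fits B M' \<and> Q w (visible M')))"

abbreviation ensures :: "com \<Rightarrow> memory \<Rightarrow> (memory \<Rightarrow> bool) \<Rightarrow> bool" where
  "ensures c L Q \<equiv> draws c L (return_pmf ()) (\<lambda>_. Q)"

lemma drawsD: "draws c (visible M) P Q \<Longrightarrow> mem_fits B M \<Longrightarrow>
    yields I c M P (ticks Z c * W) (\<lambda>w M'. mem_fits B M' \<and> Q w (visible M'))"
  by (simp add: draws_def)

lemma drawsI:
  assumes "\<And>M. mem_fits B M \<Longrightarrow> L = visible M \<Longrightarrow>
    yields I c M P (ticks Z c * W) (\<lambda>w M'. mem_fits B M' \<and> Q w (visible M'))"
  shows "draws c L P Q"
  using assms by (auto simp: draws_def)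

lemma draws_mem_fits: "(mem_fits B L \<Longrightarrow> draws c L P Q) \<Longrightarrow> draws c L P Q"
  unfolding draws_def by blast

lemma draws_frame:
  assumes "draws c L P Q" "mem_fits B M" "L = visible M"
  shows "yields I c M P (ticks Z c * W)
    (\<lambda>w M'. mem_fits B M' \<and> unchanged (writes c) L (visible M') \<and> Q w (visible M'))"
  using assms by (intro yields_mono[OF drawsD[of c M P Q] order_refl]) (auto simp: unchanged_def)

lemma draws_mono:
  assumes "draws c L P Q"
    and "\<And>w L'. w \<in> set_pmf P \<Longrightarrow> mem_fits B L' \<Longrightarrow> unchanged (writes c) L L' \<Longrightarrow> Q w L' \<Longrightarrow> Q' w L'"
  shows "draws c L P Q'"
  by (rule drawsI, rule yields_mono[OF draws_frame[OF assms(1)] order_refl]) (use assms(2) in auto)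

lemma ensures_mono:
  assumes "ensures c L Q" "\<And>L'. mem_fits B L' \<Longrightarrow> unchanged (writes c) L L' \<Longrightarrow> Q L' \<Longrightarrow> Q' L'"
  shows "ensures c L Q'"
  using draws_mono[OF assms(1), of "\<lambda>_. Q'"] assms(2) by blast

lemma draws_Seq:
  assumes "ensures c1 L Q1"
    and "\<And>L'. mem_fits B L' \<Longrightarrow> unchanged (writes c1) L L' \<Longrightarrow> Q1 L' \<Longrightarrow> draws c2 L' P Q"
  shows "draws (c1 ;; c2) L P Q"
proof (rule drawsI)
  fix M assume "mem_fits B M" "L = visible M"
  then show "yields I (c1 ;; c2) M P (ticks Z (c1 ;; c2) * W) (\<lambda>w M'. mem_fits B M' \<and> Q w (visible M'))"
    unfolding ticks.simps distrib_right
    by (rule yields_det_Seq[OF draws_frame[OF assms(1)]]) (use assms(2) in \<open>auto intro: drawsD\<close>)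
qed

lemma draws_SeqI: "ensures c1 L (\<lambda>L'. draws c2 L' P Q) \<Longrightarrow> draws (c1 ;; c2) L P Q"
  by (rule draws_Seq)

lemma draws_Seq_ensures:
  assumes "draws c1 L P Q1" "finite (set_pmf P)"
    and "\<And>v L'. v \<in> set_pmf P \<Longrightarrow> mem_fits B L' \<Longrightarrow> unchanged (writes c1) L L' \<Longrightarrow> Q1 v L' \<Longrightarrow> ensures c2 L' (Q v)"
  shows "draws (c1 ;; c2) L P Q"
proof (rule drawsI)
  fix M assume "mem_fits B M" "L = visible M"
  then show "yields I (c1 ;; c2) M P (ticks Z (c1 ;; c2) * W) (\<lambda>w M'. mem_fits B M' \<and> Q w (visible M'))"
    unfolding ticks.simps distrib_right
    by (rule yields_Seq_det[OF draws_frame[OF assms(1)] assms(2)]) (use assms(3) in \<open>auto intro: drawsD\<close>)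
qed

lemma ensures_prim:
  assumes "\<And>M k t0. visible M = L \<Longrightarrow> exec I (Suc k) c (M, t0) = return_spmf (F M, t0 + t M)"
    and "\<And>M. visible M = L \<Longrightarrow> mem_fits B L \<Longrightarrow> t M \<le> W" "\<And>M. visible M = L \<Longrightarrow> visible (F M) = L'"
    and "mem_fits B L \<Longrightarrow> mem_fits B L'" "Q L'" "ticks Z c = 1"
  shows "ensures c L Q"
proof (rule drawsI)
  fix M assume M: "mem_fits B M" "L = visible M"
  then have L': "visible (F M) = L'" "mem_fits B L'" and time: "t M \<le> W" using assms(2-4) by auto
  then have "mem_fits B (F M)" using mem_fits_visible[of B "F M"] by simp
  then show "yields_det I c M (ticks Z c * W) (\<lambda>M'. mem_fits B M' \<and> Q (visible M'))"
    by (intro yields_prim[where M' = "F M" and t = "t M"]) (use M L' time assms(1,5,6) in auto)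
qed

lemma ensures_skip:
  assumes "Q L"
  shows "ensures skip L Q"
  unfolding skip_def
  by (rule ensures_prim[where F = "set_cell 60 0 0" and t = "\<lambda>_. 1 + rat_size 0" and L' = L])
    (use assms zero_size_le in \<open>auto simp: visible_def set_cell_def\<close>)

lemma visible_compile: "\<forall>a<60. M' a = M a \<Longrightarrow> visible M' = visible M"
  by (intro visible_eqI) simp

lemma ensures_assign:
  assumes "a < 60" "admissible e" "mem_fits B L \<Longrightarrow> fits B (expr_val e L)" "Q (set_cell a 0 (expr_val e L) L)"
  shows "ensures (a ::= e) L Q"
proof (rule drawsI)
  fix M assume M: "mem_fits B M" "L = visible M"
  let ?v = "expr_val e L"
  have time: "1 + rat_size ?v + rat_size 0 \<le> W"
    using admissible_size_le[OF _ assms(2), of L] small_size_le[of 0] words_le M by simp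
  have fits: "mem_fits B (set_cell a 0 ?v L)" using M assms(3) by (simp add: mem_fits_set_cell)
  show "yields_det I (a ::= e) M (ticks Z (a ::= e) * W) (\<lambda>M'. mem_fits B M' \<and> Q (visible M'))"
    unfolding assign_def ticks.simps distrib_right mult_1
  proof (rule yields_det_Seq[OF yields_compile], goal_cases)
    case evaluated: (6 M1)
    let ?M2 = "set_cell 61 0 0 M1"
    have "visible (set_cell a 0 ?v ?M2) = set_cell a 0 ?v L"
      using evaluated M assms(1) by (auto simp: visible_def set_cell_def fun_eq_iff)
    with fits assms(4) have "mem_fits B (set_cell a 0 ?v ?M2) \<and> Q (visible (set_cell a 0 ?v ?M2))"
      by (metis mem_fits_visible)
    moreover have "M1 60 0 = ?v" using evaluated M expr_val_visible[OF assms(2)] by simp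
    ultimately show ?case
      by (intro yields_det_Seq[where ?Q1.0 = "\<lambda>M'. M' = ?M2"] yields_prim[where M' = ?M2 and t = "1 + rat_size 0"]
          yields_prim[where M' = "set_cell a 0 ?v ?M2" and t = "1 + rat_size ?v + rat_size 0"])
        (use time zero_size_le in auto)
  qed (use M assms(2) in \<open>auto simp: admissible_def\<close>)
qed

lemma ensures_store:
  assumes "a < 60" "admissible i" "admissible e" "mem_fits B L \<Longrightarrow> fits B (expr_val e L)"
    and "Q (set_cell a (index_of (expr_val i L)) (expr_val e L) L)"
  shows "ensures (a .[i] ::= e) L Q"
proof (rule drawsI)
  fix M assume M: "mem_fits B M" "L = visible M"
  let ?v = "expr_val e L" and ?j = "expr_val i L"
  let ?L' = "set_cell a (index_of ?j) ?v L"
  have time: "1 + rat_size ?j + rat_size ?v \<le> W"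
    using admissible_size_le[OF _ assms(2), of L] admissible_size_le[OF _ assms(3), of L] words_le M by simp
  have fits: "mem_fits B ?L'" using M assms(4) by (simp add: mem_fits_set_cell)
  show "yields_det I (a .[i] ::= e) M (ticks Z (a .[i] ::= e) * W) (\<lambda>M'. mem_fits B M' \<and> Q (visible M'))"
    unfolding store_def ticks.simps distrib_right mult_1
  proof (rule yields_det_Seq[OF yields_compile], goal_cases)
    case evaluated: (6 M1)
    then have M1: "mem_fits B M1" "expr_val e M1 = ?v" "M1 60 0 = ?j"
      using M assms(3) expr_val_visible[OF assms(3), of M] expr_val_visible[OF assms(2), of M]
      by (auto intro!: expr_val_cong simp: mem_fits_def admissible_def)
    show ?case
    proof (rule yields_det_Seq[OF yields_compile[OF M1(1)]], goal_cases)
      case indexed: (5 M2)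
      let ?M3 = "set_cell a (index_of ?j) ?v M2"
      have "visible ?M3 = ?L'" using indexed evaluated M assms(1) by (auto simp: visible_def set_cell_def fun_eq_iff)
      with fits assms(5) have "mem_fits B ?M3 \<and> Q (visible ?M3)" by (metis mem_fits_visible)
      then show ?case
        by (intro yields_prim[where M' = ?M3 and t = "1 + rat_size ?j + rat_size ?v"]) (use indexed evaluated M1 time in auto)
    qed (use assms(3) in \<open>auto simp: admissible_def\<close>)
  qed (use M assms(2) in \<open>auto simp: admissible_def\<close>)
qed

lemma draws_if_pos:
  assumes "admissible e" "expr_val e L > 0 \<Longrightarrow> draws c1 L P Q" "\<not> expr_val e L > 0 \<Longrightarrow> draws c2 L P Q"
  shows "draws (IF e THEN c1 ELSE c2) L P Q"
proof (rule drawsI)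
  fix M assume M: "mem_fits B M" "L = visible M"
  have time: "1 + rat_size (expr_val e L) \<le> W" using admissible_size_le[OF _ assms(1), of L] words_le M by simp
  let ?Q = "\<lambda>w M'. mem_fits B M' \<and> Q w (visible M')"
  show "yields I (IF e THEN c1 ELSE c2) M P (ticks Z (IF e THEN c1 ELSE c2) * W) ?Q"
    unfolding if_pos_def ticks.simps distrib_right mult_1
  proof (rule yields_det_Seq[OF yields_compile], goal_cases)
    case (6 M1)
    then have L: "visible M1 = L" "M1 60 0 = expr_val e L" "mem_fits B M1"
      using M visible_compile[of M1 M] expr_val_visible[OF assms(1)] by (auto simp: mem_fits_def)
    then have "draws (if M1 60 0 > 0 then c1 else c2) (visible M1) P Q" using assms(2,3) by simp
    from yields_Cond[OF drawsD[OF this L(3)]] show ?case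
      by (rule yields_mono) (use time L in \<open>auto simp: trans_le_add1 add_mono\<close>)
  qed (use M assms(1) in \<open>auto simp: admissible_def\<close>)
qed

end

lemma index_of_nat [simp]: "index_of (of_nat n) = n" "index_of 0 = 0" "index_of 1 = 1"
  "index_of (numeral w) = numeral w"
  by (simp_all add: index_of_def)

lemma replicate_pmf_return: "replicate_pmf n (return_pmf x) = return_pmf (replicate n x)"
  by (induction n) (simp_all add: bind_return_pmf)

context bounded_machine
begin

lemma yields_while_body:
  assumes e: "admissible e" and M: "mem_fits B M" and c: "draws c (visible M) P Q" "finite (set_pmf P)"
  shows "yields I (c ;; compile e 60) M P ((ticks Z c + ticks Z (compile e 60)) * W)
    (\<lambda>w M'. mem_fits B M' \<and> unchanged (writes c) (visible M) (visible M') \<and> Q w (visible M') \<and>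
      M' 60 0 = expr_val e (visible M'))"
  unfolding distrib_right
proof (rule yields_Seq_det[OF draws_frame[OF c(1) M refl] c(2)])
  fix v M1 assume M1: "mem_fits B M1 \<and> unchanged (writes c) (visible M) (visible M1) \<and> Q v (visible M1)"
  show "yields_det I (compile e 60) M1 (ticks Z (compile e 60) * W)
    (\<lambda>M'. mem_fits B M' \<and> unchanged (writes c) (visible M) (visible M') \<and> Q v (visible M') \<and>
      M' 60 0 = expr_val e (visible M'))"
  proof (rule yields_mono[OF yields_compile[of M1 e 60] order_refl])
    fix w :: unit and M' assume M': "(\<forall>a<60. M' a = M1 a) \<and> M' 60 0 = expr_val e M1"
    then have "visible M' = visible M1" by (simp add: visible_compile)
    then show "mem_fits B M' \<and> unchanged (writes c) (visible M) (visible M') \<and> Q v (visible M') \<and>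
      M' 60 0 = expr_val e (visible M')"
      using M1 M' expr_val_visible[OF e, of M1] mem_fits_visible[of B M'] by simp
  qed (use e M1 in \<open>auto simp: admissible_def\<close>)
qed

lemma yields_while_iterations:
  assumes e: "admissible e" and fin: "finite (set_pmf P)"
    and step: "\<And>ws L'. length ws < N \<Longrightarrow> set ws \<subseteq> set_pmf P \<Longrightarrow> mem_fits B L' \<Longrightarrow> unchanged (writes c) L L' \<Longrightarrow> Inv ws L' \<Longrightarrow>
      expr_val e L' > 0 \<and> draws c L' P (\<lambda>w. Inv (ws @ [w]))"
    and stop: "\<And>ws L'. length ws = N \<Longrightarrow> unchanged (writes c) L L' \<Longrightarrow> Inv ws L' \<Longrightarrow> \<not> expr_val e L' > 0"
    and "length ws + n = N" "set ws \<subseteq> set_pmf P" "mem_fits B M" "unchanged (writes c) L (visible M)"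
      "Inv ws (visible M)"
      "M 60 0 = expr_val e (visible M)"
  shows "yields I (While 60 (c ;; compile e 60)) M (replicate_pmf n P)
    (n * ((1 + ticks Z (c ;; compile e 60)) * W) + W)
    (\<lambda>vs M'. mem_fits B M' \<and> Inv (ws @ vs) (visible M'))"
  using assms(5-)
proof (induction n arbitrary: ws M)
  case 0
  then have "\<not> M 60 0 > 0" using stop[of ws "visible M"] by simp
  moreover have "1 + rat_size (M 60 0) \<le> W" using admissible_size_le[OF _ e, of "visible M"] 0 words_le by simp
  ultimately have "yields_det I (While 60 (c ;; compile e 60)) M W (\<lambda>M'. mem_fits B M' \<and> Inv ws (visible M'))"
    using runs_While_False[of M 60] 0 by (intro yieldsI) auto
  then show ?case by (simp add: yields_det_return)
next
  case (Suc n)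
  let ?body = "c ;; compile e 60"
  have pos: "M 60 0 > 0" and draw: "draws c (visible M) P (\<lambda>w. Inv (ws @ [w]))"
    using step[of ws "visible M"] Suc.prems by auto
  have time: "1 + rat_size (M 60 0) \<le> W" using admissible_size_le[OF _ e, of "visible M"] Suc.prems words_le
    by simp
  have "yields I (While 60 ?body) M (pair_pmf P (replicate_pmf n P)) (1 + rat_size (M 60 0) +
      ((ticks Z c + ticks Z (compile e 60)) * W + (n * ((1 + ticks Z ?body) * W) + W)))
      (\<lambda>(v, vs) M'. mem_fits B M' \<and> Inv (ws @ v # vs) (visible M'))"
  proof (rule yields_While_True[OF pos yields_while_body[OF e Suc.prems(3) draw fin] fin])
    fix v M' assume v: "v \<in> set_pmf P" and M': "mem_fits B M' \<and> unchanged (writes c) (visible M) (visible M') \<and>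
      Inv (ws @ [v]) (visible M') \<and> M' 60 0 = expr_val e (visible M')"
    then have "unchanged (writes c) L (visible M')"
      using unchanged_trans[OF Suc.prems(4)] unchanged_mono by (metis Int_lower1 Un_absorb)
    then show "yields I (While 60 ?body) M' (replicate_pmf n P) (n * ((1 + ticks Z ?body) * W) + W)
      (\<lambda>vs. (\<lambda>(v, vs) M'. mem_fits B M' \<and> Inv (ws @ v # vs) (visible M')) (v, vs))"
      using Suc.IH[of "ws @ [v]" M'] Suc.prems v M' by simp
  qed
  then have "yields I (While 60 ?body) M (replicate_pmf (Suc n) P) (1 + rat_size (M 60 0) +
      ((ticks Z c + ticks Z (compile e 60)) * W + (n * ((1 + ticks Z ?body) * W) + W)))
      (\<lambda>vs M'. mem_fits B M' \<and> Inv (ws @ vs) (visible M'))"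
    unfolding replicate_pmf_Suc_pair by (intro yields_map_inj) (auto simp: inj_def split_def)
  then show ?case by (rule yields_mono) (use time in \<open>auto simp: distrib_right\<close>)
qed

lemma draws_while_pos:
  assumes "admissible e" "N \<le> Z" "finite (set_pmf P)" "Inv [] L"
    and "\<And>ws L'. length ws < N \<Longrightarrow> set ws \<subseteq> set_pmf P \<Longrightarrow> mem_fits B L' \<Longrightarrow> unchanged (writes c) L L' \<Longrightarrow> Inv ws L' \<Longrightarrow>
      expr_val e L' > 0 \<and> draws c L' P (\<lambda>w. Inv (ws @ [w]))"
    and "\<And>ws L'. length ws = N \<Longrightarrow> unchanged (writes c) L L' \<Longrightarrow> Inv ws L' \<Longrightarrow> \<not> expr_val e L' > 0"
  shows "draws (WHILE e DO c) L (replicate_pmf N P) Inv"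
proof (rule drawsI)
  fix M assume M: "mem_fits B M" "L = visible M"
  define body where "body = c ;; compile e 60"
  let ?t = "ticks Z (compile e 60) * W + (N * ((1 + ticks Z body) * W) + W)"
  have "N * ((1 + ticks Z body) * W) \<le> Z * ((1 + ticks Z body) * W)"
    using assms(2) by (rule mult_right_mono) simp
  then have time: "?t \<le> ticks Z (WHILE e DO c) * W"
    unfolding while_pos_def body_def[symmetric] ticks.simps distrib_right by (simp add: algebra_simps)
  have "yields I (WHILE e DO c) M (replicate_pmf N P) ?t (\<lambda>ws M'. mem_fits B M' \<and> Inv ws (visible M'))"
    unfolding while_pos_def body_def
  proof (rule yields_det_Seq[OF yields_compile], goal_cases)
    case evaluated: (6 M1)
    then have "visible M1 = L" using M visible_compile[of M1 M] by simp
    then have "yields I (While 60 (c ;; compile e 60)) M1 (replicate_pmf N P)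
      (N * ((1 + ticks Z (c ;; compile e 60)) * W) + W)
      (\<lambda>ws M'. mem_fits B M' \<and> Inv ([] @ ws) (visible M'))"
      using evaluated M assms(4) expr_val_visible[OF assms(1), of M]
      by (intro yields_while_iterations[OF assms(1,3,5,6)]) (auto simp: unchanged_def mem_fits_def)
    then show ?case by simp
  qed (use M assms(1) in \<open>auto simp: admissible_def\<close>)
  then show "yields I (WHILE e DO c) M (replicate_pmf N P) (ticks Z (WHILE e DO c) * W)
    (\<lambda>ws M'. mem_fits B M' \<and> Inv ws (visible M'))"
    using time by (rule yields_mono) simp
qed

lemma fits_counter: "n \<le> Z \<Longrightarrow> fits B (of_nat n)"
  using Z_le by (intro fits_of_nat) linarith

lemma draws_for_below:
  assumes ok: "loop_regs_ok i n c" and N: "expr_val n L = of_nat N" "N \<le> Z" and fin: "finite (set_pmf P)"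
    and init: "Inv [] (set_cell i 0 0 L)"
    and step: "\<And>ws L'. length ws < N \<Longrightarrow> set ws \<subseteq> set_pmf P \<Longrightarrow> mem_fits B L' \<Longrightarrow> unchanged (insert i (writes c)) L L' \<Longrightarrow>
      L' i 0 = of_nat (length ws) \<Longrightarrow> Inv ws L' \<Longrightarrow>
      draws c L' P (\<lambda>w L''. Inv (ws @ [w]) (set_cell i 0 (of_nat (Suc (length ws))) L''))"
  shows "draws (FOR i < n DO c) L (replicate_pmf N P) Inv"
  unfolding for_below_def
proof (rule draws_Seq[OF ensures_assign[where Q = "\<lambda>L'. L' = set_cell i 0 0 L"]])
  let ?L = "set_cell i 0 0 L" and ?inc = "i ::= Reg i \<^bold>+ Num 1"
  have i: "i < 60" "i \<notin> writes c" using ok by (auto simp: loop_regs_ok_def)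
  have frame: "unchanged (insert i (writes c)) L L'" if "unchanged (writes (c ;; ?inc)) ?L L'" for L'
    using that i by (auto simp: unchanged_def)
  then have bound: "expr_val n L' = of_nat N" if "unchanged (writes (c ;; ?inc)) ?L L'" for L'
    unfolding N(1)[symmetric] using ok unchangedD[OF frame[OF that]]
    by (intro expr_val_cong) (auto simp: loop_regs_ok_def)
  have "draws (WHILE n \<^bold>- Reg i DO (c ;; ?inc)) ?L (replicate_pmf N P)
    (\<lambda>ws L'. Inv ws L' \<and> L' i 0 = of_nat (length ws))"
  proof (rule draws_while_pos[OF _ N(2) fin])
    fix ws L1 assume ws: "length ws < N" "set ws \<subseteq> set_pmf P"
      and L1: "mem_fits B L1" "unchanged (writes (c ;; ?inc)) ?L L1"
      and inv: "Inv ws L1 \<and> L1 i 0 = of_nat (length ws)"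
    have "draws (c ;; ?inc) L1 P (\<lambda>w L'. Inv (ws @ [w]) L' \<and> L' i 0 = of_nat (length (ws @ [w])))"
    proof (rule draws_Seq_ensures[OF step[OF ws L1(1) frame[OF L1(2)]] fin])
      fix w L2 assume "unchanged (writes c) L1 L2"
        and L2: "Inv (ws @ [w]) (set_cell i 0 (of_nat (Suc (length ws))) L2)"
      then have "L2 i 0 = of_nat (length ws)" using unchangedD i inv by metis
      then show "ensures ?inc L2 (\<lambda>L'. Inv (ws @ [w]) L' \<and> L' i 0 = of_nat (length (ws @ [w])))"
        using i L2 ws(1) N(2) fits_counter[of "Suc (length ws)"]
        by (intro ensures_assign) (auto simp: admissible_def add.commute)
    qed (use inv in auto)
    then show "0 < expr_val (n \<^bold>- Reg i) L1 \<and>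
      draws (c ;; ?inc) L1 P (\<lambda>w L'. Inv (ws @ [w]) L' \<and> L' i 0 = of_nat (length (ws @ [w])))"
      using bound[OF L1(2)] inv ws(1) by simp
  qed (use ok init bound in \<open>auto simp: admissible_def loop_regs_ok_def\<close>)
  then show "draws (WHILE n \<^bold>- Reg i DO (c ;; ?inc)) L' (replicate_pmf N P) Inv" if "L' = ?L" for L'
    unfolding that by (rule draws_mono) simp
qed (use ok in \<open>auto simp: admissible_def loop_regs_ok_def\<close>)

lemma ensures_of_replicate:
  assumes "draws c L (replicate_pmf N (return_pmf ())) (\<lambda>ws. Q (length ws))"
  shows "ensures c L (Q N)"
proof (rule drawsI)
  fix M assume "mem_fits B M" "L = visible M"
  then show "yields_det I c M (ticks Z c * W) (\<lambda>M'. mem_fits B M' \<and> Q N (visible M'))"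
    using yields_unmap[where f = "\<lambda>_::unit. replicate N ()" and P = "return_pmf ()"] drawsD assms
    by (fastforce simp: replicate_pmf_return)
qed

lemma ensures_while_pos:
  assumes "admissible e" "N \<le> Z" "Inv 0 L"
    and "\<And>j L'. j < N \<Longrightarrow> mem_fits B L' \<Longrightarrow> unchanged (writes c) L L' \<Longrightarrow> Inv j L' \<Longrightarrow>
      expr_val e L' > 0 \<and> ensures c L' (Inv (Suc j))"
    and "\<And>L'. unchanged (writes c) L L' \<Longrightarrow> Inv N L' \<Longrightarrow> \<not> expr_val e L' > 0"
  shows "ensures (WHILE e DO c) L (Inv N)"
proof -
  have "draws (WHILE e DO c) L (replicate_pmf N (return_pmf ())) (\<lambda>ws. Inv (length ws))"
    by (rule draws_while_pos) (use assms in auto)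
  then show ?thesis by (rule ensures_of_replicate)
qed

lemma ensures_for_below:
  assumes "loop_regs_ok i n c" "expr_val n L = of_nat N" "N \<le> Z" "Inv 0 (set_cell i 0 0 L)"
    and "\<And>j L'. j < N \<Longrightarrow> mem_fits B L' \<Longrightarrow> unchanged (insert i (writes c)) L L' \<Longrightarrow> L' i 0 = of_nat j \<Longrightarrow> Inv j L' \<Longrightarrow>
      ensures c L' (\<lambda>L''. Inv (Suc j) (set_cell i 0 (of_nat (Suc j)) L''))"
  shows "ensures (FOR i < n DO c) L (Inv N)"
proof -
  have "draws (FOR i < n DO c) L (replicate_pmf N (return_pmf ())) (\<lambda>ws. Inv (length ws))"
    by (rule draws_for_below) (use assms in auto)
  then show ?thesis by (rule ensures_of_replicate)
qed

lemma ensures_sum_loop: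
  assumes ok: "loop_regs_ok i n c" "acc < 60" "acc \<noteq> i" "acc \<notin> writes c" "acc \<notin> expr_regs n"
    "admissible (Reg acc \<^bold>+ e)"
    and N: "expr_val n L = of_nat N" "N \<le> Z" and fits: "\<And>j. j \<le> N \<Longrightarrow> fits B (\<Sum>k<j. f k)"
    and step: "\<And>j L'. j < N \<Longrightarrow> mem_fits B L' \<Longrightarrow> unchanged ({acc, i} \<union> writes c) L L' \<Longrightarrow> L' i 0 = of_nat j \<Longrightarrow>
      ensures c L' (\<lambda>L''. expr_val e L'' = f j)"
  shows "ensures (sum_loop acc i n c e) L (\<lambda>L'. L' acc 0 = (\<Sum>k<N. f k))"
  unfolding sum_loop_def
proof (rule draws_SeqI, rule ensures_assign)
  let ?L = "set_cell acc 0 (expr_val (Num 0) L) L" and ?b = "c ;; acc ::= Reg acc \<^bold>+ e"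
  show "ensures (FOR i < n DO ?b) ?L (\<lambda>L'. L' acc 0 = (\<Sum>k<N. f k))"
  proof (rule ensures_for_below)
    show "expr_val n ?L = of_nat N"
      unfolding N(1)[symmetric] using ok(5) by (intro expr_val_cong) (auto simp: set_cell_def)
    fix j L' assume j: "j < N" and L': "mem_fits B L'" "unchanged (insert i (writes ?b)) ?L L'" "L' i 0 = of_nat j"
      and inv: "L' acc 0 = (\<Sum>k<j. f k)"
    have "unchanged ({acc, i} \<union> writes c) L L'" using L'(2) by (auto simp: unchanged_def)
    from step[OF j L'(1) this L'(3)]
    show "ensures ?b L' (\<lambda>L''. set_cell i 0 (of_nat (Suc j)) L'' acc 0 = (\<Sum>k<Suc j. f k))"
    proof (rule draws_Seq)
      fix L2 assume "unchanged (writes c) L' L2" and e: "expr_val e L2 = f j"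
      then have "L2 acc 0 = (\<Sum>k<j. f k)" using inv unchangedD ok(2,4) by metis
      then show "ensures (acc ::= Reg acc \<^bold>+ e) L2
        (\<lambda>L''. set_cell i 0 (of_nat (Suc j)) L'' acc 0 = (\<Sum>k<Suc j. f k))"
        using ok e fits[of "Suc j"] j by (intro ensures_assign) (auto simp: add.commute)
    qed
  qed (use ok N in \<open>auto simp: loop_regs_ok_def\<close>)
qed (use ok in \<open>auto simp: admissible_def\<close>)

lemma ensures_tabulate:
  assumes ok: "loop_regs_ok i n c" "dst < 60" "dst \<noteq> i" "dst \<notin> writes c" "dst \<notin> expr_regs n" "admissible e"
    and N: "expr_val n L = of_nat N" "N \<le> Z" and fits: "\<And>j. j < N \<Longrightarrow> fits B (f j)"
    and step: "\<And>j L'. j < N \<Longrightarrow> mem_fits B L' \<Longrightarrow> unchanged ({dst, i} \<union> writes c) L L' \<Longrightarrow> L' i 0 = of_nat j \<Longrightarrow>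
      L' dst = (\<lambda>k. if k < j then f k else L dst k) \<Longrightarrow> ensures c L' (\<lambda>L''. expr_val e L'' = f j)"
  shows "ensures (tabulate dst i n c e) L (\<lambda>L'. L' dst = (\<lambda>k. if k < N then f k else L dst k))"
  unfolding tabulate_def
proof (rule ensures_for_below[OF _ N])
  fix j L' assume j: "j < N"
    and L': "mem_fits B L'" "unchanged (insert i (writes (c ;; dst .[Reg i] ::= e))) L L'" "L' i 0 = of_nat j"
    and inv: "L' dst = (\<lambda>k. if k < j then f k else L dst k)"
  have "unchanged ({dst, i} \<union> writes c) L L'" using L'(2) by (auto simp: unchanged_def)
  from step[OF j L'(1) this L'(3) inv]
  show "ensures (c ;; dst .[Reg i] ::= e) L'
    (\<lambda>L''. set_cell i 0 (of_nat (Suc j)) L'' dst = (\<lambda>k. if k < Suc j then f k else L dst k))"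
  proof (rule draws_Seq)
    fix L2 assume "unchanged (writes c) L' L2" and e: "expr_val e L2 = f j"
    then have "L2 dst = (\<lambda>k. if k < j then f k else L dst k)" "L2 i 0 = of_nat j"
      using inv L'(3) unchangedD ok by (auto simp: loop_regs_ok_def)
    then show "ensures (dst .[Reg i] ::= e) L2
      (\<lambda>L''. set_cell i 0 (of_nat (Suc j)) L'' dst = (\<lambda>k. if k < Suc j then f k else L dst k))"
      using ok e fits[OF j] by (intro ensures_store)
        (auto simp: admissible_def loop_regs_ok_def less_Suc_eq fun_eq_iff)
  qed
qed (use ok in \<open>auto simp: loop_regs_ok_def\<close>)

lemma get_vec_size:
  assumes "mem_fits B M" "b < 60"
  shows "vec_size (get_vec b (mdim I) M) \<le> mdim I * (2 * B + 3)"
proof -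
  have "(\<Sum>i<mdim I. rat_size (M b i)) \<le> of_nat (card {..<mdim I}) * (2 * B + 3)"
    using rat_size_le mem_fitsD[OF assms] by (intro sum_bounded_above) auto
  then show ?thesis by (simp add: vec_size_def get_vec_def)
qed

lemma ensures_Value:
  assumes "a < 60" "b < 60" "c < 60"
    and "fits B (value_orc I (get_vec b (mdim I) L) (get_scenario c (usize I) L))"
    and "Q (set_cell a 0 (value_orc I (get_vec b (mdim I) L) (get_scenario c (usize I) L)) L)"
  shows "ensures (Value a b c) L Q"
proof (rule ensures_prim[where t = "\<lambda>M. oracle_cost I (vec_size (get_vec b (mdim I) L) + usize I)"
      and F = "set_cell a 0 (value_orc I (get_vec b (mdim I) L) (get_scenario c (usize I) L))"])
  show "oracle_cost I (vec_size (get_vec b (mdim I) L) + usize I) \<le> W" if "mem_fits B L"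
    using get_vec_size[OF that assms(2)] by (intro W_oracle) auto
qed (use assms in \<open>auto simp: Let_def get_vec_visible get_scenario_visible visible_set_cell mem_fits_set_cell\<close>)

lemma ensures_Subgrad:
  assumes "a < 60" "b < 60" "c < 60"
    and "\<And>i. i < dim_vec (subgrad_orc I (get_vec b (mdim I) L) (get_scenario c (usize I) L)) \<Longrightarrow>
      fits B (subgrad_orc I (get_vec b (mdim I) L) (get_scenario c (usize I) L) $ i)"
    and "Q (set_vec a (subgrad_orc I (get_vec b (mdim I) L) (get_scenario c (usize I) L)) L)"
  shows "ensures (Subgrad a b c) L Q"
proof (rule ensures_prim[where t = "\<lambda>M. oracle_cost I (vec_size (get_vec b (mdim I) L) + usize I)"
      and F = "set_vec a (subgrad_orc I (get_vec b (mdim I) L) (get_scenario c (usize I) L))"])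
  show "oracle_cost I (vec_size (get_vec b (mdim I) L) + usize I) \<le> W" if "mem_fits B L"
    using get_vec_size[OF that assms(2)] by (intro W_oracle) auto
qed (use assms in \<open>auto simp: Let_def get_vec_visible get_scenario_visible visible_set_vec mem_fits_set_vec\<close>)

lemma ensures_Separate:
  assumes "a < 60" "b < 60" "c < 60"
    and "sep_orc I (get_vec c (mdim I) L) = None \<Longrightarrow> Q (set_cell a 0 0 L)"
    and "\<And>d. sep_orc I (get_vec c (mdim I) L) = Some d \<Longrightarrow>
      (\<forall>i<dim_vec d. fits B (d $ i)) \<and> Q (set_cell a 0 1 (set_vec b d L))"
  shows "ensures (Separate a b c) L Q"
proof (rule ensures_prim[where t = "\<lambda>M. oracle_cost I (vec_size (get_vec c (mdim I) L))"
      and F = "\<lambda>M. case sep_orc I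
        (get_vec c (mdim I) L) of None \<Rightarrow> set_cell a 0 0 M | Some d \<Rightarrow> set_cell a 0 1 (set_vec b d M)"])
  show "oracle_cost I (vec_size (get_vec c (mdim I) L)) \<le> W" if "mem_fits B L"
    using get_vec_size[OF that assms(3)] by (intro W_oracle) auto
  show "mem_fits B (case sep_orc I
    (get_vec c (mdim I) L) of None \<Rightarrow> set_cell a 0 0 L | Some d \<Rightarrow> set_cell a 0 1 (set_vec b d L))"
    if "mem_fits B L" using that assms(5) by (auto split: option.split intro!: mem_fits_set_cell mem_fits_set_vec)
qed (use assms in \<open>auto simp: Let_def get_vec_visible visible_set_cell visible_set_vec split: option.split\<close>)

lemma draws_Sample:
  assumes "a < 60" "\<And>A. Q A (set_vec a (Matrix.vec (usize I) (\<lambda>i. if i \<in> A then 1 else 0)) L)"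
  shows "draws (Sample a) L (center I) Q"
proof (rule drawsI)
  fix M assume "mem_fits B M" "L = visible M"
  then show "yields I (Sample a) M (center I) (ticks Z (Sample a) * W) (\<lambda>A M'. mem_fits B M' \<and> Q A (visible M'))"
    using assms W_sample by (intro yieldsI[OF runs_Sample]) (auto simp: visible_set_vec intro!: mem_fits_set_vec)
qed

end

section \<open>Uniform deviation bounds for independent samples\<close>

lemma nn_integral_replicate_pmf_exp:
  fixes f :: "'a \<Rightarrow> real"
  shows "(\<integral>\<^sup>+xs. ennreal (exp (l * (\<Sum>x\<leftarrow>xs. f x))) \<partial>replicate_pmf n p) =
    (\<integral>\<^sup>+x. ennreal (exp (l * f x)) \<partial>p) ^ n"
proof (induction n)
  case (Suc n)
  have "(\<integral>\<^sup>+xs. ennreal (exp (l * (\<Sum>x\<leftarrow>xs. f x))) \<partial>replicate_pmf (Suc n) p) =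
      (\<integral>\<^sup>+x. \<integral>\<^sup>+xs. ennreal (exp (l * f x)) * ennreal (exp (l * (\<Sum>x\<leftarrow>xs. f x))) \<partial>replicate_pmf n p \<partial>p)"
    by (simp add: algebra_simps exp_add ennreal_mult)
  also have "\<dots> = (\<integral>\<^sup>+x. ennreal (exp (l * f x)) * (\<integral>\<^sup>+x. ennreal (exp (l * f x)) \<partial>p) ^ n \<partial>p)"
    by (simp add: nn_integral_cmult Suc)
  also have "\<dots> = (\<integral>\<^sup>+x. ennreal (exp (l * f x)) \<partial>p) ^ Suc n"
    by (simp add: nn_integral_multc)
  finally show ?case .
qed simp

lemma replicate_pmf_Hoeffding_ge:
  fixes \<phi> :: "'a \<Rightarrow> real"
  assumes range: "\<And>x. x \<in> set_pmf p \<Longrightarrow> 0 \<le> \<phi> x \<and> \<phi> x \<le> 1" and \<eta>: "\<eta> > 0"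
  defines "\<mu> \<equiv> measure_pmf.expectation p \<phi>"
  shows "measure_pmf.prob (replicate_pmf n p) {xs. (\<Sum>x\<leftarrow>xs. \<phi> x) \<ge> real n * (\<mu> + \<eta>)} \<le> exp (- 2 * real n * \<eta>\<^sup>2)"
proof -
  interpret X: interval_bounded_random_variable "measure_pmf p" \<phi> 0 1
    by unfold_locales (auto simp: AE_measure_pmf_iff range)
  let ?l = "4 * \<eta>" and ?R = "replicate_pmf n p"
  let ?upper = "{xs. (\<Sum>x\<leftarrow>xs. \<phi> x) \<ge> real n * (\<mu> + \<eta>)}"
  have "emeasure (measure_pmf ?R) ?upper = (\<integral>\<^sup>+xs. indicator ?upper xs \<partial>?R)" by simp
  also have "\<dots> \<le> (\<integral>\<^sup>+xs. ennreal (exp (- ?l * (real n * \<eta>))) * ennreal (exp (?l * (\<Sum>x\<leftarrow>xs. \<phi> x - \<mu>))) \<partial>?R)"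
  proof (rule nn_integral_mono_AE, unfold AE_measure_pmf_iff, intro ballI)
    fix xs assume "xs \<in> set_pmf ?R"
    then have "length xs = n" by (simp add: set_replicate_pmf)
    then have centered: "(\<Sum>x\<leftarrow>xs. \<phi> x - \<mu>) = (\<Sum>x\<leftarrow>xs. \<phi> x) - real n * \<mu>"
      by (simp add: sum_list_subtractf sum_list_triv)
    have "indicator ?upper xs \<le> ennreal (exp (?l * ((\<Sum>x\<leftarrow>xs. \<phi> x) - real n * \<mu> - real n * \<eta>)))"
    proof (cases "xs \<in> ?upper")
      case True
      then have "0 \<le> ?l * ((\<Sum>x\<leftarrow>xs. \<phi> x) - real n * \<mu> - real n * \<eta>)"
        using \<eta> by (intro mult_nonneg_nonneg) (auto simp: algebra_simps)
      then show ?thesis using True by simp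
    qed simp
    also have "\<dots> = ennreal (exp (- ?l * (real n * \<eta>))) * ennreal (exp (?l * (\<Sum>x\<leftarrow>xs. \<phi> x - \<mu>)))"
      unfolding centered by (simp add: ennreal_mult[symmetric] exp_add[symmetric] algebra_simps)
    finally show "indicator ?upper xs \<le>
      ennreal (exp (- ?l * (real n * \<eta>))) * ennreal (exp (?l * (\<Sum>x\<leftarrow>xs. \<phi> x - \<mu>)))" .
  qed
  also have "\<dots> = ennreal (exp (- ?l * (real n * \<eta>))) * (\<integral>\<^sup>+x. ennreal (exp (?l * (\<phi> x - \<mu>))) \<partial>p) ^ n"
    by (simp add: nn_integral_cmult nn_integral_replicate_pmf_exp)
  also have "\<dots> \<le> ennreal (exp (- ?l * (real n * \<eta>))) * ennreal (exp (?l\<^sup>2 * (1 - 0)\<^sup>2 / 8)) ^ n"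
    using X.Hoeffdings_lemma_nn_integral[of ?l] \<eta> unfolding \<mu>_def
    by (intro mult_left_mono power_mono) auto
  also have "\<dots> = ennreal (exp (- ?l * (real n * \<eta>) + real n * (?l\<^sup>2 / 8)))"
    by (simp add: ennreal_power ennreal_mult[symmetric] exp_diff exp_minus exp_of_nat_mult field_simps)
  also have "- ?l * (real n * \<eta>) + real n * (?l\<^sup>2 / 8) = - 2 * real n * \<eta>\<^sup>2"
    by (simp add: power2_eq_square)
  finally show ?thesis
    by (simp add: measure_pmf.emeasure_eq_measure)
qed

lemma replicate_pmf_Hoeffding_abs:
  fixes \<phi> :: "'a \<Rightarrow> real"
  assumes range: "\<And>x. x \<in> set_pmf p \<Longrightarrow> 0 \<le> \<phi> x \<and> \<phi> x \<le> 1" and \<eta>: "\<eta> > 0"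
  defines "\<mu> \<equiv> measure_pmf.expectation p \<phi>"
  shows "measure_pmf.prob (replicate_pmf n p) {xs. \<bar>(\<Sum>x\<leftarrow>xs. \<phi> x) - real n * \<mu>\<bar> \<ge> real n * \<eta>}
    \<le> 2 * exp (- 2 * real n * \<eta>\<^sup>2)"
proof -
  let ?R = "replicate_pmf n p"
  let ?upper = "{xs. (\<Sum>x\<leftarrow>xs. \<phi> x) \<ge> real n * (\<mu> + \<eta>)}"
  let ?lower = "{xs. (\<Sum>x\<leftarrow>xs. 1 - \<phi> x) \<ge> real n * ((1 - \<mu>) + \<eta>)}"
  have integrable: "integrable (measure_pmf p) \<phi>"
    by (rule measure_pmf.integrable_const_bound[where B = 1]) (auto simp: AE_measure_pmf_iff range)
  have mean': "measure_pmf.expectation p (\<lambda>x. 1 - \<phi> x) = 1 - \<mu>"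
    using integrable by (simp add: \<mu>_def)
  have upper: "measure_pmf.prob ?R ?upper \<le> exp (- 2 * real n * \<eta>\<^sup>2)"
    unfolding \<mu>_def by (rule replicate_pmf_Hoeffding_ge[OF range \<eta>])
  have lower: "measure_pmf.prob ?R ?lower \<le> exp (- 2 * real n * \<eta>\<^sup>2)"
    using replicate_pmf_Hoeffding_ge[of p "\<lambda>x. 1 - \<phi> x" \<eta> n] range \<eta> by (simp add: mean')
  have "measure_pmf.prob ?R {xs. \<bar>(\<Sum>x\<leftarrow>xs. \<phi> x) - real n * \<mu>\<bar> \<ge> real n * \<eta>}
      \<le> measure_pmf.prob ?R (?upper \<union> ?lower)"
  proof (rule measure_pmf.finite_measure_mono_AE, unfold AE_measure_pmf_iff, intro ballI impI)
    fix xs assume "xs \<in> set_pmf ?R" and xs: "xs \<in> {xs. \<bar>(\<Sum>x\<leftarrow>xs. \<phi> x) - real n * \<mu>\<bar> \<ge> real n * \<eta>}"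
    then have "length xs = n" by (simp add: set_replicate_pmf)
    then have centered: "(\<Sum>x\<leftarrow>xs. 1 - \<phi> x) = real n - (\<Sum>x\<leftarrow>xs. \<phi> x)"
      by (simp add: sum_list_subtractf sum_list_triv)
    show "xs \<in> ?upper \<union> ?lower" using xs unfolding centered mem_Collect_eq Un_iff
      by (simp add: algebra_simps) linarith
  qed simp
  also have "\<dots> \<le> measure_pmf.prob ?R ?upper + measure_pmf.prob ?R ?lower"
    by (rule measure_Un_le) auto
  finally show ?thesis using upper lower by linarith
qed

lemma replicate_pmf_uniform_deviation:
  fixes F :: "('a \<Rightarrow> real) set"
  assumes "finite F" and range: "\<And>\<phi> x. \<phi> \<in> F \<Longrightarrow> x \<in> set_pmf p \<Longrightarrow> 0 \<le> \<phi> x \<and> \<phi> x \<le> 1" and "\<eta> > 0" "n > 0"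
  shows "measure_pmf.prob (replicate_pmf n p)
      {xs. \<exists>\<phi>\<in>F. \<bar>(\<Sum>i<n. \<phi> (xs ! i)) / real n - measure_pmf.expectation p \<phi>\<bar> \<ge> \<eta>}
    \<le> real (card F) * (2 * exp (- 2 * real n * \<eta>\<^sup>2))" (is "measure_pmf.prob ?R _ \<le> _")
proof -
  let ?dev = "\<lambda>\<phi>. {xs. \<bar>(\<Sum>i<n. \<phi> (xs ! i)) / real n - measure_pmf.expectation p \<phi>\<bar> \<ge> \<eta>}"
  have single: "measure_pmf.prob ?R (?dev \<phi>) \<le> 2 * exp (- 2 * real n * \<eta>\<^sup>2)" if "\<phi> \<in> F" for \<phi>
  proof -
    let ?\<mu> = "measure_pmf.expectation p \<phi>"
    have "measure_pmf.prob ?R (?dev \<phi>) \<le> measure_pmf.prob ?R {xs. \<bar>(\<Sum>x\<leftarrow>xs. \<phi> x) - real n * ?\<mu>\<bar> \<ge> real n * \<eta>}"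
    proof (rule measure_pmf.finite_measure_mono_AE, unfold AE_measure_pmf_iff, intro ballI impI)
      fix xs assume "xs \<in> set_pmf ?R" and dev: "xs \<in> ?dev \<phi>"
      then have "(\<Sum>x\<leftarrow>xs. \<phi> x) = (\<Sum>i<n. \<phi> (xs ! i))"
        by (simp add: set_replicate_pmf sum_list_sum_nth atLeast0LessThan)
      then have "\<bar>(\<Sum>x\<leftarrow>xs. \<phi> x) - real n * ?\<mu>\<bar> = real n * \<bar>(\<Sum>i<n. \<phi> (xs ! i)) / real n - ?\<mu>\<bar>"
        using assms(4) by (simp add: abs_if field_simps)
      then show "xs \<in> {xs. \<bar>(\<Sum>x\<leftarrow>xs. \<phi> x) - real n * ?\<mu>\<bar> \<ge> real n * \<eta>}"
        using dev by (simp add: mult_left_mono)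
    qed simp
    also have "\<dots> \<le> 2 * exp (- 2 * real n * \<eta>\<^sup>2)" by (intro replicate_pmf_Hoeffding_abs range[OF that] assms(3))
    finally show ?thesis .
  qed
  have "{xs. \<exists>\<phi>\<in>F. \<bar>(\<Sum>i<n. \<phi> (xs ! i)) / real n - measure_pmf.expectation p \<phi>\<bar> \<ge> \<eta>} = (\<Union>\<phi>\<in>F. ?dev \<phi>)"
    by auto
  then have "measure_pmf.prob ?R {xs. \<exists>\<phi>\<in>F. \<bar>(\<Sum>i<n. \<phi> (xs ! i)) / real n - measure_pmf.expectation p \<phi>\<bar> \<ge> \<eta>}
      \<le> (\<Sum>\<phi>\<in>F. measure_pmf.prob ?R (?dev \<phi>))"
    using measure_pmf.finite_measure_subadditive_finite[OF assms(1), of ?dev] by simp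
  also have "\<dots> \<le> (\<Sum>\<phi>\<in>F. 2 * exp (- 2 * real n * \<eta>\<^sup>2))" by (intro sum_mono single)
  finally show ?thesis by simp
qed

section \<open>Cutting simplices through the centroid\<close>

definition in_simplex :: "nat \<Rightarrow> (nat \<Rightarrow> nat \<Rightarrow> real) \<Rightarrow> (nat \<Rightarrow> real) \<Rightarrow> bool" where
  "in_simplex m v y \<longleftrightarrow> (\<exists>l. (\<forall>i\<le>m. 0 \<le> l i) \<and> (\<Sum>i\<le>m. l i) = 1 \<and>
    (\<forall>k<m. y k = (\<Sum>i\<le>m. l i * v i k)))"

lemma in_simplexE:
  assumes "in_simplex m v y"
  obtains l where "\<And>i. i \<le> m \<Longrightarrow> 0 \<le> l i" "(\<Sum>i\<le>m. l i) = 1" "\<And>k. k < m \<Longrightarrow> y k = (\<Sum>i\<le>m. l i * v i k)"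
  using assms unfolding in_simplex_def by blast

lemma in_simplex_cong:
  assumes "\<And>i k. i \<le> m \<Longrightarrow> k < m \<Longrightarrow> v i k = v' i k" "\<And>k. k < m \<Longrightarrow> y k = y' k"
  shows "in_simplex m v y \<longleftrightarrow> in_simplex m v' y'"
  using assms by (simp add: in_simplex_def)

definition simplex_mat :: "nat \<Rightarrow> (nat \<Rightarrow> nat \<Rightarrow> real) \<Rightarrow> real Matrix.mat" where
  "simplex_mat m v = Matrix.mat (Suc m) (Suc m) (\<lambda>(i, k). if k = 0 then 1 else v i (k - 1))"

definition simplex_vol :: "nat \<Rightarrow> (nat \<Rightarrow> nat \<Rightarrow> real) \<Rightarrow> real" where
  "simplex_vol m v = \<bar>Determinant.det (simplex_mat m v)\<bar>"

lemma simplex_mat_carrier [simp]: "simplex_mat m v \<in> carrier_mat (Suc m) (Suc m)"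
  by (simp add: simplex_mat_def)

lemma simplex_vol_nonneg: "0 \<le> simplex_vol m v"
  by (simp add: simplex_vol_def)

lemma simplex_vol_cong:
  assumes "\<And>i k. i \<le> m \<Longrightarrow> k < m \<Longrightarrow> v i k = v' i k"
  shows "simplex_vol m v = simplex_vol m v'"
proof -
  have "simplex_mat m v = simplex_mat m v'"
    by (rule eq_matI) (use assms in \<open>auto simp: simplex_mat_def\<close>)
  then show ?thesis by (simp add: simplex_vol_def)
qed

lemma simplex_vol_move_vertex:
  assumes "p \<le> m" "t \<le> m" "t \<noteq> p"
  shows "simplex_vol m (v(t := (\<lambda>k. v p k + s * (v t k - v p k)))) = \<bar>s\<bar> * simplex_vol m v"
proof -
  let ?v' = "v(t := (\<lambda>k. v p k + s * (v t k - v p k)))"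
  have "simplex_mat m ?v' = addrow (1 - s) t p (multrow t s (simplex_mat m v))"
    by (rule eq_matI) (use assms in \<open>auto simp: simplex_mat_def algebra_simps\<close>)
  then have "Determinant.det (simplex_mat m ?v') = s * Determinant.det (simplex_mat m v)"
    using assms by (simp add: det_addrow[of _ "Suc m"] det_multrow[of _ "Suc m"])
  then show ?thesis by (simp add: simplex_vol_def abs_mult)
qed

lemma simplex_vol_contract:
  assumes p: "p \<le> m" and v': "\<And>i k. i \<le> m \<Longrightarrow> k < m \<Longrightarrow> v' i k = v p k + s i * (v i k - v p k)"
  shows "simplex_vol m v' = (\<Prod>i\<in>{..m} - {p}. \<bar>s i\<bar>) * simplex_vol m v"
proof -
  define w where "w A i = (if i \<in> A then \<lambda>k. v p k + s i * (v i k - v p k) else v i)" for A i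
  have "simplex_vol m (w A) = (\<Prod>i\<in>A. \<bar>s i\<bar>) * simplex_vol m v" if "finite A" "A \<subseteq> {..m} - {p}" for A
    using that
  proof (induction A)
    case empty
    then show ?case by (simp add: w_def)
  next
    case (insert t A)
    have "w (insert t A) = (w A)(t := (\<lambda>k. w A p k + s t * (w A t k - w A p k)))"
      using insert by (auto simp: w_def fun_eq_iff)
    then have "simplex_vol m (w (insert t A)) = \<bar>s t\<bar> * simplex_vol m (w A)"
      using insert p by (simp only:) (rule simplex_vol_move_vertex, auto)
    then show ?case using insert by simp
  qed
  from this[of "{..m} - {p}"] have "simplex_vol m (w ({..m} - {p})) = (\<Prod>i\<in>{..m} - {p}. \<bar>s i\<bar>) * simplex_vol m v"
    by simp
  moreover have "simplex_vol m (w ({..m} - {p})) = simplex_vol m v'"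
    by (rule simplex_vol_cong) (use v' p in \<open>auto simp: w_def\<close>)
  ultimately show ?thesis by simp
qed

lemma det_abs_le_fact:
  fixes A :: "real Matrix.mat"
  assumes A: "A \<in> carrier_mat n n" and entries: "\<And>i j. i < n \<Longrightarrow> j < n \<Longrightarrow> \<bar>A $$ (i, j)\<bar> \<le> 1"
  shows "\<bar>Determinant.det A\<bar> \<le> fact n"
proof -
  let ?P = "{p. p permutes {0..<n}}"
  have "\<bar>Determinant.det A\<bar> \<le> (\<Sum>p\<in>?P. \<bar>signof p * (\<Prod>i = 0..<n. A $$ (i, p i))\<bar>)"
    unfolding det_def'[OF A] by (rule sum_abs)
  also have "\<dots> \<le> (\<Sum>p\<in>?P. 1)"
  proof (rule sum_mono)
    fix p assume p: "p \<in> ?P"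
    have "\<bar>signof p :: real\<bar> = 1" by (cases p rule: sign_cases) simp_all
    moreover have "(\<Prod>i = 0..<n. \<bar>A $$ (i, p i)\<bar>) \<le> 1"
      using p entries permutes_in_image[of p "{0..<n}"] by (intro prod_le_1) auto
    ultimately show "\<bar>signof p * (\<Prod>i = 0..<n. A $$ (i, p i))\<bar> \<le> 1"
      by (simp add: abs_mult abs_prod)
  qed
  also have "\<dots> = fact n" by (simp add: card_permutations[of _ n])
  finally show ?thesis .
qed

lemma simplex_vol_le:
  assumes "\<And>j. j \<le> m \<Longrightarrow> in_simplex m v (z j)"
  shows "simplex_vol m z \<le> fact (Suc m) * simplex_vol m v"
proof -
  have "\<exists>l. \<forall>j\<le>m. (\<forall>i\<le>m. 0 \<le> l j i) \<and> (\<Sum>i\<le>m. l j i) = 1 \<and> (\<forall>k<m. z j k = (\<Sum>i\<le>m. l j i * v i k))"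
    using assms unfolding in_simplex_def by metis
  then obtain l where l: "\<And>j i. j \<le> m \<Longrightarrow> i \<le> m \<Longrightarrow> 0 \<le> l j i" "\<And>j. j \<le> m \<Longrightarrow> (\<Sum>i\<le>m. l j i) = 1"
    "\<And>j k. j \<le> m \<Longrightarrow> k < m \<Longrightarrow> z j k = (\<Sum>i\<le>m. l j i * v i k)" by blast
  define A where "A = Matrix.mat (Suc m) (Suc m) (\<lambda>(j, i). l j i)"
  have A: "A \<in> carrier_mat (Suc m) (Suc m)" by (simp add: A_def)
  have "simplex_mat m z = A * simplex_mat m v"
  proof (rule eq_matI)
    fix i j assume "i < dim_row (A * simplex_mat m v)" "j < dim_col (A * simplex_mat m v)"
    then have ij: "i \<le> m" "j \<le> m" by (auto simp: A_def simplex_mat_def)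
    then have "(A * simplex_mat m v) $$ (i, j) = (\<Sum>t\<le>m. l i t * (if j = 0 then 1 else v t (j - 1)))"
      by (simp add: A_def simplex_mat_def scalar_prod_def atLeast0LessThan lessThan_Suc_atMost del: sum.op_ivl_Suc sum.lessThan_Suc)
    also have "\<dots> = (if j = 0 then 1 else z i (j - 1))" using l ij by auto
    finally show "simplex_mat m z $$ (i, j) = (A * simplex_mat m v) $$ (i, j)"
      using ij by (simp add: simplex_mat_def)
  qed (auto simp: A_def simplex_mat_def)
  then have "simplex_vol m z = \<bar>Determinant.det A\<bar> * simplex_vol m v"
    by (simp add: det_mult[OF A simplex_mat_carrier] simplex_vol_def abs_mult)
  also have "l j i \<le> 1" if "j \<le> m" "i \<le> m" for i j
    using member_le_sum[of i "{..m}" "l j"] l that by auto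
  then have "\<bar>Determinant.det A\<bar> \<le> fact (Suc m)"
    using l(1) by (intro det_abs_le_fact[OF A]) (auto simp: A_def)
  then have "\<bar>Determinant.det A\<bar> * simplex_vol m v \<le> fact (Suc m) * simplex_vol m v"
    by (intro mult_right_mono simplex_vol_nonneg)
  finally show ?thesis .
qed

definition corner_simplex :: "(nat \<Rightarrow> real) \<Rightarrow> real \<Rightarrow> nat \<Rightarrow> nat \<Rightarrow> real" where
  "corner_simplex y c i k = y k + (if i = Suc k then c else 0)"

lemma simplex_vol_corner: "simplex_vol m (corner_simplex y c) = \<bar>c\<bar> ^ m"
proof -
  define Lo :: "real Matrix.mat" where "Lo = Matrix.mat (Suc m) (Suc m) (\<lambda>(i, j). if j = 0 \<or> i = j then 1 else 0)"
  define Up :: "real Matrix.mat" where "Up = Matrix.mat (Suc m) (Suc m)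
    (\<lambda>(i, j). if i = 0 then (if j = 0 then 1 else y (j - 1)) else if i = j then c else 0)"
  have carrier: "Lo \<in> carrier_mat (Suc m) (Suc m)" "Up \<in> carrier_mat (Suc m) (Suc m)" by (auto simp: Lo_def Up_def)
  have "simplex_mat m (corner_simplex y c) = Lo * Up"
  proof (rule eq_matI)
    fix i j assume "i < dim_row (Lo * Up)" "j < dim_col (Lo * Up)"
    then have ij: "i \<le> m" "j \<le> m" by (auto simp: Lo_def Up_def)
    then have "(Lo * Up) $$ (i, j) = (\<Sum>t\<le>m. (if t = 0 \<or> i = t then 1 else 0) * Up $$ (t, j))"
      by (simp add: Lo_def scalar_prod_def atLeast0LessThan lessThan_Suc_atMost Up_def del: sum.op_ivl_Suc sum.lessThan_Suc)
    also have "\<dots> = (\<Sum>t\<in>{0, i}. Up $$ (t, j))"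
      using ij by (intro sum.mono_neutral_cong_right) auto
    also have "\<dots> = (if j = 0 then 1 else corner_simplex y c i (j - 1))" 
      using ij by (cases "i = 0") (auto simp: Up_def corner_simplex_def)
    finally show "simplex_mat m (corner_simplex y c) $$ (i, j) = (Lo * Up) $$ (i, j)" using ij
      by (simp add: simplex_mat_def)
  qed (auto simp: Lo_def Up_def simplex_mat_def)
  moreover have "Determinant.det Lo = 1"
    by (subst det_lower_triangular[OF _ carrier(1)]) (auto simp: Lo_def prod_list_diag_prod)
  moreover have "Determinant.det Up = c ^ m"
  proof (subst det_upper_triangular[OF _ carrier(2)])
    show "upper_triangular Up" by (auto simp: Up_def upper_triangular_def)
    have "prod_list (diag_mat Up) = (\<Prod>i = 0..<Suc m. if i = 0 then 1 else c)"
      unfolding prod_list_diag_prod by (intro prod.cong) (auto simp: Up_def)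
    also have "\<dots> = c ^ m" by (subst prod.atLeast0_lessThan_Suc_shift) simp
    finally show "prod_list (diag_mat Up) = c ^ m" .
  qed
  ultimately show ?thesis by (simp add: simplex_vol_def det_mult[OF carrier] power_abs)
qed

lemma in_corner_simplex:
  assumes "c > 0" "\<And>k. k < m \<Longrightarrow> 0 \<le> y k" "(\<Sum>k<m. y k) \<le> c"
  shows "in_simplex m (corner_simplex (\<lambda>_. 0) c) y"
proof -
  define l where "l i = (case i of 0 \<Rightarrow> 1 - (\<Sum>k<m. y k) / c | Suc k \<Rightarrow> y k / c)" for i
  show ?thesis unfolding in_simplex_def
  proof (intro exI[of _ l] conjI allI impI)
    show "0 \<le> l i" if "i \<le> m" for i using that assms by (auto simp: l_def split: nat.split)
    show "(\<Sum>i\<le>m. l i) = 1" by (simp add: sum.atMost_shift l_def sum_divide_distrib)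
    fix k assume k: "k < m"
    have "(\<Sum>i<m. l (Suc i) * corner_simplex (\<lambda>_. 0) c (Suc i) k) = (\<Sum>i<m. if i = k then y k else 0)"
      using assms(1) by (intro sum.cong) (auto simp: l_def corner_simplex_def)
    then show "y k = (\<Sum>i\<le>m. l i * corner_simplex (\<lambda>_. 0) c i k)"
      using k by (simp add: sum.atMost_shift) (simp add: corner_simplex_def)
  qed
qed

definition centroid :: "nat \<Rightarrow> (nat \<Rightarrow> nat \<Rightarrow> 'a::field) \<Rightarrow> nat \<Rightarrow> 'a" where
  "centroid m v k = (\<Sum>i\<le>m. v i k) / (of_nat m + 1)"

definition height :: "nat \<Rightarrow> (nat \<Rightarrow> nat \<Rightarrow> 'a::field) \<Rightarrow> (nat \<Rightarrow> 'a) \<Rightarrow> (nat \<Rightarrow> 'a) \<Rightarrow> nat \<Rightarrow> 'a" where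
  "height m v x a i = (\<Sum>k<m. a k * (v i k - x k))"

text \<open>The rescaling factor of a vertex whose height is \<open>\<beta>\<close> times the depth of the deepest vertex, rounded
  up to a multiple of the reciprocal of \<open>grid_den m\<close>.\<close>

definition grid_den :: "nat \<Rightarrow> nat" where
  "grid_den m = 32 * (m * (m * m))"

definition shrink_factor :: "nat \<Rightarrow> 'a::floor_ceiling \<Rightarrow> 'a" where
  "shrink_factor m \<beta> = (of_int \<lfloor>of_nat (grid_den m) / (1 + \<beta> / (8 * (of_nat m * of_nat m)))\<rfloor> +
    1) / of_nat (grid_den m)"

definition shrink :: "nat \<Rightarrow> (nat \<Rightarrow> nat \<Rightarrow> 'a::floor_ceiling) \<Rightarrow> (nat \<Rightarrow> 'a) \<Rightarrow> nat \<Rightarrow> nat \<Rightarrow> nat \<Rightarrow> 'a" where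
  "shrink m v \<alpha> p i k = v p k + shrink_factor m (\<alpha> i / (- \<alpha> p)) * (v i k - v p k)"

lemma centroid_heights_sum: "(\<Sum>i\<le>m. height m v (centroid m v) a i) = (0::'a::field_char_0)"
proof -
  have nz: "(of_nat m + 1 :: 'a) \<noteq> 0" by (metis Suc_eq_plus1 of_nat_Suc of_nat_neq_0 add.commute)
  have "(\<Sum>i\<le>m. height m v (centroid m v) a i) = (\<Sum>k<m. \<Sum>i\<le>m. a k * (v i k - centroid m v k))"
    unfolding height_def by (rule sum.swap)
  also have "\<dots> = (\<Sum>k<m. a k * ((\<Sum>i\<le>m. v i k) - (of_nat m + 1) * centroid m v k))"
    by (simp add: sum_distrib_left[symmetric] sum_subtractf add.commute)
  also have "\<dots> = 0" using nz by (intro sum.neutral) (simp add: centroid_def)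
  finally show ?thesis .
qed

lemma height_barycentric:
  fixes v :: "nat \<Rightarrow> nat \<Rightarrow> real"
  assumes "(\<Sum>i\<le>m. l i) = 1" "\<And>k. k < m \<Longrightarrow> y k = (\<Sum>i\<le>m. l i * v i k)"
  shows "(\<Sum>i\<le>m. l i * height m v x a i) = (\<Sum>k<m. a k * y k) - (\<Sum>k<m. a k * x k)"
proof -
  have "(\<Sum>i\<le>m. l i * height m v x a i) = (\<Sum>i\<le>m. \<Sum>k<m. a k * (l i * v i k) - l i * (a k * x k))"
    unfolding height_def by (intro sum.cong refl) (simp add: sum_distrib_left algebra_simps)
  also have "\<dots> = (\<Sum>k<m. \<Sum>i\<le>m. a k * (l i * v i k) - l i * (a k * x k))" by (rule sum.swap)
  also have "\<dots> = (\<Sum>k<m. a k * y k - a k * x k)"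
    using assms by (intro sum.cong refl)
      (simp add: sum_subtractf sum_distrib_left[symmetric] sum_distrib_right[symmetric])
  finally show ?thesis by (simp add: sum_subtractf)
qed

lemma in_simplex_rescale:
  assumes p: "p \<le> m" and l: "\<And>i. i \<le> m \<Longrightarrow> 0 \<le> l i" "(\<Sum>i\<le>m. l i) = 1" "\<And>k. k < m \<Longrightarrow> y k = (\<Sum>i\<le>m. l i * v i k)"
    and v': "\<And>i k. i \<le> m \<Longrightarrow> k < m \<Longrightarrow> v' i k = v p k + s i * (v i k - v p k)"
    and s: "\<And>i. i \<le> m \<Longrightarrow> i \<noteq> p \<Longrightarrow> 0 < s i" "(\<Sum>i\<in>{..m} - {p}. l i / s i) \<le> 1"
  shows "in_simplex m v' y"
proof -
  have fin: "finite {..m}" "p \<in> {..m}" using p by auto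
  define l' where "l' i = (if i = p then 1 - (\<Sum>i\<in>{..m} - {p}. l i / s i) else l i / s i)" for i
  have rest: "(\<Sum>i\<in>{..m} - {p}. l' i * f i) = (\<Sum>i\<in>{..m} - {p}. l i / s i * f i)" for f
    by (intro sum.cong) (auto simp: l'_def)
  have sum_l': "(\<Sum>i\<le>m. l' i) = 1"
    using sum.remove[OF fin, of l'] rest[of "\<lambda>_. 1"] by (simp add: l'_def)
  show ?thesis unfolding in_simplex_def
  proof (intro exI[of _ l'] conjI allI impI)
    show "0 \<le> l' i" if "i \<le> m" for i using s(2) s(1)[of i] l(1)[of i] that by (auto simp: l'_def)
    fix k assume k: "k < m"
    let ?d = "\<lambda>i. v i k - v p k"
    have "(\<Sum>i\<le>m. l' i * v' i k) = (\<Sum>i\<le>m. l' i * v p k + l' i * (s i * ?d i))"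
      using v' k by (intro sum.cong) (auto simp only: distrib_left atMost_iff)
    also have "\<dots> = v p k + (\<Sum>i\<le>m. l' i * (s i * ?d i))"
      by (simp add: sum.distrib sum_l' flip: sum_distrib_right)
    also have "(\<Sum>i\<le>m. l' i * (s i * ?d i)) = (\<Sum>i\<in>{..m} - {p}. l i / s i * (s i * ?d i))"
      using sum.remove[OF fin, of "\<lambda>i. l' i * (s i * ?d i)"] rest[of "\<lambda>i. s i * ?d i"] by simp
    also have "\<dots> = (\<Sum>i\<in>{..m} - {p}. l i * ?d i)"
      using s(1) by (intro sum.cong refl) force
    also have "\<dots> = (\<Sum>i\<le>m. l i * ?d i)" using sum.remove[OF fin, of "\<lambda>i. l i * ?d i"] by simp
    also have "\<dots> = y k - v p k"
      using l(2,3) k by (simp add: algebra_simps sum_subtractf flip: sum_distrib_right)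
    finally show "y k = (\<Sum>i\<le>m. l' i * v' i k)" by simp
  qed (rule sum_l')
qed

lemma simplex_cut:
  assumes p: "p \<le> m" "height m v x a p < 0" and y: "in_simplex m v y" "(\<Sum>k<m. a k * y k) < (\<Sum>k<m. a k * x k)"
    and \<kappa>: "0 < \<kappa>" "\<kappa> \<le> 1"
    and s: "\<And>i. i \<le> m \<Longrightarrow> i \<noteq> p \<Longrightarrow> 0 < s i \<and> 1 / s i \<le> 1 + \<kappa> * (height m v x a i / (- height m v x a p))"
    and v': "\<And>i k. i \<le> m \<Longrightarrow> k < m \<Longrightarrow> v' i k = v p k + s i * (v i k - v p k)"
  shows "in_simplex m v' y"
proof -
  let ?\<alpha> = "height m v x a"
  let ?c = "\<lambda>i. 1 + \<kappa> * (?\<alpha> i / (- ?\<alpha> p))"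
  obtain l where l: "\<And>i. i \<le> m \<Longrightarrow> 0 \<le> l i" "(\<Sum>i\<le>m. l i) = 1" "\<And>k. k < m \<Longrightarrow> y k = (\<Sum>i\<le>m. l i * v i k)"
    using in_simplexE[OF y(1)] by blast
  have "(\<Sum>i\<le>m. l i * ?\<alpha> i) < 0" using height_barycentric[OF l(2,3), where x = x and a = a] y(2) by simp
  moreover have "0 \<le> \<kappa> / (- ?\<alpha> p)" using p(2) \<kappa> by (intro divide_nonneg_pos) auto
  ultimately have "\<kappa> / (- ?\<alpha> p) * (\<Sum>i\<le>m. l i * ?\<alpha> i) \<le> 0" by (intro mult_nonneg_nonpos) auto
  moreover have "(\<Sum>i\<le>m. l i * ?c i) = (\<Sum>i\<le>m. l i) + \<kappa> / (- ?\<alpha> p) * (\<Sum>i\<le>m. l i * ?\<alpha> i)"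
  proof -
    have "l i * ?c i = l i + \<kappa> / (- ?\<alpha> p) * (l i * ?\<alpha> i)" for i by (simp add: algebra_simps)
    then show ?thesis by (simp only: sum.distrib sum_distrib_left)
  qed
  moreover have "(\<Sum>i\<in>{..m} - {p}. l i * ?c i) = (\<Sum>i\<le>m. l i * ?c i) - l p * (1 - \<kappa>)"
    using p sum.remove[of "{..m}" p "\<lambda>i. l i * ?c i"] by simp
  moreover have "0 \<le> l p * (1 - \<kappa>)" using l(1)[OF p(1)] \<kappa> by simp
  ultimately have "(\<Sum>i\<in>{..m} - {p}. l i * ?c i) \<le> 1" using l(2) by linarith
  moreover have "(\<Sum>i\<in>{..m} - {p}. l i / s i) \<le> (\<Sum>i\<in>{..m} - {p}. l i * ?c i)"
  proof (rule sum_mono)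
    fix i assume "i \<in> {..m} - {p}"
    then show "l i / s i \<le> l i * ?c i" using mult_left_mono[of "1 / s i" "?c i" "l i"] s[of i] l(1)[of i] by auto
  qed
  ultimately show ?thesis using s by (intro in_simplex_rescale[OF p(1) l v']) auto
qed

lemma inverse_one_plus_le: "1 / (1 + x) \<le> 1 - x + 2 * x\<^sup>2" if "-1/8 \<le> x" for x :: real
proof -
  have "(1 - x + 2 * x\<^sup>2) * (1 + x) = 1 + x\<^sup>2 * (1 + 2 * x)"
    by (simp add: algebra_simps power2_eq_square power3_eq_cube)
  moreover have "0 \<le> x\<^sup>2 * (1 + 2 * x)" using that by simp
  ultimately have "1 \<le> (1 - x + 2 * x\<^sup>2) * (1 + x)" by linarith
  then show ?thesis using that by (simp add: field_simps)
qed

lemma sum_squares_le_of_sum_eq_1: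
  fixes \<beta> :: "'a \<Rightarrow> real"
  assumes "finite S" "S \<noteq> {}" "\<And>i. i \<in> S \<Longrightarrow> -1 \<le> \<beta> i" "(\<Sum>i\<in>S. \<beta> i) = 1"
  shows "(\<Sum>i\<in>S. (\<beta> i)\<^sup>2) \<le> 2 * real (card S) ^ 2"
proof -
  let ?m = "real (card S)"
  have "1 \<le> card S" using assms(1,2) by (simp add: Suc_leI card_gt_0_iff)
  then have m: "1 \<le> ?m" by linarith
  have sum: "(\<Sum>i\<in>S. \<beta> i + 1) = ?m + 1" using assms(4) by (simp add: sum.distrib)
  have "(\<Sum>i\<in>S. (\<beta> i + 1)\<^sup>2) \<le> (\<Sum>i\<in>S. (\<beta> i + 1) * (?m + 1))"
  proof (rule sum_mono)
    fix i assume i: "i \<in> S"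
    have "\<beta> i + 1 \<le> ?m + 1" unfolding sum[symmetric]
      by (rule member_le_sum[OF i]) (use assms(1,3) in force)+
    then show "(\<beta> i + 1)\<^sup>2 \<le> (\<beta> i + 1) * (?m + 1)"
      unfolding power2_eq_square using assms(3)[OF i] by (intro mult_left_mono) auto
  qed
  also have "\<dots> = (?m + 1) * (?m + 1)" by (simp add: sum flip: sum_distrib_right)
  finally have "(\<Sum>i\<in>S. (\<beta> i)\<^sup>2 + 2 * \<beta> i + 1) \<le> (?m + 1) * (?m + 1)"
    by (simp add: power2_eq_square algebra_simps)
  then have "(\<Sum>i\<in>S. (\<beta> i)\<^sup>2) + 2 + ?m \<le> (?m + 1) * (?m + 1)"
    using assms(4) by (simp add: sum.distrib flip: sum_distrib_left)
  moreover have "?m \<le> ?m * ?m" using m by (simp add: mult_le_cancel_left1)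
  ultimately show ?thesis by (simp add: power2_eq_square algebra_simps)
qed

lemma prod_shrink_le:
  fixes \<beta> s :: "'a \<Rightarrow> real"
  assumes S: "finite S" "S \<noteq> {}" and \<beta>: "\<And>i. i \<in> S \<Longrightarrow> -1 \<le> \<beta> i" "(\<Sum>i\<in>S. \<beta> i) = 1"
  defines "M \<equiv> real (card S)"
  assumes s: "\<And>i. i \<in> S \<Longrightarrow> 0 < s i \<and> s i \<le> 1 / (1 + \<beta> i / (8 * M ^ 2)) + 1 / (32 * M ^ 3)"
  shows "(\<Prod>i\<in>S. \<bar>s i\<bar>) \<le> exp (- 1 / (32 * M ^ 2))"
proof -
  have "1 \<le> card S" using S by (simp add: Suc_leI card_gt_0_iff)
  then have M: "1 \<le> M" unfolding M_def by linarith
  define \<kappa> where "\<kappa> = 1 / (8 * M ^ 2)"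
  have \<kappa>: "0 < \<kappa>" "\<kappa> \<le> 1/8" using M by (auto simp: \<kappa>_def field_simps)
  let ?b = "\<lambda>i. - \<kappa> * \<beta> i + 2 * \<kappa>\<^sup>2 * (\<beta> i)\<^sup>2 + 1 / (32 * M ^ 3)"
  have factor: "\<bar>s i\<bar> \<le> exp (?b i)" if i: "i \<in> S" for i
  proof -
    have "\<kappa> * \<beta> i \<ge> \<kappa> * (-1)" using \<beta>(1)[OF i] \<kappa> by (intro mult_left_mono) auto
    then have "1 / (1 + \<kappa> * \<beta> i) \<le> 1 - \<kappa> * \<beta> i + 2 * (\<kappa> * \<beta> i)\<^sup>2" using \<kappa> by (intro inverse_one_plus_le) linarith
    then have "s i \<le> 1 + ?b i" using s[OF i] by (simp add: \<kappa>_def power_divide)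
    also have "\<dots> \<le> exp (?b i)" by (rule exp_ge_add_one_self)
    finally show ?thesis using s[OF i] by simp
  qed
  have "(\<Prod>i\<in>S. \<bar>s i\<bar>) \<le> (\<Prod>i\<in>S. exp (?b i))" using factor by (intro prod_mono) auto
  also have "\<dots> = exp (\<Sum>i\<in>S. ?b i)" using S by (simp add: exp_sum)
  also have "(\<Sum>i\<in>S. ?b i) = - \<kappa> * (\<Sum>i\<in>S. \<beta> i) + 2 * \<kappa>\<^sup>2 * (\<Sum>i\<in>S. (\<beta> i)\<^sup>2) + M * (1 / (32 * M ^ 3))"
    unfolding sum.distrib sum_distrib_left by (simp add: M_def)
  also have "exp \<dots> \<le> exp (- \<kappa> + 2 * \<kappa>\<^sup>2 * (2 * M ^ 2) + M * (1 / (32 * M ^ 3)))"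
    using mult_left_mono[OF sum_squares_le_of_sum_eq_1[OF S \<beta>], of "2 * \<kappa>\<^sup>2"] by (simp add: \<beta>(2) M_def)
  also have "- \<kappa> + 2 * \<kappa>\<^sup>2 * (2 * M ^ 2) + M * (1 / (32 * M ^ 3)) = - 1 / (32 * M ^ 2)"
    using M by (simp add: \<kappa>_def field_simps power2_eq_square power3_eq_cube)
  finally show ?thesis .
qed

lemma rounded_up_bounds:
  fixes D w :: real
  assumes "0 < D" "0 < w"
  shows "1 / w < (of_int \<lfloor>D / w\<rfloor> + 1) / D" "(of_int \<lfloor>D / w\<rfloor> + 1) / D \<le> 1 / w + 1 / D"
proof -
  have floor: "D / w < of_int \<lfloor>D / w\<rfloor> + 1" "of_int \<lfloor>D / w\<rfloor> \<le> D / w" by linarith+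
  show "1 / w < (of_int \<lfloor>D / w\<rfloor> + 1) / D" using floor(1) assms by (simp add: field_simps)
  have "(of_int \<lfloor>D / w\<rfloor> + 1) / D \<le> (D / w + 1) / D" using floor(2) assms by (intro divide_right_mono) auto
  then show "(of_int \<lfloor>D / w\<rfloor> + 1) / D \<le> 1 / w + 1 / D" using assms by (simp add: add_divide_distrib)
qed

lemma shrink_factor_bounds:
  fixes \<beta> :: real
  assumes m: "0 < m" and \<beta>: "-1 \<le> \<beta>"
  defines "w \<equiv> 1 + \<beta> / (8 * real m ^ 2)"
  shows "0 < shrink_factor m \<beta>" "1 / shrink_factor m \<beta> \<le> w" "shrink_factor m \<beta> \<le> 1 / w + 1 / (32 * real m ^ 3)"
proof -
  have M: "1 \<le> real m" using m by simp
  have "- 1 \<le> -1 / real m ^ 2" using M by (simp add: field_simps)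
  also have "\<dots> \<le> \<beta> / real m ^ 2" using \<beta> by (intro divide_right_mono) auto
  finally have w: "0 < w" unfolding w_def by simp
  have D: "real (grid_den m) = 32 * real m ^ 3" "0 < 32 * real m ^ 3" using M
    by (simp_all add: grid_den_def power3_eq_cube)
  have eq: "shrink_factor m \<beta> = (of_int \<lfloor>32 * real m ^ 3 / w\<rfloor> + 1) / (32 * real m ^ 3)"
    by (simp add: shrink_factor_def D(1) w_def power2_eq_square)
  have lower: "1 / w < shrink_factor m \<beta>" unfolding eq by (rule rounded_up_bounds[OF D(2) w])
  show "shrink_factor m \<beta> \<le> 1 / w + 1 / (32 * real m ^ 3)" unfolding eq by (rule rounded_up_bounds[OF D(2) w])
  have "0 < 1 / w" using w by simp
  with lower show pos: "0 < shrink_factor m \<beta>" by linarith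
  have "1 / shrink_factor m \<beta> \<le> 1 / (1 / w)" using lower w pos by (intro divide_left_mono mult_pos_pos) auto
  then show "1 / shrink_factor m \<beta> \<le> w" by simp
qed

lemma lowest_height_neg:
  fixes v :: "nat \<Rightarrow> nat \<Rightarrow> real"
  assumes y: "in_simplex m v y" "(\<Sum>k<m. a k * y k) < (\<Sum>k<m. a k * x k)"
    and p: "\<And>i. i \<le> m \<Longrightarrow> height m v x a p \<le> height m v x a i"
  shows "height m v x a p < 0"
proof (rule ccontr)
  assume "\<not> height m v x a p < 0"
  then have nonneg: "0 \<le> height m v x a i" if "i \<le> m" for i using p[OF that] by linarith
  obtain l where l: "\<And>i. i \<le> m \<Longrightarrow> 0 \<le> l i" "(\<Sum>i\<le>m. l i) = 1" "\<And>k. k < m \<Longrightarrow> y k = (\<Sum>i\<le>m. l i * v i k)"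
    using in_simplexE[OF y(1)] by blast
  have "0 \<le> (\<Sum>i\<le>m. l i * height m v x a i)" using l(1) nonneg by (intro sum_nonneg) auto
  then show False using height_barycentric[OF l(2,3), where x = x and a = a] y(2) by simp
qed

lemma shrink_progress:
  fixes v :: "nat \<Rightarrow> nat \<Rightarrow> real"
  assumes m: "m > 0" and y: "in_simplex m v y" "(\<Sum>k<m. a k * y k) < (\<Sum>k<m. a k * centroid m v k)"
  defines "\<alpha> \<equiv> height m v (centroid m v) a"
  assumes p: "p \<le> m" "\<And>i. i \<le> m \<Longrightarrow> \<alpha> p \<le> \<alpha> i"
  shows "in_simplex m (shrink m v \<alpha> p) y"
    and "simplex_vol m (shrink m v \<alpha> p) \<le> exp (- 1 / (32 * real m ^ 2)) * simplex_vol m v"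
proof -
  have neg: "\<alpha> p < 0" unfolding \<alpha>_def by (rule lowest_height_neg[OF y]) (use p \<alpha>_def in auto)
  define \<beta> where "\<beta> i = \<alpha> i / (- \<alpha> p)" for i
  have \<beta>: "-1 \<le> \<beta> i" if "i \<le> m" for i
    using p(2)[OF that] neg by (simp add: \<beta>_def field_simps)
  have "(\<Sum>i\<in>{..m} - {p}. \<alpha> i) = - \<alpha> p"
    using sum.remove[of "{..m}" p \<alpha>] p(1) centroid_heights_sum[of m v a] by (simp add: \<alpha>_def)
  then have \<beta>_sum: "(\<Sum>i\<in>{..m} - {p}. \<beta> i) = 1"
    unfolding \<beta>_def sum_divide_distrib[symmetric] using neg by simp
  have card: "finite ({..m} - {p})" "{..m} - {p} \<noteq> {}" "card ({..m} - {p}) = m"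
    using p(1) m by (auto simp flip: card_gt_0_iff)
  have factor: "0 < shrink_factor m (\<beta> i)" "1 / shrink_factor m (\<beta> i) \<le> 1 + \<beta> i / (8 * real m ^ 2)"
    "shrink_factor m (\<beta> i) \<le> 1 / (1 + \<beta> i / (8 * real m ^ 2)) + 1 / (32 * real m ^ 3)" if "i \<le> m" for i
    using shrink_factor_bounds[OF m \<beta>[OF that]] by auto
  have shrink: "shrink m v \<alpha> p i k = v p k + shrink_factor m (\<beta> i) * (v i k - v p k)" for i k
    by (simp add: shrink_def \<beta>_def)
  show "in_simplex m (shrink m v \<alpha> p) y"
  proof (rule simplex_cut[OF p(1) neg[unfolded \<alpha>_def] y, where \<kappa> = "1 / (8 * real m ^ 2)" and s = "\<lambda>i. shrink_factor m (\<beta> i)"])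
    have "1 \<le> real m ^ 2" using m by (intro one_le_power) simp
    then show "1 / (8 * real m ^ 2) \<le> 1" by (subst divide_le_eq_1_pos) linarith+
    show "0 < shrink_factor m (\<beta> i) \<and> 1 / shrink_factor m (\<beta> i)
        \<le> 1 + 1 / (8 * real m ^ 2) * (height m v (centroid m v) a i / - height m v (centroid m v) a p)" if "i \<le> m"
          for i
      using factor[OF that] by (simp add: \<beta>_def \<alpha>_def mult.commute)
  qed (use m shrink in auto)
  have "simplex_vol m (shrink m v \<alpha> p) = (\<Prod>i\<in>{..m} - {p}. \<bar>shrink_factor m (\<beta> i)\<bar>) * simplex_vol m v"
    by (rule simplex_vol_contract[OF p(1)]) (rule shrink)
  also have "(\<Prod>i\<in>{..m} - {p}. \<bar>shrink_factor m (\<beta> i)\<bar>) \<le> exp (- 1 / (32 * real m ^ 2))"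
    using prod_shrink_le[OF card(1,2) _ \<beta>_sum] \<beta> factor unfolding card(3) by auto
  then have "(\<Prod>i\<in>{..m} - {p}. \<bar>shrink_factor m (\<beta> i)\<bar>) * simplex_vol m v \<le>
    exp (- 1 / (32 * real m ^ 2)) * simplex_vol m v"
    by (rule mult_right_mono[OF _ simplex_vol_nonneg])
  finally show "simplex_vol m (shrink m v \<alpha> p) \<le> exp (- 1 / (32 * real m ^ 2)) * simplex_vol m v" .
qed

lemma of_rat_centroid: "real_of_rat (centroid m v k) = centroid m (\<lambda>i k. real_of_rat (v i k)) k"
  by (simp add: centroid_def of_rat_divide of_rat_sum of_rat_add)

lemma of_rat_height:
  "real_of_rat (height m v x a i) = height m (\<lambda>i k. real_of_rat (v i k)) (\<lambda>k. real_of_rat (x k))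
    (\<lambda>k. real_of_rat (a k)) i"
  by (simp add: height_def of_rat_sum of_rat_mult of_rat_diff)

lemma of_rat_shrink_factor: "real_of_rat (shrink_factor m \<beta>) = shrink_factor m (real_of_rat \<beta>)"
proof -
  let ?q = "of_nat (grid_den m) / (1 + \<beta> / (8 * (of_nat m * of_nat m)))"
  have "real_of_rat ?q = of_nat (grid_den m) / (1 + real_of_rat \<beta> / (8 * (of_nat m * of_nat m)))"
    by (simp add: of_rat_divide of_rat_add of_rat_mult)
  from of_rat_floor[where ?'a = real, of ?q, unfolded this] show ?thesis
    by (simp add: shrink_factor_def of_rat_divide of_rat_add)
qed

lemma of_rat_shrink:
  "real_of_rat (shrink m v \<alpha> p i k) = shrink m (\<lambda>i k. real_of_rat (v i k)) (\<lambda>i. real_of_rat (\<alpha> i)) p i k"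
  by (simp add: shrink_def of_rat_add of_rat_mult of_rat_diff of_rat_shrink_factor of_rat_divide of_rat_minus)

lemma lowest_centroid_height_nonpos:
  assumes "p \<le> m" "\<And>i. i \<le> m \<Longrightarrow> height m v (centroid m v) a p \<le> height m v (centroid m v) a i"
  shows "height m v (centroid m v) a p \<le> (0::'a::{linordered_field})"
proof (rule ccontr)
  assume "\<not> height m v (centroid m v) a p \<le> 0"
  then have "0 < height m v (centroid m v) a i" if "i \<le> m" for i using assms(2)[OF that] by linarith
  then have "0 < (\<Sum>i\<le>m. height m v (centroid m v) a i)" by (intro sum_pos) auto
  then show False by (simp add: centroid_heights_sum)
qed

subsection \<open>Vertices with bounded denominators\<close>

definition on_grid :: "nat \<Rightarrow> nat \<Rightarrow> nat \<Rightarrow> rat \<Rightarrow> bool" where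
  "on_grid D t b q \<longleftrightarrow> (\<exists>z::int. q = of_int z / of_nat D ^ t \<and> \<bar>z\<bar> \<le> int (b * 3 ^ t * D ^ t))"

lemma on_gridI: "q = of_int z / of_nat D ^ t \<Longrightarrow> \<bar>z\<bar> \<le> int (b * 3 ^ t * D ^ t) \<Longrightarrow> on_grid D t b q"
  unfolding on_grid_def by blast

lemma on_gridE:
  assumes "on_grid D t b q"
  obtains z :: int where "q = of_int z / of_nat D ^ t" "\<bar>z\<bar> \<le> int (b * 3 ^ t * D ^ t)"
  using assms unfolding on_grid_def by blast

lemma grid_power_le:
  assumes "t \<le> T"
  shows "3 ^ t * D ^ t \<le> (2::nat) ^ (T * D + 2 * T)"
proof -
  have "(3::nat) ^ t \<le> 4 ^ T" using assms by (intro order_trans[OF power_mono[of 3 4 t] power_increasing]) auto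
  then have three: "(3::nat) ^ t \<le> 2 ^ (2 * T)" by (simp add: power_mult)
  have "D ^ t \<le> (2 ^ D) ^ t" using less_exp[of D] by (intro power_mono) auto
  also have "\<dots> \<le> (2 ^ D) ^ T" using assms by (intro power_increasing) auto
  finally have "D ^ t \<le> 2 ^ (T * D)" by (simp add: power_mult[symmetric] mult.commute)
  with three have "3 ^ t * D ^ t \<le> 2 ^ (2 * T) * 2 ^ (T * D)" by (rule mult_mono) auto
  then show ?thesis by (simp add: power_add mult.commute)
qed

lemma fits_on_grid:
  assumes "D > 0" "t \<le> T" "b \<le> 2 ^ c" "on_grid D t b q"
  shows "fits (T * D + 2 * T + c) q"
proof -
  obtain z where z: "q = of_int z / of_nat D ^ t" "\<bar>z\<bar> \<le> int (b * 3 ^ t * D ^ t)" using assms(4) by (rule on_gridE)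
  have "b * (3 ^ t * D ^ t) \<le> 2 ^ c * 2 ^ (T * D + 2 * T)" by (intro mult_mono assms grid_power_le) auto
  then have "int (b * 3 ^ t * D ^ t) \<le> int (2 ^ (T * D + 2 * T + c))"
    unfolding of_nat_le_iff by (simp add: power_add mult_ac)
  then have num: "\<bar>z\<bar> \<le> 2 ^ (T * D + 2 * T + c)" using z(2) by simp
  have "1 * D ^ t \<le> 3 ^ t * D ^ t" by (intro mult_right_mono) auto
  also have "\<dots> \<le> 2 ^ (T * D + 2 * T)" by (rule grid_power_le[OF assms(2)])
  also have "\<dots> \<le> 2 ^ (T * D + 2 * T + c)" by (intro power_increasing) auto
  finally have "int (D ^ t) \<le> int (2 ^ (T * D + 2 * T + c))" unfolding of_nat_le_iff by simp
  then show ?thesis using assms(1) num z(1) by (intro fitsI[of "int D ^ t" z]) simp_all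
qed

lemma on_grid_sum:
  assumes "\<And>i. i < j \<Longrightarrow> on_grid D t b (f i)"
  shows "on_grid D t (j * b) (\<Sum>i<j. f i)"
proof -
  from assms obtain z where z: "\<And>i. i < j \<Longrightarrow> f i = of_int (z i) / of_nat D ^ t \<and> \<bar>z i\<bar> \<le> int (b * 3 ^ t * D ^ t)"
    unfolding on_grid_def by metis
  have "\<bar>\<Sum>i<j. z i\<bar> \<le> (\<Sum>i<j. \<bar>z i\<bar>)" by (rule sum_abs)
  also have "\<dots> \<le> of_nat (card {..<j}) * int (b * 3 ^ t * D ^ t)" using z by (intro sum_bounded_above) auto
  finally show ?thesis
    using z by (intro on_gridI[of _ "\<Sum>i<j. z i"]) (simp_all add: sum_divide_distrib mult_ac)
qed

lemma on_grid_refine: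
  assumes "on_grid D t b q" "t \<le> T" "D > 0"
  shows "on_grid D T b q"
proof -
  obtain z where z: "q = of_int z / of_nat D ^ t" "\<bar>z\<bar> \<le> int (b * 3 ^ t * D ^ t)" using assms(1) by (rule on_gridE)
  have pow: "D ^ t * D ^ (T - t) = D ^ T" using assms(2) by (simp flip: power_add)
  show ?thesis
  proof (rule on_gridI[of _ "z * int (D ^ (T - t))"])
    have "(of_nat D ^ T :: rat) = of_nat D ^ t * of_nat D ^ (T - t)" using assms(2) by (simp flip: power_add)
    then show "q = of_int (z * int (D ^ (T - t))) / of_nat D ^ T" using z(1) assms(3) by simp
    have "\<bar>z * int (D ^ (T - t))\<bar> \<le> int (b * 3 ^ t * D ^ t) * int (D ^ (T - t))"
      using z(2) by (simp add: abs_mult mult_right_mono)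
    also have "\<dots> = int (b * 3 ^ t * D ^ T)" by (simp flip: pow)
    also have "\<dots> \<le> int (b * 3 ^ T * D ^ T)"
      unfolding of_nat_le_iff using assms(2) by (intro mult_right_mono mult_left_mono power_increasing) auto
    finally show "\<bar>z * int (D ^ (T - t))\<bar> \<le> int (b * 3 ^ T * D ^ T)" .
  qed
qed

lemma on_grid_rescale:
  assumes D: "D > 0" and u: "on_grid D t b u" and v: "on_grid D t b v"
    and s: "s = of_int n / of_nat D" "0 \<le> n" "n \<le> 2 * int D"
  shows "on_grid D (Suc t) b (u + s * (v - u))"
proof -
  let ?b = "int (b * 3 ^ t * D ^ t)"
  obtain zu where zu: "u = of_int zu / of_nat D ^ t" "\<bar>zu\<bar> \<le> ?b" using u by (rule on_gridE)
  obtain zv where zv: "v = of_int zv / of_nat D ^ t" "\<bar>zv\<bar> \<le> ?b" using v by (rule on_gridE)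
  show ?thesis
  proof (rule on_gridI[of _ "int D * zu + n * (zv - zu)"])
    show "u + s * (v - u) = of_int (int D * zu + n * (zv - zu)) / of_nat D ^ Suc t"
      using D by (simp add: zu zv s field_simps)
    have "int D * zu + n * (zv - zu) = (int D - n) * zu + n * zv" by (simp add: algebra_simps)
    then have "\<bar>int D * zu + n * (zv - zu)\<bar> \<le> \<bar>int D - n\<bar> * \<bar>zu\<bar> + \<bar>n\<bar> * \<bar>zv\<bar>"
      by (metis abs_mult abs_triangle_ineq)
    also have "\<dots> \<le> int D * ?b + (2 * int D) * ?b" using zu zv s by (intro add_mono mult_mono) auto
    finally show "\<bar>int D * zu + n * (zv - zu)\<bar> \<le> int (b * 3 ^ Suc t * D ^ Suc t)" by (simp add: algebra_simps)
  qed
qed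

lemma card_on_grid: "finite {q. on_grid D t b q}" "card {q. on_grid D t b q} \<le> 2 * (b * 3 ^ t * D ^ t) + 1"
proof -
  let ?Z = "{- int (b * 3 ^ t * D ^ t)..int (b * 3 ^ t * D ^ t)}"
    and ?f = "\<lambda>z::int. of_int z / of_nat D ^ t :: rat"
  have sub: "{q. on_grid D t b q} \<subseteq> ?f ` ?Z"
  proof
    fix q assume "q \<in> {q. on_grid D t b q}"
    then obtain z where "q = ?f z" "\<bar>z\<bar> \<le> int (b * 3 ^ t * D ^ t)" unfolding mem_Collect_eq by (rule on_gridE)
    then show "q \<in> ?f ` ?Z" by (intro image_eqI[of _ _ z]) (simp_all add: abs_le_iff)
  qed
  then show "finite {q. on_grid D t b q}" by (rule finite_subset) auto
  have "card {q. on_grid D t b q} \<le> card ?Z" using card_mono[OF _ sub] card_image_le[of ?Z ?f] by simp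
  also have "card ?Z = 2 * (b * 3 ^ t * D ^ t) + 1" by (simp only: card_atLeastAtMost_int)
  finally show "card {q. on_grid D t b q} \<le> 2 * (b * 3 ^ t * D ^ t) + 1" .
qed

lemma shrink_factor_numerator:
  fixes \<beta> :: rat
  assumes m: "0 < m" and \<beta>: "-1 \<le> \<beta>"
  shows "\<exists>n::int. shrink_factor m \<beta> = of_int n / of_nat (grid_den m) \<and> 0 \<le> n \<and> n \<le> 2 * int (grid_den m)"
proof -
  define q where "q = of_nat (grid_den m) / (1 + \<beta> / (8 * (of_nat m * of_nat m)))"
  have "1 * 1 \<le> m * m" using m by (intro mult_mono) auto
  then have "(of_nat 1 :: rat) \<le> of_nat (m * m)" unfolding of_nat_le_iff by simp
  then have mm: "(1::rat) \<le> of_nat m * of_nat m" by simp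
  have "- 1 / 8 \<le> (-1) / (8 * (of_nat m * of_nat m) :: rat)" using mm by (simp add: field_simps)
  also have "\<dots> \<le> \<beta> / (8 * (of_nat m * of_nat m))" using \<beta> mm by (intro divide_right_mono) auto
  finally have w: "7 / 8 \<le> 1 + \<beta> / (8 * (of_nat m * of_nat m))" by simp
  have "0 \<le> q" unfolding q_def using w by (intro divide_nonneg_nonneg) auto
  then have nonneg: "0 \<le> \<lfloor>q\<rfloor> + 1" by (simp add: zero_le_floor add_increasing2)
  have "q \<le> of_nat (grid_den m) / (7 / 8)" unfolding q_def using w by (intro divide_left_mono mult_pos_pos) auto
  then have "7 / 8 * q \<le> of_nat (grid_den m)" by simp
  moreover have "32 \<le> grid_den m" using m by (cases m) (auto simp: grid_den_def)
  then have "(32::rat) \<le> of_nat (grid_den m)" by (metis of_nat_le_iff of_nat_numeral)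
  ultimately have "of_int \<lfloor>q\<rfloor> + 1 \<le> (2 * of_nat (grid_den m) :: rat)"
    using of_int_floor_le[of q] by linarith
  then have "of_int (\<lfloor>q\<rfloor> + 1) \<le> (of_int (2 * int (grid_den m)) :: rat)" by simp
  then have "\<lfloor>q\<rfloor> + 1 \<le> 2 * int (grid_den m)" by (simp only: of_int_le_iff)
  with nonneg show ?thesis
    by (intro exI[of _ "\<lfloor>q\<rfloor> + 1"]) (simp add: shrink_factor_def q_def)
qed

lemma minus_one_le_divide_minus: "-1 \<le> b / (- a)" if "a \<le> b" "a \<le> (0::'a::linordered_field)"
  using that by (cases "a = 0") (auto simp: field_simps)

lemma on_grid_shrink:
  assumes "0 < m" "\<alpha> p \<le> \<alpha> i" "\<alpha> p \<le> 0" "on_grid (grid_den m) t b (v p k)" "on_grid (grid_den m) t b (v i k)"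
  shows "on_grid (grid_den m) (Suc t) b (shrink m v \<alpha> p i k)"
proof -
  obtain n where "shrink_factor m (\<alpha> i / (- \<alpha> p)) = of_int n / of_nat (grid_den m)" "0 \<le> n"
    "n \<le> 2 * int (grid_den m)"
    using shrink_factor_numerator[OF assms(1) minus_one_le_divide_minus[OF assms(2,3)]] by blast
  then show ?thesis unfolding shrink_def using assms(1,4,5) by (intro on_grid_rescale) (auto simp: grid_den_def)
qed

lemma fits_shrink_factor:
  assumes "\<alpha> p \<le> \<alpha> i" "\<alpha> p \<le> (0::rat)"
  shows "fits (2 * grid_den m) (shrink_factor m (\<alpha> i / (- \<alpha> p)))"
proof (cases "0 < m")
  case True
  obtain n where n: "shrink_factor m (\<alpha> i / (- \<alpha> p)) = of_int n / of_nat (grid_den m)" "0 \<le> n"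
    "n \<le> 2 * int (grid_den m)"
    using shrink_factor_numerator[OF True minus_one_le_divide_minus[OF assms]] by blast
  have "int (2 * grid_den m) \<le> int (2 ^ (2 * grid_den m))" unfolding of_nat_le_iff by (rule le_two_power) simp
  then have "2 * int (grid_den m) \<le> 2 ^ (2 * grid_den m)" by simp
  then show ?thesis using True n by (intro fitsI[of "int (grid_den m)" n]) (auto simp: grid_den_def)
qed (simp add: shrink_factor_def grid_den_def)

section \<open>Redistributing probability mass\<close>

definition light_mass :: "'a set \<Rightarrow> real \<Rightarrow> ('a \<Rightarrow> real) \<Rightarrow> real" where
  "light_mass S r q = (\<Sum>A\<in>S. min (q A) r)"

definition shifts :: "'a set \<Rightarrow> real \<Rightarrow> real \<Rightarrow> ('a \<Rightarrow> real) set" where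
  "shifts S r M = {s. (\<forall>A\<in>S. 0 \<le> s A \<and> s A \<le> r) \<and> (\<Sum>A\<in>S. s A) \<le> M}"

definition shift_gain :: "'a set \<Rightarrow> real \<Rightarrow> real \<Rightarrow> ('a \<Rightarrow> real) \<Rightarrow> real" where
  "shift_gain S r M g = (SUP s\<in>shifts S r M. \<Sum>A\<in>S. s A * g A)"

lemma shiftsD:
  assumes "s \<in> shifts S r M"
  shows "A \<in> S \<Longrightarrow> 0 \<le> s A" "A \<in> S \<Longrightarrow> s A \<le> r" "(\<Sum>A\<in>S. s A) \<le> M"
  using assms by (auto simp: shifts_def)

lemma light_mass_ge:
  assumes "finite S" "\<And>A. A \<in> S \<Longrightarrow> 0 \<le> q A" "(\<Sum>A\<in>S. q A) = 1" "0 \<le> r" "r \<le> 1"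
  shows "r \<le> light_mass S r q"
proof (cases "\<exists>A\<in>S. q A \<ge> r")
  case True
  then obtain A where A: "A \<in> S" "q A \<ge> r" by blast
  have "min (q A) r \<le> light_mass S r q" unfolding light_mass_def
    using assms A by (intro member_le_sum) auto
  then show ?thesis using A by simp
next
  case False
  then have "light_mass S r q = (\<Sum>A\<in>S. q A)" unfolding light_mass_def by (intro sum.cong) auto
  then show ?thesis using assms by simp
qed

lemma light_mass_le_card: "light_mass S r q \<le> r * real (card S)"
  using sum_bounded_above[of S "\<lambda>A. min (q A) r" r] by (simp add: light_mass_def mult.commute)

lemma light_mass_le_1: "(\<Sum>A\<in>S. q A) = 1 \<Longrightarrow> light_mass S r q \<le> 1"
  using sum_mono[of S "\<lambda>A. min (q A) r" q] by (simp add: light_mass_def)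

lemma light_mass_eq_excess:
  assumes "(\<Sum>A\<in>S. q A) = 1"
  shows "light_mass S r q = 1 - (\<Sum>A\<in>S. max 0 (q A - r))"
proof -
  have "light_mass S r q = (\<Sum>A\<in>S. q A - max 0 (q A - r))"
    unfolding light_mass_def by (intro sum.cong) auto
  then show ?thesis using assms by (simp add: sum_subtractf)
qed

lemma card_heavy_le:
  assumes "finite S" "0 < r" "\<And>A. A \<in> S \<Longrightarrow> 0 \<le> q A" "(\<Sum>A\<in>S. q A) = 1"
  shows "real (card {A\<in>S. q A > r}) \<le> 1 / r"
proof -
  have "real (card {A\<in>S. q A > r}) * r \<le> (\<Sum>A | A \<in> S \<and> q A > r. q A)"
    using sum_bounded_below[of "{A\<in>S. q A > r}" r q] by (simp add: less_imp_le)
  also have "\<dots> \<le> (\<Sum>A\<in>S. q A)" using assms by (intro sum_mono2) auto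
  finally show ?thesis using assms by (simp add: field_simps)
qed

lemma light_mass_diff:
  assumes "finite S" "0 < r"
    and q: "\<And>A. A \<in> S \<Longrightarrow> 0 \<le> q A" "(\<Sum>A\<in>S. q A) = 1"
    and q': "\<And>A. A \<in> S \<Longrightarrow> 0 \<le> q' A" "(\<Sum>A\<in>S. q' A) = 1"
    and close: "\<And>A. A \<in> S \<Longrightarrow> \<bar>q A - q' A\<bar> \<le> \<eta>"
  shows "\<bar>light_mass S r q - light_mass S r q'\<bar> \<le> 2 * \<eta> / r"
proof -
  let ?heavy = "\<lambda>q. {A\<in>S. q A > r}" and ?excess = "\<lambda>q A. max 0 (q A - r)"
  let ?D = "?heavy q \<union> ?heavy q'"
  have "\<bar>light_mass S r q - light_mass S r q'\<bar> = \<bar>\<Sum>A\<in>S. ?excess q A - ?excess q' A\<bar>"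
    using light_mass_eq_excess[OF q(2)] light_mass_eq_excess[OF q'(2)] by (simp add: sum_subtractf)
  also have "(\<Sum>A\<in>S. ?excess q A - ?excess q' A) = (\<Sum>A\<in>?D. ?excess q A - ?excess q' A)"
    using assms(1) by (intro sum.mono_neutral_right) auto
  also have "\<bar>\<dots>\<bar> \<le> (\<Sum>A\<in>?D. \<bar>?excess q A - ?excess q' A\<bar>)" by (rule sum_abs)
  also have "\<dots> \<le> (\<Sum>A\<in>?D. \<eta>)"
  proof (rule sum_mono)
    fix A assume "A \<in> ?D"
    then have "\<bar>q A - q' A\<bar> \<le> \<eta>" using close by auto
    then show "\<bar>?excess q A - ?excess q' A\<bar> \<le> \<eta>" by linarith
  qed
  also have "\<dots> = real (card ?D) * \<eta>" by simp
  also have "\<dots> \<le> (2 / r) * \<eta>"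
  proof (rule mult_right_mono)
    show "real (card ?D) \<le> 2 / r"
      using card_Un_le[of "?heavy q" "?heavy q'"] card_heavy_le[OF assms(1,2) q] card_heavy_le[OF assms(1,2) q']
      by simp
    obtain A where "A \<in> S" using q(2) by fastforce
    then show "0 \<le> \<eta>" using close[of A] by linarith
  qed
  finally show ?thesis by simp
qed

lemma expectation_eq_sum:
  assumes "finite S" "set_pmf p \<subseteq> S"
  shows "measure_pmf.expectation p g = (\<Sum>A\<in>S. pmf p A * g A)"
  using assms(2) by (subst integral_measure_pmf_real[OF assms(1)]) (auto simp: mult.commute)

lemma pmf_with_values:
  assumes "finite S" "\<And>A. A \<in> S \<Longrightarrow> 0 \<le> f A" "(\<Sum>A\<in>S. f A) = 1"
  obtains q where "set_pmf q \<subseteq> S" "\<And>A. A \<in> S \<Longrightarrow> pmf q A = f A"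
proof -
  define f' where "f' A = (if A \<in> S then f A else 0)" for A
  have nonneg: "0 \<le> f' A" for A using assms(2) by (simp add: f'_def)
  have "(\<integral>\<^sup>+A. ennreal (f' A) \<partial>count_space UNIV) = (\<Sum>A\<in>S. ennreal (f' A))"
    using assms(1) by (intro nn_integral_count_space') (auto simp: f'_def)
  also have "\<dots> = 1" using assms(2,3) by (subst sum_ennreal) (auto simp: f'_def)
  finally have "pmf (embed_pmf f') A = f' A" for A by (rule pmf_embed_pmf[OF nonneg])
  then show thesis by (intro that[of "embed_pmf f'"]) (auto simp: set_pmf_iff f'_def split: if_splits)
qed

locale dominated_costs =
  fixes S :: "'a set" and r :: real and g :: "'a \<Rightarrow> real" and U :: 'a
  assumes fin: "finite S" and r: "0 < r" and U: "U \<in> S"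
    and nonneg: "\<And>A. A \<in> S \<Longrightarrow> 0 \<le> g A" and worst: "\<And>A. A \<in> S \<Longrightarrow> g A \<le> g U"
begin

lemma shift_value_le:
  assumes "s \<in> shifts S r M" shows "(\<Sum>A\<in>S. s A * g A) \<le> M * g U"
proof -
  have "(\<Sum>A\<in>S. s A * g A) \<le> (\<Sum>A\<in>S. s A * g U)"
    using shiftsD(1)[OF assms] worst by (intro sum_mono mult_left_mono) auto
  also have "\<dots> = (\<Sum>A\<in>S. s A) * g U" by (simp add: sum_distrib_right)
  also have "\<dots> \<le> M * g U" using shiftsD(3)[OF assms] nonneg[OF U] by (rule mult_right_mono)
  finally show ?thesis .
qed

lemma shift_gain_ge: "s \<in> shifts S r M \<Longrightarrow> (\<Sum>A\<in>S. s A * g A) \<le> shift_gain S r M g"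
  unfolding shift_gain_def by (rule cSUP_upper[OF _ bdd_aboveI2[OF shift_value_le]])

lemma shift_gain_least:
  assumes "0 \<le> M" "\<And>s. s \<in> shifts S r M \<Longrightarrow> (\<Sum>A\<in>S. s A * g A) \<le> b"
  shows "shift_gain S r M g \<le> b"
proof -
  have "(\<lambda>_. 0) \<in> shifts S r M" using assms(1) r by (simp add: shifts_def)
  then show ?thesis unfolding shift_gain_def using assms(2) by (intro cSUP_least) auto
qed

lemma shift_gain_le: "0 \<le> M \<Longrightarrow> shift_gain S r M g \<le> M * g U"
  by (rule shift_gain_least) (auto intro: shift_value_le)

lemma shift_gain_top: "r \<le> M \<Longrightarrow> r * g U \<le> shift_gain S r M g"
  using shift_gain_ge[of "\<lambda>A. if A = U then r else 0" M] r fin U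
  by (auto simp: shifts_def if_distrib[of "\<lambda>x. x * _"] cong: if_cong)

lemma shift_gain_scale:
  assumes "0 \<le> M'" "M' \<le> c * M" "1 \<le> c"
  shows "shift_gain S r M' g \<le> c * shift_gain S r M g"
proof (rule shift_gain_least[OF assms(1)])
  fix s assume s: "s \<in> shifts S r M'"
  have "s A / c \<le> r" if "A \<in> S" for A
  proof -
    have "r * 1 \<le> r * c" using assms(3) r by (intro mult_left_mono) auto
    then show ?thesis using shiftsD(2)[OF s that] assms(3) by (simp add: field_simps)
  qed
  then have "(\<lambda>A. s A / c) \<in> shifts S r M"
    using s assms by (auto simp: shifts_def field_simps simp flip: sum_divide_distrib)
  from shift_gain_ge[OF this] have "(\<Sum>A\<in>S. s A * g A) / c \<le> shift_gain S r M g"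
    by (simp add: sum_divide_distrib)
  then show "(\<Sum>A\<in>S. s A * g A) \<le> c * shift_gain S r M g" using assms(3) by (simp add: field_simps)
qed

lemma added_mass_le_light_mass:
  assumes "set_pmf p \<subseteq> S" "set_pmf q \<subseteq> S" "\<And>A. A \<in> S \<Longrightarrow> \<bar>pmf p A - pmf q A\<bar> \<le> r"
  shows "(\<Sum>A\<in>S. max 0 (pmf q A - pmf p A)) \<le> light_mass S r (pmf p)"
proof -
  have "(\<Sum>A\<in>S. max 0 (pmf q A - pmf p A)) = (\<Sum>A\<in>S. max 0 (pmf p A - pmf q A) + (pmf q A - pmf p A))"
    by (intro sum.cong) auto
  also have "\<dots> = (\<Sum>A\<in>S. max 0 (pmf p A - pmf q A))"
    using sum_pmf_eq_1[OF fin assms(1)] sum_pmf_eq_1[OF fin assms(2)] by (simp add: sum.distrib sum_subtractf)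
  also have "\<dots> \<le> light_mass S r (pmf p)" unfolding light_mass_def
  proof (rule sum_mono)
    fix A assume "A \<in> S"
    then have "\<bar>pmf p A - pmf q A\<bar> \<le> r" "0 \<le> pmf q A" "0 \<le> pmf p A" using assms(3) by auto
    then show "max 0 (pmf p A - pmf q A) \<le> min (pmf p A) r" by linarith
  qed
  finally show ?thesis .
qed

lemma redistribute_upper:
  assumes "set_pmf p \<subseteq> S" "set_pmf q \<subseteq> S" "\<And>A. A \<in> S \<Longrightarrow> \<bar>pmf p A - pmf q A\<bar> \<le> r"
  shows "measure_pmf.expectation q g \<le> measure_pmf.expectation p g + shift_gain S r (light_mass S r (pmf p)) g"
proof -
  let ?s = "\<lambda>A. max 0 (pmf q A - pmf p A)"
  have "?s A \<le> r" if "A \<in> S" for A using assms(3)[OF that] r by linarith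
  then have "?s \<in> shifts S r (light_mass S r (pmf p))"
    using added_mass_le_light_mass[OF assms] by (simp add: shifts_def)
  then have "(\<Sum>A\<in>S. ?s A * g A) \<le> shift_gain S r (light_mass S r (pmf p)) g" by (rule shift_gain_ge)
  moreover have "(\<Sum>A\<in>S. pmf q A * g A) \<le> (\<Sum>A\<in>S. pmf p A * g A + ?s A * g A)"
    unfolding distrib_right[symmetric] using nonneg by (intro sum_mono mult_right_mono) auto
  ultimately show ?thesis using assms by (simp add: expectation_eq_sum[OF fin] sum.distrib)
qed

text \<open>The mass of \<open>s\<close> is taken from all scenarios in proportion to the part of their probability
  below \<open>r\<close>, so that no probability decreases by more than \<open>r\<close>.\<close>

lemma redistribute_lower:
  assumes p: "set_pmf p \<subseteq> S" and s: "s \<in> shifts S r (light_mass S r (pmf p))" and r1: "r \<le> 1"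
  obtains q where "set_pmf q \<subseteq> S" "\<And>A. A \<in> S \<Longrightarrow> \<bar>pmf p A - pmf q A\<bar> \<le> r"
    "(\<Sum>A\<in>S. s A * g A) \<le> measure_pmf.expectation q g"
proof -
  define M where "M = light_mass S r (pmf p)"
  define \<rho> where "\<rho> = (\<Sum>A\<in>S. s A) / M"
  define taken where "taken A = min (pmf p A) r * \<rho>" for A
  have one: "(\<Sum>A\<in>S. pmf p A) = 1" using fin p by (rule sum_pmf_eq_1)
  have M: "0 < M" using light_mass_ge[OF fin _ one, of r] r r1 by (simp add: M_def)
  have \<rho>: "0 \<le> \<rho>" "\<rho> \<le> 1" using shiftsD[OF s] M by (auto simp: \<rho>_def M_def intro!: divide_nonneg_pos sum_nonneg)
  have taken: "0 \<le> taken A" "taken A \<le> pmf p A" "taken A \<le> r" for A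
    using mult_left_mono[OF \<rho>(2), of "min (pmf p A) r"] \<rho>(1) r by (auto simp: taken_def)
  have "(\<Sum>A\<in>S. taken A) = M * \<rho>" by (simp add: taken_def M_def light_mass_def sum_distrib_right)
  then have total: "(\<Sum>A\<in>S. taken A) = (\<Sum>A\<in>S. s A)" using M by (simp add: \<rho>_def)
  obtain q where q: "set_pmf q \<subseteq> S" "\<And>A. A \<in> S \<Longrightarrow> pmf q A = pmf p A - taken A + s A"
    using pmf_with_values[OF fin, of "\<lambda>A. pmf p A - taken A + s A"] taken shiftsD(1)[OF s] one total
    by (auto simp: sum.distrib sum_subtractf)
  show thesis
  proof (rule that[OF q(1)])
    show "\<bar>pmf p A - pmf q A\<bar> \<le> r" if "A \<in> S" for A
      using q(2)[OF that] taken[of A] shiftsD(1,2)[OF s that] by linarith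
  next
    show "(\<Sum>A\<in>S. s A * g A) \<le> measure_pmf.expectation q g"
      using q taken nonneg unfolding expectation_eq_sum[OF fin q(1)] by (intro sum_mono mult_right_mono) auto
  qed
qed

end

text \<open>An optimal shift saturates the most expensive scenarios one after the other.\<close>

definition top_seq :: "'a set \<Rightarrow> ('a \<Rightarrow> 'b::linorder) \<Rightarrow> nat \<Rightarrow> (nat \<Rightarrow> 'a) \<Rightarrow> bool" where
  "top_seq S g K cs \<longleftrightarrow> (\<forall>k<K. cs k \<in> S \<and> (\<not> S \<subseteq> cs ` {..<k} \<longrightarrow>
    cs k \<notin> cs ` {..<k} \<and> (\<forall>A\<in>S. A \<notin> cs ` {..<k} \<longrightarrow> g A \<le> g (cs k))))"

definition fill :: "'b::linordered_field \<Rightarrow> 'b \<Rightarrow> nat \<Rightarrow> 'b" where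
  "fill r M k = max 0 (min r (M - of_nat k * r))"

lemma sum_fill: "0 \<le> M \<Longrightarrow> 0 \<le> r \<Longrightarrow> (\<Sum>j<n. fill r M j) = min M (real n * r)"
proof (induction n)
  case (Suc n)
  then have "(\<Sum>j<Suc n. fill r M j) = min M (real n * r) + fill r M n" by simp
  also have "\<dots> = min M (real n * r + r)" using Suc.prems by (auto simp: fill_def min_def max_def)
  finally show ?case by (simp add: algebra_simps)
qed simp

lemma not_subset_image_lessThan:
  assumes "finite S" "k < card S"
  shows "\<not> S \<subseteq> cs ` {..<k}"
proof
  assume "S \<subseteq> cs ` {..<k}"
  then have "card S \<le> card {..<k}" using card_mono[of "cs ` {..<k}" S] card_image_le[of "{..<k}" cs] by simp
  with assms(2) show False by simp
qed

context
  fixes S :: "'a set" and g :: "'a \<Rightarrow> 'b::linorder" and K :: nat and cs :: "nat \<Rightarrow> 'a"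
  assumes cs: "top_seq S g K cs" and fin: "finite S"
begin

lemma top_seq_mem: "k < K \<Longrightarrow> cs k \<in> S"
  using cs by (auto simp: top_seq_def)

lemma top_seq_fresh: "k < K \<Longrightarrow> k < card S \<Longrightarrow> cs k \<notin> cs ` {..<k}"
  using cs not_subset_image_lessThan[OF fin] by (auto simp: top_seq_def)

lemma top_seq_greatest: "k < K \<Longrightarrow> k < card S \<Longrightarrow> A \<in> S \<Longrightarrow> A \<notin> cs ` {..<k} \<Longrightarrow> g A \<le> g (cs k)"
  using cs not_subset_image_lessThan[OF fin] by (auto simp: top_seq_def)

lemma top_seq_inj:
  assumes "n < K" "n < card S"
  shows "inj_on cs {..n}"
proof -
  have "cs j \<noteq> cs k" if "j < k" "k \<le> n" for j k
    using top_seq_fresh[of k] that assms by (metis imageI lessThan_iff order_le_less_trans)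
  then show ?thesis unfolding inj_on_def by (metis atMost_iff nat_neq_iff)
qed

lemma top_seq_antimono: "j \<le> k \<Longrightarrow> k < K \<Longrightarrow> k < card S \<Longrightarrow> g (cs k) \<le> g (cs j)"
  using top_seq_greatest[of j "cs k"] top_seq_mem[of k] top_seq_fresh[of k]
  by (cases "j = k") (auto simp: image_iff)

end

lemma shift_value_le_greedy:
  fixes cs :: "nat \<Rightarrow> 'a"
  assumes "finite S" "inj_on cs {..n}" "cs ` {..n} \<subseteq> S"
    and least: "0 \<le> g (cs n)" "\<And>k. k \<le> n \<Longrightarrow> g (cs n) \<le> g (cs k)" "\<And>A. A \<in> S \<Longrightarrow> A \<notin> cs ` {..n} \<Longrightarrow> g A \<le> g (cs n)"
    and w: "\<And>k. k < n \<Longrightarrow> w k = r" "(\<Sum>k\<le>n. w k) = M"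
    and s: "s \<in> shifts S r M"
  shows "(\<Sum>A\<in>S. s A * g A) \<le> (\<Sum>k\<le>n. w k * g (cs k))"
proof -
  define \<gamma> where "\<gamma> = g (cs n)"
  have "(\<Sum>A\<in>S. s A * (g A - \<gamma>)) \<le> (\<Sum>A\<in>S. if A \<in> cs ` {..n} then s A * (g A - \<gamma>) else 0)"
    using least(3) shiftsD(1)[OF s] by (intro sum_mono) (auto simp: \<gamma>_def intro!: mult_nonneg_nonpos)
  also have "\<dots> = (\<Sum>A\<in>cs ` {..n}. s A * (g A - \<gamma>))"
    using assms(1,3) by (subst sum.inter_restrict[symmetric]) (auto intro!: sum.cong)
  also have "\<dots> = (\<Sum>k\<le>n. s (cs k) * (g (cs k) - \<gamma>))" by (subst sum.reindex[OF assms(2)]) simp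
  also have "\<dots> \<le> (\<Sum>k\<le>n. w k * (g (cs k) - \<gamma>))"
  proof (rule sum_mono)
    fix k assume k: "k \<in> {..n}"
    show "s (cs k) * (g (cs k) - \<gamma>) \<le> w k * (g (cs k) - \<gamma>)"
    proof (cases "k = n")
      case False
      with k have "k < n" by simp
      then have "cs k \<in> S" using assms(3) by auto
      then have "s (cs k) \<le> w k" "\<gamma> \<le> g (cs k)"
        using \<open>k < n\<close> w(1) least(2)[of k] shiftsD(2)[OF s] by (auto simp: \<gamma>_def)
      then show ?thesis by (intro mult_right_mono) auto
    qed (simp add: \<gamma>_def)
  qed
  also have "\<dots> = (\<Sum>k\<le>n. w k * g (cs k)) - M * \<gamma>"
    by (simp add: algebra_simps sum_subtractf sum_distrib_left flip: w(2))
  finally have "(\<Sum>A\<in>S. s A * (g A - \<gamma>)) + (\<Sum>A\<in>S. s A) * \<gamma> \<le> (\<Sum>k\<le>n. w k * g (cs k))"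
    using mult_right_mono[OF shiftsD(3)[OF s] least(1)] by (simp add: \<gamma>_def)
  then show ?thesis by (simp add: algebra_simps sum_subtractf sum_distrib_left)
qed

context
  fixes S :: "'a set" and r M :: real and cs :: "nat \<Rightarrow> 'a" and g :: "'a \<Rightarrow> real" and K :: nat
  assumes fin: "finite S" and r: "0 < r" and M: "0 < M" "M \<le> r * real (card S)" "M \<le> r * real K"
    and cs: "top_seq S g K cs"
begin

lemma last_fill:
  obtains n where "n < K" "n < card S" "(\<Sum>k\<le>n. fill r M k) = M" "\<And>k. k < n \<Longrightarrow> fill r M k = r"
    "\<And>k. n < k \<Longrightarrow> fill r M k = 0"
proof -
  define n where "n = (LEAST n. M \<le> real (Suc n) * r)"
  have pos: "0 < K" "0 < card S" using M r by (auto intro!: Nat.gr0I)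
  then have bounds: "M \<le> real (Suc (K - 1)) * r" "M \<le> real (Suc (card S - 1)) * r"
    using M by (auto simp: mult.commute)
  have reached: "M \<le> real (Suc n) * r"
    unfolding n_def by (rule LeastI[of "\<lambda>n. M \<le> real (Suc n) * r", OF bounds(1)])
  have "n \<le> K - 1" "n \<le> card S - 1"
    unfolding n_def by (rule Least_le[of "\<lambda>n. M \<le> real (Suc n) * r"], rule bounds)+
  moreover have "fill r M k = r" if "k < n" for k
    using not_less_Least[OF that[unfolded n_def]] r by (simp add: fill_def algebra_simps)
  moreover have "fill r M k = 0" if "n < k" for k
  proof -
    have "real (Suc n) * r \<le> real k * r" using that r by (intro mult_right_mono) auto
    with reached have "M - real k * r \<le> 0" by linarith
    then show ?thesis using r by (simp add: fill_def)
  qed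
  moreover have "(\<Sum>k\<le>n. fill r M k) = M"
    using sum_fill[of M r "Suc n"] r M reached by (simp add: lessThan_Suc_atMost)
  ultimately show thesis using pos by (intro that[of n]) auto
qed

lemma sum_fill_truncate:
  assumes "n < K" "\<And>k. n < k \<Longrightarrow> fill r M k = 0"
  shows "(\<Sum>k<K. fill r M k * f k) = (\<Sum>k\<le>n. fill r M k * f k)"
  using assms by (intro sum.mono_neutral_right) auto

lemma greedy_in_shifts:
  "\<exists>s\<in>shifts S r M. \<forall>f. (\<Sum>A\<in>S. s A * f A) = (\<Sum>k<K. fill r M k * f (cs k))"
proof -
  obtain n where n: "n < K" "n < card S" "(\<Sum>k\<le>n. fill r M k) = M" "\<And>k. n < k \<Longrightarrow> fill r M k = 0"
    by (rule last_fill) blast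
  have inj: "inj_on cs {..n}" by (rule top_seq_inj[OF cs fin n(1,2)])
  have sub: "cs ` {..n} \<subseteq> S" using top_seq_mem[OF cs fin] n(1) by auto
  define s where "s A = (if A \<in> cs ` {..n} then fill r M (the_inv_into {..n} cs A) else 0)" for A
  have eq: "(\<Sum>A\<in>S. s A * f A) = (\<Sum>k<K. fill r M k * f (cs k))" for f
  proof -
    have "(\<Sum>A\<in>S. s A * f A) = (\<Sum>A\<in>cs ` {..n}. s A * f A)"
      using fin sub by (intro sum.mono_neutral_right) (auto simp: s_def)
    also have "\<dots> = (\<Sum>k\<le>n. fill r M k * f (cs k))"
      by (subst sum.reindex[OF inj]) (auto intro!: sum.cong simp: s_def the_inv_into_f_f[OF inj])
    finally show ?thesis using sum_fill_truncate[OF n(1,4)] by simp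
  qed
  have "(\<Sum>A\<in>S. s A) = M" using eq[of "\<lambda>_. 1"] sum_fill_truncate[OF n(1,4), of "\<lambda>_. 1"] n(3) by simp
  then have "s \<in> shifts S r M" using r by (auto simp: shifts_def s_def fill_def)
  then show ?thesis using eq by blast
qed

lemma greedy_optimal:
  assumes "\<And>A. A \<in> S \<Longrightarrow> 0 \<le> g A" "s \<in> shifts S r M"
  shows "(\<Sum>A\<in>S. s A * g A) \<le> (\<Sum>k<K. fill r M k * g (cs k))"
proof -
  obtain n where n: "n < K" "n < card S" "(\<Sum>k\<le>n. fill r M k) = M" "\<And>k. k < n \<Longrightarrow> fill r M k = r"
    "\<And>k. n < k \<Longrightarrow> fill r M k = 0" by (rule last_fill) blast
  have "(\<Sum>A\<in>S. s A * g A) \<le> (\<Sum>k\<le>n. fill r M k * g (cs k))"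
  proof (rule shift_value_le_greedy[OF fin top_seq_inj[OF cs fin n(1,2)] _ _ _ _ n(4,3) assms(2)])
    show "cs ` {..n} \<subseteq> S" using top_seq_mem[OF cs fin] n(1) by auto
    show "0 \<le> g (cs n)" by (rule assms(1)[OF top_seq_mem[OF cs fin n(1)]])
    show "g (cs n) \<le> g (cs k)" if "k \<le> n" for k by (rule top_seq_antimono[OF cs fin that n(1,2)])
    show "g A \<le> g (cs n)" if "A \<in> S" "A \<notin> cs ` {..n}" for A
      using that by (intro top_seq_greatest[OF cs fin n(1,2)]) auto
  qed
  then show ?thesis using sum_fill_truncate[OF n(1,5)] by simp
qed

end

section \<open>Scenarios\<close>

lemma scenarios_finite: "A \<in> scenarios I \<Longrightarrow> finite A"
  by (auto simp: scenarios_def ground_def intro: finite_subset)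

lemma finite_scenarios: "finite (scenarios I)"
  by (simp add: scenarios_def ground_def)

lemma full_scenario: "{..<usize I} \<in> scenarios I"
  by (simp add: scenarios_def ground_def)

lemma set_encode_less:
  assumes "A \<in> scenarios I"
  shows "set_encode A < 2 ^ usize I"
proof -
  have "set_encode A \<le> (\<Sum>i<usize I. 2 ^ i)"
    unfolding set_encode_def using assms by (intro sum_mono2) (auto simp: scenarios_def ground_def)
  also have "\<dots> < 2 ^ usize I" using sum_power2[of "usize I"] by (simp add: atLeast0LessThan)
  finally show ?thesis .
qed

lemma set_encode_indicator:
  assumes "A \<in> scenarios I"
  shows "(\<Sum>i<usize I. 2 ^ i * (if i \<in> A then 1 else 0)) = (of_nat (set_encode A) :: rat)"
proof -
  have "{..<usize I} \<inter> A = A" using assms by (auto simp: scenarios_def ground_def)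
  then have "(\<Sum>i<usize I. 2 ^ i * (if i \<in> A then 1 else 0)) = (\<Sum>i\<in>A. (2::rat) ^ i)"
    by (simp add: if_distrib[of "\<lambda>x. _ * x"] sum.If_cases cong: if_cong)
  then show ?thesis by (simp add: set_encode_def)
qed

lemma set_encode_remove:
  assumes "finite A"
  shows "of_nat (set_encode A) - 2 ^ e * (if e \<in> A then 1 else 0) = (of_nat (set_encode (A - {e})) :: rat)"
proof (cases "e \<in> A")
  case True
  then have "set_encode A = 2 ^ e + set_encode (A - {e})" using assms by (simp add: set_encode_def sum.remove)
  then show ?thesis using True by simp
qed simp

subsection \<open>The most expensive scenarios\<close>

text \<open>A value of \<open>-1\<close> marks that no candidate has been seen.\<close>

definition best_of :: "'a set set \<Rightarrow> ('a set \<Rightarrow> rat) \<Rightarrow> 'a set \<Rightarrow> rat \<Rightarrow> bool" where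
  "best_of C g A v \<longleftrightarrow> (if C = {} then A = {} \<and> v = -1 else A \<in> C \<and> v = g A \<and> (\<forall>A'\<in>C. g A' \<le> g A))"

lemma best_of_insert:
  assumes "best_of C g A v" "0 \<le> g A'"
  shows "best_of (insert A' C) g (if v < g A' then A' else A) (if v < g A' then g A' else v)"
  using assms by (fastforce simp: best_of_def split: if_splits)

lemma unchosen_below_child:
  assumes "\<And>A. A \<in> \<C> \<Longrightarrow> finite A" "U \<in> \<C>" "A \<subseteq> U" "A \<notin> \<C>"
  shows "\<exists>A'\<in>\<C>. \<exists>e\<in>A'. A' - {e} \<notin> \<C> \<and> A \<subseteq> A' - {e}"
proof -
  obtain A' where A': "A' \<in> \<C>" "A \<subseteq> A'" "\<And>A''. A'' \<in> \<C> \<and> A \<subseteq> A'' \<Longrightarrow> card A' \<le> card A''"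
    using ex_has_least_nat[of "\<lambda>A'. A' \<in> \<C> \<and> A \<subseteq> A'" U card] assms(2,3) by blast
  then obtain e where e: "e \<in> A'" "e \<notin> A" using assms(4) by (metis subset_antisym subsetI)
  have "card (A' - {e}) < card A'" using e assms(1)[OF A'(1)] by (intro card_Diff1_less) auto
  then have "A' - {e} \<notin> \<C>" using A'(2) A'(3)[of "A' - {e}"] e by auto
  then show ?thesis using A' e by blast
qed

text \<open>By monotonicity, the best scenario not yet in the sequence arises from a chosen one by removing an
  element; \<open>n\<close> counts the pairs inspected so far.\<close>

definition candidates :: "(nat \<Rightarrow> nat set) \<Rightarrow> nat \<Rightarrow> nat \<Rightarrow> nat \<Rightarrow> nat set set" where
  "candidates cs u k n = (\<lambda>i. cs (i div u) - {i mod u}) ` {..<n} - cs ` {..k}"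

lemma candidates_0: "candidates cs u k 0 = {}"
  by (simp add: candidates_def)

lemma candidates_Suc:
  "candidates cs u k (Suc n) = (let A = cs (n div u) - {n mod u} in
    if A \<in> cs ` {..k} then candidates cs u k n else insert A (candidates cs u k n))"
  by (auto simp: candidates_def lessThan_Suc Let_def)

lemma candidates_subset:
  assumes "\<And>j. j \<le> k \<Longrightarrow> cs j \<in> scenarios I"
  shows "candidates cs (usize I) k (Suc k * usize I) \<subseteq> scenarios I"
proof
  fix A assume "A \<in> candidates cs (usize I) k (Suc k * usize I)"
  then obtain i where i: "i < Suc k * usize I" "A = cs (i div usize I) - {i mod usize I}"
    by (auto simp: candidates_def)
  then have "i div usize I \<le> k" by (metis less_Suc_eq_le less_mult_imp_div_less)
  then show "A \<in> scenarios I" using assms i(2) by (auto simp: scenarios_def)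
qed

lemma below_candidate:
  assumes "\<And>j. j \<le> k \<Longrightarrow> cs j \<in> scenarios I" "cs 0 = {..<usize I}" "A \<in> scenarios I" "A \<notin> cs ` {..k}"
  shows "\<exists>A'\<in>candidates cs (usize I) k (Suc k * usize I). A \<subseteq> A'"
proof -
  have "\<exists>A'\<in>cs ` {..k}. \<exists>e\<in>A'. A' - {e} \<notin> cs ` {..k} \<and> A \<subseteq> A' - {e}"
  proof (rule unchosen_below_child)
    show "finite A'" if "A' \<in> cs ` {..k}" for A' using that assms(1) scenarios_finite by blast
    show "cs 0 \<in> cs ` {..k}" by blast
    show "A \<subseteq> cs 0" using assms(2,3) by (simp add: scenarios_def ground_def)
  qed (rule assms(4))
  then obtain j e where je: "j \<le> k" "e \<in> cs j" "cs j - {e} \<notin> cs ` {..k}" "A \<subseteq> cs j - {e}" by blast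
  then have e: "e < usize I" using assms(1) by (auto simp: scenarios_def ground_def)
  have "j * usize I + e < Suc j * usize I" using e by simp
  also have "\<dots> \<le> Suc k * usize I" using je(1) by (intro mult_right_mono) auto
  finally have "cs j - {e} \<in> candidates cs (usize I) k (Suc k * usize I)"
    unfolding candidates_def using je(3) e by (intro DiffI image_eqI[of _ _ "j * usize I + e"]) auto
  then show ?thesis using je(4) by blast
qed

lemma top_seq_Suc:
  assumes "top_seq S g (Suc k) cs" "A \<in> S"
    and "\<not> S \<subseteq> cs ` {..k} \<Longrightarrow> A \<notin> cs ` {..k} \<and> (\<forall>A'\<in>S. A' \<notin> cs ` {..k} \<longrightarrow> g A' \<le> g A)"
  shows "top_seq S g (Suc (Suc k)) (cs(Suc k := A))"
  unfolding top_seq_def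
proof (intro allI impI)
  fix j assume "j < Suc (Suc k)"
  moreover from this have "(cs(Suc k := A)) ` {..<j} = cs ` {..<j}" by (intro image_cong) auto
  ultimately show "(cs(Suc k := A)) j \<in> S \<and> (\<not> S \<subseteq> (cs(Suc k := A)) ` {..<j} \<longrightarrow>
      (cs(Suc k := A)) j \<notin> (cs(Suc k := A)) ` {..<j} \<and>
      (\<forall>A'\<in>S. A' \<notin> (cs(Suc k := A)) ` {..<j} \<longrightarrow> g A' \<le> g ((cs(Suc k := A)) j)))"
    using assms by (cases "j = Suc k") (simp_all add: top_seq_def lessThan_Suc_atMost)
qed

lemma top_seq_extend:
  assumes top: "top_seq (scenarios I) g (Suc k) cs" "cs 0 = {..<usize I}"
    and mono: "\<And>A A'. A \<in> scenarios I \<Longrightarrow> A' \<in> scenarios I \<Longrightarrow> A \<subseteq> A' \<Longrightarrow> g A \<le> g A'"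
    and best: "best_of (candidates cs (usize I) k (Suc k * usize I)) g A v"
  shows "A \<in> scenarios I" "top_seq (scenarios I) g (Suc (Suc k)) (cs(Suc k := A))"
proof -
  let ?C = "candidates cs (usize I) k (Suc k * usize I)"
  have cs: "cs j \<in> scenarios I" if "j \<le> k" for j using top(1) that by (simp add: top_seq_def)
  then have sub: "?C \<subseteq> scenarios I" by (rule candidates_subset)
  note below = below_candidate[where cs = cs and k = k, OF cs top(2)]
  show A: "A \<in> scenarios I" using best sub by (auto simp: best_of_def scenarios_def split: if_splits)
  show "top_seq (scenarios I) g (Suc (Suc k)) (cs(Suc k := A))"
  proof (rule top_seq_Suc[OF top(1) A], intro conjI ballI impI)
    assume "\<not> scenarios I \<subseteq> cs ` {..k}"
    then have best': "A \<in> ?C" "\<And>A'. A' \<in> ?C \<Longrightarrow> g A' \<le> g A"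
      using best below by (auto simp: best_of_def split: if_splits)
    then show "A \<notin> cs ` {..k}" by (simp add: candidates_def)
    fix A' assume A': "A' \<in> scenarios I" "A' \<notin> cs ` {..k}"
    then obtain A'' where "A'' \<in> ?C" "A' \<subseteq> A''" using below by blast
    then show "g A' \<le> g A" using mono[OF A'(1)] best'(2) sub by (meson order_trans subsetD)
  qed
qed

lemma top_seq_full:
  assumes "\<And>A A'. A \<in> scenarios I \<Longrightarrow> A' \<in> scenarios I \<Longrightarrow> A \<subseteq> A' \<Longrightarrow> g A \<le> g A'"
  shows "top_seq (scenarios I) g (Suc 0) (\<lambda>_. {..<usize I})"
  using assms full_scenario[of I] by (auto simp: top_seq_def scenarios_def ground_def)

section \<open>The program\<close>

abbreviation (input) costs_r :: nat where "costs_r \<equiv> 0"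
abbreviation (input) input_r :: nat where "input_r \<equiv> Suc 0"
abbreviation (input) answer_r :: nat where "answer_r \<equiv> 2"
abbreviation (input) powers_r :: nat where "powers_r \<equiv> 3"
abbreviation (input) full_code_r :: nat where "full_code_r \<equiv> 4"
abbreviation (input) top_val_r :: nat where "top_val_r \<equiv> 5"
abbreviation (input) cost_sum_r :: nat where "cost_sum_r \<equiv> 6"
abbreviation (input) side_r :: nat where "side_r \<equiv> 7"
abbreviation (input) ratio_r :: nat where "ratio_r \<equiv> 8"
abbreviation (input) power_r :: nat where "power_r \<equiv> 9"
abbreviation (input) log_ratio_r :: nat where "log_ratio_r \<equiv> 10"
abbreviation (input) grid_r :: nat where "grid_r \<equiv> 11"
abbreviation (input) cuts_r :: nat where "cuts_r \<equiv> 12"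
abbreviation (input) log_points_r :: nat where "log_points_r \<equiv> 13"
abbreviation (input) samples_r :: nat where "samples_r \<equiv> 14"
abbreviation (input) n_top_r :: nat where "n_top_r \<equiv> 15"
abbreviation (input) mass_r :: nat where "mass_r \<equiv> 16"
abbreviation (input) codes_r :: nat where "codes_r \<equiv> 17"
abbreviation (input) scenario_r :: nat where "scenario_r \<equiv> 20"
abbreviation (input) bit_r :: nat where "bit_r \<equiv> 21"
abbreviation (input) code_r :: nat where "code_r \<equiv> 22"
abbreviation (input) draw_r :: nat where "draw_r \<equiv> 23"
abbreviation (input) hits_r :: nat where "hits_r \<equiv> 24"
abbreviation (input) probe_r :: nat where "probe_r \<equiv> 25"
abbreviation (input) weight_r :: nat where "weight_r \<equiv> 26"
abbreviation (input) vertices_r :: nat where "vertices_r \<equiv> 27"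
abbreviation (input) best_cost_r :: nat where "best_cost_r \<equiv> 28"
abbreviation (input) round_r :: nat where "round_r \<equiv> 29"
abbreviation (input) row_r :: nat where "row_r \<equiv> 30"
abbreviation (input) col_r :: nat where "col_r \<equiv> 31"
abbreviation (input) flat_r :: nat where "flat_r \<equiv> 32"
abbreviation (input) acc_r :: nat where "acc_r \<equiv> 33"
abbreviation (input) point_r :: nat where "point_r \<equiv> 34"
abbreviation (input) outside_r :: nat where "outside_r \<equiv> 35"
abbreviation (input) normal_r :: nat where "normal_r \<equiv> 36"
abbreviation (input) heights_r :: nat where "heights_r \<equiv> 37"
abbreviation (input) lowest_r :: nat where "lowest_r \<equiv> 38"
abbreviation (input) scale_r :: nat where "scale_r \<equiv> 39"
abbreviation (input) tops_r :: nat where "tops_r \<equiv> 40"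
abbreviation (input) chosen_r :: nat where "chosen_r \<equiv> 41"
abbreviation (input) best_code_r :: nat where "best_code_r \<equiv> 42"
abbreviation (input) best_val_r :: nat where "best_val_r \<equiv> 43"
abbreviation (input) child_r :: nat where "child_r \<equiv> 44"
abbreviation (input) val_r :: nat where "val_r \<equiv> 45"
abbreviation (input) subgrad_r :: nat where "subgrad_r \<equiv> 46"
abbreviation (input) term_r :: nat where "term_r \<equiv> 47"
abbreviation (input) cost_r :: nat where "cost_r \<equiv> 48"

abbreviation (input) "dim_e \<equiv> Cell input_r (Num 0)"
abbreviation (input) "ground_e \<equiv> Cell input_r (Num 1)"
abbreviation (input) "lam_e \<equiv> Cell input_r (Num 2)"
abbreviation (input) "radius_e \<equiv> Cell input_r (Num 3)"
abbreviation (input) "outer_e \<equiv> Cell input_r (Num 4)"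
abbreviation (input) "inner_e \<equiv> Cell input_r (Num 5)"
abbreviation (input) "accuracy_e \<equiv> Cell input_r (Num 6)"
abbreviation (input) "confidence_e \<equiv> Cell input_r (Num 7)"

text \<open>\<open>bit_expr c p\<close> is the binary digit of the number \<open>c\<close> at the power of two \<open>p\<close>, and \<open>eq_expr\<close>
  compares two integers; both are 0 or 1.\<close>

definition bit_expr :: "expr \<Rightarrow> expr \<Rightarrow> expr" where
  "bit_expr c p = Flr (c \<^bold>/ p) \<^bold>- Num 2 \<^bold>* Flr (Flr (c \<^bold>/ p) \<^bold>/ Num 2)"

definition eq_expr :: "expr \<Rightarrow> expr \<Rightarrow> expr" where
  "eq_expr a b = Flr (Num 1 \<^bold>/ (Num 1 \<^bold>+ (a \<^bold>- b) \<^bold>* (a \<^bold>- b)))"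

definition vertex_expr :: "expr \<Rightarrow> expr \<Rightarrow> expr" where
  "vertex_expr i k = Cell vertices_r (i \<^bold>* dim_e \<^bold>+ k)"

definition assign_min :: "nat \<Rightarrow> expr \<Rightarrow> expr \<Rightarrow> com" where
  "assign_min a e1 e2 = IF e1 \<^bold>- e2 THEN a ::= e2 ELSE a ::= e1"

definition assign_max :: "nat \<Rightarrow> expr \<Rightarrow> expr \<Rightarrow> com" where
  "assign_max a e1 e2 = IF e1 \<^bold>- e2 THEN a ::= e1 ELSE a ::= e2"

definition copy_prog :: "nat \<Rightarrow> nat \<Rightarrow> com" where
  "copy_prog dst src = tabulate dst col_r dim_e skip (Cell src (Reg col_r))"

definition split_index :: "expr \<Rightarrow> com" where
  "split_index n = row_r ::= Flr (Reg flat_r \<^bold>/ n) ;; col_r ::= Reg flat_r \<^bold>- Reg row_r \<^bold>* n"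

text \<open>A scenario is stored as the number with these binary digits; oracle calls read it from \<open>scenario_r\<close>.\<close>

definition powers_prog :: com where
  "powers_prog = powers_r .[Num 0] ::= Num 1 ;;
    FOR bit_r < ground_e DO powers_r .[Reg bit_r \<^bold>+ Num 1] ::= Num 2 \<^bold>* Cell powers_r (Reg bit_r)"

definition encode_prog :: com where
  "encode_prog = sum_loop code_r bit_r ground_e skip (Cell powers_r (Reg bit_r) \<^bold>* Cell scenario_r (Reg bit_r))"

definition decode_prog :: "expr \<Rightarrow> com" where
  "decode_prog c = tabulate scenario_r bit_r ground_e skip (bit_expr c (Cell powers_r (Reg bit_r)))"

definition full_code_prog :: com where
  "full_code_prog = powers_prog ;; sum_loop full_code_r bit_r ground_e skip (Cell powers_r (Reg bit_r))"

definition ratio_prog :: com where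
  "ratio_prog =
    decode_prog (Reg full_code_r) ;;
    Value top_val_r answer_r scenario_r ;;
    sum_loop cost_sum_r col_r dim_e skip (Cell costs_r (Reg col_r)) ;;
    side_r ::= dim_e \<^bold>* (Flr outer_e \<^bold>+ Num 1) ;;
    ratio_r ::= (accuracy_e \<^bold>* lam_e) \<^bold>* (outer_e \<^bold>* Reg cost_sum_r \<^bold>+ Num 2 \<^bold>* Reg top_val_r)
      \<^bold>/ (radius_e \<^bold>* Reg top_val_r) ;;
    ratio_r ::= (dim_e \<^bold>+ Num 1) \<^bold>* Reg side_r \<^bold>* Reg ratio_r \<^bold>/ inner_e"

definition log_ratio_prog :: com where
  "log_ratio_prog =
    log_ratio_r ::= Num 0 ;;
    power_r ::= Num 1 ;;
    WHILE Reg ratio_r \<^bold>- Reg power_r DO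
      (power_r ::= Num 2 \<^bold>* Reg power_r ;; log_ratio_r ::= Reg log_ratio_r \<^bold>+ Num 1)"

definition counts_prog :: com where
  "counts_prog =
    grid_r ::= Num 32 \<^bold>* (dim_e \<^bold>* (dim_e \<^bold>* dim_e)) ;;
    cuts_r ::= Reg grid_r \<^bold>* Reg log_ratio_r \<^bold>+ Num 1 ;;
    log_points_r ::= dim_e \<^bold>* (Reg cuts_r \<^bold>* (Num 2 \<^bold>+ Reg grid_r) \<^bold>+ Reg log_ratio_r \<^bold>+ (dim_e \<^bold>+ Num 5)) ;;
    samples_r ::= Flr (Num 16 \<^bold>* (accuracy_e \<^bold>* accuracy_e) \<^bold>/ ((radius_e \<^bold>* radius_e) \<^bold>* (radius_e \<^bold>* radius_e))
      \<^bold>* ((ground_e \<^bold>+ Reg log_points_r) \<^bold>+ (Num 2 \<^bold>+ confidence_e))) \<^bold>+ Num 1 ;;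
    n_top_r ::= Flr (Num 1 \<^bold>/ radius_e) \<^bold>+ Num 1"

definition setup_prog :: com where
  "setup_prog = full_code_prog ;; ratio_prog ;; log_ratio_prog ;; counts_prog"

definition sample_prog :: com where
  "sample_prog = FOR draw_r < Reg samples_r DO
    (Sample scenario_r ;; encode_prog ;; codes_r .[Reg draw_r] ::= Reg code_r)"

definition mass_prog :: com where
  "mass_prog = sum_loop mass_r row_r (Reg samples_r)
    (sum_loop hits_r probe_r (Reg samples_r) skip
      (eq_expr (Cell codes_r (Reg probe_r)) (Cell codes_r (Reg row_r))) ;;
     assign_min weight_r (Num 1 \<^bold>/ Reg samples_r) (radius_e \<^bold>/ Reg hits_r))
    (Reg weight_r)"

definition init_prog :: com where
  "init_prog =
    tabulate vertices_r flat_r ((dim_e \<^bold>+ Num 1) \<^bold>* dim_e) (split_index dim_e)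
      (Reg side_r \<^bold>* eq_expr (Reg row_r) (Reg col_r \<^bold>+ Num 1)) ;;
    best_cost_r ::= Num 2 \<^bold>* Reg top_val_r"

definition centroid_prog :: com where
  "centroid_prog = tabulate point_r col_r dim_e
    (sum_loop acc_r row_r (dim_e \<^bold>+ Num 1) skip (vertex_expr (Reg row_r) (Reg col_r)))
    (Reg acc_r \<^bold>/ (dim_e \<^bold>+ Num 1))"

definition child_prog :: com where
  "child_prog = split_index ground_e ;;
    child_r ::= Cell tops_r (Reg row_r)
      \<^bold>- Cell powers_r (Reg col_r) \<^bold>* bit_expr (Cell tops_r (Reg row_r)) (Cell powers_r (Reg col_r))"

definition compare_prog :: com where
  "compare_prog =
    decode_prog (Reg child_r) ;;
    Value val_r point_r scenario_r ;;
    IF Reg val_r \<^bold>- Reg best_val_r THEN (best_val_r ::= Reg val_r ;; best_code_r ::= Reg child_r) ELSE skip"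

definition candidate_prog :: com where
  "candidate_prog =
    child_prog ;;
    sum_loop hits_r probe_r (Reg chosen_r \<^bold>+ Num 1) skip (eq_expr (Cell tops_r (Reg probe_r)) (Reg child_r)) ;;
    IF Reg hits_r THEN skip ELSE compare_prog"

definition greedy_prog :: com where
  "greedy_prog = tops_r .[Num 0] ::= Reg full_code_r ;;
    FOR chosen_r < Reg n_top_r \<^bold>- Num 1 DO
      (best_code_r ::= Num 0 ;;
       best_val_r ::= Num 0 \<^bold>- Num 1 ;;
       FOR flat_r < (Reg chosen_r \<^bold>+ Num 1) \<^bold>* ground_e DO candidate_prog ;;
       tops_r .[Reg chosen_r \<^bold>+ Num 1] ::= Reg best_code_r)"

definition add_term_prog :: "nat \<Rightarrow> com" where
  "add_term_prog src =
    decode_prog (Cell src (Reg term_r)) ;;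
    Value val_r point_r scenario_r ;;
    Subgrad subgrad_r point_r scenario_r ;;
    cost_r ::= Reg cost_r \<^bold>+ Reg weight_r \<^bold>* Reg val_r ;;
    tabulate normal_r col_r dim_e skip
      (Cell normal_r (Reg col_r) \<^bold>+ Reg weight_r \<^bold>* Cell subgrad_r (Reg col_r))"

definition accumulate_prog :: "expr \<Rightarrow> nat \<Rightarrow> com \<Rightarrow> com" where
  "accumulate_prog n src weigh = FOR term_r < n DO (weigh ;; add_term_prog src)"

definition fill_prog :: com where
  "fill_prog = assign_min weight_r radius_e (Reg mass_r \<^bold>- Reg term_r \<^bold>* radius_e) ;;
    assign_max weight_r (Num 0) (Reg weight_r)"

definition objective_prog :: com where
  "objective_prog =
    sum_loop cost_r col_r dim_e skip (Cell costs_r (Reg col_r) \<^bold>* Cell point_r (Reg col_r)) ;;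
    copy_prog normal_r costs_r ;;
    accumulate_prog (Reg samples_r) codes_r (weight_r ::= Num 1 \<^bold>/ Reg samples_r) ;;
    accumulate_prog (Reg n_top_r) tops_r fill_prog"

definition record_prog :: com where
  "record_prog = IF Reg best_cost_r \<^bold>- Reg cost_r
    THEN (best_cost_r ::= Reg cost_r ;; copy_prog answer_r point_r) ELSE skip"

definition heights_prog :: com where
  "heights_prog = tabulate heights_r row_r (dim_e \<^bold>+ Num 1)
    (sum_loop acc_r col_r dim_e skip
      (Cell normal_r (Reg col_r) \<^bold>* (vertex_expr (Reg row_r) (Reg col_r) \<^bold>- Cell point_r (Reg col_r))))
    (Reg acc_r)"

definition lowest_prog :: com where
  "lowest_prog = lowest_r ::= Num 0 ;;
    FOR row_r < dim_e \<^bold>+ Num 1 DO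
      IF Cell heights_r (Reg lowest_r) \<^bold>- Cell heights_r (Reg row_r) THEN lowest_r ::= Reg row_r ELSE skip"

definition scales_prog :: com where
  "scales_prog =
    tabulate scale_r row_r (dim_e \<^bold>+ Num 1) skip
      ((Flr (Reg grid_r \<^bold>/ (Num 1 \<^bold>+ Cell heights_r (Reg row_r) \<^bold>/ (Num 0 \<^bold>- Cell heights_r (Reg lowest_r))
        \<^bold>/ (Num 8 \<^bold>* (dim_e \<^bold>* dim_e)))) \<^bold>+ Num 1) \<^bold>/ Reg grid_r)"

definition shrink_prog :: com where
  "shrink_prog =
    scales_prog ;;
    tabulate vertices_r flat_r ((dim_e \<^bold>+ Num 1) \<^bold>* dim_e) (split_index dim_e)
      (vertex_expr (Reg lowest_r) (Reg col_r) \<^bold>+ Cell scale_r (Reg row_r)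
        \<^bold>* (Cell vertices_r (Reg flat_r) \<^bold>- vertex_expr (Reg lowest_r) (Reg col_r)))"

definition evaluate_prog :: com where
  "evaluate_prog = greedy_prog ;; objective_prog ;; record_prog"

definition query_prog :: com where
  "query_prog = Separate outside_r normal_r point_r ;; IF Reg outside_r THEN skip ELSE evaluate_prog"

definition contract_prog :: com where
  "contract_prog = heights_prog ;; lowest_prog ;; shrink_prog"

definition cut_prog :: com where
  "cut_prog = centroid_prog ;; query_prog ;; contract_prog"

definition optimize_prog :: com where
  "optimize_prog = mass_prog ;; init_prog ;; FOR round_r < Reg cuts_r DO cut_prog"

definition main_prog :: com where
  "main_prog = setup_prog ;; sample_prog ;; optimize_prog"

lemma writes_assign_min [simp]: "b < 60 \<Longrightarrow> b \<in> writes (assign_min a e1 e2) \<longleftrightarrow> b = a"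
  by (auto simp: assign_min_def)

lemma writes_assign_max [simp]: "b < 60 \<Longrightarrow> b \<in> writes (assign_max a e1 e2) \<longleftrightarrow> b = a"
  by (auto simp: assign_max_def)

lemma writes_copy [simp]: "b < 60 \<Longrightarrow> b \<in> writes (copy_prog dst src) \<longleftrightarrow> b \<in> {dst, col_r}"
  by (auto simp: copy_prog_def)

lemma writes_split_index [simp]: "b < 60 \<Longrightarrow> b \<in> writes (split_index n) \<longleftrightarrow> b \<in> {row_r, col_r}"
  by (auto simp: split_index_def)

lemma writes_encode [simp]: "b < 60 \<Longrightarrow> b \<in> writes encode_prog \<longleftrightarrow> b \<in> {code_r, bit_r}"
  by (auto simp: encode_prog_def)

lemma writes_decode [simp]: "b < 60 \<Longrightarrow> b \<in> writes (decode_prog c) \<longleftrightarrow> b \<in> {scenario_r, bit_r}"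
  by (auto simp: decode_prog_def)

lemma writes_full_code [simp]: "b < 60 \<Longrightarrow> b \<in> writes full_code_prog \<longleftrightarrow> b \<in> {powers_r, bit_r, full_code_r}"
  by (auto simp: full_code_prog_def powers_prog_def)

lemma writes_ratio [simp]: "b < 60 \<Longrightarrow>
  b \<in> writes ratio_prog \<longleftrightarrow> b \<in> {scenario_r, bit_r, top_val_r, cost_sum_r, col_r, side_r, ratio_r}"
  by (auto simp: ratio_prog_def)

lemma writes_log_ratio [simp]: "b < 60 \<Longrightarrow> b \<in> writes log_ratio_prog \<longleftrightarrow> b \<in> {log_ratio_r, power_r}"
  by (auto simp: log_ratio_prog_def)

lemma writes_counts [simp]: "b < 60 \<Longrightarrow>
  b \<in> writes counts_prog \<longleftrightarrow> b \<in> {grid_r, cuts_r, log_points_r, samples_r, n_top_r}"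
  by (auto simp: counts_prog_def)

lemma writes_setup [simp]: "b < 60 \<Longrightarrow>
  b \<in> writes setup_prog \<longleftrightarrow> b \<in> {powers_r, bit_r, full_code_r, scenario_r, top_val_r,
    cost_sum_r, col_r, side_r, ratio_r, log_ratio_r, power_r, grid_r, cuts_r, log_points_r, samples_r, n_top_r}"
  by (auto simp: setup_prog_def)

lemma writes_sample [simp]: "b < 60 \<Longrightarrow> b \<in> writes sample_prog \<longleftrightarrow> b \<in> {draw_r, scenario_r, bit_r, code_r, codes_r}"
  by (auto simp: sample_prog_def)

lemma writes_mass [simp]: "b < 60 \<Longrightarrow> b \<in> writes mass_prog \<longleftrightarrow> b \<in> {mass_r, row_r, hits_r, probe_r, weight_r}"
  by (auto simp: mass_prog_def)

lemma writes_init [simp]: "b < 60 \<Longrightarrow> b \<in> writes init_prog \<longleftrightarrow> b \<in> {vertices_r, flat_r, row_r, col_r, best_cost_r}"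
  by (auto simp: init_prog_def)

lemma writes_centroid [simp]: "b < 60 \<Longrightarrow> b \<in> writes centroid_prog \<longleftrightarrow> b \<in> {point_r, col_r, acc_r, row_r}"
  by (auto simp: centroid_prog_def)

lemma writes_child [simp]: "b < 60 \<Longrightarrow> b \<in> writes child_prog \<longleftrightarrow> b \<in> {row_r, col_r, child_r}"
  by (auto simp: child_prog_def)

lemma writes_compare [simp]: "b < 60 \<Longrightarrow>
  b \<in> writes compare_prog \<longleftrightarrow> b \<in> {scenario_r, bit_r, val_r, best_val_r, best_code_r}"
  by (auto simp: compare_prog_def)

lemma writes_candidate [simp]: "b < 60 \<Longrightarrow>
  b \<in> writes candidate_prog \<longleftrightarrow>
  b \<in> {row_r, col_r, child_r, hits_r, probe_r, scenario_r, bit_r, val_r, best_val_r, best_code_r}"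
  by (auto simp: candidate_prog_def)

lemma writes_greedy [simp]: "b < 60 \<Longrightarrow>
  b \<in> writes greedy_prog \<longleftrightarrow> b \<in> {tops_r, chosen_r, flat_r, row_r, col_r, child_r, hits_r, probe_r, scenario_r, bit_r, val_r, best_val_r, best_code_r}"
  by (auto simp: greedy_prog_def)

lemma writes_add_term [simp]: "b < 60 \<Longrightarrow>
  b \<in> writes (add_term_prog src) \<longleftrightarrow> b \<in> {scenario_r, bit_r, val_r, subgrad_r, cost_r, normal_r, col_r}"
  by (auto simp: add_term_prog_def)

lemma writes_accumulate [simp]: "b < 60 \<Longrightarrow>
  b \<in> writes (accumulate_prog n src weigh) \<longleftrightarrow>
  b \<in> writes weigh \<or> b \<in> {term_r, scenario_r, bit_r, val_r, subgrad_r, cost_r, normal_r, col_r}"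
  by (auto simp: accumulate_prog_def)

lemma writes_fill [simp]: "b < 60 \<Longrightarrow> b \<in> writes fill_prog \<longleftrightarrow> b \<in> {weight_r}"
  by (auto simp: fill_prog_def)

lemma writes_objective [simp]: "b < 60 \<Longrightarrow>
  b \<in> writes objective_prog \<longleftrightarrow> b \<in> {weight_r, term_r, scenario_r, bit_r, val_r, subgrad_r, cost_r, normal_r, col_r}"
  by (auto simp: objective_prog_def)

lemma writes_record [simp]: "b < 60 \<Longrightarrow> b \<in> writes record_prog \<longleftrightarrow> b \<in> {best_cost_r, answer_r, col_r}"
  by (auto simp: record_prog_def)

lemma writes_heights [simp]: "b < 60 \<Longrightarrow> b \<in> writes heights_prog \<longleftrightarrow> b \<in> {heights_r, row_r, acc_r, col_r}"
  by (auto simp: heights_prog_def)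

lemma writes_lowest [simp]: "b < 60 \<Longrightarrow> b \<in> writes lowest_prog \<longleftrightarrow> b \<in> {lowest_r, row_r}"
  by (auto simp: lowest_prog_def)

lemma writes_scales [simp]: "b < 60 \<Longrightarrow> b \<in> writes scales_prog \<longleftrightarrow> b \<in> {scale_r, row_r}"
  by (auto simp: scales_prog_def)

lemma writes_shrink [simp]: "b < 60 \<Longrightarrow> b \<in> writes shrink_prog \<longleftrightarrow> b \<in> {scale_r, row_r, vertices_r, flat_r, col_r}"
  by (auto simp: shrink_prog_def)

lemma writes_evaluate [simp]: "b < 60 \<Longrightarrow>
  b \<in> writes evaluate_prog \<longleftrightarrow>
  b \<in> {tops_r, chosen_r, flat_r, row_r, col_r, child_r, hits_r, probe_r, scenario_r, bit_r, val_r, best_val_r, best_code_r, weight_r, term_r, subgrad_r, cost_r, normal_r, best_cost_r, answer_r}"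
  by (auto simp: evaluate_prog_def)

lemma writes_query [simp]: "b < 60 \<Longrightarrow>
  b \<in> writes query_prog \<longleftrightarrow> b \<in> {outside_r, tops_r, chosen_r, flat_r, row_r, col_r, child_r, hits_r, probe_r, scenario_r, bit_r, val_r, best_val_r, best_code_r, weight_r, term_r, subgrad_r, cost_r, normal_r, best_cost_r, answer_r}"
  by (auto simp: query_prog_def)

lemma writes_contract [simp]: "b < 60 \<Longrightarrow>
  b \<in> writes contract_prog \<longleftrightarrow> b \<in> {heights_r, row_r, acc_r, col_r, lowest_r, scale_r, vertices_r, flat_r}"
  by (auto simp: contract_prog_def)

lemma writes_cut [simp]: "b < 60 \<Longrightarrow>
  b \<in> writes cut_prog \<longleftrightarrow> b \<in> {point_r, outside_r, tops_r, chosen_r, flat_r, row_r, col_r, child_r, hits_r, probe_r, scenario_r, bit_r, val_r, best_val_r, best_code_r, weight_r, term_r, subgrad_r, cost_r, normal_r, best_cost_r, answer_r, heights_r, acc_r, lowest_r, scale_r, vertices_r}"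
  by (auto simp: cut_prog_def)

section \<open>Parameters of the algorithm\<close>

definition top_value :: "drso \<Rightarrow> rat" where
  "top_value I = value_orc I (0\<^sub>v (mdim I)) {..<usize I}"

definition simplex_size :: "drso \<Rightarrow> nat" where
  "simplex_size I = mdim I * (nat \<lfloor>outer_rad I\<rfloor> + 1)"

definition inv_theta :: "drso \<Rightarrow> nat \<Rightarrow> rat" where
  "inv_theta I E = (of_nat E * lam I) *
    (outer_rad I * (\<Sum>k<mdim I. cost1 I $ k) + 2 * top_value I) / (radius I * top_value I)"

definition vol_ratio :: "drso \<Rightarrow> nat \<Rightarrow> rat" where
  "vol_ratio I E = (of_nat (mdim I) + 1) * of_nat (simplex_size I) * inv_theta I E / inner_rad I"

definition log_ratio :: "drso \<Rightarrow> nat \<Rightarrow> nat" where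
  "log_ratio I E = (LEAST l. vol_ratio I E \<le> 2 ^ l)"

definition n_cuts :: "drso \<Rightarrow> nat \<Rightarrow> nat" where
  "n_cuts I E = grid_den (mdim I) * log_ratio I E + 1"

text \<open>An upper bound for the binary logarithm of the number of points at which the objective may be evaluated.\<close>

definition log_points :: "drso \<Rightarrow> nat \<Rightarrow> nat" where
  "log_points I E = mdim I * (n_cuts I E * (2 + grid_den (mdim I)) + log_ratio I E + (mdim I + 5))"

definition n_samples :: "drso \<Rightarrow> nat \<Rightarrow> nat \<Rightarrow> nat" where
  "n_samples I E \<Delta> = nat \<lfloor>16 * (of_nat E * of_nat E) / ((radius I * radius I) * (radius I * radius I)) *
    ((of_nat (usize I) + of_nat (log_points I E)) + (2 + of_nat \<Delta>))\<rfloor> + 1"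

definition n_top :: "drso \<Rightarrow> nat" where
  "n_top I = nat \<lfloor>1 / radius I\<rfloor> + 1"

lemma vol_ratio_le: "vol_ratio I E \<le> 2 ^ log_ratio I E"
  and less_vol_ratio: "l < log_ratio I E \<Longrightarrow> 2 ^ l < vol_ratio I E"
proof -
  obtain n where "vol_ratio I E \<le> of_nat n" using reals_Archimedean2[of "vol_ratio I E"] less_imp_le by blast
  then have "vol_ratio I E \<le> 2 ^ n" using of_nat_less_two_power[of n, where ?'a = rat] by linarith
  then show "vol_ratio I E \<le> 2 ^ log_ratio I E" unfolding log_ratio_def by (rule LeastI)
  assume "l < log_ratio I E"
  then show "2 ^ l < vol_ratio I E" unfolding log_ratio_def using not_less_Least[of l "\<lambda>l. vol_ratio I E \<le> 2 ^ l"]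
    by auto
qed

text \<open>\<open>OT\<close> bounds the encoding lengths of the answers of the oracles.\<close>

definition ratio_bits :: "drso \<Rightarrow> nat \<Rightarrow> nat \<Rightarrow> nat" where
  "ratio_bits I E OT = (mdim I + 1) + (2 * isize I + 1) +
    ((E + isize I) + (isize I + mdim I * (isize I + 1) + OT + 3) + (isize I + OT)) + isize I"

definition vertex_bits :: "drso \<Rightarrow> nat \<Rightarrow> nat" where
  "vertex_bits I E = n_cuts I E * grid_den (mdim I) + 2 * n_cuts I E + (2 * isize I + 1)"

definition point_bits :: "drso \<Rightarrow> nat \<Rightarrow> nat" where
  "point_bits I E = n_cuts I E * grid_den (mdim I) + 2 * n_cuts I E + ((2 * isize I + 1) + (mdim I + 1)) +
    (mdim I + 1)"

definition weight_bits :: "drso \<Rightarrow> nat \<Rightarrow> nat \<Rightarrow> nat" where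
  "weight_bits I E \<Delta> = n_samples I E \<Delta> * (isize I + n_samples I E \<Delta> + 1) + n_top I + isize I + 1"

definition term_bits :: "drso \<Rightarrow> nat \<Rightarrow> nat \<Rightarrow> nat \<Rightarrow> nat" where
  "term_bits I E \<Delta> OT = n_samples I E \<Delta> * (weight_bits I E \<Delta> + OT + 1) + n_top I * (weight_bits I E \<Delta> + OT + 1) +
    2"

definition normal_bits :: "drso \<Rightarrow> nat \<Rightarrow> nat \<Rightarrow> nat \<Rightarrow> nat" where
  "normal_bits I E \<Delta> OT = isize I + term_bits I E \<Delta> OT + OT"

definition cell_bits :: "drso \<Rightarrow> nat \<Rightarrow> nat \<Rightarrow> nat \<Rightarrow> nat" where
  "cell_bits I E \<Delta> OT = ratio_bits I E OT + point_bits I E + weight_bits I E \<Delta> +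
    (mdim I * (isize I + point_bits I E + 1) + term_bits I E \<Delta> OT) + normal_bits I E \<Delta> OT +
    mdim I * (normal_bits I E \<Delta> OT + (vertex_bits I E + point_bits I E + 1) + 1) +
    2 * grid_den (mdim I) + n_cuts I E + log_points I E + n_samples I E \<Delta> + n_top I + \<Delta>"

definition loop_bound :: "drso \<Rightarrow> nat \<Rightarrow> nat \<Rightarrow> nat \<Rightarrow> nat" where
  "loop_bound I E \<Delta> OT = ratio_bits I E OT + n_cuts I E + n_samples I E \<Delta> + n_top I + n_top I * usize I +
    (mdim I + 1) * (mdim I + 1) + usize I"

section \<open>The empirical objective\<close>

definition empirical :: "nat \<Rightarrow> (nat \<Rightarrow> 'a) \<Rightarrow> 'a \<Rightarrow> real" where
  "empirical n As A = real (card {j. j < n \<and> As j = A}) / real n"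

definition empirical_light_mass :: "nat \<Rightarrow> rat \<Rightarrow> (nat \<Rightarrow> 'a) \<Rightarrow> rat" where
  "empirical_light_mass n r As = (\<Sum>i<n. min (1 / of_nat n) (r / of_nat (card {j. j < n \<and> As j = As i})))"

lemma of_rat_min: "real_of_rat (min a b) = min (real_of_rat a) (real_of_rat b)"
  and of_rat_max: "real_of_rat (max a b) = max (real_of_rat a) (real_of_rat b)"
  by (simp_all add: min_def max_def of_rat_less_eq)

lemma of_rat_fill: "real_of_rat (fill r M k) = fill (real_of_rat r) (real_of_rat M) k"
  by (simp add: fill_def of_rat_max of_rat_min of_rat_diff of_rat_mult)

context
  fixes S :: "'a set" and n :: nat and As :: "nat \<Rightarrow> 'a"
  assumes fin: "finite S" and As: "\<And>j. j < n \<Longrightarrow> As j \<in> S" and n: "0 < n"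
begin

lemma sum_by_value: "(\<Sum>i<n. h (As i)) = (\<Sum>A\<in>S. real (card {j. j < n \<and> As j = A}) * (h A :: real))"
proof -
  have "(\<Sum>i<n. h (As i)) = (\<Sum>A\<in>S. \<Sum>i\<in>{i\<in>{..<n}. As i = A}. h (As i))"
    using As fin by (intro sum.group[symmetric]) auto
  also have "\<dots> = (\<Sum>A\<in>S. real (card {j. j < n \<and> As j = A}) * h A)"
    by (intro sum.cong refl) simp
  finally show ?thesis .
qed

lemma empirical_mean: "(\<Sum>i<n. h (As i)) / real n = (\<Sum>A\<in>S. empirical n As A * h A)"
  unfolding sum_by_value empirical_def by (simp add: sum_divide_distrib)

lemma empirical_nonneg: "0 \<le> empirical n As A"
  by (simp add: empirical_def)

lemma sum_empirical: "(\<Sum>A\<in>S. empirical n As A) = 1"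
  using empirical_mean[of "\<lambda>_. 1"] n by simp

lemma of_rat_empirical_light_mass:
  assumes "0 < r"
  shows "real_of_rat (empirical_light_mass n r As) = light_mass S (real_of_rat r) (empirical n As)"
proof -
  have scale: "c * min (1 / q) (b / c) = min (c / q) b" if "c > 0" for c q b :: real
    using that by (simp add: min_mult_distrib_left)
  have "real_of_rat (empirical_light_mass n r As) =
      (\<Sum>i<n. min (1 / real n) (real_of_rat r / real (card {j. j < n \<and> As j = As i})))"
    unfolding empirical_light_mass_def by (simp add: of_rat_sum of_rat_min of_rat_divide)
  also have "\<dots> = (\<Sum>A\<in>S. real (card {j. j < n \<and> As j = A}) * min (1 / real n)
    (real_of_rat r / real (card {j. j < n \<and> As j = A})))"
    by (rule sum_by_value)
  also have "\<dots> = light_mass S (real_of_rat r) (empirical n As)" unfolding light_mass_def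
  proof (intro sum.cong refl)
    fix A
    define k where "k = card {j. j < n \<and> As j = A}"
    show "real (card {j. j < n \<and> As j = A}) * min (1 / real n)
      (real_of_rat r / real (card {j. j < n \<and> As j = A})) =
        min (empirical n As A) (real_of_rat r)"
      using scale[of "real k"] assms unfolding empirical_def k_def[symmetric]
      by (cases "k = 0") (auto simp: min_absorb1)
  qed
  finally show ?thesis .
qed

end

section \<open>Instances satisfying the standing assumptions\<close>

locale drso_run = bounded_machine +
  fixes E \<Delta> :: nat and \<pi> :: "real poly" and OT :: nat
  assumes std: "standing_assumptions \<pi> I" and mon: "monotone_recourse I" and E_pos: "1 \<le> E"
    and orc_time_le: "\<And>b. b \<le> mdim I * (2 * point_bits I E + 3) + usize I \<Longrightarrow> orc_time I b \<le> OT"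
    and cell_bits_le: "cell_bits I E \<Delta> OT \<le> B" and loop_bound_le: "loop_bound I E \<Delta> OT \<le> Z"
begin

abbreviation "m \<equiv> mdim I"
abbreviation "U \<equiv> {..<usize I}"
abbreviation "S \<equiv> scenarios I"
abbreviation "N \<equiv> n_samples I E \<Delta>"
abbreviation "K \<equiv> n_top I"
abbreviation "D \<equiv> grid_den m"
abbreviation "T \<equiv> n_cuts I E"
abbreviation "R \<equiv> simplex_size I"
abbreviation "r \<equiv> real_of_rat (radius I)"
abbreviation "c \<equiv> real_vec (cost1 I)"

lemma
  shows basic: "basic_data I" and nonneg: "nonneg_costs \<pi> I" and inflation: "bounded_inflation I"
    and rounded: "well_rounded \<pi> I"
    and efficient: "efficient_feas \<pi> I" "efficient_convex_recourse I" "efficient_subgradients I"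
  using std by (simp_all add: standing_assumptions_def)

lemma
  shows cost_dim: "cost1 I \<in> carrier_vec m"
    and radius: "0 < radius I" "radius I \<le> 1"
    and center: "set_pmf (center I) \<subseteq> S"
    and sizes: "m + usize I + vec_size (cost1 I) + rat_size (lam I) + rat_size (radius I)
      + rat_size (outer_rad I) + rat_size (inner_rad I) \<le> isize I"
    and zero_feas: "0\<^sub>v m \<in> feas I"
    and lam: "1 \<le> lam I"
    and rads: "0 < outer_rad I" "0 < inner_rad I" "inner_rad I \<le> 1"
  using basic nonneg inflation rounded
  unfolding basic_data_def nonneg_costs_def bounded_inflation_def well_rounded_def int_feas_def by blast+

lemma feas_carrier: "x \<in> feas I \<Longrightarrow> x \<in> carrier_vec m"
  using basic by (auto simp: basic_data_def polytope_vec_def)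

lemma feas_nonneg:
  assumes "x \<in> feas I" "k < m"
  shows "0 \<le> x $ k"
proof -
  have "0\<^sub>v m \<le> x" using basic assms(1) by (auto simp: basic_data_def)
  then show ?thesis using assms feas_carrier[OF assms(1)] by (auto simp: less_eq_vec_def)
qed

lemma cost_nonneg: "k < m \<Longrightarrow> 0 \<le> cost1 I $ k"
  using nonneg cost_dim by (auto simp: nonneg_costs_def less_eq_vec_def)

lemma dims_le: "m \<le> isize I" "usize I \<le> isize I"
  using sizes by linarith+

lemma r_pos: "0 < r" "r \<le> 1"
  using radius by (simp_all add: zero_less_of_rat_iff)

lemma recourse_nonneg: "x \<in> feas I \<Longrightarrow> A \<in> S \<Longrightarrow> 0 \<le> recourse I x A"
  using nonneg by (auto simp: nonneg_costs_def)

lemma recourse_mono: "x \<in> feas I \<Longrightarrow> A \<in> S \<Longrightarrow> A' \<in> S \<Longrightarrow> A \<subseteq> A' \<Longrightarrow> recourse I x A \<le> recourse I x A'"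
  using mon by (auto simp: monotone_recourse_def)

lemma recourse_le_full: "x \<in> feas I \<Longrightarrow> A \<in> S \<Longrightarrow> recourse I x A \<le> recourse I x U"
  by (rule recourse_mono[OF _ _ full_scenario]) (auto simp: scenarios_def ground_def)

lemma N_pos: "0 < N" and K_pos: "0 < K" and T_pos: "0 < T"
  by (simp_all add: n_samples_def n_top_def n_cuts_def)

lemma K_large: "1 \<le> r * real K"
proof -
  have "1 / radius I < of_int \<lfloor>1 / radius I\<rfloor> + 1" by linarith
  also have "\<dots> = of_nat K" using radius by (simp add: n_top_def)
  finally have "1 < radius I * of_nat K" using radius by (simp add: field_simps)
  then have "real_of_rat 1 < real_of_rat (radius I * of_nat K)" by (simp only: of_rat_less)
  then show ?thesis by (simp add: of_rat_mult)
qed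

lemma fits_input:
  "fits (isize I) (lam I)" "fits (isize I) (radius I)" "fits (isize I) (outer_rad I)"
    "fits (isize I) (inner_rad I)"
  by (rule fits_mono[OF fits_rat_size]; use sizes in linarith)+

lemma fits_vec_component:
  assumes "vec_size v \<le> b" "k < dim_vec v"
  shows "fits b (v $ k)"
proof (rule fits_mono[OF fits_rat_size])
  have "rat_size (v $ k) \<le> vec_size v" unfolding vec_size_def using assms(2) by (intro member_le_sum) auto
  then show "rat_size (v $ k) \<le> b" using assms(1) by linarith
qed

lemma fits_cost: "k < m \<Longrightarrow> fits (isize I) (cost1 I $ k)"
  using sizes cost_dim by (intro fits_vec_component) auto

lemma fits_params: "ratio_bits I E OT \<le> B" "point_bits I E \<le> B" "weight_bits I E \<Delta> \<le> B"
    "m * (isize I + point_bits I E + 1) + term_bits I E \<Delta> OT \<le> B" "normal_bits I E \<Delta> OT \<le> B"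
    "m * (normal_bits I E \<Delta> OT + (vertex_bits I E + point_bits I E + 1) + 1) \<le> B"
    "2 * D \<le> B" "T \<le> B" "log_points I E \<le> B" "N \<le> B" "K \<le> B" "\<Delta> \<le> B"
  using cell_bits_le unfolding cell_bits_def by linarith+

lemma small_le_B: "isize I \<le> B" "E \<le> B" "OT \<le> B" "vertex_bits I E \<le> B"
  using fits_params(1,2) by (simp_all add: ratio_bits_def point_bits_def vertex_bits_def)

lemma loop_counts: "ratio_bits I E OT \<le> Z" "T \<le> Z" "N \<le> Z" "K \<le> Z" "K * usize I \<le> Z" "(m + 1) * (m + 1) \<le> Z"
  "usize I \<le> Z"
  using loop_bound_le unfolding loop_bound_def by linarith+

subsection \<open>Oracles\<close>

lemma vec_size_le:
  assumes "x \<in> carrier_vec m" "\<And>k. k < m \<Longrightarrow> fits (point_bits I E) (x $ k)"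
  shows "vec_size x \<le> m * (2 * point_bits I E + 3)"
proof -
  have "(\<Sum>i<m. rat_size (x $ i)) \<le> of_nat (card {..<m}) * (2 * point_bits I E + 3)"
    by (intro sum_bounded_above rat_size_le assms(2)) simp
  then show ?thesis using assms(1) by (simp add: vec_size_def)
qed

definition queryable :: "rat Matrix.vec \<Rightarrow> bool" where
  "queryable x \<longleftrightarrow> x \<in> carrier_vec m \<and> real_vec x \<in> feas I \<and> (\<forall>k<m. fits (point_bits I E) (x $ k))"

lemma value_oracle:
  assumes "queryable x" "A \<in> S"
  shows "real_of_rat (value_orc I x A) = recourse I (real_vec x) A" "fits OT (value_orc I x A)"
proof -
  have x: "x \<in> carrier_vec m" "real_vec x \<in> feas I" "\<And>k. k < m \<Longrightarrow> fits (point_bits I E) (x $ k)"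
    using assms(1) by (auto simp: queryable_def)
  have "orc_time I (vec_size x + usize I) \<le> OT" using vec_size_le[OF x(1,3)] by (intro orc_time_le) simp
  moreover have "real_of_rat (value_orc I x A) = recourse I (real_vec x) A \<and>
      rat_size (value_orc I x A) \<le> orc_time I (vec_size x + usize I)"
    using efficient(2) x assms(2) by (auto simp: efficient_convex_recourse_def)
  ultimately show "real_of_rat (value_orc I x A) = recourse I (real_vec x) A" "fits OT (value_orc I x A)"
    by (auto intro!: fits_mono[OF fits_rat_size])
qed

lemma value_oracle_nonneg: "queryable x \<Longrightarrow> A \<in> S \<Longrightarrow> 0 \<le> value_orc I x A"
  using value_oracle(1)[of x A] recourse_nonneg[of "real_vec x" A]
  by (simp add: queryable_def zero_le_of_rat_iff flip: value_oracle(1))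

lemma value_oracle_mono: "queryable x \<Longrightarrow> A \<in> S \<Longrightarrow> A' \<in> S \<Longrightarrow> A \<subseteq> A' \<Longrightarrow> value_orc I x A \<le> value_orc I x A'"
  using recourse_mono[of "real_vec x" A A'] by (simp add: queryable_def of_rat_less_eq flip: value_oracle(1))

lemma subgradient_oracle:
  assumes "queryable x" "A \<in> S"
  shows "good_subgradient I (real_vec x) A (real_vec (subgrad_orc I x A))"
    "dim_vec (subgrad_orc I x A) = m" "k < m \<Longrightarrow> fits OT (subgrad_orc I x A $ k)"
proof -
  have x: "x \<in> carrier_vec m" "real_vec x \<in> feas I" "\<And>k. k < m \<Longrightarrow> fits (point_bits I E) (x $ k)"
    using assms(1) by (auto simp: queryable_def)
  have time: "orc_time I (vec_size x + usize I) \<le> OT" using vec_size_le[OF x(1,3)] by (intro orc_time_le) simp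
  have sub: "good_subgradient I (real_vec x) A (real_vec (subgrad_orc I x A)) \<and>
      vec_size (subgrad_orc I x A) \<le> orc_time I (vec_size x + usize I)"
    using efficient(3) x assms(2) by (auto simp: efficient_subgradients_def)
  then show "good_subgradient I (real_vec x) A (real_vec (subgrad_orc I x A))" by simp
  show dim: "dim_vec (subgrad_orc I x A) = m" using sub by (auto simp: good_subgradient_def)
  show "fits OT (subgrad_orc I x A $ k)" if "k < m"
    using sub time dim that by (intro fits_vec_component) auto
qed

lemma subgradient_le:
  assumes "queryable x" "A \<in> S" "y \<in> feas I"
  shows "recourse I (real_vec x) A + (\<Sum>k<m. real_of_rat (subgrad_orc I x A $ k) * (y $ k - real_of_rat (x $ k))) \<le>
    recourse I y A"
proof -
  have "recourse I y A \<ge> recourse I (real_vec x) A + real_vec (subgrad_orc I x A) \<bullet> (y - real_vec x)"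
    using subgradient_oracle(1)[OF assms(1,2)] assms(3) by (simp add: good_subgradient_def subgradient_on_def)
  moreover have "real_vec (subgrad_orc I x A) \<bullet> (y - real_vec x) =
      (\<Sum>k<m. real_of_rat (subgrad_orc I x A $ k) * (y $ k - real_of_rat (x $ k)))"
    using subgradient_oracle(2)[OF assms(1,2)] assms(1) feas_carrier[OF assms(3)]
    by (auto simp: queryable_def scalar_prod_def atLeast0LessThan)
  ultimately show ?thesis by simp
qed

lemma separation_oracle_None:
  assumes "x \<in> carrier_vec m" "sep_orc I x = None"
  shows "real_vec x \<in> feas I"
  using efficient(1) assms by (force simp: efficient_feas_def)

lemma separation_oracle_Some:
  assumes "x \<in> carrier_vec m" "\<And>k. k < m \<Longrightarrow> fits (point_bits I E) (x $ k)" "sep_orc I x = Some a"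
  shows "dim_vec a = m" "k < m \<Longrightarrow> fits OT (a $ k)" "y \<in> feas I \<Longrightarrow> real_vec a \<bullet> y < real_vec a \<bullet> real_vec x"
proof -
  have a: "a \<in> carrier_vec m" "\<forall>y\<in>feas I. real_vec a \<bullet> y < real_vec a \<bullet> real_vec x"
    "vec_size a \<le> orc_time I (vec_size x)"
    using efficient(1) assms(1,3) by (force simp: efficient_feas_def)+
  then show "dim_vec a = m" "y \<in> feas I \<Longrightarrow> real_vec a \<bullet> y < real_vec a \<bullet> real_vec x" by auto
  have "orc_time I (vec_size x) \<le> OT" using vec_size_le[OF assms(1,2)] by (intro orc_time_le) simp
  then show "fits OT (a $ k)" if "k < m" using a that by (intro fits_vec_component) auto
qed

lemma real_vec_zero: "real_vec (0\<^sub>v m) = 0\<^sub>v m"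
  by (intro eq_vecI) auto

lemma zero_queryable: "queryable (0\<^sub>v m)"
  by (simp add: queryable_def zero_feas real_vec_zero)

lemma of_rat_top_value: "real_of_rat (top_value I) = recourse I (0\<^sub>v m) U"
  and fits_top_value: "fits OT (top_value I)"
  unfolding top_value_def using value_oracle[OF zero_queryable full_scenario] by (simp_all add: real_vec_zero)

lemma top_value_nonneg: "0 \<le> top_value I"
  unfolding top_value_def by (rule value_oracle_nonneg[OF zero_queryable full_scenario])

subsection \<open>Values and subgradients of the empirical objective\<close>

abbreviation "mhat As \<equiv> empirical_light_mass N (radius I) As"

definition fhat :: "(nat \<Rightarrow> nat set) \<Rightarrow> real Matrix.vec \<Rightarrow> real" where
  "fhat As y = c \<bullet> y + (\<Sum>i<N. recourse I y (As i)) / real N +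
    shift_gain S r (light_mass S r (empirical N As)) (recourse I y)"

definition cost_value :: "(nat \<Rightarrow> nat set) \<Rightarrow> (nat \<Rightarrow> nat set) \<Rightarrow> rat Matrix.vec \<Rightarrow> rat" where
  "cost_value As cs x = (\<Sum>k<m. cost1 I $ k * x $ k) + (\<Sum>i<N. 1 / of_nat N * value_orc I x (As i)) +
    (\<Sum>k<K. fill (radius I) (mhat As) k * value_orc I x (cs k))"

definition cost_slope :: "(nat \<Rightarrow> nat set) \<Rightarrow> (nat \<Rightarrow> nat set) \<Rightarrow> rat Matrix.vec \<Rightarrow> nat \<Rightarrow> rat" where
  "cost_slope As cs x k = cost1 I $ k + (\<Sum>i<N. 1 / of_nat N * subgrad_orc I x (As i) $ k) +
    (\<Sum>j<K. fill (radius I) (mhat As) j * subgrad_orc I x (cs j) $ k)"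

lemma dot_eq: "y \<in> carrier_vec m \<Longrightarrow> c \<bullet> y = (\<Sum>k<m. real_of_rat (cost1 I $ k) * y $ k)"
  using cost_dim by (simp add: scalar_prod_def atLeast0LessThan)

lemma dot_nonneg: "y \<in> feas I \<Longrightarrow> 0 \<le> c \<bullet> y"
  by (subst dot_eq) (auto intro!: sum_nonneg mult_nonneg_nonneg simp: feas_carrier feas_nonneg cost_nonneg zero_le_of_rat_iff)

lemma dominated:
  assumes "y \<in> feas I"
  shows "dominated_costs S r (recourse I y) U"
  using assms finite_scenarios r_pos(1) full_scenario recourse_nonneg recourse_le_full by unfold_locales auto

context
  fixes As :: "nat \<Rightarrow> nat set" assumes As: "\<And>j. j < N \<Longrightarrow> As j \<in> S"
begin

lemma of_rat_mhat: "real_of_rat (mhat As) = light_mass S r (empirical N As)"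
  using finite_scenarios As N_pos radius(1) by (intro of_rat_empirical_light_mass) auto

lemma mhat_bounds:
  "r \<le> real_of_rat (mhat As)" "real_of_rat (mhat As) \<le> r * real (card S)" "real_of_rat (mhat As) \<le> r * real K"
  "real_of_rat (mhat As) \<le> 1"
proof -
  note sum_empirical = sum_empirical[OF finite_scenarios As N_pos]
    and nonneg = empirical_nonneg[OF finite_scenarios As N_pos]
  show "r \<le> real_of_rat (mhat As)" unfolding of_rat_mhat
    using light_mass_ge[OF finite_scenarios nonneg sum_empirical] r_pos by simp
  show "real_of_rat (mhat As) \<le> r * real (card S)" unfolding of_rat_mhat by (rule light_mass_le_card)
  show "real_of_rat (mhat As) \<le> 1" unfolding of_rat_mhat using sum_empirical by (rule light_mass_le_1)
  then show "real_of_rat (mhat As) \<le> r * real K" using K_large by linarith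
qed

lemma mhat_pos: "0 < real_of_rat (mhat As)"
  using mhat_bounds(1) r_pos(1) by linarith

lemma fhat_le_full:
  assumes y: "y \<in> feas I"
  shows "fhat As y \<le> c \<bullet> y + 2 * recourse I y U"
proof -
  have "(\<Sum>i<N. recourse I y (As i)) \<le> of_nat (card {..<N}) * recourse I y U"
    using As recourse_le_full[OF y] by (intro sum_bounded_above) auto
  then have "(\<Sum>i<N. recourse I y (As i)) / real N \<le> recourse I y U"
    using N_pos by (simp add: field_simps)
  moreover have "shift_gain S r (real_of_rat (mhat As)) (recourse I y) \<le> real_of_rat (mhat As) * recourse I y U"
    using mhat_pos by (intro dominated_costs.shift_gain_le[OF dominated[OF y]]) simp
  moreover have "real_of_rat (mhat As) * recourse I y U \<le> 1 * recourse I y U"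
    using mhat_bounds(4) recourse_nonneg[OF y full_scenario] by (rule mult_right_mono)
  ultimately show ?thesis unfolding fhat_def of_rat_mhat[symmetric] by linarith
qed

context
  fixes x :: "rat Matrix.vec" and cs :: "nat \<Rightarrow> nat set"
  assumes x: "queryable x" and cs: "top_seq S (value_orc I x) K cs"
begin

lemma top_scenario: "k < K \<Longrightarrow> cs k \<in> S"
  using cs by (simp add: top_seq_def)

lemma top_seq_recourse: "top_seq S (recourse I (real_vec x)) K cs"
  using cs top_scenario unfolding top_seq_def by (simp add: of_rat_less_eq value_oracle(1)[OF x, symmetric])

lemma greedy_le_gain:
  assumes "y \<in> feas I"
  shows "(\<Sum>k<K. fill r (real_of_rat (mhat As)) k * recourse I y (cs k)) \<le>
    shift_gain S r (real_of_rat (mhat As)) (recourse I y)"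
proof -
  obtain s where "s \<in> shifts S r (real_of_rat (mhat As))"
    "\<And>f. (\<Sum>A\<in>S. s A * f A) = (\<Sum>k<K. fill r (real_of_rat (mhat As)) k * f (cs k))"
    using greedy_in_shifts[OF finite_scenarios r_pos(1) mhat_pos mhat_bounds(2,3) top_seq_recourse] by blast
  then show ?thesis using dominated_costs.shift_gain_ge[OF dominated[OF assms]] by metis
qed

lemma gain_eq_greedy:
  "shift_gain S r (real_of_rat (mhat As)) (recourse I (real_vec x)) =
    (\<Sum>k<K. fill r (real_of_rat (mhat As)) k * recourse I (real_vec x) (cs k))"
proof (rule antisym[OF dominated_costs.shift_gain_least[OF dominated] greedy_le_gain])
  show "real_vec x \<in> feas I" using x by (simp add: queryable_def)
  fix s assume "s \<in> shifts S r (real_of_rat (mhat As))"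
  then show "(\<Sum>A\<in>S. s A * recourse I (real_vec x) A) \<le>
    (\<Sum>k<K. fill r (real_of_rat (mhat As)) k * recourse I (real_vec x) (cs k))"
    using x recourse_nonneg
    by (intro greedy_optimal[OF finite_scenarios r_pos(1) mhat_pos mhat_bounds(2,3) top_seq_recourse]) (auto simp: queryable_def)
qed (use x mhat_pos in \<open>auto simp: queryable_def\<close>)

lemma of_rat_cost_value: "real_of_rat (cost_value As cs x) = fhat As (real_vec x)"
proof -
  have "real_of_rat (value_orc I x (As i)) = recourse I (real_vec x) (As i)" if "i < N" for i
    using value_oracle(1)[OF x As[OF that]] .
  moreover have "real_of_rat (value_orc I x (cs k)) = recourse I (real_vec x) (cs k)" if "k < K" for k
    using value_oracle(1)[OF x top_scenario[OF that]] .
  ultimately show ?thesis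
    using x unfolding cost_value_def fhat_def of_rat_mhat[symmetric] gain_eq_greedy
    by (auto simp: queryable_def dot_eq of_rat_add of_rat_sum of_rat_mult of_rat_divide of_rat_fill sum_divide_distrib)
qed

lemma cost_slope_dot:
  fixes y :: "nat \<Rightarrow> real"
  defines "lin A \<equiv> \<Sum>k<m. real_of_rat (subgrad_orc I x A $ k) * y k"
  shows "(\<Sum>k<m. real_of_rat (cost_slope As cs x k) * y k) = (\<Sum>k<m. real_of_rat (cost1 I $ k) * y k) +
    (\<Sum>i<N. lin (As i)) / real N + (\<Sum>j<K. fill r (real_of_rat (mhat As)) j * lin (cs j))"
proof -
  have swap: "(\<Sum>k<m. (\<Sum>i<n. w i * h i k) * y k) = (\<Sum>i<n. w i * (\<Sum>k<m. h i k * y k))" for n and w :: "nat \<Rightarrow> real"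
    and h
    unfolding sum_distrib_left sum_distrib_right by (subst sum.swap) (simp add: mult.assoc)
  have "real_of_rat (cost_slope As cs x k) = real_of_rat (cost1 I $ k) +
      (\<Sum>i<N. 1 / real N * real_of_rat (subgrad_orc I x (As i) $ k)) +
      (\<Sum>j<K. fill r (real_of_rat (mhat As)) j * real_of_rat (subgrad_orc I x (cs j) $ k))" for k
    by (simp add: cost_slope_def of_rat_add of_rat_sum of_rat_mult of_rat_divide of_rat_fill)
  then show ?thesis
    by (simp only: distrib_right sum.distrib swap lin_def) (simp add: sum_divide_distrib)
qed

lemma fhat_subgradient:
  assumes y: "y \<in> feas I"
  shows "fhat As (real_vec x) + (\<Sum>k<m. real_of_rat (cost_slope As cs x k) * (y $ k - real_of_rat (x $ k))) \<le>
    fhat As y"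
proof -
  let ?fill = "fill r (real_of_rat (mhat As))"
  let ?lin = "\<lambda>A. \<Sum>k<m. real_of_rat (subgrad_orc I x A $ k) * (y $ k - real_of_rat (x $ k))"
  have "(\<Sum>i<N. recourse I (real_vec x) (As i) + ?lin (As i)) \<le> (\<Sum>i<N. recourse I y (As i))"
    using subgradient_le[OF x As y] by (intro sum_mono) auto
  from divide_right_mono[OF this, of "real N"]
    have samples: "(\<Sum>i<N. recourse I (real_vec x) (As i)) / real N + (\<Sum>i<N. ?lin (As i)) / real N \<le>
    (\<Sum>i<N. recourse I y (As i)) / real N"
    by (simp add: sum.distrib add_divide_distrib)
  have "(\<Sum>j<K. ?fill j * (recourse I (real_vec x) (cs j) + ?lin (cs j))) \<le> (\<Sum>j<K. ?fill j * recourse I y (cs j))"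
    using subgradient_le[OF x top_scenario y] by (intro sum_mono mult_left_mono) (auto simp: fill_def)
  also have "\<dots> \<le> shift_gain S r (real_of_rat (mhat As)) (recourse I y)" by (rule greedy_le_gain[OF y])
  finally have top: "shift_gain S r (real_of_rat (mhat As)) (recourse I (real_vec x)) +
    (\<Sum>j<K. ?fill j * ?lin (cs j))
      \<le> shift_gain S r (real_of_rat (mhat As)) (recourse I y)"
    by (simp add: gain_eq_greedy distrib_left sum.distrib)
  have "(\<Sum>k<m. real_of_rat (cost1 I $ k) * (y $ k - real_of_rat (x $ k))) = c \<bullet> y - c \<bullet> real_vec x"
    using x feas_carrier[OF y] by (auto simp: queryable_def dot_eq right_diff_distrib sum_subtractf)
  then show ?thesis
    using samples top cost_slope_dot[of "\<lambda>k. y $ k - real_of_rat (x $ k)"]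
    unfolding fhat_def of_rat_mhat[symmetric] by linarith
qed

end

end

end

section \<open>Correctness of the program\<close>

lemma expr_val_equal:
  assumes "expr_val a M = of_nat x" "expr_val b M = of_nat y"
  shows "expr_val (eq_expr a b) M = (if x = y then 1 else 0)"
proof (cases "x = y")
  case False
  define z where "z = int x - int y"
  have "1 \<le> z * z" using False by (auto simp: z_def int_one_le_iff_zero_less zero_less_mult_iff)
  then have "(1::rat) \<le> of_int (z * z)" unfolding of_int_1_le_iff .
  moreover have "of_int (z * z) = (of_nat x - of_nat y) * (of_nat x - of_nat y :: rat)" by (simp add: z_def)
  ultimately have "(1::rat) < 1 + (of_nat x - of_nat y) * (of_nat x - of_nat y)" by linarith
  then have "\<lfloor>1 / (1 + (of_nat x - of_nat y) * (of_nat x - of_nat y) :: rat)\<rfloor> = 0"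
    by (intro floor_unique) (auto simp: field_simps)
  then show ?thesis using assms False by (simp add: eq_expr_def)
qed (simp add: eq_expr_def assms)

lemma of_nat_minus_div_mult: "(of_nat j :: rat) - of_nat (j div n) * of_nat n = of_nat (j mod n)"
  by (metis add_diff_cancel_left' div_mult_mod_eq of_nat_add of_nat_mult)

lemma expr_val_bit:
  assumes "expr_val c M = of_nat z" "expr_val p M = 2 ^ i"
  shows "expr_val (bit_expr c p) M = (if i \<in> set_decode z then 1 else 0)"
proof -
  have floor: "\<lfloor>(of_nat x :: rat) / of_nat y\<rfloor> = int (x div y)" for x y by (rule floor_divide_of_nat_eq)
  have "expr_val (bit_expr c p) M = of_nat (z div 2 ^ i) - 2 * of_nat (z div 2 ^ i div 2)"
    using floor[of z "2 ^ i"] floor[of "z div 2 ^ i" 2] by (simp add: bit_expr_def assms)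
  also have "\<dots> = of_nat (z div 2 ^ i mod 2)"
    using of_nat_minus_div_mult[of "z div 2 ^ i" 2] by (simp add: mult.commute)
  finally show ?thesis by (simp add: set_decode_def odd_iff_mod_2_eq_one)
qed

context bounded_machine
begin

lemma ensures_assign_min:
  assumes "a < 60" "admissible (e1 \<^bold>- e2)" "mem_fits B L \<Longrightarrow> fits B (min (expr_val e1 L) (expr_val e2 L))"
    and "Q (set_cell a 0 (min (expr_val e1 L) (expr_val e2 L)) L)"
  shows "ensures (assign_min a e1 e2) L Q"
  unfolding assign_min_def
  by (intro draws_if_pos ensures_assign) (use assms in \<open>auto simp: admissible_def min_def split: if_splits\<close>)

lemma ensures_assign_max:
  assumes "a < 60" "admissible (e1 \<^bold>- e2)" "mem_fits B L \<Longrightarrow> fits B (max (expr_val e1 L) (expr_val e2 L))"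
    and "Q (set_cell a 0 (max (expr_val e1 L) (expr_val e2 L)) L)"
  shows "ensures (assign_max a e1 e2) L Q"
  unfolding assign_max_def
  by (intro draws_if_pos ensures_assign) (use assms in \<open>auto simp: admissible_def max_def split: if_splits\<close>)

lemma ensures_copy:
  assumes "dst < 60" "src < 60" "distinct [dst, src, col_r, input_r]" "L input_r 0 = of_nat n" "n \<le> Z"
  shows "ensures (copy_prog dst src) L (\<lambda>L'. L' dst = (\<lambda>k. if k < n then L src k else L dst k))"
proof (rule draws_mem_fits)
  assume L: "mem_fits B L"
  show ?thesis unfolding copy_prog_def
  proof (rule ensures_tabulate)
    fix j L' assume "unchanged ({dst, col_r} \<union> writes skip) L L'" "L' col_r 0 = of_nat j"
    then show "ensures skip L' (\<lambda>L''. expr_val (Cell src (Reg col_r)) L'' = L src j)"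
      using assms unchangedD[of _ L L' src] by (intro ensures_skip) auto
  qed (use assms mem_fitsD[OF L] in \<open>auto simp: loop_regs_ok_def admissible_def\<close>)
qed

lemma ensures_split_index:
  assumes "L flat_r 0 = of_nat j" "L input_r k = of_nat n" "k \<le> 1024" "j \<le> 2 ^ B"
  shows "ensures (split_index (Cell input_r (Num k))) L
    (\<lambda>L'. L' row_r 0 = of_nat (j div n) \<and> L' col_r 0 = of_nat (j mod n))"
  unfolding split_index_def
proof (intro draws_SeqI ensures_assign)
  have floor: "\<lfloor>(of_nat j :: rat) / of_nat n\<rfloor> = int (j div n)" by (rule floor_divide_of_nat_eq)
  have "j div n \<le> 2 ^ B" "j mod n \<le> 2 ^ B" using assms(4) div_le_dividend[of j n] mod_less_eq_dividend[of j n]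
    by linarith+
  then have fits: "fits B (of_nat (j div n))" "fits B (of_nat (j mod n))" by (auto intro: fits_of_nat)
  note mod = of_nat_minus_div_mult[of j n]
  let ?L = "set_cell row_r 0 (expr_val (Flr (Reg flat_r \<^bold>/ Cell input_r (Num k))) L) L"
  show "fits B (expr_val (Flr (Reg flat_r \<^bold>/ Cell input_r (Num k))) L)" using assms floor fits by simp
  show "fits B (expr_val (Reg flat_r \<^bold>- Reg row_r \<^bold>* Cell input_r (Num k)) ?L)" using assms floor fits mod by simp
  show "set_cell col_r 0 (expr_val (Reg flat_r \<^bold>- Reg row_r \<^bold>* Cell input_r (Num k)) ?L) ?L row_r 0 =
    of_nat (j div n) \<and>
      set_cell col_r 0 (expr_val (Reg flat_r \<^bold>- Reg row_r \<^bold>* Cell input_r (Num k)) ?L) ?L col_r 0 =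
        of_nat (j mod n)"
    using assms floor mod by simp
qed (use assms(3) in \<open>auto simp: admissible_def\<close>)

end

context drso_run
begin

definition inputs :: "memory \<Rightarrow> bool" where
  "inputs L \<longleftrightarrow> (\<forall>k<m. L costs_r k = cost1 I $ k) \<and> L input_r 0 = of_nat m \<and> L input_r 1 = of_nat (usize I) \<and>
    L input_r 2 = lam I \<and> L input_r 3 = radius I \<and> L input_r 4 = outer_rad I \<and> L input_r 5 = inner_rad I \<and>
    L input_r 6 = of_nat E \<and> L input_r 7 = of_nat \<Delta>"

definition codes_ready :: "memory \<Rightarrow> bool" where
  "codes_ready L \<longleftrightarrow> inputs L \<and> (\<forall>i\<le>usize I. L powers_r i = 2 ^ i) \<and> L full_code_r 0 = of_nat (set_encode U)"

definition parameters_ready :: "memory \<Rightarrow> bool" where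
  "parameters_ready L \<longleftrightarrow> codes_ready L \<and> L top_val_r 0 = top_value I \<and> L side_r 0 = of_nat R \<and>
    L grid_r 0 = of_nat D \<and>
    L cuts_r 0 = of_nat T \<and> L samples_r 0 = of_nat N \<and> L n_top_r 0 = of_nat K"

lemma inputsD:
  assumes "inputs L"
  shows "k < m \<Longrightarrow> L costs_r k = cost1 I $ k" "L input_r 0 = of_nat m" "L input_r 1 = of_nat (usize I)"
    "L input_r 2 = lam I" "L input_r 3 = radius I" "L input_r 4 = outer_rad I" "L input_r 5 = inner_rad I"
    "L input_r 6 = of_nat E" "L input_r 7 = of_nat \<Delta>" "L input_r (Suc 0) = of_nat (usize I)"
  using assms by (auto simp: inputs_def)

lemma codes_readyD:
  assumes "codes_ready L"
  shows "inputs L" "i \<le> usize I \<Longrightarrow> L powers_r i = 2 ^ i" "L full_code_r 0 = of_nat (set_encode U)"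
  using assms by (auto simp: codes_ready_def)

lemma parameters_readyD:
  assumes "parameters_ready L"
  shows "codes_ready L" "inputs L" "L top_val_r 0 = top_value I" "L side_r 0 = of_nat R" "L grid_r 0 = of_nat D"
    "L cuts_r 0 = of_nat T" "L samples_r 0 = of_nat N" "L n_top_r 0 = of_nat K"
  using assms by (auto simp: parameters_ready_def codes_ready_def)

lemma inputs_unchanged: "unchanged X L L' \<Longrightarrow> inputs L \<Longrightarrow> {costs_r, input_r} \<inter> X = {} \<Longrightarrow> inputs L'"
  by (auto simp: inputs_def unchanged_def)

lemma codes_ready_unchanged:
  "unchanged X L L' \<Longrightarrow> codes_ready L \<Longrightarrow> {costs_r, input_r, powers_r, full_code_r} \<inter> X = {} \<Longrightarrow> codes_ready L'"
  unfolding codes_ready_def using inputs_unchanged[of X L L'] by (auto simp: unchanged_def)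

lemma parameters_ready_unchanged:
  "unchanged X L L' \<Longrightarrow> parameters_ready L \<Longrightarrow>
    {costs_r, input_r, powers_r, full_code_r, top_val_r, side_r, grid_r, cuts_r, samples_r, n_top_r} \<inter> X = {} \<Longrightarrow>
    parameters_ready L'"
  unfolding parameters_ready_def using codes_ready_unchanged[of X L L'] by (auto simp: unchanged_def)

lemma fits_power_two: "i \<le> usize I \<Longrightarrow> fits B (2 ^ i)"
  using fits_of_nat[of "2 ^ i" B] dims_le(2) small_le_B(1) by (auto intro: power_increasing)

lemma fits_code: "A \<in> S \<Longrightarrow> fits B (of_nat (set_encode A))"
  using set_encode_less[of A I] power_increasing[of "usize I" B "2::nat"] dims_le(2) small_le_B(1)
  by (intro fits_of_nat) linarith

lemma m_le_Z: "m \<le> Z" and Suc_m_le_Z: "Suc m \<le> Z" and flat_le_Z: "Suc m * m \<le> Z"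
  using loop_counts(6) by (auto simp: algebra_simps intro: order_trans)

subsection \<open>Preparation\<close>

lemma ensures_powers:
  assumes "inputs L"
  shows "ensures powers_prog L (\<lambda>L'. \<forall>i\<le>usize I. L' powers_r i = 2 ^ i)"
  unfolding powers_prog_def
proof (rule draws_SeqI, rule ensures_store)
  let ?L = "set_cell powers_r (index_of (expr_val (Num 0) L)) (expr_val (Num 1) L) L"
  show "ensures (FOR bit_r < ground_e DO powers_r .[Reg bit_r \<^bold>+ Num 1] ::= Num 2 \<^bold>* Cell powers_r (Reg bit_r)) ?L
      (\<lambda>L'. \<forall>i\<le>usize I. L' powers_r i = 2 ^ i)"
  proof (rule ensures_for_below)
    fix j and L' :: memory assume "j < usize I" "L' bit_r 0 = of_nat j" "\<forall>i\<le>j. L' powers_r i = 2 ^ i"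
    then show "ensures (powers_r .[Reg bit_r \<^bold>+ Num 1] ::= Num 2 \<^bold>* Cell powers_r (Reg bit_r)) L'
        (\<lambda>L''. \<forall>i\<le>Suc j. set_cell bit_r 0 (of_nat (Suc j)) L'' powers_r i = 2 ^ i)"
      using fits_power_two[of "Suc j"] index_of_nat(1)[of "Suc j"]
      by (intro ensures_store) (auto simp: admissible_def le_Suc_eq add.commute)
  qed (use inputsD[OF assms] loop_counts in \<open>auto simp: loop_regs_ok_def\<close>)
qed (auto simp: admissible_def)

lemma ensures_full_code:
  assumes "inputs L"
  shows "ensures full_code_prog L codes_ready"
  unfolding full_code_prog_def
proof (rule draws_Seq[OF ensures_powers[OF assms]])
  fix L1 assume "unchanged (writes powers_prog) L L1" and powers: "\<forall>i\<le>usize I. L1 powers_r i = 2 ^ i"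
  then have inputs: "inputs L1" using inputs_unchanged[OF _ assms] by (simp add: powers_prog_def)
  have partial: "(\<Sum>k<j. 2 ^ k) = (of_nat (set_encode {..<j}) :: rat)" for j by (simp add: set_encode_def)
  have "ensures (sum_loop full_code_r bit_r ground_e skip (Cell powers_r (Reg bit_r))) L1
    (\<lambda>L'. L' full_code_r 0 = (\<Sum>k<usize I. 2 ^ k))"
  proof (rule ensures_sum_loop)
    fix j L' assume "j < usize I" "unchanged ({full_code_r, bit_r} \<union> writes skip) L1 L'" "L' bit_r 0 = of_nat j"
    then show "ensures skip L' (\<lambda>L''. expr_val (Cell powers_r (Reg bit_r)) L'' = 2 ^ j)"
      using powers unchangedD[of _ L1 L' powers_r] by (intro ensures_skip) auto
  next
    fix j assume "j \<le> usize I"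
    then show "fits B (\<Sum>k<j. 2 ^ k)" unfolding partial by (intro fits_code) (auto simp: scenarios_def ground_def)
  qed (use inputsD[OF inputs] loop_counts in \<open>auto simp: loop_regs_ok_def admissible_def\<close>)
  then show "ensures (sum_loop full_code_r bit_r ground_e skip (Cell powers_r (Reg bit_r))) L1 codes_ready"
  proof (rule ensures_mono)
    fix L' assume "unchanged (writes (sum_loop full_code_r bit_r ground_e skip (Cell powers_r (Reg bit_r)))) L1 L'"
      "L' full_code_r 0 = (\<Sum>k<usize I. 2 ^ k)"
    then show "codes_ready L'"
      using inputs_unchanged[OF _ inputs] unchangedD[of _ L1 L' powers_r] powers
      by (simp add: codes_ready_def partial)
  qed
qed

lemma ensures_encode:
  assumes "codes_ready L" "A \<in> S" "\<And>i. i < usize I \<Longrightarrow> L scenario_r i = (if i \<in> A then 1 else 0)"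
  shows "ensures encode_prog L (\<lambda>L'. L' code_r 0 = of_nat (set_encode A))"
  unfolding encode_prog_def set_encode_indicator[OF assms(2), symmetric]
proof (rule ensures_sum_loop)
  fix j L' assume "j < usize I" "unchanged ({code_r, bit_r} \<union> writes skip) L L'" "L' bit_r 0 = of_nat j"
  then show "ensures skip L'
    (\<lambda>L''. expr_val (Cell powers_r (Reg bit_r) \<^bold>* Cell scenario_r (Reg bit_r)) L'' =
    2 ^ j * (if j \<in> A then 1 else 0))"
    using assms(3) codes_readyD(2)[OF assms(1)] unchangedD[of _ L L'] by (intro ensures_skip) auto
next
  fix j
  have "(\<Sum>i<j. 2 ^ i * (if i \<in> A then 1 else 0)) = (of_nat (set_encode (A \<inter> {..<j})) :: rat)"
    by (simp add: set_encode_def if_distrib[of "\<lambda>x. _ * x"] sum.If_cases Int_commute cong: if_cong)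
  then show "fits B (\<Sum>i<j. 2 ^ i * (if i \<in> A then 1 else 0))"
    using assms(2) fits_code[of "A \<inter> {..<j}"] by (auto simp: scenarios_def)
qed (use inputsD[OF codes_readyD(1)[OF assms(1)]] loop_counts in \<open>auto simp: loop_regs_ok_def admissible_def\<close>)

lemma ensures_decode:
  assumes "codes_ready L" "A \<in> S" "expr_val e L = of_nat (set_encode A)"
    and e: "expr_regs e \<subseteq> {..<60}" "scenario_r \<notin> expr_regs e" "bit_r \<notin> expr_regs e" "nodes e \<le> 3" "small_nums e"
  shows "ensures (decode_prog e) L (\<lambda>L'. get_scenario scenario_r (usize I) L' = A)"
proof -
  have "ensures (decode_prog e) L
    (\<lambda>L'. L' scenario_r = (\<lambda>i. if i < usize I then if i \<in> A then 1 else 0 else L scenario_r i))"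
    unfolding decode_prog_def
  proof (rule ensures_tabulate)
    fix j L' assume j: "j < usize I" "unchanged ({scenario_r, bit_r} \<union> writes skip) L L'" "L' bit_r 0 = of_nat j"
    have "expr_val e L' = of_nat (set_encode A)"
      unfolding assms(3)[symmetric] using e j(2) by (intro expr_val_cong unchangedD[of _ L]) auto
    moreover have "expr_val (Cell powers_r (Reg bit_r)) L' = 2 ^ j"
      using j codes_readyD(2)[OF assms(1)] unchangedD[OF j(2), of powers_r] by simp
    ultimately show "ensures skip L'
      (\<lambda>L''. expr_val (bit_expr e (Cell powers_r (Reg bit_r))) L'' = (if j \<in> A then 1 else 0))"
      using scenarios_finite[OF assms(2)] by (intro ensures_skip) (simp add: expr_val_bit)
  qed (use e inputsD[OF codes_readyD(1)[OF assms(1)]] loop_counts in \<open>auto simp: loop_regs_ok_def admissible_def bit_expr_def\<close>)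
  then show ?thesis
    by (rule ensures_mono) (use assms(2) in \<open>auto simp: get_scenario_def scenarios_def ground_def\<close>)
qed

lemma R_le: "R \<le> 2 ^ (2 * isize I + 1)"
proof -
  have "fits (isize I) (of_nat (nat \<lfloor>outer_rad I\<rfloor>))" using fits_floor[OF fits_input(3)] rads(1) by simp
  then have "nat \<lfloor>outer_rad I\<rfloor> \<le> 2 ^ isize I" by (rule nat_le_of_fits)
  moreover have "m \<le> 2 ^ isize I" using dims_le(1) by (rule le_two_power)
  ultimately have "R \<le> 2 ^ isize I * (2 ^ isize I + 1)" unfolding simplex_size_def by (intro mult_mono) auto
  also have "\<dots> \<le> 2 ^ isize I * (2 ^ isize I * 2)" by (intro mult_left_mono) auto
  also have "\<dots> = 2 ^ (2 * isize I + 1)" by (simp add: power_add mult_2)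
  finally show ?thesis .
qed

lemma fits_side: "fits B (of_nat R)"
  using R_le fits_params(1) by (intro fits_mono[OF fits_of_nat[OF R_le]]) (simp add: ratio_bits_def)

lemma fits_cost_sum: "j \<le> m \<Longrightarrow> fits (m * (isize I + 1)) (\<Sum>k<j. cost1 I $ k)"
  by (rule fits_partial_sum[OF fits_cost])

lemma fits_inv_theta:
  assumes top: "fits b (top_value I)"
  shows "fits ((E + isize I) + (isize I + m * (isize I + 1) + b + 3) + (isize I + b)) (inv_theta I E)"
  unfolding inv_theta_def
proof (rule fits_divide[OF fits_mult fits_mult])
  have "fits 1 (2 :: rat)" using fits_of_nat[of 2 1] by simp
  from fits_add[OF fits_mult[OF fits_input(3) fits_cost_sum[of m]] fits_mult[OF this top]]
  show "fits (isize I + m * (isize I + 1) + b + 3) (outer_rad I * (\<Sum>k<m. cost1 I $ k) + 2 * top_value I)"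
    by (rule fits_mono) auto
qed (intro fits_mult fits_of_nat_le fits_input top order_refl)+

lemma fits_vol_ratio:
  assumes "fits b (top_value I)"
  shows "fits (ratio_bits I E b) (vol_ratio I E)"
proof -
  have "fits (m + 1) (of_nat (m + 1))" by (rule fits_of_nat_le) simp
  then show ?thesis unfolding vol_ratio_def ratio_bits_def
    by (intro fits_divide fits_mult fits_inv_theta assms fits_input fits_of_nat R_le) (simp add: add.commute)
qed

lemma log_ratio_le: "fits b (top_value I) \<Longrightarrow> log_ratio I E \<le> ratio_bits I E b"
  unfolding log_ratio_def by (rule Least_le) (rule le_of_fits[OF fits_vol_ratio])

lemma ensures_cost_sum:
  assumes "inputs L"
  shows "ensures (sum_loop cost_sum_r col_r dim_e skip (Cell costs_r (Reg col_r))) L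
    (\<lambda>L'. L' cost_sum_r 0 = (\<Sum>k<m. cost1 I $ k))"
proof (rule ensures_sum_loop)
  fix j L' assume "j < m" "unchanged ({cost_sum_r, col_r} \<union> writes skip) L L'" "L' col_r 0 = of_nat j"
  then show "ensures skip L' (\<lambda>L''. expr_val (Cell costs_r (Reg col_r)) L'' = cost1 I $ j)"
    using inputsD(1)[OF assms] unchangedD[of _ L L' costs_r] by (intro ensures_skip) auto
next
  show "fits B (\<Sum>k<j. cost1 I $ k)" if "j \<le> m" for j
    using fits_params(1) by (intro fits_mono[OF fits_cost_sum[OF that]]) (simp add: ratio_bits_def)
qed (use inputsD[OF assms] m_le_Z in \<open>auto simp: loop_regs_ok_def admissible_def\<close>)

lemma ensures_ratio:
  assumes "codes_ready L" "get_vec answer_r m L = 0\<^sub>v m"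
  shows "ensures ratio_prog L
    (\<lambda>L'. L' top_val_r 0 = top_value I \<and> L' side_r 0 = of_nat R \<and> L' ratio_r 0 = vol_ratio I E)"
  unfolding ratio_prog_def
proof (rule draws_Seq[OF ensures_decode[OF assms(1) full_scenario]], goal_cases)
  case decoded: (7 L1)
  let ?sum = "sum_loop cost_sum_r col_r dim_e skip (Cell costs_r (Reg col_r))"
  let ?L1 = "set_cell top_val_r 0 (top_value I) L1"
  have same: "unchanged {scenario_r, bit_r, top_val_r} L ?L1" using decoded(2) by (auto simp: unchanged_def)
  then have inputs: "inputs ?L1" using codes_readyD(1)[OF assms(1)] by (rule inputs_unchanged) simp
  have query: "value_orc I (get_vec answer_r m L1) (get_scenario scenario_r (usize I) L1) = top_value I"
    using unchangedD[OF same, of answer_r] assms(2) decoded(3) by (simp add: get_vec_def top_value_def)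
  show ?case
  proof (rule draws_SeqI, rule ensures_Value, goal_cases)
    case 5
    show ?case unfolding query
    proof (rule draws_Seq[OF ensures_cost_sum[OF inputs]])
      fix L2 assume L2: "unchanged (writes ?sum) ?L1 L2" "L2 cost_sum_r 0 = (\<Sum>k<m. cost1 I $ k)"
      have ready: "inputs L2" using L2(1) inputs by (rule inputs_unchanged) simp
      have top: "L2 top_val_r 0 = top_value I" using unchangedD[OF L2(1), of top_val_r] by simp
      have side: "of_nat m * (of_int \<lfloor>outer_rad I\<rfloor> + 1) = (of_nat R :: rat)" using rads(1)
        by (simp add: simplex_size_def algebra_simps)
      have theta: "of_nat E * lam I * (outer_rad I * (\<Sum>k<m. cost1 I $ k) + 2 * top_value I) /
        (radius I * top_value I) = inv_theta I E"
        by (simp add: inv_theta_def)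
      have vol: "(of_nat m + 1) * of_nat R * inv_theta I E / inner_rad I = vol_ratio I E"
        by (simp add: vol_ratio_def)
      have fits: "fits B (inv_theta I E)" "fits B (vol_ratio I E)"
        using fits_mono[OF fits_inv_theta[OF fits_top_value]] fits_mono[OF fits_vol_ratio[OF fits_top_value]]
          fits_params(1) by (auto simp: ratio_bits_def)
      show "ensures (side_r ::= dim_e \<^bold>* (Flr outer_e \<^bold>+ Num 1) ;;
          ratio_r ::= (accuracy_e \<^bold>* lam_e) \<^bold>* (outer_e \<^bold>* Reg cost_sum_r \<^bold>+ Num 2 \<^bold>* Reg top_val_r) \<^bold>/
            (radius_e \<^bold>* Reg top_val_r) ;;
          ratio_r ::= (dim_e \<^bold>+ Num 1) \<^bold>* Reg side_r \<^bold>* Reg ratio_r \<^bold>/ inner_e) L2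
        (\<lambda>L'. L' top_val_r 0 = top_value I \<and> L' side_r 0 = of_nat R \<and> L' ratio_r 0 = vol_ratio I E)"
        using inputsD[OF ready] top L2(2) side theta vol fits fits_side
        by (intro draws_SeqI ensures_assign) (simp_all add: admissible_def)
    qed
  qed (use query fits_mono[OF fits_top_value small_le_B(3)] in simp_all)
qed (use codes_readyD[OF assms(1)] in auto)

lemma ensures_log_ratio:
  assumes "L ratio_r 0 = vol_ratio I E"
  shows "ensures log_ratio_prog L (\<lambda>L'. L' log_ratio_r 0 = of_nat (log_ratio I E))"
proof -
  let ?body = "power_r ::= Num 2 \<^bold>* Reg power_r ;; log_ratio_r ::= Reg log_ratio_r \<^bold>+ Num 1"
  let ?L = "set_cell power_r 0 1 (set_cell log_ratio_r 0 0 L)"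
  let ?Inv = "\<lambda>l L'. L' log_ratio_r 0 = of_nat l \<and> L' power_r 0 = 2 ^ l"
  have "ensures (WHILE Reg ratio_r \<^bold>- Reg power_r DO ?body) ?L (?Inv (log_ratio I E))"
  proof (rule ensures_while_pos)
    show "log_ratio I E \<le> Z" using log_ratio_le[OF fits_top_value] loop_counts(1) by linarith
    fix l L' assume l: "l < log_ratio I E" and L': "unchanged (writes ?body) ?L L'" "?Inv l L'"
    have ratio: "L' ratio_r 0 = vol_ratio I E" using unchangedD[OF L'(1), of ratio_r] assms by simp
    have "Suc l \<le> B" using l log_ratio_le[OF fits_top_value] fits_params(1) by linarith
    then have "fits B (2 ^ Suc l)" "fits B (of_nat (Suc l))"
      using fits_of_nat[of "2 ^ Suc l" B] fits_of_nat_le[of "Suc l" B] power_increasing[of "Suc l" B "2::nat"]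
      by simp_all
    then have "ensures ?body L' (?Inv (Suc l))"
      using L'(2) by (intro draws_SeqI ensures_assign) (auto simp: admissible_def add.commute)
    then show "expr_val (Reg ratio_r \<^bold>- Reg power_r) L' > 0 \<and> ensures ?body L' (?Inv (Suc l))"
      using less_vol_ratio[OF l] ratio L'(2) by simp
  next
    fix L' assume "unchanged (writes ?body) ?L L'" "?Inv (log_ratio I E) L'"
    then show "\<not> expr_val (Reg ratio_r \<^bold>- Reg power_r) L' > 0"
      using unchangedD[of _ ?L L' ratio_r] assms vol_ratio_le[of I E] by simp
  qed (auto simp: admissible_def)
  then have "ensures (WHILE Reg ratio_r \<^bold>- Reg power_r DO ?body) ?L
    (\<lambda>L'. L' log_ratio_r 0 = of_nat (log_ratio I E))"
    by (rule ensures_mono) simp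
  then show ?thesis unfolding log_ratio_prog_def
    by (intro draws_SeqI ensures_assign) (simp_all add: admissible_def)
qed

lemma ensures_counts:
  assumes "inputs L" "L log_ratio_r 0 = of_nat (log_ratio I E)"
  shows "ensures counts_prog L
    (\<lambda>L'. L' grid_r 0 = of_nat D \<and> L' cuts_r 0 = of_nat T \<and> L' samples_r 0 = of_nat N \<and> L' n_top_r 0 = of_nat K)"
proof -
  have grid: "32 * (of_nat m * (of_nat m * of_nat m)) = (of_nat D :: rat)" by (simp add: grid_den_def)
  have cuts: "of_nat D * of_nat (log_ratio I E) + 1 = (of_nat T :: rat)" by (simp add: n_cuts_def)
  have log_points: "of_nat m * (of_nat T * (2 + of_nat D) + of_nat (log_ratio I E) + (of_nat m + 5)) =
    (of_nat (log_points I E) :: rat)"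
    by (simp add: log_points_def algebra_simps)
  have "0 \<le> 16 * (of_nat E * of_nat E) / (radius I * radius I * (radius I * radius I)) *
      ((of_nat (usize I) + of_nat (log_points I E)) + (2 + of_nat \<Delta>))"
    by (intro mult_nonneg_nonneg divide_nonneg_nonneg) (use radius in auto)
  then have samples: "of_int \<lfloor>16 * (of_nat E * of_nat E) / (radius I * radius I * (radius I * radius I)) *
      ((of_nat (usize I) + of_nat (log_points I E)) + (2 + of_nat \<Delta>))\<rfloor> + 1 = (of_nat N :: rat)"
    by (simp add: n_samples_def)
  have top: "of_int \<lfloor>1 / radius I\<rfloor> + 1 = (of_nat K :: rat)" using radius by (simp add: n_top_def)
  have "fits B (of_nat D)" "fits B (of_nat T)" "fits B (of_nat (log_points I E))" "fits B (of_nat N)"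
    "fits B (of_nat K)"
    using fits_params by (auto intro!: fits_of_nat_le)
  then show ?thesis unfolding counts_prog_def
    using inputsD[OF assms(1)] assms(2) grid cuts log_points samples top
    by (intro draws_SeqI ensures_assign) (simp_all add: admissible_def)
qed

lemma ensures_setup:
  assumes "inputs L" "get_vec answer_r m L = 0\<^sub>v m"
  shows "ensures setup_prog L parameters_ready"
  unfolding setup_prog_def
proof (rule draws_Seq[OF ensures_full_code[OF assms(1)]])
  fix L1 assume L1: "unchanged (writes full_code_prog) L L1" "codes_ready L1"
  have "get_vec answer_r m L1 = 0\<^sub>v m" using assms(2) unchangedD[OF L1(1), of answer_r] by (simp add: get_vec_def)
  then show "ensures (ratio_prog ;; log_ratio_prog ;; counts_prog) L1 parameters_ready"
  proof (rule draws_Seq[OF ensures_ratio[OF L1(2)]])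
    fix L2 assume L2: "unchanged (writes ratio_prog) L1 L2"
      "L2 top_val_r 0 = top_value I \<and> L2 side_r 0 = of_nat R \<and> L2 ratio_r 0 = vol_ratio I E"
    have codes2: "codes_ready L2" using L2(1) L1(2) by (rule codes_ready_unchanged) simp
    show "ensures (log_ratio_prog ;; counts_prog) L2 parameters_ready"
    proof (rule draws_Seq[OF ensures_log_ratio])
      fix L3 assume L3: "unchanged (writes log_ratio_prog) L2 L3" "L3 log_ratio_r 0 = of_nat (log_ratio I E)"
      have codes3: "codes_ready L3" using L3(1) codes2 by (rule codes_ready_unchanged) simp
      have kept: "L3 top_val_r 0 = top_value I" "L3 side_r 0 = of_nat R"
        using L2(2) unchangedD[OF L3(1), of top_val_r] unchangedD[OF L3(1), of side_r] by simp_all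
      show "ensures counts_prog L3 parameters_ready"
      proof (rule ensures_mono[OF ensures_counts[OF codes_readyD(1)[OF codes3] L3(2)]])
        fix L4 assume L4: "unchanged (writes counts_prog) L3 L4"
          "L4 grid_r 0 = of_nat D \<and> L4 cuts_r 0 = of_nat T \<and> L4 samples_r 0 = of_nat N \<and> L4 n_top_r 0 = of_nat K"
        have "codes_ready L4" using L4(1) codes3 by (rule codes_ready_unchanged) simp
        then show "parameters_ready L4"
          using L4 kept unchangedD[OF L4(1), of top_val_r] unchangedD[OF L4(1), of side_r]
          by (simp add: parameters_ready_def)
      qed
    qed (use L2(2) in simp)
  qed
qed

definition sampled :: "(nat \<Rightarrow> nat set) \<Rightarrow> nat \<Rightarrow> memory \<Rightarrow> bool" where
  "sampled As n L \<longleftrightarrow> (\<forall>j<n. L codes_r j = of_nat (set_encode (As j)))"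

lemma draws_sample:
  assumes "parameters_ready L"
  shows "draws sample_prog L (replicate_pmf N (center I)) (\<lambda>ws. sampled ((!) ws) N)"
proof -
  let ?body = "Sample scenario_r ;; encode_prog ;; codes_r .[Reg draw_r] ::= Reg code_r"
  have "draws sample_prog L (replicate_pmf N (center I)) (\<lambda>ws L'. length ws \<le> N \<longrightarrow> sampled ((!) ws) (length ws) L')"
    unfolding sample_prog_def
  proof (rule draws_for_below)
    show "finite (set_pmf (center I))" using center finite_scenarios by (rule finite_subset)
    fix ws and L' :: memory assume ws: "length ws < N" "set ws \<subseteq> set_pmf (center I)"
      and L': "unchanged (insert draw_r (writes ?body)) L L'" "L' draw_r 0 = of_nat (length ws)"
      and inv: "length ws \<le> N \<longrightarrow> sampled ((!) ws) (length ws) L'"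
    have ready: "parameters_ready L'" using L'(1) assms by (rule parameters_ready_unchanged) simp
    let ?Q = "\<lambda>A L''. length (ws @ [A]) \<le> N \<longrightarrow>
      sampled ((!) (ws @ [A])) (length (ws @ [A])) (set_cell draw_r 0 (of_nat (Suc (length ws))) L'')"
    have "draws (Sample scenario_r) L' (center I)
      (\<lambda>A L''. L'' = set_vec scenario_r (Matrix.vec (usize I) (\<lambda>i. if i \<in> A then 1 else 0)) L')"
      by (rule draws_Sample) auto
    then show "draws ?body L' (center I) ?Q"
    proof (rule draws_Seq_ensures)
      fix A L1 assume A: "A \<in> set_pmf (center I)"
        and L1: "unchanged (writes (Sample scenario_r)) L' L1"
          "L1 = set_vec scenario_r (Matrix.vec (usize I) (\<lambda>i. if i \<in> A then 1 else 0)) L'"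
      have AS: "A \<in> S" using A center by blast
      have "parameters_ready L1" using L1(1) ready by (rule parameters_ready_unchanged) simp
      then show "ensures (encode_prog ;; codes_r .[Reg draw_r] ::= Reg code_r) L1 (?Q A)"
      proof (rule draws_Seq[OF ensures_encode[OF parameters_readyD(1) AS]])
        fix L2 assume L2: "unchanged (writes encode_prog) L1 L2" "L2 code_r 0 = of_nat (set_encode A)"
        have "L2 draw_r 0 = of_nat (length ws)" "L2 codes_r = L' codes_r"
          using L'(2) unchangedD[OF L1(1)] unchangedD[OF L2(1)] by simp_all
        then show "ensures (codes_r .[Reg draw_r] ::= Reg code_r) L2 (?Q A)"
          using L2(2) inv ws(1) fits_code[OF AS]
          by (intro ensures_store) (auto simp: admissible_def sampled_def nth_append less_Suc_eq)
      qed (use L1(2) in \<open>auto simp: set_vec_def\<close>)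
    qed (use center finite_scenarios in \<open>auto intro: finite_subset\<close>)
  qed (use parameters_readyD[OF assms] loop_counts in \<open>auto simp: loop_regs_ok_def sampled_def\<close>)
  then show ?thesis
    by (rule draws_mono) (auto simp: set_replicate_pmf)
qed

end

subsection \<open>The light mass of the sample and the initial simplex\<close>

lemma sum_indicator_lessThan:
  fixes n :: nat
  shows "(\<Sum>k<n. if P k then 1 else 0) = (of_nat (card {k. k < n \<and> P k}) :: 'a::semiring_1)"
  using sum.inter_filter[of "{..<n}" "\<lambda>_. 1 :: 'a" P] by simp

lemma index_of_nat_arith [simp]:
  "index_of (of_nat i * of_nat n + of_nat k) = i * n + k" "index_of (of_nat n + 1) = Suc n"
  using index_of_nat(1)[of "i * n + k"] index_of_nat(1)[of "Suc n"] by (simp_all add: add.commute)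

context bounded_machine
begin

lemma ensures_count:
  assumes "arr < 60" "arr \<notin> {hits_r, probe_r}" "\<And>k. k < n \<Longrightarrow> L arr k = of_nat (f k)"
    and e: "expr_val e L = of_nat x" "expr_regs e \<subseteq> {..<60} - {hits_r, probe_r}" "nodes e \<le> 3" "small_nums e"
    and b: "expr_val b L = of_nat n" "n \<le> Z" "expr_regs b \<subseteq> {..<60} - {hits_r, probe_r}" "nodes b \<le> 3"
      "small_nums b"
  shows "ensures (sum_loop hits_r probe_r b skip (eq_expr (Cell arr (Reg probe_r)) e)) L
    (\<lambda>L'. L' hits_r 0 = of_nat (card {k. k < n \<and> f k = x}))"
  unfolding sum_indicator_lessThan[symmetric]
proof (rule ensures_sum_loop)
  fix j L' assume j: "j < n" "unchanged ({hits_r, probe_r} \<union> writes skip) L L'" "L' probe_r 0 = of_nat j"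
  have "expr_val (Cell arr (Reg probe_r)) L' = of_nat (f j)"
    using assms(1,2) j unchangedD[OF j(2), of arr] assms(3) by auto
  moreover have "expr_val e L' = of_nat x"
    unfolding e(1)[symmetric] using e(2) by (intro expr_val_cong unchangedD[OF j(2)]) auto
  ultimately show "ensures skip L'
    (\<lambda>L''. expr_val (eq_expr (Cell arr (Reg probe_r)) e) L'' = (if f j = x then 1 else 0))"
    by (intro ensures_skip) (simp add: expr_val_equal)
next
  fix j assume "j \<le> n"
  moreover have "card {k. k < j \<and> f k = x} \<le> card {..<j}" by (intro card_mono) auto
  ultimately show "fits B (\<Sum>k<j. if f k = x then 1 else 0)"
    unfolding sum_indicator_lessThan using b(2) by (intro fits_counter) simp
qed (use assms in \<open>auto simp: loop_regs_ok_def admissible_def eq_expr_def\<close>)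

end

context drso_run
begin

lemma fits_mass_term: "fits (isize I + N) (min (1 / of_nat N) (radius I / of_nat (card {j. j < N \<and> As j = As i})))"
proof -
  have "fits (0 + N) (1 / of_nat N)" by (intro fits_divide fits_of_nat_le) auto
  moreover have "card {j. j < N \<and> As j = As i} \<le> card {..<N}" by (rule card_mono) auto
  then have "fits (isize I + N) (radius I / of_nat (card {j. j < N \<and> As j = As i}))"
    by (intro fits_divide fits_input fits_of_nat_le) simp
  ultimately show ?thesis by (auto simp: min_def intro: fits_mono)
qed

lemma fits_partial_mass:
  "j \<le> N \<Longrightarrow> fits (N * (isize I + N + 1))
    (\<Sum>i<j. min (1 / of_nat N) (radius I / of_nat (card {j. j < N \<and> As j = As i})))"
  by (rule fits_partial_sum[OF fits_mass_term])

lemma mass_term_bits: "isize I + N \<le> weight_bits I E \<Delta>"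
proof -
  have "1 * (isize I + N + 1) \<le> N * (isize I + N + 1)" using N_pos by (intro mult_right_mono) auto
  then show ?thesis by (simp add: weight_bits_def)
qed

lemma fits_mhat: "fits (N * (isize I + N + 1)) (mhat As)"
  unfolding empirical_light_mass_def by (rule fits_partial_mass) simp

lemma set_encode_eq_iff: "A \<in> S \<Longrightarrow> A' \<in> S \<Longrightarrow> set_encode A = set_encode A' \<longleftrightarrow> A = A'"
  using set_encode_eq[of A A'] scenarios_finite by blast

lemma ensures_mass:
  assumes ready: "parameters_ready L" and As: "sampled As N L" "\<And>j. j < N \<Longrightarrow> As j \<in> S"
  shows "ensures mass_prog L (\<lambda>L'. L' mass_r 0 = mhat As)"
  unfolding mass_prog_def empirical_light_mass_def
proof (rule ensures_sum_loop)
  let ?hits = "sum_loop hits_r probe_r (Reg samples_r) skip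
    (eq_expr (Cell codes_r (Reg probe_r)) (Cell codes_r (Reg row_r)))"
  let ?min = "assign_min weight_r (Num 1 \<^bold>/ Reg samples_r) (radius_e \<^bold>/ Reg hits_r)"
  fix i L' assume i: "i < N" "unchanged ({mass_r, row_r} \<union> writes (?hits ;; ?min)) L L'" "L' row_r 0 = of_nat i"
  let ?n = "card {k. k < N \<and> As k = As i}"
  have ready': "parameters_ready L'" using i(2) ready by (rule parameters_ready_unchanged) simp
  have codes: "L' codes_r k = of_nat (set_encode (As k))" if "k < N" for k
    using As(1) that unchangedD[OF i(2), of codes_r] by (simp add: sampled_def)
  have hits: "{k. k < N \<and> set_encode (As k) = set_encode (As i)} = {k. k < N \<and> As k = As i}"
    using set_encode_eq_iff As(2) i(1) by blast
  have weight: "fits B (min (1 / of_nat N) (radius I / of_nat ?n))"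
    by (rule fits_mono[OF fits_mass_term]) (use mass_term_bits fits_params(3) in linarith)
  show "ensures (?hits ;; ?min) L' (\<lambda>L''. expr_val (Reg weight_r) L'' = min (1 / of_nat N) (radius I / of_nat ?n))"
  proof (rule draws_Seq[OF ensures_count[where arr = codes_r and f = "\<lambda>k. set_encode (As k)" and x = "set_encode (As i)" and n = N]])
    fix L'' assume L'': "unchanged (writes ?hits) L' L''"
      "L'' hits_r 0 = of_nat (card {k. k < N \<and> set_encode (As k) = set_encode (As i)})"
    have "parameters_ready L''" using L''(1) ready' by (rule parameters_ready_unchanged) simp
    from parameters_readyD[OF this]
      show "ensures ?min L'' (\<lambda>L''. expr_val (Reg weight_r) L'' = min (1 / of_nat N) (radius I / of_nat ?n))"
      using L''(2) weight hits inputsD[of L''] by (intro ensures_assign_min) (auto simp: admissible_def)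
  qed (use codes i parameters_readyD[OF ready'] loop_counts in auto)
next
  fix j assume "j \<le> N"
  then show "fits B (\<Sum>i<j. min (1 / of_nat N) (radius I / of_nat (card {j. j < N \<and> As j = As i})))"
    using fits_params(3) by (intro fits_mono[OF fits_partial_mass]) (auto simp: weight_bits_def)
qed (use parameters_readyD[OF ready] loop_counts in \<open>auto simp: loop_regs_ok_def admissible_def\<close>)

definition vertex :: "memory \<Rightarrow> nat \<Rightarrow> nat \<Rightarrow> rat" where
  "vertex L i k = L vertices_r (i * m + k)"

lemma expr_val_vertex:
  assumes "inputs L" "expr_val a L = of_nat i" "expr_val b L = of_nat k"
  shows "expr_val (vertex_expr a b) L = vertex L i k"
  using inputsD[OF assms(1)] assms(2,3) by (simp add: vertex_expr_def vertex_def)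

lemma vertex_unchanged: "unchanged X L L' \<Longrightarrow> vertices_r \<notin> X \<Longrightarrow> vertex L' = vertex L"
  using unchangedD[of X L L' vertices_r] by (simp add: vertex_def fun_eq_iff)

lemma flat_index:
  assumes "i \<le> m" "k < m"
  shows "i * m + k < Suc m * m" "(i * m + k) div m = i" "(i * m + k) mod m = k"
proof -
  have "i * m + k < Suc i * m" using assms(2) by simp
  also have "\<dots> \<le> Suc m * m" using assms(1) by (intro mult_right_mono) auto
  finally show "i * m + k < Suc m * m" .
qed (use assms in auto)

lemma flat_index_inverse:
  assumes "n < Suc m * m"
  shows "n div m \<le> m" "n mod m < m"
proof -
  have "0 < m" using assms by (cases m) auto
  then show "n div m \<le> m" "n mod m < m" using less_mult_imp_div_less[OF assms] by auto
qed

lemma ensures_tabulate_vertices: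
  assumes "inputs L" and fits: "\<And>i k. i \<le> m \<Longrightarrow> k < m \<Longrightarrow> fits B (f i k)" and e: "admissible e"
    and step: "\<And>i k L'. i \<le> m \<Longrightarrow> k < m \<Longrightarrow> inputs L' \<Longrightarrow> unchanged {vertices_r, flat_r, row_r, col_r} L L' \<Longrightarrow>
      L' flat_r 0 = of_nat (i * m + k) \<Longrightarrow> L' row_r 0 = of_nat i \<Longrightarrow> L' col_r 0 = of_nat k \<Longrightarrow>
      (\<And>i' k'. i' \<le> m \<Longrightarrow> k' < m \<Longrightarrow> vertex L' i' k' = (if i' * m + k' < i * m + k then f i' k' else vertex L i' k')) \<Longrightarrow>
      expr_val e L' = f i k"
  shows "ensures (tabulate vertices_r flat_r ((dim_e \<^bold>+ Num 1) \<^bold>* dim_e) (split_index dim_e) e) L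
    (\<lambda>L'. \<forall>i\<le>m. \<forall>k<m. vertex L' i k = f i k)"
proof -
  have "ensures (tabulate vertices_r flat_r ((dim_e \<^bold>+ Num 1) \<^bold>* dim_e) (split_index dim_e) e) L
    (\<lambda>L'. L' vertices_r = (\<lambda>n. if n < Suc m * m then f (n div m) (n mod m) else L vertices_r n))"
  proof (rule ensures_tabulate)
    fix n and L' :: memory assume n: "n < Suc m * m"
      and L': "unchanged ({vertices_r, flat_r} \<union> writes (split_index dim_e)) L L'" "L' flat_r 0 = of_nat n"
      and done_part: "L' vertices_r = (\<lambda>i. if i < n then f (i div m) (i mod m) else L vertices_r i)"
    have ik: "n div m \<le> m" "n mod m < m" "n = n div m * m + n mod m" using flat_index_inverse[OF n] by simp_all
    have inputs: "inputs L'" using L'(1) assms(1) by (rule inputs_unchanged) simp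
    have "n \<le> 2 ^ B" using n flat_le_Z Z_le by linarith
    then have "ensures (split_index dim_e) L'
      (\<lambda>L''. L'' row_r 0 = of_nat (n div m) \<and> L'' col_r 0 = of_nat (n mod m))"
      using inputsD(2)[OF inputs] L'(2) by (intro ensures_split_index) simp_all
    then show "ensures (split_index dim_e) L' (\<lambda>L''. expr_val e L'' = f (n div m) (n mod m))"
    proof (rule ensures_mono, goal_cases)
      case split: (1 L'')
      show ?case
      proof (rule step[OF ik(1,2)])
        show "inputs L''" using split(2) inputs by (rule inputs_unchanged) simp
        show "unchanged {vertices_r, flat_r, row_r, col_r} L L''"
          using unchanged_trans[OF L'(1) split(2)] by (rule unchanged_mono) auto
        fix i' k' assume "i' \<le> m" "k' < m"
        then show "vertex L'' i' k' = (if i' * m + k' < n div m * m + n mod m then f i' k' else vertex L i' k')"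
          using done_part ik(3) flat_index vertex_unchanged[OF split(2)] by (simp add: vertex_def)
      qed (use split L'(2) ik(3) unchangedD[OF split(2), of flat_r] in auto)
    qed
  qed (use inputsD[OF assms(1)] fits[OF flat_index_inverse] e flat_le_Z in \<open>auto simp: loop_regs_ok_def distrib_right\<close>)
  then show ?thesis by (rule ensures_mono) (use flat_index in \<open>auto simp: vertex_def\<close>)
qed

lemma fits_double_top: "fits (OT + 1) (2 * top_value I)"
  using fits_mult[OF fits_of_nat[of 2 1] fits_top_value] by (simp add: add.commute)

lemma ensures_init:
  assumes "parameters_ready L"
  shows "ensures init_prog L
    (\<lambda>L'. (\<forall>i\<le>m. \<forall>k<m. vertex L' i k = (if i = Suc k then of_nat R else 0)) \<and> L' best_cost_r 0 = 2 * top_value I)"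
  unfolding init_prog_def
proof (rule draws_Seq[OF ensures_tabulate_vertices[where f = "\<lambda>i k. if i = Suc k then of_nat R else 0"]])
  let ?e = "Reg side_r \<^bold>* eq_expr (Reg row_r) (Reg col_r \<^bold>+ Num 1)"
  let ?tab = "tabulate vertices_r flat_r ((dim_e \<^bold>+ Num 1) \<^bold>* dim_e) (split_index dim_e) ?e"
  fix L' assume L': "unchanged (writes ?tab) L L'"
    "\<forall>i\<le>m. \<forall>k<m. vertex L' i k = (if i = Suc k then of_nat R else 0)"
  have "parameters_ready L'" using L'(1) assms by (rule parameters_ready_unchanged) simp
  moreover have "fits B (2 * top_value I)"
    by (rule fits_mono[OF fits_double_top]) (use fits_params(1) in \<open>simp add: ratio_bits_def\<close>)
  ultimately show "ensures (best_cost_r ::= Num 2 \<^bold>* Reg top_val_r) L'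
      (\<lambda>L'. (\<forall>i\<le>m. \<forall>k<m. vertex L' i k = (if i = Suc k then of_nat R else 0)) \<and>
        L' best_cost_r 0 = 2 * top_value I)"
    using L'(2) parameters_readyD[of L'] by (intro ensures_assign) (auto simp: admissible_def vertex_def)
next
  fix i k L' assume "unchanged {vertices_r, flat_r, row_r, col_r} L L'" "L' row_r 0 = of_nat i"
    "L' col_r 0 = of_nat k"
  moreover from this have "expr_val (eq_expr (Reg row_r) (Reg col_r \<^bold>+ Num 1)) L' = (if i = Suc k then 1 else 0)"
    by (intro expr_val_equal) auto
  ultimately show "expr_val (Reg side_r \<^bold>* eq_expr (Reg row_r) (Reg col_r \<^bold>+ Num 1)) L' =
    (if i = Suc k then of_nat R else 0)"
    using parameters_readyD[OF assms] unchangedD[of _ L L' side_r] by simp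
qed (use parameters_readyD[OF assms] fits_side in \<open>auto simp: admissible_def eq_expr_def\<close>)

subsection \<open>Query points\<close>

definition points :: "rat Matrix.vec set" where
  "points = {x \<in> carrier_vec m. \<forall>k<m. on_grid D T (Suc m * R) (x $ k * of_nat (Suc m))}"

lemma D_pos: "k < m \<Longrightarrow> 0 < D"
  by (simp add: grid_den_def)

lemma fits_vertex:
  assumes "0 < m" "on_grid D t R q" "t \<le> T"
  shows "fits (vertex_bits I E) q"
  using fits_on_grid[OF D_pos[OF assms(1)] assms(3) R_le assms(2)] by (simp add: vertex_bits_def)

lemma fits_grid_sum:
  assumes "0 < m" "on_grid D t b q" "t \<le> T" "b \<le> Suc m * R"
  shows "fits (T * D + 2 * T + ((2 * isize I + 1) + (m + 1))) q"
proof (rule fits_on_grid[OF D_pos[OF assms(1)] assms(3) _ assms(2)])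
  have "Suc m * R \<le> 2 ^ (m + 1) * 2 ^ (2 * isize I + 1)" using R_le le_two_power[of "Suc m" "m + 1"]
    by (intro mult_mono) auto
  then show "b \<le> 2 ^ ((2 * isize I + 1) + (m + 1))" using assms(4) by (simp add: power_add mult_ac)
qed

lemma fits_point:
  assumes "x \<in> points" "k < m"
  shows "fits (point_bits I E) (x $ k)"
proof -
  have "on_grid D T (Suc m * R) (x $ k * of_nat (Suc m))" using assms by (simp add: points_def)
  then have "fits (T * D + 2 * T + ((2 * isize I + 1) + (m + 1))) (x $ k * of_nat (Suc m))"
    using assms(2) by (intro fits_grid_sum) auto
  moreover have "fits (m + 1) (of_nat (Suc m))" by (intro fits_of_nat_le) simp
  ultimately have "fits (point_bits I E) (x $ k * of_nat (Suc m) / of_nat (Suc m))"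
    unfolding point_bits_def by (rule fits_divide)
  then show ?thesis by (simp del: of_nat_Suc)
qed

lemma on_grid_0: "on_grid D' t b 0"
  by (rule on_gridI[of _ 0]) auto

lemma zero_point: "0\<^sub>v m \<in> points"
  by (simp add: points_def on_grid_0)

context
  fixes v :: "nat \<Rightarrow> nat \<Rightarrow> rat" and t :: nat
  assumes t: "t \<le> T" and v: "\<And>i k. i \<le> m \<Longrightarrow> k < m \<Longrightarrow> on_grid D t R (v i k)"
begin

lemma on_grid_partial_centroid: "j \<le> Suc m \<Longrightarrow> k < m \<Longrightarrow> on_grid D t (j * R) (\<Sum>i<j. v i k)"
  using v by (intro on_grid_sum) auto

lemma fits_partial_centroid: "j \<le> Suc m \<Longrightarrow> k < m \<Longrightarrow>
  fits (T * D + 2 * T + ((2 * isize I + 1) + (m + 1))) (\<Sum>i<j. v i k)"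
  by (rule fits_grid_sum[OF _ on_grid_partial_centroid t mult_right_mono]) auto

lemma centroid_in_points:
  assumes "x \<in> carrier_vec m" "\<And>k. k < m \<Longrightarrow> x $ k = centroid m v k"
  shows "x \<in> points"
  unfolding points_def
proof (intro CollectI conjI allI impI assms(1))
  fix k assume k: "k < m"
  have "x $ k * of_nat (Suc m) = (\<Sum>i<Suc m. v i k)"
    using assms(2)[OF k] by (simp add: centroid_def lessThan_Suc_atMost add.commute)
  then show "on_grid D T (Suc m * R) (x $ k * of_nat (Suc m))"
    using on_grid_refine[OF on_grid_partial_centroid[OF order_refl k] t D_pos[OF k]] by simp
qed

end

lemma ensures_centroid:
  assumes inputs: "inputs L" and v: "t \<le> T" "\<And>i k. i \<le> m \<Longrightarrow> k < m \<Longrightarrow> on_grid D t R (vertex L i k)"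
  shows "ensures centroid_prog L
    (\<lambda>L'. (\<forall>k<m. L' point_r k = centroid m (vertex L) k) \<and> get_vec point_r m L' \<in> points)"
proof -
  let ?sum = "sum_loop acc_r row_r (dim_e \<^bold>+ Num 1) skip (vertex_expr (Reg row_r) (Reg col_r))"
  have "ensures centroid_prog L (\<lambda>L'. L' point_r = (\<lambda>k. if k < m then centroid m (vertex L) k else L point_r k))"
    unfolding centroid_prog_def
  proof (rule ensures_tabulate)
    fix k L' assume k: "k < m" "unchanged ({point_r, col_r} \<union> writes ?sum) L L'" "L' col_r 0 = of_nat k"
    have inputs': "inputs L'" using k(2) inputs by (rule inputs_unchanged) simp
    have "ensures ?sum L' (\<lambda>L''. L'' acc_r 0 = (\<Sum>i<Suc m. vertex L i k))"
    proof (rule ensures_sum_loop)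
      fix i L'' assume i: "i < Suc m" "unchanged ({acc_r, row_r} \<union> writes skip) L' L''" "L'' row_r 0 = of_nat i"
      have "inputs L''" using i(2) inputs' by (rule inputs_unchanged) simp
      then show "ensures skip L'' (\<lambda>L''. expr_val (vertex_expr (Reg row_r) (Reg col_r)) L'' = vertex L i k)"
        using i k unchangedD[OF i(2), of col_r] vertex_unchanged[OF i(2)] vertex_unchanged[OF k(2)]
        by (intro ensures_skip) (simp add: expr_val_vertex)
    next
      show "fits B (\<Sum>i<j. vertex L i k)" if "j \<le> Suc m" for j
        using fits_params(2) by (intro fits_mono[OF fits_partial_centroid[OF v that k(1)]])
          (auto simp: point_bits_def)
    qed (use inputsD[OF inputs'] Suc_m_le_Z in \<open>auto simp: loop_regs_ok_def admissible_def vertex_expr_def\<close>)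
    then show "ensures ?sum L' (\<lambda>L''. expr_val (Reg acc_r \<^bold>/ (dim_e \<^bold>+ Num 1)) L'' = centroid m (vertex L) k)"
    proof (rule ensures_mono)
      fix L'' assume L'': "unchanged (writes ?sum) L' L''" "L'' acc_r 0 = (\<Sum>i<Suc m. vertex L i k)"
      have "inputs L''" using L''(1) inputs' by (rule inputs_unchanged) simp
      then show "expr_val (Reg acc_r \<^bold>/ (dim_e \<^bold>+ Num 1)) L'' = centroid m (vertex L) k"
        using L''(2) inputsD[of L''] by (simp add: centroid_def lessThan_Suc_atMost)
    qed
  next
    fix k assume "k < m"
    moreover have "Matrix.vec m (centroid m (vertex L)) \<in> points" by (rule centroid_in_points[OF v]) auto
    ultimately show "fits B (centroid m (vertex L) k)" using fits_point fits_params(2) fits_mono by fastforce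
  qed (use inputsD[OF inputs] m_le_Z in \<open>auto simp: loop_regs_ok_def admissible_def\<close>)
  then show ?thesis
    by (rule ensures_mono) (auto intro!: centroid_in_points[OF v] simp: get_vec_def)
qed

subsection \<open>The greedy choice of expensive scenarios\<close>

definition tops :: "(nat \<Rightarrow> nat set) \<Rightarrow> nat \<Rightarrow> memory \<Rightarrow> bool" where
  "tops cs n L \<longleftrightarrow> (\<forall>j<n. L tops_r j = of_nat (set_encode (cs j)) \<and> cs j \<in> S)"

definition best_recorded :: "nat set set \<Rightarrow> rat Matrix.vec \<Rightarrow> memory \<Rightarrow> bool" where
  "best_recorded C x L \<longleftrightarrow> (\<exists>A\<in>S. L best_code_r 0 = of_nat (set_encode A) \<and>
    best_of C (value_orc I x) A (L best_val_r 0))"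

lemma tops_unchanged: "unchanged X L L' \<Longrightarrow> tops_r \<notin> X \<Longrightarrow> tops cs n L \<Longrightarrow> tops cs n L'"
  using unchangedD[of X L L' tops_r] by (simp add: tops_def)

lemma best_recorded_unchanged:
  "unchanged X L L' \<Longrightarrow> best_code_r \<notin> X \<Longrightarrow> best_val_r \<notin> X \<Longrightarrow> best_recorded C x L \<Longrightarrow> best_recorded C x L'"
  using unchangedD[of X L L' best_code_r] unchangedD[of X L L' best_val_r] by (simp add: best_recorded_def)

lemma point_unchanged: "unchanged X L L' \<Longrightarrow> point_r \<notin> X \<Longrightarrow> get_vec point_r m L' = get_vec point_r m L"
  using unchangedD[of X L L' point_r] by (simp add: get_vec_def)

lemma ensures_child:
  assumes ready: "parameters_ready L" and L: "tops cs (Suc k) L" "L flat_r 0 = of_nat n" "n < Suc k * usize I"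
    and k: "k < K"
  defines "A \<equiv> cs (n div usize I) - {n mod usize I}"
  shows "A \<in> S" "ensures child_prog L (\<lambda>L'. L' child_r 0 = of_nat (set_encode A))"
proof -
  let ?P = "cs (n div usize I)" and ?e = "n mod usize I"
  have "0 < usize I" using L(3) by (cases "usize I") auto
  then have range: "n div usize I \<le> k" "?e < usize I" using less_mult_imp_div_less[OF L(3)] by auto
  then have P: "?P \<in> S" using L(1) by (simp add: tops_def)
  then have finite: "finite ?P" by (rule scenarios_finite)
  from P show A: "A \<in> S" by (auto simp: A_def scenarios_def)
  have "Suc k * usize I \<le> K * usize I" using k by (intro mult_right_mono) auto
  then have "n \<le> 2 ^ B" using L(3) loop_counts(5) Z_le by linarith
  then have "ensures (split_index ground_e) L (\<lambda>L'. L' row_r 0 = of_nat (n div usize I) \<and> L' col_r 0 = of_nat ?e)"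
    using L(2) inputsD[OF parameters_readyD(2)[OF ready]] by (intro ensures_split_index) simp_all
  then show "ensures child_prog L (\<lambda>L'. L' child_r 0 = of_nat (set_encode A))"
    unfolding child_prog_def
  proof (rule draws_Seq)
    fix L' assume L': "unchanged (writes (split_index ground_e)) L L'"
      "L' row_r 0 = of_nat (n div usize I) \<and> L' col_r 0 = of_nat ?e"
    have "codes_ready L'" using L'(1) parameters_readyD(1)[OF ready] by (rule codes_ready_unchanged) simp
    then have power: "expr_val (Cell powers_r (Reg col_r)) L' = 2 ^ ?e" using L'(2) range codes_readyD(2) by simp
    have top: "expr_val (Cell tops_r (Reg row_r)) L' = of_nat (set_encode ?P)"
      using L'(2) L(1) unchangedD[OF L'(1), of tops_r] range by (simp add: tops_def)
    let ?child = "Cell tops_r (Reg row_r) \<^bold>- Cell powers_r (Reg col_r) \<^bold>* bit_expr (Cell tops_r (Reg row_r))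
      (Cell powers_r (Reg col_r))"
    have "expr_val ?child L' = of_nat (set_encode A)"
      using top power expr_val_bit[OF top power] set_encode_remove[OF finite, of ?e] finite by (simp add: A_def)
    then show "ensures (child_r ::= ?child) L' (\<lambda>L'. L' child_r 0 = of_nat (set_encode A))"
      using fits_code[OF A] by (intro ensures_assign) (auto simp: admissible_def bit_expr_def)
  qed
qed

lemma ensures_compare:
  assumes ready: "parameters_ready L" and x: "queryable x" "get_vec point_r m L = x"
    and A: "A \<in> S" "L child_r 0 = of_nat (set_encode A)" and best: "best_recorded C x L"
  shows "ensures compare_prog L (best_recorded (insert A C) x)"
  unfolding compare_prog_def
proof (rule draws_Seq[OF ensures_decode[OF parameters_readyD(1)[OF ready] A(1)]], goal_cases)
  case decoded: (7 L')
  have recorded: "best_recorded C x L'" using decoded(2) by (rule best_recorded_unchanged) (use best in simp_all)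
  have child: "L' child_r 0 = of_nat (set_encode A)" using unchangedD[OF decoded(2), of child_r] A(2) by simp
  have query: "value_orc I (get_vec point_r m L') (get_scenario scenario_r (usize I) L') = value_orc I x A"
    using point_unchanged[OF decoded(2)] x(2) decoded(3) by simp
  have fits: "fits B (value_orc I x A)" using value_oracle(2)[OF x(1) A(1)] small_le_B(3) by (rule fits_mono)
  obtain A' where A': "A' \<in> S" "L' best_code_r 0 = of_nat (set_encode A')"
    "best_of C (value_orc I x) A' (L' best_val_r 0)"
    using recorded by (auto simp: best_recorded_def)
  have insert: "best_recorded (insert A C) x M" if
    "M best_code_r 0 = of_nat (set_encode (if L' best_val_r 0 < value_orc I x A then A else A'))"
    "M best_val_r 0 = (if L' best_val_r 0 < value_orc I x A then value_orc I x A else L' best_val_r 0)" for M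
    unfolding best_recorded_def using that best_of_insert[OF A'(3) value_oracle_nonneg[OF x(1) A(1)]] A(1) A'(1)
    by (intro bexI[of _ "if L' best_val_r 0 < value_orc I x A then A else A'"]) auto
  show ?case
    by (intro draws_SeqI ensures_Value draws_if_pos ensures_assign ensures_skip insert)
      (use query fits fits_code[OF A(1)] child A'(2) in \<open>auto simp: admissible_def\<close>)
qed (use A(2) in auto)

lemma ensures_compare_fresh:
  assumes ready: "parameters_ready L" and x: "queryable x" "get_vec point_r m L = x"
    and A: "A \<in> S" "A = cs (n div usize I) - {n mod usize I}"
    and cs: "\<And>j. j \<le> k \<Longrightarrow> cs j \<in> S" and best: "best_recorded (candidates cs (usize I) k n) x L"
    and child: "L child_r 0 = of_nat (set_encode A)"
    and hits: "L hits_r 0 = of_nat (card {j. j < Suc k \<and> set_encode (cs j) = set_encode A})"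
  shows "ensures (IF Reg hits_r THEN skip ELSE compare_prog) L
    (best_recorded (candidates cs (usize I) k (Suc n)) x)"
proof (rule draws_if_pos)
  have "{j. j < Suc k \<and> set_encode (cs j) = set_encode A} = {j. j < Suc k \<and> cs j = A}"
    using set_encode_eq_iff[OF cs A(1)] by auto
  then have found: "expr_val (Reg hits_r) L > 0 \<longleftrightarrow> A \<in> cs ` {..k}"
    using hits by (auto simp: card_gt_0_iff less_Suc_eq_le)
  show "ensures skip L (best_recorded (candidates cs (usize I) k (Suc n)) x)" if "expr_val (Reg hits_r) L > 0"
    using that found best by (intro ensures_skip) (simp add: candidates_Suc flip: A(2))
  assume "\<not> expr_val (Reg hits_r) L > 0"
  then have "candidates cs (usize I) k (Suc n) = insert A (candidates cs (usize I) k n)"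
    using found by (simp add: candidates_Suc flip: A(2))
  then show "ensures compare_prog L (best_recorded (candidates cs (usize I) k (Suc n)) x)"
    using ensures_compare[OF ready x A(1) child best] by simp
qed (auto simp: admissible_def)

lemma ensures_candidate:
  assumes ready: "parameters_ready L" and x: "queryable x" "get_vec point_r m L = x"
    and tops: "tops cs (Suc k) L" "L chosen_r 0 = of_nat k" "k < K"
    and n: "L flat_r 0 = of_nat n" "n < Suc k * usize I"
    and best: "best_recorded (candidates cs (usize I) k n) x L"
  shows "ensures candidate_prog L (best_recorded (candidates cs (usize I) k (Suc n)) x)"
  unfolding candidate_prog_def
proof (rule draws_Seq[OF ensures_child(2)[OF ready tops(1) n tops(3)]])
  define A where "A = cs (n div usize I) - {n mod usize I}"
  let ?hits = "sum_loop hits_r probe_r (Reg chosen_r \<^bold>+ Num 1) skip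
    (eq_expr (Cell tops_r (Reg probe_r)) (Reg child_r))"
  let ?Q = "best_recorded (candidates cs (usize I) k (Suc n)) x"
  have A: "A \<in> S" unfolding A_def by (rule ensures_child(1)[OF ready tops(1) n tops(3)])
  have cs: "cs j \<in> S" if "j \<le> k" for j using tops(1) that by (simp add: tops_def)
  fix L1 assume L1: "unchanged (writes child_prog) L L1"
    "L1 child_r 0 = of_nat (set_encode (cs (n div usize I) - {n mod usize I}))"
  then have same: "unchanged {row_r, col_r, child_r} L L1" by (auto simp: unchanged_def)
  show "ensures (?hits ;; IF Reg hits_r THEN skip ELSE compare_prog) L1 ?Q"
  proof (rule draws_Seq[OF ensures_count[where n = "Suc k" and f = "\<lambda>j. set_encode (cs j)" and x = "set_encode A"]])
    fix L2 assume L2: "unchanged (writes ?hits) L1 L2"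
      "L2 hits_r 0 = of_nat (card {j. j < Suc k \<and> set_encode (cs j) = set_encode A})"
    have same2: "unchanged {row_r, col_r, child_r, hits_r, probe_r} L L2" using same L2(1)
      by (auto simp: unchanged_def)
    show "ensures (IF Reg hits_r THEN skip ELSE compare_prog) L2 ?Q"
    proof (rule ensures_compare_fresh[where L = L2 and A = A and cs = cs and n = n and k = k, OF _ x(1) _ A A_def _ _ _ L2(2)])
      show "parameters_ready L2" using same2 ready by (rule parameters_ready_unchanged) simp
      show "get_vec point_r m L2 = x" using point_unchanged[OF same2] x(2) by simp
      show "best_recorded (candidates cs (usize I) k n) x L2" using best_recorded_unchanged[OF same2] best by simp
      show "L2 child_r 0 = of_nat (set_encode A)" using L1(2) unchangedD[OF L2(1), of child_r] by (simp add: A_def)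
    qed (rule cs)
  qed (use L1(2) tops unchangedD[OF same, of tops_r] unchangedD[OF same, of chosen_r] loop_counts(4) in \<open>auto simp: tops_def A_def\<close>)
qed

lemma ensures_search:
  assumes ready: "parameters_ready L" and x: "queryable x" "get_vec point_r m L = x"
    and tops: "tops cs (Suc k) L" "L chosen_r 0 = of_nat k" "k < K"
    and best: "L best_code_r 0 = 0" "L best_val_r 0 = -1"
  shows "ensures (FOR flat_r < (Reg chosen_r \<^bold>+ Num 1) \<^bold>* ground_e DO candidate_prog) L
    (best_recorded (candidates cs (usize I) k (Suc k * usize I)) x)"
proof (rule ensures_for_below)
  show "best_recorded (candidates cs (usize I) k 0) x (set_cell flat_r 0 0 L)"
    using best unfolding best_recorded_def
    by (intro bexI[of _ "{}"]) (auto simp: candidates_0 best_of_def scenarios_def)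
  have "Suc k * usize I \<le> K * usize I" using tops(3) by (intro mult_right_mono) auto
  then show "Suc k * usize I \<le> Z" using loop_counts(5) by linarith
  fix n L' assume n: "n < Suc k * usize I"
    and L': "unchanged (insert flat_r (writes candidate_prog)) L L'" "L' flat_r 0 = of_nat n"
    and recorded: "best_recorded (candidates cs (usize I) k n) x L'"
  have "parameters_ready L'" using L'(1) ready by (rule parameters_ready_unchanged) simp
  moreover have "get_vec point_r m L' = x" using point_unchanged[OF L'(1)] x(2) by simp
  moreover have "tops cs (Suc k) L'" using tops_unchanged[OF L'(1)] tops(1) by simp
  moreover have "L' chosen_r 0 = of_nat k" using unchangedD[OF L'(1), of chosen_r] tops(2) by simp
  ultimately have "ensures candidate_prog L' (best_recorded (candidates cs (usize I) k (Suc n)) x)"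
    using x(1) tops(3) L'(2) n recorded by (intro ensures_candidate) auto
  then show "ensures candidate_prog L'
    (\<lambda>L''. best_recorded (candidates cs (usize I) k (Suc n)) x (set_cell flat_r 0 (of_nat (Suc n)) L''))"
    by (rule ensures_mono) (simp add: best_recorded_def)
qed (use tops(2) inputsD[OF parameters_readyD(2)[OF ready]] in \<open>auto simp: loop_regs_ok_def algebra_simps\<close>)

lemma ensures_extend:
  assumes ready: "parameters_ready L" and x: "queryable x" "get_vec point_r m L = x"
    and cs: "top_seq S (value_orc I x) (Suc k) cs" "cs 0 = U" "tops cs (Suc k) L"
    and k: "L chosen_r 0 = of_nat k" "Suc k < K"
  shows "ensures (best_code_r ::= Num 0 ;; best_val_r ::= Num 0 \<^bold>- Num 1 ;;
      FOR flat_r < (Reg chosen_r \<^bold>+ Num 1) \<^bold>* ground_e DO candidate_prog ;;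
        tops_r .[Reg chosen_r \<^bold>+ Num 1] ::= Reg best_code_r) L
    (\<lambda>L'. \<exists>cs. top_seq S (value_orc I x) (Suc (Suc k)) cs \<and> cs 0 = U \<and>
      tops cs (Suc (Suc k)) (set_cell chosen_r 0 (of_nat (Suc k)) L'))"
    (is "ensures _ _ ?Q")
proof -
  let ?L = "set_cell best_val_r 0 (-1) (set_cell best_code_r 0 0 L)"
  let ?search = "FOR flat_r < (Reg chosen_r \<^bold>+ Num 1) \<^bold>* ground_e DO candidate_prog"
  have same: "unchanged {best_code_r, best_val_r} L ?L" by (auto simp: unchanged_def)
  have "ensures ?search ?L (best_recorded (candidates cs (usize I) k (Suc k * usize I)) x)"
  proof (rule ensures_search[OF _ x(1)])
    show "parameters_ready ?L" using same ready by (rule parameters_ready_unchanged) simp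
    show "get_vec point_r m ?L = x" using point_unchanged[OF same] x(2) by simp
    show "tops cs (Suc k) ?L" using tops_unchanged[OF same] cs(3) by simp
  qed (use k in simp_all)
  then have "ensures (?search ;; tops_r .[Reg chosen_r \<^bold>+ Num 1] ::= Reg best_code_r) ?L ?Q"
  proof (rule draws_Seq)
    fix L' assume L': "unchanged (writes ?search) ?L L'"
      "best_recorded (candidates cs (usize I) k (Suc k * usize I)) x L'"
    then obtain A where A: "A \<in> S" "L' best_code_r 0 = of_nat (set_encode A)"
      "best_of (candidates cs (usize I) k (Suc k * usize I)) (value_orc I x) A (L' best_val_r 0)"
      by (auto simp: best_recorded_def)
    have "L' tops_r = L tops_r" "L' chosen_r 0 = of_nat k"
      using unchangedD[OF L'(1), of tops_r] unchangedD[OF L'(1), of chosen_r] k(1) by simp_all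
    then have "tops (cs(Suc k := A)) (Suc (Suc k))
      (set_cell chosen_r 0 (of_nat (Suc k)) (set_cell tops_r (Suc k) (L' best_code_r 0) L'))"
      using cs(3) A(1,2) by (auto simp: tops_def less_Suc_eq)
    then have "?Q (set_cell tops_r (Suc k) (L' best_code_r 0) L')"
      using top_seq_extend(2)[OF cs(1,2) value_oracle_mono[OF x(1)] A(3)] cs(2)
      by (intro exI[of _ "cs(Suc k := A)"]) auto
    then show "ensures (tops_r .[Reg chosen_r \<^bold>+ Num 1] ::= Reg best_code_r) L' ?Q"
      using A(2) fits_code[OF A(1)] \<open>L' chosen_r 0 = of_nat k\<close> by (intro ensures_store) (auto simp: admissible_def)
  qed
  then show ?thesis by (intro draws_SeqI[OF ensures_assign]) (auto simp: admissible_def fits_minus)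
qed

lemma ensures_greedy:
  assumes ready: "parameters_ready L" and x: "queryable x" "get_vec point_r m L = x"
  shows "ensures greedy_prog L (\<lambda>L'. \<exists>cs. top_seq S (value_orc I x) K cs \<and> tops cs K L')"
proof -
  let ?g = "value_orc I x" and ?L = "set_cell tops_r 0 (of_nat (set_encode U)) L"
  let ?search = "FOR flat_r < (Reg chosen_r \<^bold>+ Num 1) \<^bold>* ground_e DO candidate_prog"
  let ?extend = "best_code_r ::= Num 0 ;; best_val_r ::= Num 0 \<^bold>- Num 1 ;; ?search ;;
    tops_r .[Reg chosen_r \<^bold>+ Num 1] ::= Reg best_code_r"
  let ?Inv = "\<lambda>k L. \<exists>cs. top_seq S ?g (Suc k) cs \<and> cs 0 = U \<and> tops cs (Suc k) L"
  have "ensures (FOR chosen_r < Reg n_top_r \<^bold>- Num 1 DO ?extend) ?L (?Inv (K - 1))"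
  proof (rule ensures_for_below[where Inv = ?Inv and N = "K - 1"])
    show "?Inv 0 (set_cell chosen_r 0 0 ?L)"
      using top_seq_full[of I ?g] value_oracle_mono[OF x(1)] full_scenario[of I] by (auto simp: tops_def)
    fix k and L' :: memory assume k: "k < K - 1"
      and L': "unchanged (insert chosen_r (writes ?extend)) ?L L'" "L' chosen_r 0 = of_nat k"
      and "?Inv k L'"
    then obtain cs where cs: "top_seq S ?g (Suc k) cs" "cs 0 = U" "tops cs (Suc k) L'" by blast
    have "unchanged (insert tops_r (insert chosen_r (writes ?extend))) L L'" using L'(1)
      by (auto simp: unchanged_def)
    then have "parameters_ready L'" "get_vec point_r m L' = x"
      using parameters_ready_unchanged[OF _ ready] point_unchanged x(2) by simp_all
    then show "ensures ?extend L' (\<lambda>L''. ?Inv (Suc k) (set_cell chosen_r 0 (of_nat (Suc k)) L''))"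
      using ensures_extend[OF _ x(1) _ cs L'(2)] k by simp
  qed (use parameters_readyD[OF ready] K_pos loop_counts(4) in \<open>auto simp: loop_regs_ok_def of_nat_diff\<close>)
  then have "ensures (FOR chosen_r < Reg n_top_r \<^bold>- Num 1 DO ?extend) ?L
    (\<lambda>L'. \<exists>cs. top_seq S ?g K cs \<and> tops cs K L')"
    by (rule ensures_mono) (use K_pos in auto)
  then show ?thesis
    unfolding greedy_prog_def using parameters_readyD[OF ready] codes_readyD fits_code[OF full_scenario]
    by (intro draws_SeqI[OF ensures_store]) (auto simp: admissible_def)
qed

subsection \<open>Evaluating the objective\<close>

lemma ensures_add_term:
  assumes ready: "parameters_ready L" and x: "queryable x" "get_vec point_r m L = x"
    and A: "src \<in> {codes_r, tops_r}" "L term_r 0 = of_nat i" "L src i = of_nat (set_encode A)" "A \<in> S"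
  defines "w \<equiv> L weight_r 0"
  assumes fits: "fits B (L cost_r 0 + w * value_orc I x A)"
    "\<And>k. k < m \<Longrightarrow> fits B (L normal_r k + w * subgrad_orc I x A $ k)"
  shows "ensures (add_term_prog src) L (\<lambda>L'. L' cost_r 0 = L cost_r 0 + w * value_orc I x A \<and>
    (\<forall>k<m. L' normal_r k = L normal_r k + w * subgrad_orc I x A $ k))"
  unfolding add_term_prog_def
proof (rule draws_Seq[OF ensures_decode[OF parameters_readyD(1)[OF ready] A(4)]], goal_cases)
  case decoded: (7 L1)
  let ?tab = "tabulate normal_r col_r dim_e skip
    (Cell normal_r (Reg col_r) \<^bold>+ Reg weight_r \<^bold>* Cell subgrad_r (Reg col_r))"
  let ?g = "value_orc I x A" and ?d = "subgrad_orc I x A"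
  let ?L2 = "set_vec subgrad_r ?d (set_cell val_r 0 ?g L1)"
  let ?L3 = "set_cell cost_r 0 (L cost_r 0 + w * ?g) ?L2"
  have query: "get_vec point_r m L1 = x" using point_unchanged[OF decoded(2)] x(2) by simp
  note same = unchangedD[OF decoded(2)]
  have "inputs L1" using decoded(2) parameters_readyD(2)[OF ready] by (rule inputs_unchanged) simp
  moreover have "unchanged {val_r, subgrad_r, cost_r} L1 ?L3" by (auto simp: unchanged_def set_vec_def)
  ultimately have inputs: "inputs ?L3" using inputs_unchanged by simp
  have "ensures ?tab ?L3 (\<lambda>L'. L' normal_r = (\<lambda>k. if k < m then L normal_r k + w * ?d $ k else ?L3 normal_r k))"
  proof (rule ensures_tabulate)
    fix k and L' :: memory assume "k < m" "unchanged ({normal_r, col_r} \<union> writes skip) ?L3 L'"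
      "L' col_r 0 = of_nat k"
      "L' normal_r = (\<lambda>j. if j < k then L normal_r j + w * ?d $ j else ?L3 normal_r j)"
    then show "ensures skip L'
      (\<lambda>L''. expr_val (Cell normal_r (Reg col_r) \<^bold>+ Reg weight_r \<^bold>* Cell subgrad_r (Reg col_r)) L'' =
      L normal_r k + w * ?d $ k)"
      using unchangedD[of _ ?L3 L'] same subgradient_oracle(2)[OF x(1) A(4)]
      by (intro ensures_skip) (auto simp: set_vec_def w_def)
  qed (use inputsD[OF inputs] m_le_Z fits(2) in \<open>auto simp: loop_regs_ok_def admissible_def\<close>)
  then have "ensures ?tab ?L3
    (\<lambda>L'. L' cost_r 0 = L cost_r 0 + w * ?g \<and> (\<forall>k<m. L' normal_r k = L normal_r k + w * ?d $ k))"
    by (rule ensures_mono) (auto dest: unchangedD[of _ _ _ cost_r])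
  then show ?case
    using decoded(3) query fits(1) same value_oracle(2)[OF x(1) A(4)] subgradient_oracle(2,3)[OF x(1) A(4)]
      fits_mono[OF _ small_le_B(3)]
    by (intro draws_SeqI[OF ensures_Value] draws_SeqI[OF ensures_Subgrad] draws_SeqI[OF ensures_assign])
      (auto simp: admissible_def get_vec_def get_scenario_def set_vec_def w_def)
qed (use A in auto)

lemma ensures_accumulate:
  assumes ready: "parameters_ready L" and x: "queryable x" "get_vec point_r m L = x"
    and n: "a \<in> {samples_r, n_top_r}" "L a 0 = of_nat n" "n \<le> Z"
    and Bs: "src \<in> {codes_r, tops_r}" "\<And>i. i < n \<Longrightarrow> L src i = of_nat (set_encode (Bs i)) \<and> Bs i \<in> S"
    and weigh: "\<And>b. b < 60 \<Longrightarrow> b \<in> writes weigh \<longleftrightarrow> b = weight_r"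
      "\<And>i L'. i < n \<Longrightarrow> parameters_ready L' \<Longrightarrow> L' mass_r = L mass_r \<Longrightarrow> L' term_r 0 = of_nat i \<Longrightarrow>
        ensures weigh L' (\<lambda>L'. L' weight_r 0 = w i)"
  defines "value_upto j \<equiv> L cost_r 0 + (\<Sum>i<j. w i * value_orc I x (Bs i))"
    and "slope j k \<equiv> L normal_r k + (\<Sum>i<j. w i * subgrad_orc I x (Bs i) $ k)"
  assumes fits: "\<And>j. j \<le> n \<Longrightarrow> fits B (value_upto j)" "\<And>j k. j \<le> n \<Longrightarrow> k < m \<Longrightarrow> fits B (slope j k)"
  shows "ensures (accumulate_prog (Reg a) src weigh) L
    (\<lambda>L'. L' cost_r 0 = value_upto n \<and> (\<forall>k<m. L' normal_r k = slope n k))"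
  unfolding accumulate_prog_def
proof (rule ensures_for_below[where Inv = "\<lambda>j L'. L' cost_r 0 = value_upto j \<and> (\<forall>k<m. L' normal_r k = slope j k)" and N = n])
  let ?body = "weigh ;; add_term_prog src"
  fix j L' assume j: "j < n" and L': "unchanged (insert term_r (writes ?body)) L L'" "L' term_r 0 = of_nat j"
    and inv: "L' cost_r 0 = value_upto j \<and> (\<forall>k<m. L' normal_r k = slope j k)"
  have ready': "parameters_ready L'" using L'(1) ready by (rule parameters_ready_unchanged) (simp add: weigh(1))
  have "ensures weigh L' (\<lambda>L'. L' weight_r 0 = w j)"
    using unchangedD[OF L'(1), of mass_r] by (intro weigh(2)[OF j ready' _ L'(2)]) (simp add: weigh(1))
  then show "ensures ?body L' (\<lambda>L''. set_cell term_r 0 (of_nat (Suc j)) L'' cost_r 0 = value_upto (Suc j) \<and>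
      (\<forall>k<m. set_cell term_r 0 (of_nat (Suc j)) L'' normal_r k = slope (Suc j) k))"
  proof (rule draws_Seq)
    fix L1 assume L1: "unchanged (writes weigh) L' L1" "L1 weight_r 0 = w j"
    have kept: "L1 term_r = L' term_r" "L1 src = L src" "L1 cost_r = L' cost_r" "L1 normal_r = L' normal_r"
      using Bs(1) unchangedD[OF L1(1)] unchangedD[OF L'(1), of src] weigh(1) by auto
    have "parameters_ready L1" using L1(1) ready' by (rule parameters_ready_unchanged) (simp add: weigh(1))
    moreover have "get_vec point_r m L1 = x"
      using point_unchanged[OF L1(1)] point_unchanged[OF L'(1)] x(2) by (simp add: weigh(1))
    ultimately have "ensures (add_term_prog src) L1
      (\<lambda>L''. L'' cost_r 0 = L1 cost_r 0 + L1 weight_r 0 * value_orc I x (Bs j) \<and>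
        (\<forall>k<m. L'' normal_r k = L1 normal_r k + L1 weight_r 0 * subgrad_orc I x (Bs j) $ k))"
      using fits(1)[of "Suc j"] fits(2)[of "Suc j"] Bs(2)[OF j] j L'(2) L1(2) inv kept
      by (intro ensures_add_term[OF _ x(1) _ Bs(1)]) (auto simp: value_upto_def slope_def add.assoc)
    then show "ensures (add_term_prog src) L1
      (\<lambda>L''. set_cell term_r 0 (of_nat (Suc j)) L'' cost_r 0 = value_upto (Suc j) \<and>
        (\<forall>k<m. set_cell term_r 0 (of_nat (Suc j)) L'' normal_r k = slope (Suc j) k))"
      by (rule ensures_mono) (use L1(2) inv kept in \<open>auto simp: value_upto_def slope_def add.assoc\<close>)
  qed
qed (use n weigh(1) in \<open>auto simp: loop_regs_ok_def value_upto_def slope_def\<close>)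

lemma fits_fill: "k < K \<Longrightarrow> fits (weight_bits I E \<Delta>) (min (radius I) (mhat As - of_nat k * radius I))"
  and fits_fill_max: "k < K \<Longrightarrow> fits (weight_bits I E \<Delta>) (fill (radius I) (mhat As) k)"
proof -
  assume "k < K"
  then have "fits K (of_nat k)" by (intro fits_of_nat_le) simp
  from fits_diff[OF fits_mhat fits_mult[OF this fits_input(2)]]
  have "fits (weight_bits I E \<Delta>) (mhat As - of_nat k * radius I)" by (rule fits_mono) (simp add: weight_bits_def)
  moreover have "fits (weight_bits I E \<Delta>) (radius I)"
    by (rule fits_mono[OF fits_input(2)]) (simp add: weight_bits_def)
  ultimately show "fits (weight_bits I E \<Delta>) (min (radius I) (mhat As - of_nat k * radius I))"
    "fits (weight_bits I E \<Delta>) (fill (radius I) (mhat As) k)" by (auto simp: fill_def min_def max_def)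
qed

lemma fits_sample_weight: "fits (weight_bits I E \<Delta>) (1 / of_nat N)"
proof (rule fits_mono[OF fits_divide[OF fits_1[of 0] fits_of_nat_le[of N N]]])
  show "0 + N \<le> weight_bits I E \<Delta>" using mass_term_bits by linarith
qed simp

lemma ensures_fill:
  assumes "parameters_ready L" "L mass_r 0 = mhat As" "L term_r 0 = of_nat k" "k < K"
  shows "ensures fill_prog L (\<lambda>L'. L' weight_r 0 = fill (radius I) (mhat As) k)"
proof -
  let ?w = "min (radius I) (mhat As - of_nat k * radius I)"
  have "ensures (assign_max weight_r (Num 0) (Reg weight_r)) (set_cell weight_r 0 ?w L)
    (\<lambda>L'. L' weight_r 0 = fill (radius I) (mhat As) k)"
    using fits_mono[OF fits_fill_max[OF assms(4)] fits_params(3)]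
    by (intro ensures_assign_max) (auto simp: admissible_def fill_def)
  then show ?thesis unfolding fill_prog_def
    using assms inputsD[OF parameters_readyD(2)[OF assms(1)]] fits_mono[OF fits_fill[OF assms(4)] fits_params(3)]
    by (intro draws_SeqI[OF ensures_assign_min]) (auto simp: admissible_def)
qed

lemma fits_weighted_sum:
  assumes "\<And>i. i < n \<Longrightarrow> fits (weight_bits I E \<Delta>) (w i)" "\<And>i. i < n \<Longrightarrow> fits OT (q i)" "j \<le> n"
  shows "fits (n * (weight_bits I E \<Delta> + OT + 1)) (\<Sum>i<j. w i * q i)"
  by (rule fits_partial_sum[OF fits_mult assms(3)]) (use assms in auto)

lemma fits_base_cost:
  assumes "x \<in> points" "j \<le> m"
  shows "fits (m * (isize I + point_bits I E + 1)) (\<Sum>k<j. cost1 I $ k * x $ k)"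
  by (rule fits_partial_sum[OF fits_mult assms(2)]) (use fits_cost fits_point[OF assms(1)] in auto)

context
  fixes As cs :: "nat \<Rightarrow> nat set" and x :: "rat Matrix.vec"
  assumes As: "\<And>j. j < N \<Longrightarrow> As j \<in> S" and cs: "\<And>j. j < K \<Longrightarrow> cs j \<in> S" and x: "queryable x" "x \<in> points"
begin

lemma fits_samples_sum:
  assumes "\<And>A. A \<in> S \<Longrightarrow> fits OT (q A)" "fits b y" "j \<le> N"
  shows "fits (b + N * (weight_bits I E \<Delta> + OT + 1) + 1) (y + (\<Sum>i<j. 1 / of_nat N * q (As i)))"
  using assms As fits_sample_weight by (intro fits_add fits_weighted_sum) auto

lemma fits_top_sum:
  assumes "\<And>A. A \<in> S \<Longrightarrow> fits OT (q A)" "fits b y" "j \<le> K"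
  shows "fits (b + K * (weight_bits I E \<Delta> + OT + 1) + 1) (y + (\<Sum>i<j. fill (radius I) (mhat As) i * q (cs i)))"
  using assms cs fits_fill_max by (intro fits_add fits_weighted_sum) auto

lemma fits_cost_partial:
  "j \<le> N \<Longrightarrow> fits B ((\<Sum>k<m. cost1 I $ k * x $ k) + (\<Sum>i<j. 1 / of_nat N * value_orc I x (As i)))"
  "j \<le> K \<Longrightarrow> fits B ((\<Sum>k<m. cost1 I $ k * x $ k) + (\<Sum>i<N. 1 / of_nat N * value_orc I x (As i)) +
    (\<Sum>i<j. fill (radius I) (mhat As) i * value_orc I x (cs i)))"
proof -
  have val: "A \<in> S \<Longrightarrow> fits OT (value_orc I x A)" for A using value_oracle(2)[OF x(1)] .
  note samples = fits_samples_sum[where q = "value_orc I x", OF val fits_base_cost[OF x(2) order_refl]]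
  from fits_params(4) show "j \<le> N \<Longrightarrow>
    fits B ((\<Sum>k<m. cost1 I $ k * x $ k) + (\<Sum>i<j. 1 / of_nat N * value_orc I x (As i)))"
    by (intro fits_mono[OF samples]) (simp_all add: term_bits_def)
  from fits_params(4) show "j \<le> K \<Longrightarrow>
    fits B ((\<Sum>k<m. cost1 I $ k * x $ k) + (\<Sum>i<N. 1 / of_nat N * value_orc I x (As i)) +
      (\<Sum>i<j. fill (radius I) (mhat As) i * value_orc I x (cs i)))"
    by (intro fits_mono[OF fits_top_sum[where q = "value_orc I x", OF val samples[OF _ order_refl]]]) (simp_all add: term_bits_def)
qed

lemma fits_slope_partial:
  assumes "k < m"
  shows "j \<le> N \<Longrightarrow> fits (normal_bits I E \<Delta> OT) (cost1 I $ k + (\<Sum>i<j. 1 / of_nat N * subgrad_orc I x (As i) $ k))"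
    "j \<le> K \<Longrightarrow> fits (normal_bits I E \<Delta> OT) (cost1 I $ k + (\<Sum>i<N. 1 / of_nat N * subgrad_orc I x (As i) $ k) +
      (\<Sum>i<j. fill (radius I) (mhat As) i * subgrad_orc I x (cs i) $ k))"
proof -
  have sub: "A \<in> S \<Longrightarrow> fits OT (subgrad_orc I x A $ k)" for A using subgradient_oracle(3)[OF x(1) _ assms] .
  note samples = fits_samples_sum[where q = "\<lambda>A. subgrad_orc I x A $ k", OF sub fits_cost[OF assms]]
  show "j \<le> N \<Longrightarrow> fits (normal_bits I E \<Delta> OT) (cost1 I $ k + (\<Sum>i<j. 1 / of_nat N * subgrad_orc I x (As i) $ k))"
    by (intro fits_mono[OF samples]) (simp_all add: term_bits_def normal_bits_def)
  show "j \<le> K \<Longrightarrow> fits (normal_bits I E \<Delta> OT) (cost1 I $ k + (\<Sum>i<N. 1 / of_nat N * subgrad_orc I x (As i) $ k) +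
      (\<Sum>i<j. fill (radius I) (mhat As) i * subgrad_orc I x (cs i) $ k))"
    by (intro fits_mono[OF fits_top_sum[where q = "\<lambda>A. subgrad_orc I x A $ k", OF sub samples[OF _ order_refl]]])
      (simp_all add: term_bits_def normal_bits_def)
qed

lemma fits_cost_slope: "k < m \<Longrightarrow> fits (normal_bits I E \<Delta> OT) (cost_slope As cs x k)"
  unfolding cost_slope_def by (rule fits_slope_partial) auto

lemma ensures_base_cost:
  assumes "inputs L" "get_vec point_r m L = x"
  shows "ensures (sum_loop cost_r col_r dim_e skip (Cell costs_r (Reg col_r) \<^bold>* Cell point_r (Reg col_r))) L
    (\<lambda>L'. L' cost_r 0 = (\<Sum>k<m. cost1 I $ k * x $ k))"
proof (rule ensures_sum_loop)
  fix j L' assume "j < m" "unchanged ({cost_r, col_r} \<union> writes skip) L L'" "L' col_r 0 = of_nat j"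
  then show "ensures skip L'
    (\<lambda>L''. expr_val (Cell costs_r (Reg col_r) \<^bold>* Cell point_r (Reg col_r)) L'' = cost1 I $ j * x $ j)"
    using inputsD(1)[OF assms(1)] assms(2) unchangedD[of _ L L'] by (intro ensures_skip) (auto simp: get_vec_def)
next
  show "fits B (\<Sum>k<j. cost1 I $ k * x $ k)" if "j \<le> m" for j
    using fits_params(4) by (intro fits_mono[OF fits_base_cost[OF x(2) that]]) simp
qed (use inputsD[OF assms(1)] m_le_Z in \<open>auto simp: loop_regs_ok_def admissible_def\<close>)

lemma ensures_add_samples:
  assumes ready: "parameters_ready L" and point: "get_vec point_r m L = x" and sample: "sampled As N L"
    and start: "L cost_r 0 = (\<Sum>k<m. cost1 I $ k * x $ k)" "\<And>k. k < m \<Longrightarrow> L normal_r k = cost1 I $ k"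
  shows "ensures (accumulate_prog (Reg samples_r) codes_r (weight_r ::= Num 1 \<^bold>/ Reg samples_r)) L
    (\<lambda>L'. L' cost_r 0 = (\<Sum>k<m. cost1 I $ k * x $ k) + (\<Sum>i<N. 1 / of_nat N * value_orc I x (As i)) \<and>
      (\<forall>k<m. L' normal_r k = cost1 I $ k + (\<Sum>i<N. 1 / of_nat N * subgrad_orc I x (As i) $ k)))"
proof (rule ensures_mono[OF ensures_accumulate[where n = N and Bs = As and w = "\<lambda>_. 1 / of_nat N" and L = L and x = x]])
  show "ensures (weight_r ::= Num 1 \<^bold>/ Reg samples_r) L' (\<lambda>L'. L' weight_r 0 = 1 / of_nat N)"
    if "parameters_ready L'" for L'
    using parameters_readyD[OF that] fits_mono[OF fits_sample_weight fits_params(3)]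
    by (intro ensures_assign) (auto simp: admissible_def)
  show "L codes_r i = of_nat (set_encode (As i)) \<and> As i \<in> S" if "i < N" for i using that sample As
    by (simp add: sampled_def)
qed (use ready x(1) point parameters_readyD[OF ready] loop_counts start fits_cost_partial(1)
    fits_mono[OF fits_slope_partial(1) fits_params(5)] in auto)

lemma ensures_add_tops:
  assumes ready: "parameters_ready L" and point: "get_vec point_r m L = x" and mass: "L mass_r 0 = mhat As"
    and tops: "tops cs K L"
    and start: "L cost_r 0 = (\<Sum>k<m. cost1 I $ k * x $ k) + (\<Sum>i<N. 1 / of_nat N * value_orc I x (As i))"
      "\<And>k. k < m \<Longrightarrow> L normal_r k = cost1 I $ k + (\<Sum>i<N. 1 / of_nat N * subgrad_orc I x (As i) $ k)"
  shows "ensures (accumulate_prog (Reg n_top_r) tops_r fill_prog) L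
    (\<lambda>L'. L' cost_r 0 = cost_value As cs x \<and> (\<forall>k<m. L' normal_r k = cost_slope As cs x k))"
proof (rule ensures_mono[OF ensures_accumulate[where n = K and Bs = cs and w = "fill (radius I) (mhat As)" and L = L and x = x]])
  show "ensures fill_prog L' (\<lambda>L'. L' weight_r 0 = fill (radius I) (mhat As) i)"
    if "i < K" "parameters_ready L'" "L' mass_r = L mass_r" "L' term_r 0 = of_nat i" for i L'
    using that mass by (intro ensures_fill) simp_all
  show "L tops_r i = of_nat (set_encode (cs i)) \<and> cs i \<in> S" if "i < K" for i using that tops
    by (simp add: tops_def)
qed (use ready x(1) point parameters_readyD[OF ready] loop_counts start fits_cost_partial(2)
    fits_mono[OF fits_slope_partial(2) fits_params(5)] in \<open>auto simp: cost_value_def cost_slope_def\<close>)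

lemma ensures_objective:
  assumes ready: "parameters_ready L" and point: "get_vec point_r m L = x"
    and sample: "sampled As N L" "L mass_r 0 = mhat As" and tops: "tops cs K L"
  shows "ensures objective_prog L
    (\<lambda>L'. L' cost_r 0 = cost_value As cs x \<and> (\<forall>k<m. L' normal_r k = cost_slope As cs x k))"
    (is "ensures _ _ ?Q")
  unfolding objective_prog_def
proof (rule draws_Seq[OF ensures_base_cost[OF parameters_readyD(2)[OF ready] point]])
  let ?base = "sum_loop cost_r col_r dim_e skip (Cell costs_r (Reg col_r) \<^bold>* Cell point_r (Reg col_r))"
  let ?samples = "accumulate_prog (Reg samples_r) codes_r (weight_r ::= Num 1 \<^bold>/ Reg samples_r)"
  let ?tops = "accumulate_prog (Reg n_top_r) tops_r fill_prog"
  have kept: "parameters_ready L' \<and> get_vec point_r m L' = x \<and> sampled As N L' \<and> L' mass_r 0 = mhat As \<and>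
    tops cs K L'"
    if "unchanged (writes objective_prog) L L'" for L'
    using parameters_ready_unchanged[OF that ready] point_unchanged[OF that] point sample tops
      unchangedD[OF that, of codes_r] unchangedD[OF that, of mass_r] unchangedD[OF that, of tops_r]
    by (simp add: sampled_def tops_def)
  fix L1 assume L1: "unchanged (writes ?base) L L1" "L1 cost_r 0 = (\<Sum>k<m. cost1 I $ k * x $ k)"
  have same1: "unchanged (writes objective_prog) L L1"
    by (rule unchanged_mono[OF L1(1)]) (auto simp: objective_prog_def)
  have inputs1: "inputs L1" using kept[OF same1] parameters_readyD(2) by blast
  show "ensures (copy_prog normal_r costs_r ;; ?samples ;; ?tops) L1 ?Q"
  proof (rule draws_Seq[OF ensures_copy[where n = m]])
    fix L2 assume L2: "unchanged (writes (copy_prog normal_r costs_r)) L1 L2"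
      "L2 normal_r = (\<lambda>k. if k < m then L1 costs_r k else L1 normal_r k)"
    have same2: "unchanged (writes objective_prog) L L2"
      by (rule unchanged_mono[OF unchanged_trans[OF same1 L2(1)]]) (auto simp: objective_prog_def)
    have start: "L2 cost_r 0 = (\<Sum>k<m. cost1 I $ k * x $ k)" "\<And>k. k < m \<Longrightarrow> L2 normal_r k = cost1 I $ k"
      using L1(2) L2(2) unchangedD[OF L2(1), of cost_r] inputsD(1)[OF inputs1] by auto
    show "ensures (?samples ;; ?tops) L2 ?Q"
    proof (rule draws_Seq[OF ensures_add_samples])
      fix L3 assume L3: "unchanged (writes ?samples) L2 L3"
        "L3 cost_r 0 = (\<Sum>k<m. cost1 I $ k * x $ k) + (\<Sum>i<N. 1 / of_nat N * value_orc I x (As i)) \<and>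
          (\<forall>k<m. L3 normal_r k = cost1 I $ k + (\<Sum>i<N. 1 / of_nat N * subgrad_orc I x (As i) $ k))"
      have "unchanged (writes objective_prog) L L3"
        by (rule unchanged_mono[OF unchanged_trans[OF same2 L3(1)]]) (auto simp: objective_prog_def)
      from kept[OF this] show "ensures ?tops L3 ?Q" using L3(2) by (intro ensures_add_tops) auto
    qed (use kept[OF same2] start in auto)
  qed (use inputsD[OF inputs1] m_le_Z in auto)
qed

end

lemma ensures_record:
  assumes "inputs L"
  shows "ensures record_prog L (\<lambda>L'. L' best_cost_r 0 = min (L best_cost_r 0) (L cost_r 0) \<and>
    get_vec answer_r m L' = (if L cost_r 0 < L best_cost_r 0 then get_vec point_r m L else get_vec answer_r m L))"
  unfolding record_prog_def
proof (rule draws_mem_fits, rule draws_if_pos)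
  assume L: "mem_fits B L" "expr_val (Reg best_cost_r \<^bold>- Reg cost_r) L > 0"
  let ?L = "set_cell best_cost_r 0 (L cost_r 0) L"
  have "unchanged {best_cost_r} L ?L" by (auto simp: unchanged_def)
  then have "inputs ?L" using assms by (rule inputs_unchanged) simp
  then have "ensures (copy_prog answer_r point_r) ?L
    (\<lambda>L'. L' answer_r = (\<lambda>k. if k < m then ?L point_r k else ?L answer_r k))"
    using m_le_Z by (intro ensures_copy inputsD(2)) auto
  then have "ensures (copy_prog answer_r point_r) ?L (\<lambda>L'. L' best_cost_r 0 = min (L best_cost_r 0) (L cost_r 0) \<and>
      get_vec answer_r m L' = (if L cost_r 0 < L best_cost_r 0 then get_vec point_r m L else get_vec answer_r m L))"
    by (rule ensures_mono) (use L(2) in \<open>auto simp: get_vec_def dest: unchangedD[of _ _ _ best_cost_r]\<close>)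
  then show "ensures (best_cost_r ::= Reg cost_r ;; copy_prog answer_r point_r) L
    (\<lambda>L'. L' best_cost_r 0 = min (L best_cost_r 0) (L cost_r 0) \<and>
      get_vec answer_r m L' = (if L cost_r 0 < L best_cost_r 0 then get_vec point_r m L else get_vec answer_r m L))"
    using mem_fitsD[OF L(1)] by (intro draws_SeqI[OF ensures_assign]) (auto simp: admissible_def)
qed (auto simp: admissible_def intro!: ensures_skip)

subsection \<open>Cutting the simplex\<close>

lemma ensures_heights:
  assumes inputs: "inputs L" and point: "get_vec point_r m L \<in> points"
    and normal: "\<And>k. k < m \<Longrightarrow> fits (normal_bits I E \<Delta> OT) (L normal_r k)"
    and v: "t \<le> T" "\<And>i k. i \<le> m \<Longrightarrow> k < m \<Longrightarrow> on_grid D t R (vertex L i k)"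
  shows "ensures heights_prog L (\<lambda>L'. \<forall>i\<le>m. L' heights_r i = height m (vertex L) (L point_r) (L normal_r) i)"
proof -
  let ?e = "Cell normal_r (Reg col_r) \<^bold>* (vertex_expr (Reg row_r) (Reg col_r) \<^bold>- Cell point_r (Reg col_r))"
  let ?term = "\<lambda>i k. L normal_r k * (vertex L i k - L point_r k)"
  have partial: "fits B (\<Sum>k<j. ?term i k)" if "i \<le> m" "j \<le> m" for i j
  proof (rule fits_mono[OF fits_partial_sum[OF fits_mult[OF _ fits_diff] that(2)] fits_params(6)])
    fix k assume k: "k < m"
    show "fits (normal_bits I E \<Delta> OT) (L normal_r k)" by (rule normal[OF k])
    show "fits (vertex_bits I E) (vertex L i k)" using fits_vertex[OF _ v(2)[OF that(1) k] v(1)] k by simp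
    show "fits (point_bits I E) (L point_r k)" using fits_point[OF point k] k by (simp add: get_vec_def)
  qed
  have "ensures heights_prog L
    (\<lambda>L'. L' heights_r = (\<lambda>i. if i < Suc m then height m (vertex L) (L point_r) (L normal_r) i else L heights_r i))"
    unfolding heights_prog_def height_def
  proof (rule ensures_tabulate)
    fix i L' assume i: "i < Suc m"
      "unchanged ({heights_r, row_r} \<union> writes (sum_loop acc_r col_r dim_e skip ?e)) L L'" "L' row_r 0 = of_nat i"
    have inputs': "inputs L'" using i(2) inputs by (rule inputs_unchanged) simp
    have "ensures (sum_loop acc_r col_r dim_e skip ?e) L' (\<lambda>L''. L'' acc_r 0 = (\<Sum>k<m. ?term i k))"
    proof (rule ensures_sum_loop)
      fix k L'' assume k: "k < m" "unchanged ({acc_r, col_r} \<union> writes skip) L' L''" "L'' col_r 0 = of_nat k"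
      have "inputs L''" using k(2) inputs' by (rule inputs_unchanged) simp
      then have "expr_val (vertex_expr (Reg row_r) (Reg col_r)) L'' = vertex L i k"
        using i k unchangedD[OF k(2), of row_r] vertex_unchanged[OF k(2)] vertex_unchanged[OF i(2)]
        by (simp add: expr_val_vertex)
      moreover have "L'' normal_r = L normal_r" "L'' point_r = L point_r"
        using unchangedD[OF k(2)] unchangedD[OF i(2)] by simp_all
      ultimately show "ensures skip L'' (\<lambda>L''. expr_val ?e L'' = ?term i k)" using k(3)
        by (intro ensures_skip) simp
    qed (use inputsD[OF inputs'] m_le_Z i(1) partial in \<open>auto simp: loop_regs_ok_def admissible_def vertex_expr_def\<close>)
    then show "ensures (sum_loop acc_r col_r dim_e skip ?e) L'
      (\<lambda>L''. expr_val (Reg acc_r) L'' = (\<Sum>k<m. ?term i k))" by simp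
  qed (use inputsD[OF inputs] Suc_m_le_Z partial in \<open>auto simp: loop_regs_ok_def admissible_def\<close>)
  then show ?thesis by (rule ensures_mono) auto
qed

lemma ensures_lowest:
  assumes "inputs L"
  shows "ensures lowest_prog L (\<lambda>L'. \<exists>p\<le>m. L' lowest_r 0 = of_nat p \<and> (\<forall>i\<le>m. L heights_r p \<le> L heights_r i))"
proof -
  let ?body = "IF Cell heights_r (Reg lowest_r) \<^bold>- Cell heights_r
    (Reg row_r) THEN lowest_r ::= Reg row_r ELSE skip"
  let ?L = "set_cell lowest_r 0 0 L"
  let ?Inv = "\<lambda>j L'. \<exists>p\<le>m. L' lowest_r 0 = of_nat p \<and> (\<forall>i<j. L heights_r p \<le> L heights_r i)"
  have "ensures (FOR row_r < dim_e \<^bold>+ Num 1 DO ?body) ?L (?Inv (Suc m))"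
  proof (rule ensures_for_below[where Inv = ?Inv])
    fix j L' assume j: "j < Suc m" and L': "unchanged (insert row_r (writes ?body)) ?L L'" "L' row_r 0 = of_nat j"
      and "?Inv j L'"
    then obtain p where p: "p \<le> m" "L' lowest_r 0 = of_nat p" "\<And>i. i < j \<Longrightarrow> L heights_r p \<le> L heights_r i" by blast
    have heights: "L' heights_r = L heights_r" using unchangedD[OF L'(1), of heights_r] by simp
    show "ensures ?body L' (\<lambda>L''. ?Inv (Suc j) (set_cell row_r 0 (of_nat (Suc j)) L''))"
    proof (rule draws_if_pos)
      assume lower: "expr_val (Cell heights_r (Reg lowest_r) \<^bold>- Cell heights_r (Reg row_r)) L' > 0"
      have "?Inv (Suc j) (set_cell row_r 0 (of_nat (Suc j)) (set_cell lowest_r 0 (L' row_r 0) L'))"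
        using lower p j L'(2) heights by (intro exI[of _ j]) (force simp: less_Suc_eq)
      then show "ensures (lowest_r ::= Reg row_r) L' (\<lambda>L''. ?Inv (Suc j) (set_cell row_r 0 (of_nat (Suc j)) L''))"
        using L'(2) j Suc_m_le_Z fits_counter[of j] by (intro ensures_assign) (auto simp: admissible_def)
    next
      assume "\<not> expr_val (Cell heights_r (Reg lowest_r) \<^bold>- Cell heights_r (Reg row_r)) L' > 0"
      then show "ensures skip L' (\<lambda>L''. ?Inv (Suc j) (set_cell row_r 0 (of_nat (Suc j)) L''))"
        using p L'(2) heights by (intro ensures_skip exI[of _ p]) (auto simp: less_Suc_eq)
    qed (auto simp: admissible_def)
  qed (use inputsD[OF assms] Suc_m_le_Z in \<open>auto simp: loop_regs_ok_def\<close>)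
  then have "ensures (FOR row_r < dim_e \<^bold>+ Num 1 DO ?body) ?L
      (\<lambda>L'. \<exists>p\<le>m. L' lowest_r 0 = of_nat p \<and> (\<forall>i\<le>m. L heights_r p \<le> L heights_r i))"
    by (rule ensures_mono) (auto simp: less_Suc_eq_le)
  then show ?thesis unfolding lowest_prog_def by (intro draws_SeqI[OF ensures_assign]) (auto simp: admissible_def)
qed

lemma ensures_scales:
  assumes inputs: "inputs L" and grid: "L grid_r 0 = of_nat D"
    and p: "p \<le> m" "L lowest_r 0 = of_nat p" "\<And>i. i \<le> m \<Longrightarrow> L heights_r p \<le> L heights_r i" "L heights_r p \<le> 0"
  shows "ensures scales_prog L (\<lambda>L'. \<forall>i\<le>m. L' scale_r i = shrink_factor m (L heights_r i / (- L heights_r p)))"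
proof -
  let ?scale = "\<lambda>i. shrink_factor m (L heights_r i / (- L heights_r p))"
  let ?e = "(Flr (Reg grid_r \<^bold>/ (Num 1 \<^bold>+ Cell heights_r (Reg row_r) \<^bold>/ (Num 0 \<^bold>- Cell heights_r (Reg lowest_r))
        \<^bold>/ (Num 8 \<^bold>* (dim_e \<^bold>* dim_e)))) \<^bold>+ Num 1) \<^bold>/ Reg grid_r"
  have "ensures (tabulate scale_r row_r (dim_e \<^bold>+ Num 1) skip ?e) L
    (\<lambda>L'. L' scale_r = (\<lambda>i. if i < Suc m then ?scale i else L scale_r i))"
  proof (rule ensures_tabulate)
    fix i L' assume i: "i < Suc m" "unchanged ({scale_r, row_r} \<union> writes skip) L L'" "L' row_r 0 = of_nat i"
    have "inputs L'" using i(2) inputs by (rule inputs_unchanged) simp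
    then show "ensures skip L' (\<lambda>L''. expr_val ?e L'' = ?scale i)"
      using i(3) unchangedD[OF i(2)] grid p(2) inputsD(2)[of L']
      by (intro ensures_skip) (simp add: shrink_factor_def)
  next
    fix i assume "i < Suc m"
    then show "fits B (?scale i)" using p by (intro fits_mono[OF fits_shrink_factor fits_params(7)]) auto
  qed (use inputsD[OF inputs] Suc_m_le_Z in \<open>auto simp: loop_regs_ok_def admissible_def\<close>)
  then show ?thesis unfolding scales_prog_def by (rule ensures_mono) auto
qed

text \<open>The vertices may be overwritten one by one, since the vertex \<open>p\<close> itself does not move.\<close>

lemma ensures_shrink:
  assumes inputs: "inputs L" and grid: "L grid_r 0 = of_nat D"
    and p: "p \<le> m" "L lowest_r 0 = of_nat p" "\<And>i. i \<le> m \<Longrightarrow> L heights_r p \<le> L heights_r i" "L heights_r p \<le> 0"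
    and v: "t < T" "\<And>i k. i \<le> m \<Longrightarrow> k < m \<Longrightarrow> on_grid D t R (vertex L i k)"
  shows "ensures shrink_prog L (\<lambda>L'. \<forall>i\<le>m. \<forall>k<m. vertex L' i k = shrink m (vertex L) (L heights_r) p i k)"
proof -
  let ?scale = "\<lambda>i. shrink_factor m (L heights_r i / (- L heights_r p))"
  let ?v = "vertex_expr (Reg lowest_r) (Reg col_r)"
  have fixed: "shrink m (vertex L) (L heights_r) p p k = vertex L p k" for k by (simp add: shrink_def)
  show ?thesis unfolding shrink_prog_def
  proof (rule draws_Seq[OF ensures_scales[OF inputs grid p]])
    fix L1 assume L1: "unchanged (writes scales_prog) L L1" "\<forall>i\<le>m. L1 scale_r i = ?scale i"
    have inputs1: "inputs L1" using L1(1) inputs by (rule inputs_unchanged) simp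
    show "ensures (tabulate vertices_r flat_r ((dim_e \<^bold>+ Num 1) \<^bold>* dim_e) (split_index dim_e)
        (?v \<^bold>+ Cell scale_r (Reg row_r) \<^bold>* (Cell vertices_r (Reg flat_r) \<^bold>- ?v))) L1
      (\<lambda>L'. \<forall>i\<le>m. \<forall>k<m. vertex L' i k = shrink m (vertex L) (L heights_r) p i k)"
    proof (rule ensures_tabulate_vertices[OF inputs1])
      fix i k assume ik: "i \<le> m" "k < m"
      then have "on_grid D (Suc t) R (shrink m (vertex L) (L heights_r) p i k)" using p v
        by (intro on_grid_shrink) auto
      then show "fits B (shrink m (vertex L) (L heights_r) p i k)" using ik v(1)
        by (intro fits_mono[OF fits_vertex small_le_B(4)]) auto
    next
      fix i k L' assume ik: "i \<le> m" "k < m"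
        and L': "inputs L'" "unchanged {vertices_r, flat_r, row_r, col_r} L1 L'"
        "L' flat_r 0 = of_nat (i * m + k)" "L' row_r 0 = of_nat i" "L' col_r 0 = of_nat k"
        and vertices: "\<And>i' k'. i' \<le> m \<Longrightarrow> k' < m \<Longrightarrow>
          vertex L' i' k' = (if i' * m + k' < i * m +
            k then shrink m (vertex L) (L heights_r) p i' k' else vertex L1 i' k')"
      have "L' lowest_r 0 = of_nat p"
        using unchangedD[OF L'(2), of lowest_r] unchangedD[OF L1(1), of lowest_r] p(2) by simp
      then have "expr_val ?v L' = vertex L p k"
        using vertices[OF p(1) ik(2)] fixed vertex_unchanged[OF L1(1)]
          expr_val_vertex[OF L'(1) _ , of "Reg lowest_r" p "Reg col_r" k] L'(5) by simp
      moreover have "L' vertices_r (i * m + k) = vertex L i k"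
        using vertices[OF ik] vertex_unchanged[OF L1(1)] by (simp add: vertex_def)
      moreover have "L' scale_r i = ?scale i" using unchangedD[OF L'(2), of scale_r] L1(2) ik(1) by simp
      ultimately show "expr_val (?v \<^bold>+ Cell scale_r (Reg row_r) \<^bold>* (Cell vertices_r (Reg flat_r) \<^bold>- ?v)) L' =
        shrink m (vertex L) (L heights_r) p i k"
        using L'(3,4) index_of_nat(1)[of "i * m + k"] by (simp add: shrink_def)
    qed (auto simp: admissible_def vertex_expr_def)
  qed
qed

end

subsection \<open>One cut\<close>

context drso_run
begin

definition real_vertex :: "memory \<Rightarrow> nat \<Rightarrow> nat \<Rightarrow> real" where
  "real_vertex L i k = real_of_rat (vertex L i k)"

definition run_data :: "(nat \<Rightarrow> nat set) \<Rightarrow> memory \<Rightarrow> bool" where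
  "run_data As L \<longleftrightarrow> parameters_ready L \<and> sampled As N L \<and> L mass_r 0 = mhat As"

definition answer_recorded :: "(nat \<Rightarrow> nat set) \<Rightarrow> memory \<Rightarrow> bool" where
  "answer_recorded As L \<longleftrightarrow> get_vec answer_r m L \<in> points \<and> real_vec (get_vec answer_r m L) \<in> feas I \<and>
    fhat As (real_vec (get_vec answer_r m L)) \<le> real_of_rat (L best_cost_r 0) \<and> L best_cost_r 0 \<le> 2 * top_value I"

definition cheaper :: "(nat \<Rightarrow> nat set) \<Rightarrow> memory \<Rightarrow> real Matrix.vec set" where
  "cheaper As L = {y \<in> feas I. fhat As y < real_of_rat (L best_cost_r 0)}"

definition cheaper_enclosed :: "(nat \<Rightarrow> nat set) \<Rightarrow> nat \<Rightarrow> memory \<Rightarrow> bool" where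
  "cheaper_enclosed As t L \<longleftrightarrow> (\<forall>i\<le>m. \<forall>k<m. on_grid D t R (vertex L i k)) \<and>
    (0 < m \<longrightarrow> (\<forall>y\<in>cheaper As L. in_simplex m (real_vertex L) (($) y)) \<and>
      (cheaper As L \<noteq> {} \<longrightarrow> simplex_vol m (real_vertex L) \<le> exp (- real t / (32 * real m ^ 2)) * real R ^ m))"

definition tracked :: "(nat \<Rightarrow> nat set) \<Rightarrow> nat \<Rightarrow> memory \<Rightarrow> bool" where
  "tracked As t L \<longleftrightarrow> run_data As L \<and> answer_recorded As L \<and> cheaper_enclosed As t L"

definition cut_found :: "(nat \<Rightarrow> nat set) \<Rightarrow> memory \<Rightarrow> bool" where
  "cut_found As L \<longleftrightarrow> (\<forall>k<m. fits (normal_bits I E \<Delta> OT) (L normal_r k)) \<and>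
    (\<forall>y\<in>cheaper As L. (\<Sum>k<m. real_of_rat (L normal_r k) * y $ k) <
      (\<Sum>k<m. real_of_rat (L normal_r k) * real_of_rat (L point_r k)))"

abbreviation "queried As b L \<equiv> answer_recorded As L \<and> cut_found As L \<and> L best_cost_r 0 \<le> b"

lemma run_data_unchanged:
  "unchanged X L L' \<Longrightarrow> run_data As L \<Longrightarrow>
    {costs_r, input_r, powers_r, full_code_r, top_val_r, side_r, grid_r, cuts_r, samples_r, n_top_r, codes_r, mass_r} \<inter> X = {} \<Longrightarrow> run_data As L'"
  unfolding run_data_def sampled_def using parameters_ready_unchanged[of X L L'] by (auto simp: unchanged_def)

lemma answer_recorded_unchanged: "unchanged X L L' \<Longrightarrow> answer_r \<notin> X \<Longrightarrow> best_cost_r \<notin> X \<Longrightarrow> answer_recorded As L \<Longrightarrow>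
  answer_recorded As L'"
  using unchangedD[of X L L' answer_r] unchangedD[of X L L' best_cost_r]
  by (simp add: answer_recorded_def get_vec_def)

lemma cheaper_unchanged: "unchanged X L L' \<Longrightarrow> best_cost_r \<notin> X \<Longrightarrow> cheaper As L' = cheaper As L"
  using unchangedD[of X L L' best_cost_r] by (simp add: cheaper_def)

lemma cheaper_antimono: "L' best_cost_r 0 \<le> L best_cost_r 0 \<Longrightarrow> cheaper As L' \<subseteq> cheaper As L"
  unfolding cheaper_def using of_rat_less_eq[where ?'a = real] order_less_le_trans by blast

lemma cheaper_enclosed_mono:
  assumes "cheaper_enclosed As t L" "L' best_cost_r 0 \<le> L best_cost_r 0" "vertex L' = vertex L"
  shows "cheaper_enclosed As t L'"
  using assms(1,3) cheaper_antimono[of L' L As] assms(2)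
  by (auto simp: cheaper_enclosed_def real_vertex_def[abs_def])

context
  fixes As :: "nat \<Rightarrow> nat set"
  assumes As: "\<And>j. j < N \<Longrightarrow> As j \<in> S"
begin

lemma ensures_record_cut:
  assumes ready: "parameters_ready L" and ans: "answer_recorded As L"
    and x: "queryable x" "x \<in> points" "get_vec point_r m L = x"
    and cs: "top_seq S (value_orc I x) K cs" "\<And>j. j < K \<Longrightarrow> cs j \<in> S"
    and objective: "L cost_r 0 = cost_value As cs x" "\<And>k. k < m \<Longrightarrow> L normal_r k = cost_slope As cs x k"
  shows "ensures record_prog L (queried As (L best_cost_r 0))"
proof (rule ensures_mono[OF ensures_record[OF parameters_readyD(2)[OF ready]]])
  fix L' assume L': "unchanged (writes record_prog) L L'" "L' best_cost_r 0 = min (L best_cost_r 0) (L cost_r 0) \<and>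
    get_vec answer_r m L' = (if L cost_r 0 < L best_cost_r 0 then get_vec point_r m L else get_vec answer_r m L)"
  have cost: "real_of_rat (L cost_r 0) = fhat As (real_vec x)"
    using objective(1) of_rat_cost_value[OF As x(1) cs(1)] by simp
  have "answer_recorded As L'"
    using L'(2) ans cost x by (auto simp: answer_recorded_def queryable_def min_def not_less)
  moreover have "cut_found As L'" unfolding cut_found_def
  proof (intro conjI allI impI ballI)
    have normal: "L' normal_r k = cost_slope As cs x k" "L' point_r k = x $ k" if "k < m" for k
      using that objective(2) unchangedD[OF L'(1), of normal_r] unchangedD[OF L'(1), of point_r] x(3)
      by (auto simp: get_vec_def)
    show "fits (normal_bits I E \<Delta> OT) (L' normal_r k)" if "k < m" for k
      using fits_cost_slope[OF As cs(2) x(1,2) that] normal(1)[OF that] by simp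
    fix y assume "y \<in> cheaper As L'"
    then have "y \<in> feas I" "fhat As y < real_of_rat (min (L best_cost_r 0) (L cost_r 0))" using L'(2)
      by (auto simp: cheaper_def)
    then have y: "y \<in> feas I" "fhat As y < fhat As (real_vec x)" using cost by (auto simp: of_rat_min)
    from fhat_subgradient[where As = As, OF As x(1) cs(1) y(1)]
    have "(\<Sum>k<m. real_of_rat (cost_slope As cs x k) * (y $ k - real_of_rat (x $ k))) < 0" using y(2) by linarith
    then show "(\<Sum>k<m. real_of_rat (L' normal_r k) * y $ k) <
      (\<Sum>k<m. real_of_rat (L' normal_r k) * real_of_rat (L' point_r k))"
      using normal by (simp add: right_diff_distrib sum_subtractf)
  qed
  ultimately show "queried As (L best_cost_r 0) L'" using L'(2) by simp
qed

lemma ensures_evaluate: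
  assumes run: "run_data As L" and ans: "answer_recorded As L"
    and point: "get_vec point_r m L \<in> points" "real_vec (get_vec point_r m L) \<in> feas I"
  shows "ensures evaluate_prog L (queried As (L best_cost_r 0))"
proof -
  define x where "x = get_vec point_r m L"
  have x: "queryable x" "x \<in> points" "get_vec point_r m L = x"
    using point fits_point[OF point(1)] by (auto simp: queryable_def x_def points_def)
  have data: "parameters_ready L" "sampled As N L" "L mass_r 0 = mhat As" using run by (auto simp: run_data_def)
  show ?thesis unfolding evaluate_prog_def
  proof (rule draws_Seq[OF ensures_greedy[OF data(1) x(1,3)]])
    fix L1 assume L1: "unchanged (writes greedy_prog) L L1" "\<exists>cs. top_seq S (value_orc I x) K cs \<and> tops cs K L1"
    then obtain cs where cs: "top_seq S (value_orc I x) K cs" "tops cs K L1" by blast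
    then have csS: "cs j \<in> S" if "j < K" for j using that by (simp add: tops_def)
    have "run_data As L1" using L1(1) run by (rule run_data_unchanged) simp
    then have data1: "parameters_ready L1" "sampled As N L1" "L1 mass_r 0 = mhat As" by (auto simp: run_data_def)
    have point1: "get_vec point_r m L1 = x" using point_unchanged[OF L1(1)] x(3) by simp
    show "ensures (objective_prog ;; record_prog) L1 (queried As (L best_cost_r 0))"
    proof (rule draws_Seq[OF ensures_objective[OF As csS x(1,2) data1(1) point1 data1(2,3) cs(2)]])
      fix L2 assume L2: "unchanged (writes objective_prog) L1 L2"
        "L2 cost_r 0 = cost_value As cs x \<and> (\<forall>k<m. L2 normal_r k = cost_slope As cs x k)"
      have same: "unchanged (writes greedy_prog \<union> writes objective_prog) L L2"
        by (rule unchanged_trans[OF L1(1) L2(1)])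
      have "answer_recorded As L2" using same by (rule answer_recorded_unchanged) (use ans in simp_all)
      moreover have "parameters_ready L2" using same data(1) by (rule parameters_ready_unchanged) simp
      moreover have "get_vec point_r m L2 = x" "L2 best_cost_r 0 = L best_cost_r 0"
        using point_unchanged[OF same] unchangedD[OF same, of best_cost_r] x(3) by simp_all
      ultimately show "ensures record_prog L2 (queried As (L best_cost_r 0))"
        using ensures_record_cut[of L2 x cs] x(1,2) cs(1) csS L2(2) by simp
    qed
  qed
qed

lemma cut_found_separating:
  assumes x: "get_vec point_r m L = x" and a: "dim_vec a = m" "\<And>k. k < m \<Longrightarrow> fits OT (a $ k)"
    and sep: "\<And>y. y \<in> feas I \<Longrightarrow> real_vec a \<bullet> y < real_vec a \<bullet> real_vec x"
  shows "cut_found As (set_cell outside_r 0 1 (set_vec normal_r a L))"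
  unfolding cut_found_def
proof (intro conjI allI impI ballI)
  let ?L = "set_cell outside_r 0 1 (set_vec normal_r a L)"
  show "fits (normal_bits I E \<Delta> OT) (?L normal_r k)" if "k < m" for k
    using fits_mono[OF a(2)[OF that], of "normal_bits I E \<Delta> OT"] a(1) that
    by (simp add: set_vec_def normal_bits_def)
  fix y assume "y \<in> cheaper As ?L"
  then have y: "y \<in> feas I" by (simp add: cheaper_def)
  have dot: "real_vec a \<bullet> z = (\<Sum>k<m. real_of_rat (?L normal_r k) * z $ k)" if "dim_vec z = m" for z
    using a(1) that by (simp add: scalar_prod_def atLeast0LessThan set_vec_def)
  show "(\<Sum>k<m. real_of_rat (?L normal_r k) * y $ k) <
    (\<Sum>k<m. real_of_rat (?L normal_r k) * real_of_rat (?L point_r k))"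
    using sep[OF y] dot[of y] dot[of "real_vec x"] feas_carrier[OF y] x by (auto simp: get_vec_def set_vec_def)
qed

lemma ensures_query:
  assumes run: "run_data As L" and ans: "answer_recorded As L" and point: "get_vec point_r m L \<in> points"
  shows "ensures query_prog L (queried As (L best_cost_r 0))"
  unfolding query_prog_def
proof (rule draws_SeqI, rule ensures_Separate)
  let ?x = "get_vec point_r m L" and ?Q = "queried As (L best_cost_r 0)"
  have x: "?x \<in> carrier_vec m" "\<And>k. k < m \<Longrightarrow> fits (point_bits I E) (?x $ k)" using point fits_point[OF point]
    by (auto simp: points_def)
  show "ensures (IF Reg outside_r THEN skip ELSE evaluate_prog) (set_cell outside_r 0 0 L) ?Q"
    if "sep_orc I ?x = None"
  proof -
    let ?L = "set_cell outside_r 0 0 L"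
    have same: "unchanged {outside_r} L ?L" by (auto simp: unchanged_def)
    have "ensures evaluate_prog ?L (queried As (?L best_cost_r 0))"
    proof (rule ensures_evaluate)
      show "run_data As ?L" using same run by (rule run_data_unchanged) simp
      show "answer_recorded As ?L" using same by (rule answer_recorded_unchanged) (use ans in simp_all)
    qed (use point point_unchanged[OF same] separation_oracle_None[OF x(1) that] in simp_all)
    then show ?thesis by (intro draws_if_pos) (simp_all add: admissible_def)
  qed
  fix a assume sep: "sep_orc I ?x = Some a"
  have a: "dim_vec a = m" "\<And>k. k < m \<Longrightarrow> fits OT (a $ k)"
    "\<And>y. y \<in> feas I \<Longrightarrow> real_vec a \<bullet> y < real_vec a \<bullet> real_vec ?x"
    using separation_oracle_Some[OF x(1) _ sep] x(2) by blast+
  let ?L = "set_cell outside_r 0 1 (set_vec normal_r a L)"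
  have same: "unchanged {outside_r, normal_r} L ?L" by (auto simp: unchanged_def set_vec_def)
  have "cut_found As ?L" by (rule cut_found_separating[OF refl a])
  moreover have "answer_recorded As ?L" using same by (rule answer_recorded_unchanged) (use ans in simp_all)
  ultimately have "ensures (IF Reg outside_r THEN skip ELSE evaluate_prog) ?L ?Q"
    by (intro draws_if_pos ensures_skip) (simp_all add: admissible_def set_vec_def)
  then show "(\<forall>i<dim_vec a. fits B (a $ i)) \<and> ensures (IF Reg outside_r THEN skip ELSE evaluate_prog) ?L ?Q"
    using a(1,2) fits_mono[OF _ small_le_B(3)] by simp
qed auto

lemma cheaper_enclosed_shrink:
  assumes L: "cheaper_enclosed As t L" "cut_found As L" "\<And>k. k < m \<Longrightarrow> L point_r k = centroid m (vertex L) k"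
    and p: "p \<le> m" "\<And>i. i \<le> m \<Longrightarrow> \<alpha> p \<le> \<alpha> i"
      "\<And>i. i \<le> m \<Longrightarrow> \<alpha> i = height m (vertex L) (centroid m (vertex L)) (L normal_r) i"
    and L': "\<And>i k. i \<le> m \<Longrightarrow> k < m \<Longrightarrow> vertex L' i k = shrink m (vertex L) \<alpha> p i k" "cheaper As L' = cheaper As L"
  shows "cheaper_enclosed As (Suc t) L'"
  unfolding cheaper_enclosed_def L'(2)
proof (intro conjI allI impI ballI)
  have "\<alpha> p \<le> 0" using lowest_centroid_height_nonpos[of p m "vertex L" "L normal_r"] p by simp
  then show "on_grid D (Suc t) R (vertex L' i k)" if "i \<le> m" "k < m" for i k
    using L(1) p that by (subst L'(1)[OF that], intro on_grid_shrink) (auto simp: cheaper_enclosed_def)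
  assume m: "0 < m"
  let ?v = "real_vertex L" and ?a = "\<lambda>k. real_of_rat (L normal_r k)"
  let ?\<alpha> = "height m ?v (centroid m ?v) ?a"
  have \<alpha>: "real_of_rat (\<alpha> i) = ?\<alpha> i" if "i \<le> m" for i
    using p(3)[OF that] by (simp add: of_rat_height of_rat_centroid real_vertex_def[abs_def])
  have v': "real_vertex L' i k = shrink m ?v ?\<alpha> p i k" if "i \<le> m" "k < m" for i k
    using L'(1)[OF that] \<alpha>[OF p(1)] \<alpha>[OF that(1)]
    by (simp add: real_vertex_def of_rat_shrink) (simp add: shrink_def real_vertex_def)
  have lowest: "?\<alpha> p \<le> ?\<alpha> i" if "i \<le> m" for i using p(2)[OF that] \<alpha>[OF that] \<alpha>[OF p(1)] by (metis of_rat_less_eq)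
  have progress: "in_simplex m (shrink m ?v ?\<alpha> p) (($) y) \<and>
      simplex_vol m (shrink m ?v ?\<alpha> p) \<le> exp (- 1 / (32 * real m ^ 2)) * simplex_vol m ?v" if y: "y \<in> cheaper As L"
        for y
  proof -
    have "in_simplex m ?v (($) y)" using L(1) m y by (simp add: cheaper_enclosed_def)
    moreover have "(\<Sum>k<m. ?a k * y $ k) < (\<Sum>k<m. ?a k * centroid m ?v k)"
      using L(2,3) y by (simp add: cut_found_def of_rat_centroid real_vertex_def[abs_def])
    ultimately show ?thesis using shrink_progress[OF m _ _ p(1) lowest] by blast
  qed
  show "in_simplex m (real_vertex L') (($) y)" if "y \<in> cheaper As L" for y
    using progress[OF that] in_simplex_cong[of m "real_vertex L'" "shrink m ?v ?\<alpha> p"] v' by blast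
  assume nonempty: "cheaper As L \<noteq> {}"
  then have "simplex_vol m (real_vertex L') \<le> exp (- 1 / (32 * real m ^ 2)) * simplex_vol m ?v"
    using progress simplex_vol_cong[of m "real_vertex L'" "shrink m ?v ?\<alpha> p"] v' by auto
  also have "\<dots> \<le> exp (- 1 / (32 * real m ^ 2)) * (exp (- real t / (32 * real m ^ 2)) * real R ^ m)"
    using L(1) m nonempty by (intro mult_left_mono) (auto simp: cheaper_enclosed_def)
  also have "\<dots> = exp (- real (Suc t) / (32 * real m ^ 2)) * real R ^ m"
    by (simp add: mult.assoc[symmetric] exp_add[symmetric] diff_divide_distrib)
  finally show "simplex_vol m (real_vertex L') \<le> exp (- real (Suc t) / (32 * real m ^ 2)) * real R ^ m" .
qed

lemma ensures_shrink_enclosed: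
  assumes t: "t < T" and L: "cheaper_enclosed As t L" "cut_found As L"
      "\<And>k. k < m \<Longrightarrow> L point_r k = centroid m (vertex L) k"
    and same: "unchanged (writes heights_prog \<union> writes lowest_prog) L L'"
    and L': "inputs L'" "L' grid_r 0 = of_nat D" "vertex L' = vertex L" "L' lowest_r 0 = of_nat p"
    and p: "p \<le> m" "\<And>i. i \<le> m \<Longrightarrow> L' heights_r p \<le> L' heights_r i"
    and heights: "\<And>i. i \<le> m \<Longrightarrow> L' heights_r i = height m (vertex L) (centroid m (vertex L)) (L normal_r) i"
  shows "ensures shrink_prog L' (cheaper_enclosed As (Suc t))"
proof -
  have "on_grid D t R (vertex L i k)" if "i \<le> m" "k < m" for i k using L(1) that by (simp add: cheaper_enclosed_def)
  moreover have "L' heights_r p \<le> 0"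
    using lowest_centroid_height_nonpos[of p m "vertex L" "L normal_r"] p heights by simp
  ultimately have "ensures shrink_prog L'
    (\<lambda>L''. \<forall>i\<le>m. \<forall>k<m. vertex L'' i k = shrink m (vertex L') (L' heights_r) p i k)"
    using L' p t by (intro ensures_shrink) auto
  then show ?thesis
  proof (rule ensures_mono)
    fix L'' assume L'': "unchanged (writes shrink_prog) L' L''"
      "\<forall>i\<le>m. \<forall>k<m. vertex L'' i k = shrink m (vertex L') (L' heights_r) p i k"
    have "cheaper As L'' = cheaper As L" using cheaper_unchanged[OF unchanged_trans[OF same L''(1)]] by simp
    then show "cheaper_enclosed As (Suc t) L''"
      using L''(2) L'(3) cheaper_enclosed_shrink[OF L p heights] by simp
  qed
qed

lemma ensures_contract:
  assumes run: "run_data As L" and t: "t < T" and L: "cheaper_enclosed As t L" "cut_found As L"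
    and point: "get_vec point_r m L \<in> points" "\<And>k. k < m \<Longrightarrow> L point_r k = centroid m (vertex L) k"
  shows "ensures contract_prog L (cheaper_enclosed As (Suc t))"
  unfolding contract_prog_def
proof -
  have inputs: "inputs L" and grid: "L grid_r 0 = of_nat D" using run parameters_readyD by (auto simp: run_data_def)
  have v: "on_grid D t R (vertex L i k)" if "i \<le> m" "k < m" for i k using L(1) that by (simp add: cheaper_enclosed_def)
  let ?h = "height m (vertex L) (centroid m (vertex L)) (L normal_r)"
  have heights: "height m (vertex L) (L point_r) (L normal_r) i = ?h i" for i using point(2) by (simp add: height_def)
  show "ensures (heights_prog ;; lowest_prog ;; shrink_prog) L (cheaper_enclosed As (Suc t))"
  proof (rule draws_Seq[OF ensures_heights[OF inputs point(1) _ less_imp_le[OF t] v]])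
    show "fits (normal_bits I E \<Delta> OT) (L normal_r k)" if "k < m" for k using L(2) that by (simp add: cut_found_def)
    fix L1 assume L1: "unchanged (writes heights_prog) L L1"
      "\<forall>i\<le>m. L1 heights_r i = height m (vertex L) (L point_r) (L normal_r) i"
    have "inputs L1" using L1(1) inputs by (rule inputs_unchanged) simp
    then show "ensures (lowest_prog ;; shrink_prog) L1 (cheaper_enclosed As (Suc t))"
    proof (rule draws_Seq[OF ensures_lowest])
      fix L2 assume L2: "unchanged (writes lowest_prog) L1 L2"
        "\<exists>p\<le>m. L2 lowest_r 0 = of_nat p \<and> (\<forall>i\<le>m. L1 heights_r p \<le> L1 heights_r i)"
      then obtain p where p: "p \<le> m" "L2 lowest_r 0 = of_nat p" "\<And>i. i \<le> m \<Longrightarrow> L1 heights_r p \<le> L1 heights_r i"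
        by blast
      have same: "unchanged (writes heights_prog \<union> writes lowest_prog) L L2"
        by (rule unchanged_trans[OF L1(1) L2(1)])
      have kept: "inputs L2" "L2 grid_r 0 = of_nat D" "vertex L2 = vertex L"
        using inputs_unchanged[OF same inputs] unchangedD[OF same, of grid_r] grid vertex_unchanged[OF same]
        by simp_all
      show "ensures shrink_prog L2 (cheaper_enclosed As (Suc t))"
        by (rule ensures_shrink_enclosed[OF t L point(2) same kept p(2,1)])
          (use L1(2) heights p(3) unchangedD[OF L2(1), of heights_r] in simp_all)
    qed
  qed
qed

lemma ensures_cut:
  assumes tracked: "tracked As t L" and t: "t < T"
  shows "ensures cut_prog L (tracked As (Suc t))"
proof -
  have run: "run_data As L" and ans: "answer_recorded As L" and enclosed: "cheaper_enclosed As t L" using tracked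
    by (auto simp: tracked_def)
  have inputs: "inputs L" using run parameters_readyD(2) by (simp add: run_data_def)
  have v: "on_grid D t R (vertex L i k)" if "i \<le> m" "k < m" for i k using enclosed that
    by (simp add: cheaper_enclosed_def)
  show ?thesis unfolding cut_prog_def
  proof (rule draws_Seq[OF ensures_centroid[OF inputs less_imp_le[OF t] v]])
    fix L1 assume L1: "unchanged (writes centroid_prog) L L1"
      "(\<forall>k<m. L1 point_r k = centroid m (vertex L) k) \<and> get_vec point_r m L1 \<in> points"
    have run1: "run_data As L1" using L1(1) run by (rule run_data_unchanged) simp
    have "answer_recorded As L1" using L1(1) by (rule answer_recorded_unchanged) (use ans in simp_all)
    then show "ensures (query_prog ;; contract_prog) L1 (tracked As (Suc t))"
    proof (rule draws_Seq[OF ensures_query[OF run1]])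
      show "get_vec point_r m L1 \<in> points" using L1(2) by simp
      fix L2 assume L2: "unchanged (writes query_prog) L1 L2"
        "answer_recorded As L2 \<and> cut_found As L2 \<and> L2 best_cost_r 0 \<le> L1 best_cost_r 0"
      have same: "vertex L1 = vertex L" "vertex L2 = vertex L" "L1 best_cost_r = L best_cost_r"
        "L2 point_r = L1 point_r"
        using vertex_unchanged[OF L1(1)] vertex_unchanged[OF L2(1)] unchangedD[OF L1(1), of best_cost_r]
          unchangedD[OF L2(1), of point_r] by simp_all
      have run2: "run_data As L2" using L2(1) run1 by (rule run_data_unchanged) simp
      have "cheaper_enclosed As t L2" using cheaper_enclosed_mono[of As t L L2] enclosed L2(2) same by simp
      moreover have "get_vec point_r m L2 \<in> points" using L1(2) point_unchanged[OF L2(1)] by simp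
      ultimately have "ensures contract_prog L2 (cheaper_enclosed As (Suc t))"
        using L1(2) L2(2) same by (intro ensures_contract[OF run2 t]) auto
      then show "ensures contract_prog L2 (tracked As (Suc t))"
      proof (rule ensures_mono)
        fix L3 assume L3: "unchanged (writes contract_prog) L2 L3" "cheaper_enclosed As (Suc t) L3"
        have "run_data As L3" using L3(1) run2 by (rule run_data_unchanged) simp
        moreover have "answer_recorded As L3" using L3(1)
          by (rule answer_recorded_unchanged) (use L2(2) in simp_all)
        ultimately show "tracked As (Suc t) L3" using L3(2) by (simp add: tracked_def)
      qed
    qed
  qed
qed

end

end

subsection \<open>The complete run\<close>

lemma component_le_norm2:
  assumes "x \<in> carrier_vec n" "k < n" shows "x $ k \<le> norm2 x"
proof -
  have "x $ k * x $ k \<le> (\<Sum>i = 0..<n. x $ i * x $ i)" using assms by (intro member_le_sum) auto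
  then have "(x $ k)\<^sup>2 \<le> x \<bullet> x" using assms by (simp add: scalar_prod_def power2_eq_square)
  then show ?thesis unfolding norm2_def by (rule real_le_rsqrt)
qed

context drso_run
begin

lemma feas_le_outer: "x \<in> feas I \<Longrightarrow> k < m \<Longrightarrow> x $ k \<le> real_of_rat (outer_rad I)"
  using component_le_norm2[OF feas_carrier] rounded by (fastforce simp: well_rounded_def)

lemma feas_sum_le:
  assumes "x \<in> feas I"
  shows "(\<Sum>k<m. x $ k) \<le> real R"
proof -
  have "real_of_rat (outer_rad I) < of_int \<lfloor>real_of_rat (outer_rad I)\<rfloor> + 1" by linarith
  also have "\<dots> = real (nat \<lfloor>outer_rad I\<rfloor> + 1)" using rads(1) by simp
  finally have "x $ k \<le> real (nat \<lfloor>outer_rad I\<rfloor> + 1)" if "k < m" for k using feas_le_outer[OF assms that]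
    by linarith
  then have "(\<Sum>k<m. x $ k) \<le> of_nat (card {..<m}) * real (nat \<lfloor>outer_rad I\<rfloor> + 1)" by (intro sum_bounded_above) auto
  then show ?thesis by (simp add: simplex_size_def distrib_left add.commute)
qed

context
  fixes As :: "nat \<Rightarrow> nat set"
  assumes As: "\<And>j. j < N \<Longrightarrow> As j \<in> S"
begin

lemma fhat_zero_le: "fhat As (0\<^sub>v m) \<le> 2 * real_of_rat (top_value I)"
  using fhat_le_full[OF As zero_feas] cost_dim by (simp add: of_rat_top_value)

lemma initially_tracked:
  assumes run: "run_data As L" and ans: "get_vec answer_r m L = 0\<^sub>v m" "L best_cost_r 0 = 2 * top_value I"
    and vertices: "\<And>i k. i \<le> m \<Longrightarrow> k < m \<Longrightarrow> vertex L i k = (if i = Suc k then of_nat R else 0)"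
  shows "tracked As 0 L"
proof -
  have "on_grid D 0 R (of_nat R)" by (rule on_gridI[of _ "int R"]) auto
  then have grid: "on_grid D 0 R (vertex L i k)" if "i \<le> m" "k < m" for i k using vertices[OF that] on_grid_0
    by simp
  have corner: "real_vertex L i k = corner_simplex (\<lambda>_. 0) (real R) i k" if "i \<le> m" "k < m" for i k
    using vertices[OF that] by (simp add: real_vertex_def corner_simplex_def)
  have "in_simplex m (real_vertex L) (($) y)" if "0 < m" "y \<in> cheaper As L" for y
  proof -
    have y: "y \<in> feas I" using that(2) by (simp add: cheaper_def)
    have "0 < R" using that(1) by (simp add: simplex_size_def)
    then have "0 < real R" by (simp only: of_nat_0_less_iff)
    then have "in_simplex m (corner_simplex (\<lambda>_. 0) (real R)) (($) y)"
      using feas_nonneg[OF y] feas_sum_le[OF y] by (rule in_corner_simplex)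
    then show ?thesis using in_simplex_cong[of m "real_vertex L" "corner_simplex (\<lambda>_. 0) (real R)"] corner by blast
  qed
  moreover have "simplex_vol m (real_vertex L) = real R ^ m"
    using simplex_vol_cong[of m "real_vertex L" "corner_simplex (\<lambda>_. 0) (real R)"] corner
      simplex_vol_corner[of m "\<lambda>_. 0" "real R"] by simp
  ultimately have "cheaper_enclosed As 0 L" using grid by (simp add: cheaper_enclosed_def)
  moreover have "answer_recorded As L"
    using ans fhat_zero_le zero_feas by (simp add: answer_recorded_def zero_point real_vec_zero of_rat_mult)
  ultimately show ?thesis using run by (simp add: tracked_def)
qed

lemma ensures_cuts:
  assumes "tracked As 0 L"
  shows "ensures (FOR round_r < Reg cuts_r DO cut_prog) L (tracked As T)"
proof (rule ensures_for_below)
  have kept: "tracked As t (set_cell round_r 0 q L') \<longleftrightarrow> tracked As t L'" for t q L'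
  proof -
    have "unchanged {round_r} L' (set_cell round_r 0 q L')" "unchanged {round_r} (set_cell round_r 0 q L') L'"
      by (auto simp: unchanged_def)
    note same = this run_data_unchanged[OF this(1), of As] run_data_unchanged[OF this(2), of As]
    show ?thesis unfolding tracked_def cheaper_enclosed_def
      using same answer_recorded_unchanged[OF same(1), of As] answer_recorded_unchanged[OF same(2), of As]
        cheaper_unchanged[OF same(1), of As] vertex_unchanged[OF same(1)]
      by (auto simp: real_vertex_def[abs_def])
  qed
  show "tracked As 0 (set_cell round_r 0 0 L)" using assms kept by simp
  show "ensures cut_prog L' (\<lambda>L''. tracked As (Suc t) (set_cell round_r 0 (of_nat (Suc t)) L''))"
    if "t < T" "tracked As t L'" for t L'
    unfolding kept by (rule ensures_cut[OF As that(2,1)])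
qed (use assms loop_counts parameters_readyD in \<open>auto simp: loop_regs_ok_def tracked_def run_data_def\<close>)

lemma ensures_optimize:
  assumes ready: "parameters_ready L" and sample: "sampled As N L" and zero: "get_vec answer_r m L = 0\<^sub>v m"
  shows "ensures optimize_prog L (tracked As T)"
  unfolding optimize_prog_def
proof (rule draws_Seq[OF ensures_mass[OF ready sample As]])
  fix L1 assume L1: "unchanged (writes mass_prog) L L1" "L1 mass_r 0 = mhat As"
  have ready1: "parameters_ready L1" using L1(1) ready by (rule parameters_ready_unchanged) simp
  have run1: "run_data As L1"
    using ready1 L1(2) sample unchangedD[OF L1(1), of codes_r] by (simp add: run_data_def sampled_def)
  show "ensures (init_prog ;; FOR round_r < Reg cuts_r DO cut_prog) L1 (tracked As T)"
  proof (rule draws_Seq[OF ensures_init[OF ready1]])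
    fix L2 assume L2: "unchanged (writes init_prog) L1 L2"
      "(\<forall>i\<le>m. \<forall>k<m. vertex L2 i k = (if i = Suc k then of_nat R else 0)) \<and> L2 best_cost_r 0 = 2 * top_value I"
    have "run_data As L2" using L2(1) run1 by (rule run_data_unchanged) simp
    moreover have "get_vec answer_r m L2 = 0\<^sub>v m"
      using zero unchangedD[OF L2(1), of answer_r] unchangedD[OF L1(1), of answer_r] by (simp add: get_vec_def)
    ultimately show "ensures (FOR round_r < Reg cuts_r DO cut_prog) L2 (tracked As T)"
      using L2(2) by (intro ensures_cuts initially_tracked) auto
  qed
qed

end

lemma sample_in_scenarios:
  assumes "ws \<in> set_pmf (replicate_pmf N (center I))"
  shows "length ws = N" "j < N \<Longrightarrow> ws ! j \<in> S"
proof -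
  have ws: "set ws \<subseteq> set_pmf (center I)" "length ws = N" using assms by (auto simp: set_replicate_pmf)
  then show "length ws = N" by simp
  assume "j < N"
  then have "ws ! j \<in> set ws" using ws by simp
  then show "ws ! j \<in> S" using ws center by blast
qed

lemma draws_main:
  assumes "inputs L" "get_vec answer_r m L = 0\<^sub>v m"
  shows "draws main_prog L (replicate_pmf N (center I)) (\<lambda>ws. tracked ((!) ws) T)"
  unfolding main_prog_def
proof (rule draws_Seq[OF ensures_setup[OF assms]])
  fix L1 assume L1: "unchanged (writes setup_prog) L L1" "parameters_ready L1"
  have "finite (set_pmf (center I))" using center finite_scenarios by (rule finite_subset)
  then have finite: "finite (set_pmf (replicate_pmf N (center I)))"
    by (simp add: set_replicate_pmf finite_lists_length_eq lists_eq_set)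
  show "draws (sample_prog ;; optimize_prog) L1 (replicate_pmf N (center I)) (\<lambda>ws. tracked ((!) ws) T)"
  proof (rule draws_Seq_ensures[OF draws_sample[OF L1(2)] finite])
    fix ws L2 assume ws: "ws \<in> set_pmf (replicate_pmf N (center I))"
      and L2: "unchanged (writes sample_prog) L1 L2" "sampled ((!) ws) N L2"
    have "parameters_ready L2" using L2(1) L1(2) by (rule parameters_ready_unchanged) simp
    moreover have "get_vec answer_r m L2 = 0\<^sub>v m"
      using assms(2) unchangedD[OF L2(1), of answer_r] unchangedD[OF L1(1), of answer_r] by (simp add: get_vec_def)
    ultimately show "ensures optimize_prog L2 (tracked ((!) ws) T)"
      using sample_in_scenarios(2)[OF ws] L2(2) by (intro ensures_optimize)
  qed
qed

end

section \<open>Approximation guarantee\<close>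

lemma polytope_convex:
  assumes P: "polytope_vec n P" and xy: "x \<in> P" "y \<in> P" and t: "0 \<le> t" "t \<le> 1"
  shows "(1 - t) \<cdot>\<^sub>v x + t \<cdot>\<^sub>v y \<in> P"
proof -
  obtain F where F: "F \<subseteq> carrier_vec n \<times> UNIV" "P = {x \<in> carrier_vec n. \<forall>(a, b) \<in> F. a \<bullet> x \<le> b}"
    using P unfolding polytope_vec_def by blast
  have "a \<bullet> ((1 - t) \<cdot>\<^sub>v x + t \<cdot>\<^sub>v y) \<le> b" if ab: "(a, b) \<in> F" for a b
  proof -
    have carrier: "a \<in> carrier_vec n" "x \<in> carrier_vec n" "y \<in> carrier_vec n" using F ab xy by auto
    have "a \<bullet> ((1 - t) \<cdot>\<^sub>v x + t \<cdot>\<^sub>v y) = (1 - t) * (a \<bullet> x) + t * (a \<bullet> y)"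
      using carrier by (subst scalar_prod_add_distrib[of _ n]) (auto simp: scalar_prod_smult_distrib[of _ n])
    also have "\<dots> \<le> (1 - t) * b + t * b" using F ab xy t by (intro add_mono mult_left_mono) auto
    finally show ?thesis by (simp add: algebra_simps)
  qed
  then show ?thesis using F xy by auto
qed

lemma fact_Suc_le_power: "fact (Suc n) \<le> real (Suc n) ^ n"
proof (induction n)
  case (Suc n)
  have "fact (Suc (Suc n)) = real (Suc (Suc n)) * fact (Suc n)" by (rule fact_Suc)
  also have "\<dots> \<le> real (Suc (Suc n)) * real (Suc (Suc n)) ^ n"
    using Suc power_mono[of "real (Suc n)" "real (Suc (Suc n))" n] by (intro mult_left_mono) auto
  finally show ?case by simp
qed simp

context drso_run
begin

subsection \<open>The robust objective\<close>

abbreviation "h \<equiv> robust_cost I"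
abbreviation "mass \<equiv> light_mass S r (pmf (center I))"
abbreviation "mean y \<equiv> measure_pmf.expectation (center I) (recourse I y)"

lemma ambiguity_iff: "q \<in> ambiguity I \<longleftrightarrow> set_pmf q \<subseteq> S \<and> (\<forall>A\<in>S. \<bar>pmf (center I) A - pmf q A\<bar> \<le> r)"
proof -
  have "linf_dist I (center I) q \<le> r \<longleftrightarrow> (\<forall>A\<in>S. \<bar>pmf (center I) A - pmf q A\<bar> \<le> r)"
    using Max_le_iff[of "(\<lambda>A. \<bar>pmf (center I) A - pmf q A\<bar>) ` S" r] finite_scenarios[of I] full_scenario[of I]
    unfolding linf_dist_def by blast
  then show ?thesis by (simp add: ambiguity_def)
qed

lemma center_ambiguity: "center I \<in> ambiguity I"
  using center r_pos by (simp add: ambiguity_iff less_imp_le)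

lemma expectation_nonneg: "y \<in> feas I \<Longrightarrow> set_pmf q \<subseteq> S \<Longrightarrow> 0 \<le> measure_pmf.expectation q (recourse I y)"
  using recourse_nonneg by (auto simp: expectation_eq_sum[OF finite_scenarios] intro!: sum_nonneg)

lemma expectation_le_full:
  assumes y: "y \<in> feas I" and q: "set_pmf q \<subseteq> S"
  shows "measure_pmf.expectation q (recourse I y) \<le> recourse I y U"
proof -
  have "(\<Sum>A\<in>S. pmf q A * recourse I y A) \<le> (\<Sum>A\<in>S. pmf q A * recourse I y U)"
    using recourse_le_full[OF y] by (intro sum_mono mult_left_mono) auto
  also have "\<dots> = recourse I y U" using sum_pmf_eq_1[OF finite_scenarios q] by (simp flip: sum_distrib_right)
  finally show ?thesis unfolding expectation_eq_sum[OF finite_scenarios q] .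
qed

lemma mass_ge: "r \<le> mass"
  using light_mass_ge[OF finite_scenarios _ sum_pmf_eq_1[OF finite_scenarios center]] r_pos by simp

lemma robust_ge:
  assumes "y \<in> feas I" "q \<in> ambiguity I"
  shows "c \<bullet> y + measure_pmf.expectation q (recourse I y) \<le> h y"
proof -
  have "bdd_above ((\<lambda>q. measure_pmf.expectation q (recourse I y)) ` ambiguity I)"
    using expectation_le_full[OF assms(1)] by (intro bdd_aboveI[of _ "recourse I y U"]) (auto simp: ambiguity_iff)
  from cSUP_upper[OF assms(2) this] show ?thesis unfolding robust_cost_def by simp
qed

lemma robust_le:
  assumes "\<And>q. q \<in> ambiguity I \<Longrightarrow> measure_pmf.expectation q (recourse I y) \<le> b"
  shows "h y \<le> c \<bullet> y + b"
  unfolding robust_cost_def using center_ambiguity assms by (intro add_left_mono cSUP_least) auto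

lemma robust_le_full: "y \<in> feas I \<Longrightarrow> h y \<le> c \<bullet> y + recourse I y U"
  by (rule robust_le) (auto simp: ambiguity_iff expectation_le_full)

lemma mean_le_robust: "y \<in> feas I \<Longrightarrow> c \<bullet> y + mean y \<le> h y"
  by (rule robust_ge[OF _ center_ambiguity])

lemma robust_nonneg: "y \<in> feas I \<Longrightarrow> 0 \<le> h y"
  using mean_le_robust[of y] expectation_nonneg[OF _ center, of y] dot_nonneg[of y] by linarith

lemma robust_le_mean_gain: "y \<in> feas I \<Longrightarrow> h y \<le> c \<bullet> y + (mean y + shift_gain S r mass (recourse I y))"
  using dominated_costs.redistribute_upper[OF dominated center] by (intro robust_le) (auto simp: ambiguity_iff)

lemma gain_le_robust:
  assumes y: "y \<in> feas I"
  shows "c \<bullet> y + shift_gain S r mass (recourse I y) \<le> h y"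
proof -
  have "shift_gain S r mass (recourse I y) \<le> h y - c \<bullet> y"
  proof (rule dominated_costs.shift_gain_least[OF dominated[OF y]])
    show "0 \<le> mass" using mass_ge r_pos by linarith
    fix s assume "s \<in> shifts S r mass"
    then obtain q where "q \<in> ambiguity I" "(\<Sum>A\<in>S. s A * recourse I y A) \<le> measure_pmf.expectation q (recourse I y)"
      using dominated_costs.redistribute_lower[OF dominated[OF y] center _ r_pos(2)] by (metis ambiguity_iff)
    then show "(\<Sum>A\<in>S. s A * recourse I y A) \<le> h y - c \<bullet> y" using robust_ge[OF y] by fastforce
  qed
  then show ?thesis by simp
qed

lemma top_le_robust:
  assumes y: "y \<in> feas I"
  shows "r * real_of_rat (top_value I) \<le> real_of_rat (lam I) * h y"
proof -
  have l: "1 \<le> real_of_rat (lam I)" using lam by simp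
  have inflation_bound: "recourse I (0\<^sub>v m) U \<le> recourse I y U + real_of_rat (lam I) * (c \<bullet> y)"
    using inflation y full_scenario[of I] unfolding bounded_inflation_def by blast
  have "r * real_of_rat (top_value I) \<le> r * recourse I y U + r * (real_of_rat (lam I) * (c \<bullet> y))"
    unfolding of_rat_top_value distrib_left[symmetric] using inflation_bound r_pos by (intro mult_left_mono) auto
  also have "r * recourse I y U \<le> shift_gain S r mass (recourse I y)"
    by (rule dominated_costs.shift_gain_top[OF dominated[OF y] mass_ge])
  also have "\<dots> \<le> h y - c \<bullet> y" using gain_le_robust[OF y] by linarith
  also have "\<dots> \<le> real_of_rat (lam I) * (h y - c \<bullet> y)"
    using l mult_right_mono[of 1 "real_of_rat (lam I)" "h y - c \<bullet> y"] mean_le_robust[OF y]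
      expectation_nonneg[OF y center] by simp
  also have "r * (real_of_rat (lam I) * (c \<bullet> y)) \<le> 1 * (real_of_rat (lam I) * (c \<bullet> y))"
    using r_pos l dot_nonneg[OF y] by (intro mult_right_mono) auto
  finally show ?thesis by (simp add: algebra_simps)
qed

subsection \<open>Representative samples\<close>

abbreviation "\<eta> \<equiv> r\<^sup>2 / (4 * real E)"

definition representative :: "(nat \<Rightarrow> nat set) \<Rightarrow> real Matrix.vec \<Rightarrow> bool" where
  "representative As y \<longleftrightarrow> (\<forall>A\<in>S. \<bar>empirical N As A - pmf (center I) A\<bar> \<le> \<eta>) \<and>
    \<bar>(\<Sum>i<N. recourse I y (As i)) / real N - mean y\<bar> \<le> \<eta> * recourse I y U"

context
  fixes As :: "nat \<Rightarrow> nat set"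
  assumes As: "\<And>j. j < N \<Longrightarrow> As j \<in> S"
begin

lemma empirical_mass_ge: "r \<le> light_mass S r (empirical N As)"
  using mhat_bounds(1)[OF As] of_rat_mhat[OF As] by simp

lemma sample_mean_nonneg: "y \<in> feas I \<Longrightarrow> 0 \<le> (\<Sum>i<N. recourse I y (As i)) / real N"
  using As recourse_nonneg by (intro divide_nonneg_nonneg sum_nonneg) auto

lemma dot_le_fhat:
  assumes y: "y \<in> feas I"
  shows "c \<bullet> y \<le> fhat As y"
proof -
  have "0 \<le> r * recourse I y U" using r_pos recourse_nonneg[OF y full_scenario] by simp
  also have "\<dots> \<le> shift_gain S r (light_mass S r (empirical N As)) (recourse I y)"
    by (rule dominated_costs.shift_gain_top[OF dominated[OF y] empirical_mass_ge])
  finally show ?thesis unfolding fhat_def using sample_mean_nonneg[OF y] by linarith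
qed

lemma fhat_nonneg: "y \<in> feas I \<Longrightarrow> 0 \<le> fhat As y"
  using dot_le_fhat[of y] dot_nonneg[of y] by linarith

context
  fixes y :: "real Matrix.vec"
  assumes y: "y \<in> feas I" and rep: "representative As y"
begin

abbreviation "mass_hat \<equiv> light_mass S r (empirical N As)"
abbreviation "gain M \<equiv> shift_gain S r M (recourse I y)"

lemma representative_mass: "mass \<le> (1 + 1 / (2 * real E)) * mass_hat" "mass_hat \<le> (1 + 1 / (2 * real E)) * mass"
proof -
  let ?e = "1 / (2 * real E)"
  have "\<bar>mass_hat - mass\<bar> \<le> 2 * \<eta> / r"
    using rep sum_empirical[OF finite_scenarios As N_pos] empirical_nonneg[OF finite_scenarios As N_pos]
    by (intro light_mass_diff finite_scenarios r_pos sum_pmf_eq_1[OF finite_scenarios center]) (auto simp: representative_def)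
  also have "\<dots> = ?e * r" using r_pos(1) E_pos by (simp add: power2_eq_square field_simps)
  finally have "\<bar>mass_hat - mass\<bar> \<le> ?e * r" .
  moreover have "?e * r \<le> ?e * mass_hat" "?e * r \<le> ?e * mass"
    using empirical_mass_ge mass_ge by (intro mult_left_mono; simp)+
  ultimately show "mass \<le> (1 + ?e) * mass_hat" "mass_hat \<le> (1 + ?e) * mass" unfolding distrib_right by linarith+
qed

lemma representative_gain: "gain mass \<le> (1 + 1 / (2 * real E)) * gain mass_hat"
  "gain mass_hat \<le> (1 + 1 / (2 * real E)) * gain mass"
proof -
  have "0 \<le> mass" "0 \<le> mass_hat" using empirical_mass_ge mass_ge r_pos(1) by linarith+
  then show "gain mass \<le> (1 + 1 / (2 * real E)) * gain mass_hat"
    "gain mass_hat \<le> (1 + 1 / (2 * real E)) * gain mass"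
    using representative_mass by (intro dominated_costs.shift_gain_scale[OF dominated[OF y]]; simp)+
qed

lemma representative_mean:
  assumes "r \<le> M"
  shows "\<bar>(\<Sum>i<N. recourse I y (As i)) / real N - mean y\<bar> \<le> 1 / (2 * real E) * gain M"
proof -
  have full: "0 \<le> r * recourse I y U" using recourse_nonneg[OF y full_scenario] r_pos(1) by simp
  have "\<eta> * recourse I y U = r * (r * recourse I y U) / (4 * real E)" by (simp add: power2_eq_square)
  also have "\<dots> \<le> 2 * (r * recourse I y U) / (4 * real E)"
    using mult_right_mono[OF r_pos(2) full] full by (intro divide_right_mono) auto
  also have "\<dots> = 1 / (2 * real E) * (r * recourse I y U)" by simp
  also have "\<dots> \<le> 1 / (2 * real E) * gain M"
    using dominated_costs.shift_gain_top[OF dominated[OF y] assms] by (intro mult_left_mono) auto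
  finally show ?thesis using rep unfolding representative_def by linarith
qed

lemma robust_le_fhat: "h y \<le> (1 + 1 / real E) * fhat As y"
proof -
  let ?mean = "(\<Sum>i<N. recourse I y (As i)) / real N" and ?e = "1 / (2 * real E)"
  have split: "(1 + 1 / real E) * g = g + ?e * g + ?e * g" for g :: real using E_pos by (simp add: field_simps)
  have "h y \<le> c \<bullet> y + ?mean + (1 + 1 / real E) * gain mass_hat"
    using robust_le_mean_gain[OF y] representative_mean[OF empirical_mass_ge] representative_gain(1)
    unfolding split distrib_right by linarith
  moreover have "1 * (c \<bullet> y + ?mean) \<le> (1 + 1 / real E) * (c \<bullet> y + ?mean)"
    using dot_nonneg[OF y] sample_mean_nonneg[OF y] by (intro mult_right_mono) auto
  ultimately show ?thesis unfolding fhat_def by (simp only: distrib_left)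
qed

lemma fhat_le_robust: "fhat As y \<le> (2 + 1 / real E) * h y"
proof -
  let ?e = "1 / (2 * real E)"
  have split: "(1 + 1 / real E) * g = g + ?e * g + ?e * g" for g :: real using E_pos by (simp add: field_simps)
  have "fhat As y \<le> (c \<bullet> y + mean y) + (1 + 1 / real E) * gain mass"
    using representative_mean[OF mass_ge] representative_gain(2) unfolding fhat_def split distrib_right by linarith
  also have "\<dots> \<le> h y + (1 + 1 / real E) * h y"
    using mean_le_robust[OF y] gain_le_robust[OF y] dot_nonneg[OF y] by (intro add_mono mult_left_mono) auto
  finally show ?thesis by (simp add: algebra_simps)
qed

end

lemma shift_gain_convex:
  assumes xy: "x \<in> feas I" "y \<in> feas I" "(1 - t) \<cdot>\<^sub>v x + t \<cdot>\<^sub>v y \<in> feas I" and t: "0 \<le> t" "t \<le> 1" and M: "0 \<le> M"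
  shows "shift_gain S r M (recourse I ((1 - t) \<cdot>\<^sub>v x + t \<cdot>\<^sub>v y)) \<le>
    (1 - t) * shift_gain S r M (recourse I x) + t * shift_gain S r M (recourse I y)"
proof (rule dominated_costs.shift_gain_least[OF dominated[OF xy(3)] M])
  let ?z = "(1 - t) \<cdot>\<^sub>v x + t \<cdot>\<^sub>v y"
  fix s assume s: "s \<in> shifts S r M"
  have "recourse I ?z A \<le> (1 - t) * recourse I x A + t * recourse I y A" if "A \<in> S" for A
    using efficient(2) that xy t unfolding efficient_convex_recourse_def convex_fun_on_def by blast
  then have "(\<Sum>A\<in>S. s A * recourse I ?z A) \<le> (\<Sum>A\<in>S. s A * ((1 - t) * recourse I x A + t * recourse I y A))"
    using shiftsD(1)[OF s] by (intro sum_mono mult_left_mono) auto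
  also have "\<dots> = (1 - t) * (\<Sum>A\<in>S. s A * recourse I x A) + t * (\<Sum>A\<in>S. s A * recourse I y A)"
    by (simp add: sum_distrib_left sum.distrib distrib_left mult_ac)
  also have "\<dots> \<le> (1 - t) * shift_gain S r M (recourse I x) + t * shift_gain S r M (recourse I y)"
    using dominated_costs.shift_gain_ge[OF dominated s] xy t by (intro add_mono mult_left_mono) auto
  finally show "(\<Sum>A\<in>S. s A * recourse I ?z A) \<le>
    (1 - t) * shift_gain S r M (recourse I x) + t * shift_gain S r M (recourse I y)" .
qed

lemma fhat_convex:
  assumes xy: "x \<in> feas I" "y \<in> feas I" and t: "0 \<le> t" "t \<le> 1"
  shows "fhat As ((1 - t) \<cdot>\<^sub>v x + t \<cdot>\<^sub>v y) \<le> (1 - t) * fhat As x + t * fhat As y"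
proof -
  let ?z = "(1 - t) \<cdot>\<^sub>v x + t \<cdot>\<^sub>v y"
  have z: "?z \<in> feas I" using basic by (intro polytope_convex[OF _ xy t]) (auto simp: basic_data_def)
  have linear: "c \<bullet> ?z = (1 - t) * (c \<bullet> x) + t * (c \<bullet> y)"
    using feas_carrier[OF xy(1)] feas_carrier[OF xy(2)] cost_dim
    by (subst scalar_prod_add_distrib[of _ m]) (auto simp: scalar_prod_smult_distrib[of _ m])
  have "recourse I ?z A \<le> (1 - t) * recourse I x A + t * recourse I y A" if "A \<in> S" for A
    using efficient(2) that xy t unfolding efficient_convex_recourse_def convex_fun_on_def by blast
  then have "(\<Sum>i<N. recourse I ?z (As i)) \<le> (\<Sum>i<N. (1 - t) * recourse I x (As i) + t * recourse I y (As i))"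
    using As by (intro sum_mono) auto
  then have "(\<Sum>i<N. recourse I ?z (As i)) / real N \<le>
    ((1 - t) * (\<Sum>i<N. recourse I x (As i)) + t * (\<Sum>i<N. recourse I y (As i))) / real N"
    by (intro divide_right_mono) (auto simp: sum.distrib sum_distrib_left)
  also have "\<dots> = (1 - t) * ((\<Sum>i<N. recourse I x (As i)) / real N) + t * ((\<Sum>i<N. recourse I y (As i)) / real N)"
    by (simp add: add_divide_distrib)
  finally have "(\<Sum>i<N. recourse I ?z (As i)) / real N \<le>
    (1 - t) * ((\<Sum>i<N. recourse I x (As i)) / real N) + t * ((\<Sum>i<N. recourse I y (As i)) / real N)" .
  moreover have "0 \<le> mass_hat" using empirical_mass_ge r_pos(1) by linarith
  note shift_gain_convex[OF xy z t this]
  ultimately show ?thesis unfolding fhat_def linear distrib_left by linarith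
qed

end

subsection \<open>Exhausting the simplex\<close>

abbreviation "width \<equiv> real_of_rat (outer_rad I) * (\<Sum>k<m. real_of_rat (cost1 I $ k)) +
  2 * real_of_rat (top_value I)"
abbreviation "\<theta> \<equiv> 1 / real_of_rat (inv_theta I E)"
abbreviation "V \<equiv> real_of_rat (inner_rad I)"

lemma recourse_le_top: "y \<in> feas I \<Longrightarrow> recourse I y U \<le> real_of_rat (top_value I)"
  using nonneg full_scenario[of I] by (simp add: of_rat_top_value nonneg_costs_def)

lemma fhat_le_width:
  assumes As: "\<And>j. j < N \<Longrightarrow> As j \<in> S" and y: "y \<in> feas I"
  shows "fhat As y \<le> width"
proof -
  have "c \<bullet> y \<le> (\<Sum>k<m. real_of_rat (cost1 I $ k) * real_of_rat (outer_rad I))"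
    unfolding dot_eq[OF feas_carrier[OF y]]
    by (intro sum_mono mult_left_mono) (auto simp: feas_le_outer[OF y] cost_nonneg)
  then show ?thesis using fhat_le_full[where As = As, OF As y] recourse_le_top[OF y]
    unfolding sum_distrib_right[symmetric] by (simp add: mult.commute)
qed

context
  assumes top: "0 < top_value I"
begin

lemma width_ge: "2 * real_of_rat (top_value I) \<le> width"
  using rads(1) by (auto intro!: mult_nonneg_nonneg sum_nonneg simp: cost_nonneg zero_le_of_rat_iff)

lemma of_rat_inv_theta: "real_of_rat (inv_theta I E) =
  (real E * real_of_rat (lam I)) * width / (r * real_of_rat (top_value I))"
  by (simp add: inv_theta_def of_rat_divide of_rat_mult of_rat_add of_rat_sum)

lemma inv_theta_ge_1: "1 \<le> real_of_rat (inv_theta I E)"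
proof -
  have l: "1 \<le> real_of_rat (lam I)" and E1: "1 \<le> real E" and t: "0 < real_of_rat (top_value I)" using lam E_pos top
    by simp_all
  have "1 * (2 * real_of_rat (top_value I)) \<le> (real E * real_of_rat (lam I)) * width"
    using E1 l width_ge t mult_mono[of 1 "real E" 1 "real_of_rat (lam I)"] by (intro mult_mono) auto
  moreover have "r * real_of_rat (top_value I) \<le> 1 * real_of_rat (top_value I)" using r_pos t
    by (intro mult_right_mono) auto
  ultimately have "r * real_of_rat (top_value I) \<le> (real E * real_of_rat (lam I)) * width" using t by linarith
  moreover have "0 < r * real_of_rat (top_value I)" using r_pos(1) t by (rule mult_pos_pos)
  ultimately show ?thesis unfolding of_rat_inv_theta by (simp add: le_divide_eq)
qed

lemma theta_bounds: "0 < \<theta>" "\<theta> \<le> 1"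
  using inv_theta_ge_1 by (simp_all add: divide_le_eq)

lemma theta_width_le:
  assumes y: "y \<in> feas I"
  shows "\<theta> * width \<le> h y / real E"
proof -
  have l: "0 < real_of_rat (lam I)" and E0: "0 < real E" using lam E_pos by simp_all
  have "0 < real_of_rat (top_value I)" using top by simp
  then have w: "0 < width" using width_ge by linarith
  have cancel: "1 / (a * l * w / b) * w = (b / l) / a" if "w > 0" "a > 0" "l > 0" for a l w b :: real using that
    by (simp add: field_simps)
  have "\<theta> * width = (r * real_of_rat (top_value I) / real_of_rat (lam I)) / real E"
    unfolding of_rat_inv_theta by (rule cancel[OF w E0 l])
  also have "r * real_of_rat (top_value I) / real_of_rat (lam I) \<le> h y" using top_le_robust[OF y] l
    by (simp add: divide_le_eq mult.commute)
  finally show ?thesis using E0 by (simp add: divide_right_mono)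
qed

lemma volume_budget: "real (Suc m) * real R * real_of_rat (inv_theta I E) / V \<le> 2 ^ log_ratio I E"
proof -
  have "real_of_rat (vol_ratio I E) \<le> real_of_rat (2 ^ log_ratio I E)" using vol_ratio_le
    by (simp only: of_rat_less_eq)
  then show ?thesis by (simp add: vol_ratio_def of_rat_divide of_rat_mult of_rat_add of_rat_power add.commute)
qed

lemma R_le_log_ratio: "R \<le> 2 ^ log_ratio I E"
proof -
  have V: "0 < V" "V \<le> 1" using rads by simp_all
  have "real R * 1 \<le> (real (Suc m) * real R) * real_of_rat (inv_theta I E)"
    using inv_theta_ge_1 mult_right_mono[of 1 "real (Suc m)" "real R"] by (intro mult_mono) auto
  also have "\<dots> \<le> real (Suc m) * real R * real_of_rat (inv_theta I E) / V"
    using V inv_theta_ge_1 by (simp add: le_divide_eq mult_left_le)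
  also have "\<dots> \<le> 2 ^ log_ratio I E" by (rule volume_budget)
  finally have "real R \<le> real (2 ^ log_ratio I E)" by simp
  then show ?thesis by (simp only: of_nat_le_iff)
qed

lemma inner_corners:
  obtains w where "\<And>i. w i \<in> feas I" "\<And>i k. k < m \<Longrightarrow> w i $ k = corner_simplex (($) (w 0)) V i k"
proof -
  obtain z where z: "z \<in> carrier_vec m" and ball: "\<And>y. y \<in> carrier_vec m \<Longrightarrow> norm2 (y - z) \<le> V \<Longrightarrow> y \<in> feas I"
    using rounded unfolding well_rounded_def by blast
  define w where "w i = Matrix.vec m (\<lambda>k. z $ k + (if i = Suc k then V else 0))" for i
  have V: "0 < V" using rads by simp
  have "w i \<in> feas I" for i
  proof (rule ball)
    have "w i - z = Matrix.vec m (\<lambda>k. if i = Suc k then V else 0)" using z by (auto simp: w_def)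
    then have "(w i - z) \<bullet> (w i - z) = (\<Sum>k = 0..<m. if i = Suc k then V * V else 0)"
      by (simp add: scalar_prod_def if_distrib cong: if_cong)
    also have "\<dots> \<le> (\<Sum>k = 0..<m. if k = i - 1 then V * V else 0)" by (intro sum_mono) auto
    also have "\<dots> \<le> V\<^sup>2" by (simp add: power2_eq_square)
    finally show "norm2 (w i - z) \<le> V" unfolding norm2_def using V by (intro real_le_lsqrt) auto
  qed (simp add: w_def)
  then show thesis by (rule that[of w]) (simp add: w_def corner_simplex_def)
qed

text \<open>A small copy, near \<open>x\<close>, of a simplex contained in the polytope.\<close>

lemma probes:
  assumes x: "x \<in> feas I"
  obtains q where "\<And>i. q i \<in> feas I" "\<And>i k. k < m \<Longrightarrow> q i $ k = corner_simplex (($) (q 0)) (\<theta> * V) i k"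
    "\<And>As i. (\<And>j. j < N \<Longrightarrow> As j \<in> S) \<Longrightarrow> fhat As (q i) \<le> fhat As x + h x / real E"
proof -
  obtain w where w: "\<And>i. w i \<in> feas I" "\<And>i k. k < m \<Longrightarrow> w i $ k = corner_simplex (($) (w 0)) V i k"
    by (rule inner_corners) blast
  define q where "q i = (1 - \<theta>) \<cdot>\<^sub>v x + \<theta> \<cdot>\<^sub>v w i" for i
  have t: "0 \<le> \<theta>" "\<theta> \<le> 1" using theta_bounds by linarith+
  have dim: "dim_vec x = m" "dim_vec (w i) = m" for i using feas_carrier[OF x] feas_carrier[OF w(1), of i] by auto
  show thesis
  proof (rule that[of q])
    show "q i \<in> feas I" for i using basic polytope_convex[OF _ x w(1) t] by (auto simp: q_def basic_data_def)
    show "q i $ k = corner_simplex (($) (q 0)) (\<theta> * V) i k" if "k < m" for i k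
      using that w(2)[OF that, of i] dim by (auto simp: q_def corner_simplex_def distrib_left)
    fix As i assume As: "\<And>j. j < N \<Longrightarrow> As j \<in> S"
    have "fhat As (q i) \<le> (1 - \<theta>) * fhat As x + \<theta> * fhat As (w i)" unfolding q_def
      by (rule fhat_convex[OF As x w(1) t])
    also have "\<dots> \<le> 1 * fhat As x + \<theta> * width"
      using t fhat_nonneg[OF As x] fhat_le_width[OF As w(1)]
      by (intro add_mono mult_left_mono mult_right_mono) auto
    also have "\<dots> \<le> fhat As x + h x / real E" using theta_width_le[OF x] by simp
    finally show "fhat As (q i) \<le> fhat As x + h x / real E" .
  qed
qed

lemma final_volume_less:
  assumes m: "0 < m"
  shows "fact (Suc m) * (exp (- real T / (32 * real m ^ 2)) * real R ^ m) < (\<theta> * V) ^ m"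
proof -
  let ?l = "log_ratio I E"
  have "0 < R" using m by (simp add: simplex_size_def)
  have "real m * real ?l < real T / (32 * real m ^ 2)"
    using m by (simp add: n_cuts_def grid_den_def field_simps power2_eq_square)
  then have "exp (- real T / (32 * real m ^ 2)) < exp (- (real m * real ?l))" by simp
  also have "\<dots> = exp (- 1) ^ (?l * m)" by (simp add: mult.commute flip: exp_of_nat_mult)
  also have "\<dots> \<le> (1 / 2) ^ (?l * m)"
  proof (rule power_mono)
    have "(2::real) \<le> exp 1" using exp_ge_add_one_self[of 1] by simp
    then show "exp (- 1) \<le> 1 / (2::real)" by (simp add: exp_minus field_simps)
  qed simp
  finally have "fact (Suc m) * (exp (- real T / (32 * real m ^ 2)) * real R ^ m) < fact (Suc m) *
    ((1 / 2) ^ (?l * m) * real R ^ m)"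
    using \<open>0 < R\<close> by (intro mult_strict_left_mono mult_strict_right_mono) auto
  also have "\<dots> \<le> real (Suc m) ^ m * ((1 / 2) ^ (?l * m) * real R ^ m)"
    by (intro mult_right_mono fact_Suc_le_power) auto
  also have "\<dots> = (real (Suc m) * ((1 / 2) ^ ?l * real R)) ^ m" by (simp only: power_mult power_mult_distrib)
  also have "\<dots> \<le> (\<theta> * V) ^ m"
  proof (rule power_mono)
    have cancel: "a * (1 / p * b) \<le> 1 / i * v" if "a * b * i / v \<le> p" "0 < p" "0 < i" "0 < v" for a b i v p :: real
      using that by (simp add: field_simps)
    show "real (Suc m) * ((1 / 2) ^ ?l * real R) \<le> \<theta> * V"
      unfolding power_one_over by (rule cancel[OF volume_budget]) (use inv_theta_ge_1 rads in auto)
  qed simp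
  finally show ?thesis .
qed

lemma best_cost_le:
  assumes As: "\<And>j. j < N \<Longrightarrow> As j \<in> S" and m: "0 < m" and enclosed: "cheaper_enclosed As T L" and x: "x \<in> feas I"
  shows "real_of_rat (L best_cost_r 0) \<le> fhat As x + h x / real E"
proof (rule ccontr)
  assume "\<not> real_of_rat (L best_cost_r 0) \<le> fhat As x + h x / real E"
  then have expensive: "fhat As x + h x / real E < real_of_rat (L best_cost_r 0)" by simp
  obtain q where q: "\<And>i. q i \<in> feas I" "\<And>i k. k < m \<Longrightarrow> q i $ k = corner_simplex (($) (q 0)) (\<theta> * V) i k"
    "\<And>i. fhat As (q i) \<le> fhat As x + h x / real E" using probes[OF x] As by metis
  have cheap: "q i \<in> cheaper As L" for i using q(1,3)[of i] expensive by (simp add: cheaper_def)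
  have "(\<theta> * V) ^ m = simplex_vol m (\<lambda>i. ($) (q i))"
    using simplex_vol_cong[of m "\<lambda>i. ($) (q i)" "corner_simplex (($) (q 0)) (\<theta> * V)"] q(2) simplex_vol_corner
      theta_bounds rads by simp
  also have "\<dots> \<le> fact (Suc m) * simplex_vol m (real_vertex L)"
    using enclosed m cheap by (intro simplex_vol_le) (simp add: cheaper_enclosed_def)
  also have "\<dots> \<le> fact (Suc m) * (exp (- real T / (32 * real m ^ 2)) * real R ^ m)"
    using enclosed m cheap by (intro mult_left_mono) (auto simp: cheaper_enclosed_def)
  finally show False using final_volume_less[OF m] by linarith
qed

end

end

subsection \<open>Success probability\<close>

lemma tail_bound:
  fixes \<eta> n :: real
  assumes "real (a + 2 + d) \<le> n * \<eta>\<^sup>2"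
  shows "2 ^ (a + 2) * (2 * exp (- 2 * n * \<eta>\<^sup>2)) \<le> (1 / 2) ^ d"
proof -
  have "exp (- 2 * n * \<eta>\<^sup>2) \<le> exp (- (2 * real (a + 2 + d)))" using assms by simp
  also have "\<dots> = exp (real (a + 2 + d) * - 2)" by simp
  also have "\<dots> = exp (- 2) ^ (a + 2 + d)" by (rule exp_of_nat_mult)
  also have "\<dots> \<le> (1 / 4) ^ (a + 2 + d)"
  proof (rule power_mono)
    have "(2::real) \<le> exp 1" using exp_ge_add_one_self[of 1] by simp
    then have "(2::real) * 2 \<le> exp 1 * exp 1" by (intro mult_mono) auto
    then have "4 \<le> exp (2::real)" by (simp flip: exp_add)
    then show "exp (- 2) \<le> 1 / (4::real)" by (simp add: exp_minus field_simps)
  qed simp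
  finally have "2 ^ (a + 2) * (2 * exp (- 2 * n * \<eta>\<^sup>2)) \<le> 2 ^ (a + 2) * (2 * (1 / 4) ^ (a + 2 + d))" by simp
  also have "\<dots> = 2 * (1 / 2) ^ (a + 2) * (1 / 4) ^ d"
    using power_mult_distrib[of "2::real" "1 / 4" "a + 2"] by (simp add: power_add)
  also have "\<dots> \<le> 1 * (1 / 2) ^ d"
    using power_le_one[of "1 / 2 :: real" a] by (intro mult_mono power_mono) (auto simp: power_add)
  finally show ?thesis by simp
qed

context drso_run
begin

lemma finite_points: "finite points"
  and card_points: "0 < top_value I \<Longrightarrow> card points \<le> 2 ^ log_points I E"
proof -
  let ?Q = "{q. on_grid D T (Suc m * R) q}"
    and ?f = "\<lambda>x. restrict (\<lambda>k. x $ k * of_nat (Suc m)) {..<m} :: nat \<Rightarrow> rat"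
  have image: "?f ` points \<subseteq> PiE {..<m} (\<lambda>_. ?Q)"
    by (intro image_subsetI restrict_PiE_iff[THEN iffD2]) (simp add: points_def del: of_nat_Suc)
  have inj: "inj_on ?f points"
  proof (rule inj_onI)
    fix x y assume xy: "x \<in> points" "y \<in> points" "?f x = ?f y"
    have "x $ k = y $ k" if "k < m" for k
      using fun_cong[OF xy(3), of k] that by (simp del: of_nat_Suc)
    then show "x = y" using xy(1,2) by (intro eq_vecI) (auto simp: points_def)
  qed
  have finite: "finite (PiE {..<m} (\<lambda>_. ?Q))" using card_on_grid(1) by (intro finite_PiE) auto
  show "finite points" using finite_imageD[OF finite_subset[OF image finite] inj] .
  assume top: "0 < top_value I"
  let ?k = "T * D + 2 * T + log_ratio I E + (m + 1)"
  have "Suc m * R * 3 ^ T * D ^ T = (3 ^ T * D ^ T) * R * Suc m" by (simp only: mult_ac)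
  also have "\<dots> \<le> 2 ^ (T * D + 2 * T) * 2 ^ log_ratio I E * 2 ^ (m + 1)"
    using grid_power_le[of T T D] R_le_log_ratio[OF top] le_two_power[of "Suc m" "m + 1"] by (intro mult_mono) auto
  finally have grid: "Suc m * R * 3 ^ T * D ^ T \<le> 2 ^ ?k" by (simp add: power_add)
  have "card points \<le> card (PiE {..<m} (\<lambda>_. ?Q))" using card_inj_on_le[OF inj image finite] .
  also have "\<dots> = card ?Q ^ m" by (simp add: card_PiE)
  also have "\<dots> \<le> (2 ^ (?k + 2)) ^ m"
  proof (rule power_mono)
    have "2 * (Suc m * R * 3 ^ T * D ^ T) + 1 \<le> 2 * 2 ^ ?k + 2 ^ ?k" using grid one_le_power[of "2::nat" ?k]
      by linarith
    also have "\<dots> \<le> 2 ^ (?k + 2)" by (simp add: power_add)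
    finally show "card ?Q \<le> 2 ^ (?k + 2)" using card_on_grid(2)[of D T "Suc m * R"] by linarith
  qed simp
  also have "\<dots> = 2 ^ (m * (?k + 2))" by (simp only: power_mult[symmetric] mult.commute)
  also have "\<dots> \<le> 2 ^ log_points I E"
    unfolding log_points_def by (intro power_increasing mult_left_mono) (auto simp: algebra_simps)
  finally show "card points \<le> 2 ^ log_points I E" .
qed

definition relative_cost :: "real Matrix.vec \<Rightarrow> nat set \<Rightarrow> real" where
  "relative_cost y A = recourse I y A / recourse I y U"

definition test_functions :: "real Matrix.vec set \<Rightarrow> (nat set \<Rightarrow> real) set" where
  "test_functions Y = (\<lambda>A. indicator {A}) ` S \<union> relative_cost ` Y"

lemma test_function_range:
  assumes "Y \<subseteq> feas I" "\<phi> \<in> test_functions Y" "A \<in> S"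
  shows "0 \<le> \<phi> A \<and> \<phi> A \<le> 1"
proof -
  consider (indicator) B where "\<phi> = indicator {B}" | (cost) y where "y \<in> Y" "\<phi> = relative_cost y" using assms(2)
    by (auto simp: test_functions_def)
  then show ?thesis
  proof cases
    case indicator
    then show ?thesis by (simp add: indicator_def)
  next
    case cost
    then have "0 \<le> recourse I y A" "recourse I y A \<le> recourse I y U"
      using recourse_nonneg recourse_le_full assms(1,3) by blast+
    then show ?thesis using cost by (simp add: relative_cost_def divide_le_eq_1) linarith
  qed
qed

lemma representative_of_deviations:
  assumes As: "\<And>j. j < N \<Longrightarrow> As j \<in> S" and y: "y \<in> feas I" "y \<in> Y"
    and dev: "\<And>\<phi>. \<phi> \<in> test_functions Y \<Longrightarrow> \<bar>(\<Sum>i<N. \<phi> (As i)) / real N - measure_pmf.expectation (center I) \<phi>\<bar> \<le> \<eta>"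
  shows "representative As y"
  unfolding representative_def
proof (intro conjI ballI)
  fix A assume A: "A \<in> S"
  have "(\<Sum>i<N. indicator {A} (As i)) = (\<Sum>i<N. if As i = A then 1 else 0 :: real)" by (intro sum.cong refl) simp
  then have "empirical N As A = (\<Sum>i<N. indicator {A} (As i)) / real N"
    by (simp add: empirical_def sum_indicator_lessThan)
  moreover have "measure_pmf.expectation (center I) (indicator {A}) = pmf (center I) A" by (simp add: pmf.rep_eq)
  ultimately show "\<bar>empirical N As A - pmf (center I) A\<bar> \<le> \<eta>" using dev[of "indicator {A}"] A
    by (simp add: test_functions_def)
next
  let ?mean = "(\<Sum>i<N. recourse I y (As i)) / real N" and ?full = "recourse I y U"
  have full: "0 \<le> ?full" by (rule recourse_nonneg[OF y(1) full_scenario])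
  show "\<bar>?mean - mean y\<bar> \<le> \<eta> * ?full"
  proof (cases "?full = 0")
    case True
    have "recourse I y A = 0" if "A \<in> S" for A
      using recourse_nonneg[OF y(1) that] recourse_le_full[OF y(1) that] True by simp
    moreover have "mean y = 0" using expectation_nonneg[OF y(1) center] expectation_le_full[OF y(1) center] True
      by linarith
    ultimately show ?thesis using As True by simp
  next
    case False
    have "\<bar>(\<Sum>i<N. relative_cost y (As i)) / real N - measure_pmf.expectation (center I) (relative_cost y)\<bar> \<le> \<eta>"
      using dev y(2) by (simp add: test_functions_def)
    moreover have "(\<Sum>i<N. relative_cost y (As i)) / real N = ?mean / ?full"
      by (simp add: relative_cost_def sum_divide_distrib mult.commute)
    moreover have "measure_pmf.expectation (center I) (relative_cost y) = mean y / ?full"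
      by (simp add: relative_cost_def[abs_def])
    ultimately have "\<bar>?mean - mean y\<bar> / ?full \<le> \<eta>"
      using full by (simp only: diff_divide_distrib[symmetric] abs_divide abs_of_nonneg)
    then show ?thesis using False full by (simp add: divide_le_eq)
  qed
qed

lemma n_samples_ge: "real (usize I + log_points I E + 2 + \<Delta>) \<le> real N * \<eta>\<^sup>2"
proof -
  let ?q = "16 * (of_nat E * of_nat E) / ((radius I * radius I) * (radius I * radius I)) *
    ((of_nat (usize I) + of_nat (log_points I E)) + (2 + of_nat \<Delta>)) :: rat"
  have "0 \<le> ?q" using radius by simp
  then have "?q \<le> of_nat N" unfolding n_samples_def by linarith
  then have "real_of_rat ?q \<le> real_of_rat (of_nat N)" by (simp only: of_rat_less_eq)
  then have "16 * (real E)\<^sup>2 / r ^ 4 * real (usize I + log_points I E + 2 + \<Delta>) \<le> real N"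
    by (simp add: of_rat_divide of_rat_mult of_rat_add power2_eq_square power4_eq_xxxx mult_ac add_ac)
  from mult_right_mono[OF this, of "\<eta>\<^sup>2"] show ?thesis
    using E_pos r_pos(1) by (simp add: power_divide power_mult_distrib flip: power_mult)
qed

lemma card_test_functions:
  assumes "0 < top_value I"
  shows "card (test_functions (insert x (real_vec ` points \<inter> feas I))) \<le> 2 ^ (usize I + log_points I E + 2)"
proof -
  let ?Y = "insert x (real_vec ` points \<inter> feas I)"
  have "card (test_functions ?Y) \<le> card S + card ?Y"
    unfolding test_functions_def using finite_scenarios finite_points
    by (intro order_trans[OF card_Un_le] add_mono card_image_le) auto
  moreover have "card S = 2 ^ usize I" by (simp add: scenarios_def ground_def card_Pow)
  moreover have "card (real_vec ` points \<inter> feas I) \<le> card points"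
    using finite_points by (intro order_trans[OF card_mono card_image_le]) auto
  then have "card ?Y \<le> Suc (2 ^ log_points I E)"
    using card_points[OF assms] card_insert_le_m1[of "Suc (card points)" "real_vec ` points \<inter> feas I" x] by simp
  moreover have "a + Suc b \<le> a * b * 4" if "1 \<le> a" "1 \<le> b" for a b :: nat
  proof -
    have "a * 1 \<le> a * b" "1 * b \<le> a * b" using that by (intro mult_mono; simp)+
    then show ?thesis using that by linarith
  qed
  from this[of "2 ^ usize I" "2 ^ log_points I E"]
  have "2 ^ usize I + Suc (2 ^ log_points I E) \<le> (2::nat) ^ usize I * 2 ^ log_points I E * 4" by simp
  ultimately show ?thesis by (simp add: power_add)
qed

lemma representative_prob:
  assumes top: "0 < top_value I" and x: "x \<in> feas I"
  shows "measure_pmf.prob (replicate_pmf N (center I))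
    {ws. \<exists>y\<in>insert x (real_vec ` points \<inter> feas I). \<not> representative ((!) ws) y} \<le> (1 / 2) ^ \<Delta>"
proof -
  let ?P = "replicate_pmf N (center I)" and ?Y = "insert x (real_vec ` points \<inter> feas I)"
  let ?bad = "{ws. \<exists>\<phi>\<in>test_functions ?Y. \<bar>(\<Sum>i<N. \<phi> (ws ! i)) / real N - measure_pmf.expectation (center I) \<phi>\<bar> \<ge> \<eta>}"
  have Y: "?Y \<subseteq> feas I" "finite ?Y" using x finite_points by auto
  have \<eta>: "0 < \<eta>" using r_pos(1) E_pos by simp
  have "representative ((!) ws) y" if "ws \<in> set_pmf ?P" "ws \<notin> ?bad" "y \<in> ?Y" for ws y
    using that Y(1) sample_in_scenarios(2)
    by (intro representative_of_deviations[where Y = ?Y]) (auto simp: not_le)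
  then have "measure_pmf.prob ?P {ws. \<exists>y\<in>?Y. \<not> representative ((!) ws) y} \<le> measure_pmf.prob ?P ?bad"
    by (intro measure_pmf.finite_measure_mono_AE) (auto simp: AE_measure_pmf_iff)
  also have "\<dots> \<le> real (card (test_functions ?Y)) * (2 * exp (- 2 * real N * \<eta>\<^sup>2))"
    using Y center finite_scenarios \<eta> N_pos test_function_range[OF Y(1)]
    by (intro replicate_pmf_uniform_deviation) (auto simp: test_functions_def)
  also have "\<dots> \<le> 2 ^ (usize I + log_points I E + 2) * (2 * exp (- 2 * real N * \<eta>\<^sup>2))"
  proof (rule mult_right_mono)
    have "real (card (test_functions ?Y)) \<le> real (2 ^ (usize I + log_points I E + 2))"
      using card_test_functions[OF top, of x] by (simp only: of_nat_le_iff)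
    then show "real (card (test_functions ?Y)) \<le> 2 ^ (usize I + log_points I E + 2)" by simp
  qed simp
  also have "\<dots> \<le> (1 / 2) ^ \<Delta>" by (rule tail_bound[OF n_samples_ge])
  finally show ?thesis .
qed

abbreviation "solution L \<equiv> real_vec (get_vec answer_r m L)"
abbreviation "opt \<equiv> INF x\<in>feas I. h x"

lemma opt_nonneg: "0 \<le> opt"
  using zero_feas robust_nonneg by (intro cINF_greatest) auto

lemma near_optimal_exists:
  assumes top: "0 < top_value I"
  obtains x where "x \<in> feas I" "h x < (1 + 1 / real E) * opt"
proof -
  have "0 < r * real_of_rat (top_value I) / real_of_rat (lam I)" using top r_pos(1) lam
    by (intro divide_pos_pos mult_pos_pos) auto
  also have "\<dots> \<le> opt"
  proof (rule cINF_greatest)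
    fix x assume "x \<in> feas I"
    then show "r * real_of_rat (top_value I) / real_of_rat (lam I) \<le> h x"
      using top_le_robust[of x] lam by (simp add: divide_le_eq mult.commute)
  qed (use zero_feas in blast)
  finally have "opt < (1 + 1 / real E) * opt" using E_pos by (simp add: distrib_right)
  then show thesis using that cInf_lessD[of "h ` feas I" "(1 + 1 / real E) * opt"] zero_feas by blast
qed

lemma tracked_near_optimal:
  assumes top: "0 < top_value I" and m: "0 < m" and As: "\<And>j. j < N \<Longrightarrow> As j \<in> S" and L: "tracked As T L"
    and x: "x \<in> feas I" "h x < (1 + 1 / real E) * opt"
    and rep: "representative As x" "representative As (solution L)"
  shows "h (solution L) \<le> 2 * (1 + 1 / real E) ^ 3 * opt"
proof -
  let ?e = "1 / real E"
  have answer: "solution L \<in> feas I" "fhat As (solution L) \<le> real_of_rat (L best_cost_r 0)"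
    and enclosed: "cheaper_enclosed As T L"
    using L by (auto simp: tracked_def answer_recorded_def)
  have "fhat As (solution L) \<le> fhat As x + h x / real E"
    using answer(2) best_cost_le[OF top As m enclosed x(1)] by linarith
  then have "fhat As (solution L) \<le> (2 + 2 * ?e) * h x"
    using fhat_le_robust[OF As x(1) rep(1)] by (simp add: distrib_right)
  also have "\<dots> \<le> (2 + 2 * ?e) * ((1 + ?e) * opt)" using x(2) by (intro mult_left_mono) auto
  finally have "(1 + ?e) * fhat As (solution L) \<le> (1 + ?e) * ((2 + 2 * ?e) * ((1 + ?e) * opt))"
    by (intro mult_left_mono) auto
  moreover have "(1 + e) * ((2 + 2 * e) * ((1 + e) * b)) = 2 * (1 + e) ^ 3 * b" for e b :: real
    by (simp add: power3_eq_cube algebra_simps)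
  ultimately have "(1 + ?e) * fhat As (solution L) \<le> 2 * (1 + ?e) ^ 3 * opt" by (simp only:)
  then show ?thesis using robust_le_fhat[OF As answer(1) rep(2)] by linarith
qed

lemma tracked_optimal_degenerate:
  assumes degenerate: "\<not> (0 < top_value I \<and> 0 < m)" and As: "\<And>j. j < N \<Longrightarrow> As j \<in> S" and L: "tracked As T L"
  shows "h (solution L) \<le> opt"
proof (cases "m = 0")
  case True
  have "h (solution L) \<le> h x" if "x \<in> feas I" for x
  proof -
    have "solution L = x" using feas_carrier[OF that] True by (intro eq_vecI) (auto simp: get_vec_def)
    then show ?thesis by simp
  qed
  then show ?thesis using zero_feas by (intro cINF_greatest) auto
next
  case False
  have answer: "solution L \<in> feas I" "fhat As (solution L) \<le> real_of_rat (L best_cost_r 0)"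
    "L best_cost_r 0 \<le> 2 * top_value I"
    using L by (auto simp: tracked_def answer_recorded_def)
  have top: "top_value I = 0" using degenerate False top_value_nonneg by simp
  have "real_of_rat (L best_cost_r 0) \<le> real_of_rat 0" using answer(3) top by (simp only: of_rat_less_eq)
  moreover have "c \<bullet> solution L \<le> fhat As (solution L)" using As answer(1) by (rule dot_le_fhat)
  ultimately have "c \<bullet> solution L \<le> 0" using answer(2) by (simp only: of_rat_0)
  moreover have "recourse I (solution L) U \<le> 0" using recourse_le_top[OF answer(1)] top by simp
  ultimately show ?thesis using robust_le_full[OF answer(1)] opt_nonneg by linarith
qed

lemma success_prob:
  fixes L :: "nat set list \<Rightarrow> memory"
  assumes L: "\<And>ws. ws \<in> set_pmf (replicate_pmf N (center I)) \<Longrightarrow> tracked ((!) ws) T (L ws)"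
  shows "1 - (1 / 2) ^ \<Delta> \<le> measure_pmf.prob
    (replicate_pmf N (center I)) {ws. h (solution (L ws)) \<le> 2 * (1 + 1 / real E) ^ 3 * opt}"
    (is "_ \<le> measure_pmf.prob ?P ?good")
proof (cases "0 < top_value I \<and> 0 < m")
  case True
  obtain x where x: "x \<in> feas I" "h x < (1 + 1 / real E) * opt" using near_optimal_exists True by blast
  let ?bad = "{ws. \<exists>y\<in>insert x (real_vec ` points \<inter> feas I). \<not> representative ((!) ws) y}"
  have good: "ws \<in> ?good" if "ws \<in> set_pmf ?P" "ws \<notin> ?bad" for ws
  proof -
    have "solution (L ws) \<in> real_vec ` points \<inter> feas I" using L[OF that(1)]
      by (auto simp: tracked_def answer_recorded_def)
    then show ?thesis
      using True that(2) tracked_near_optimal[OF _ _ sample_in_scenarios(2)[OF that(1)] L[OF that(1)] x] by auto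
  qed
  have "1 - (1 / 2) ^ \<Delta> \<le> 1 - measure_pmf.prob ?P ?bad" using representative_prob[OF _ x(1)] True by simp
  also have "\<dots> = measure_pmf.prob ?P (UNIV - ?bad)" using measure_pmf.prob_compl[of ?bad ?P] by simp
  also have "\<dots> \<le> measure_pmf.prob ?P ?good"
    using good by (intro measure_pmf.finite_measure_mono_AE) (auto simp: AE_measure_pmf_iff)
  finally show ?thesis .
next
  case False
  have "1 \<le> (1 + 1 / real E) ^ 3" by (intro one_le_power) simp
  then have "1 \<le> 2 * (1 + 1 / real E) ^ 3" by linarith
  from mult_right_mono[OF this opt_nonneg] have "opt \<le> 2 * (1 + 1 / real E) ^ 3 * opt" by simp
  then have "measure_pmf.prob ?P ?good = 1"
    using tracked_optimal_degenerate[OF False sample_in_scenarios(2) L]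
    by (subst measure_pmf.prob_eq_1) (auto simp: AE_measure_pmf_iff intro: order_trans)
  then show ?thesis by simp
qed

lemma main_run:
  assumes "mem_fits B M" "inputs M" "get_vec answer_r m M = 0\<^sub>v m"
  obtains F where "runs I main_prog M (replicate_pmf N (center I)) F"
    "\<And>ws. ws \<in> set_pmf (replicate_pmf N (center I)) \<Longrightarrow>
      snd (F ws) \<le> ticks Z main_prog * W \<and> solution (fst (F ws)) \<in> feas I"
    "1 - (1 / 2) ^ \<Delta> \<le> measure_pmf.prob
      (replicate_pmf N (center I)) {ws. h (solution (fst (F ws))) \<le> 2 * (1 + 1 / real E) ^ 3 * opt}"
proof -
  let ?P = "replicate_pmf N (center I)"
  have "inputs (visible M)" using assms(2) by (simp add: inputs_def)
  moreover have same: "get_vec answer_r m (visible M') = get_vec answer_r m M'" for M'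
    by (rule get_vec_visible) simp
  ultimately obtain F where F: "runs I main_prog M ?P F"
    "\<And>ws. ws \<in> set_pmf ?P \<Longrightarrow> snd (F ws) \<le> ticks Z main_prog * W \<and> tracked ((!) ws) T (visible (fst (F ws)))"
    using drawsD[OF draws_main assms(1)] assms(3) unfolding yields_def by auto
  show thesis
  proof (rule that[OF F(1)])
    show "snd (F ws) \<le> ticks Z main_prog * W \<and> solution (fst (F ws)) \<in> feas I" if "ws \<in> set_pmf ?P" for ws
      using F(2)[OF that] by (auto simp: tracked_def answer_recorded_def same)
    show "1 - (1 / 2) ^ \<Delta> \<le> measure_pmf.prob ?P {ws. h (solution (fst (F ws))) \<le> 2 * (1 + 1 / real E) ^ 3 * opt}"
      using success_prob[of "\<lambda>ws. visible (fst (F ws))"] F(2) by (simp add: same)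
  qed
qed

end

subsection \<open>Polynomial running time\<close>

definition poly_bounded :: "'a set \<Rightarrow> ('a \<Rightarrow> real) \<Rightarrow> ('a \<Rightarrow> real) \<Rightarrow> bool" where
  "poly_bounded A X f \<longleftrightarrow> (\<exists>p. \<forall>a\<in>A. \<bar>f a\<bar> \<le> poly p (X a))"

lemma poly_bounded_mono:
  assumes "poly_bounded A X g" "\<And>a. a \<in> A \<Longrightarrow> \<bar>f a\<bar> \<le> g a"
  shows "poly_bounded A X f"
  using assms unfolding poly_bounded_def by (meson abs_ge_self order_trans)

lemma poly_bounded_const: "poly_bounded A X (\<lambda>_. b)"
  unfolding poly_bounded_def by (intro exI[of _ "[:\<bar>b\<bar>:]"]) simp

lemma poly_bounded_add:
  assumes "poly_bounded A X f" "poly_bounded A X g"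
  shows "poly_bounded A X (\<lambda>a. f a + g a)"
proof -
  obtain p q where "\<And>a. a \<in> A \<Longrightarrow> \<bar>f a\<bar> \<le> poly p (X a)" "\<And>a. a \<in> A \<Longrightarrow> \<bar>g a\<bar> \<le> poly q (X a)"
    using assms unfolding poly_bounded_def by blast
  then show ?thesis unfolding poly_bounded_def
    by (intro exI[of _ "p + q"] ballI order_trans[OF abs_triangle_ineq]) (simp add: add_mono)
qed

lemma poly_bounded_mult:
  assumes "poly_bounded A X f" "poly_bounded A X g"
  shows "poly_bounded A X (\<lambda>a. f a * g a)"
proof -
  obtain p q where "\<And>a. a \<in> A \<Longrightarrow> \<bar>f a\<bar> \<le> poly p (X a)" "\<And>a. a \<in> A \<Longrightarrow> \<bar>g a\<bar> \<le> poly q (X a)"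
    using assms unfolding poly_bounded_def by blast
  then show ?thesis unfolding poly_bounded_def
    by (intro exI[of _ "p * q"] ballI) (auto simp: abs_mult intro!: mult_mono intro: order_trans[OF abs_ge_zero])
qed

lemmas poly_bounded_intros = poly_bounded_const poly_bounded_add poly_bounded_mult

lemma poly_bounded_power: "poly_bounded A X f \<Longrightarrow> poly_bounded A X (\<lambda>a. f a ^ n)"
  by (induction n) (simp_all add: poly_bounded_intros)

lemma poly_bounded_poly: "poly_bounded A X f \<Longrightarrow> poly_bounded A X (\<lambda>a. poly p (f a))"
  by (induction p) (simp_all add: poly_bounded_intros)

lemma poly_bounded_ticks: "poly_bounded A X (\<lambda>a. real (z a)) \<Longrightarrow> poly_bounded A X (\<lambda>a. real (ticks (z a) prog))"
  by (induction prog) (auto intro!: poly_bounded_intros)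

lemma abs_poly_le_poly_abs:
  fixes p :: "real poly"
  assumes "0 \<le> x" "x \<le> y"
  shows "\<bar>poly p x\<bar> \<le> poly (map_poly abs p) y"
proof (induction p)
  case (pCons b p)
  have "\<bar>poly (pCons b p) x\<bar> \<le> \<bar>b\<bar> + x * \<bar>poly p x\<bar>" using assms
    by (simp add: abs_mult order_trans[OF abs_triangle_ineq])
  also have "x * \<bar>poly p x\<bar> \<le> y * poly (map_poly abs p) y" using assms pCons.IH by (intro mult_mono) auto
  finally show ?case by (simp add: map_poly_pCons)
qed simp

definition oracle_max :: "drso \<Rightarrow> nat \<Rightarrow> nat" where
  "oracle_max I n = Max (orc_time I ` {..n})"

definition oracle_bits :: "drso \<Rightarrow> nat \<Rightarrow> nat" where
  "oracle_bits I E = oracle_max I (mdim I * (2 * point_bits I E + 3) + usize I)"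

definition word_bits :: "drso \<Rightarrow> nat \<Rightarrow> nat \<Rightarrow> nat" where
  "word_bits I E \<Delta> = cell_bits I E \<Delta> (oracle_bits I E) + loop_bound I E \<Delta> (oracle_bits I E) + 10"

definition step_time :: "drso \<Rightarrow> nat \<Rightarrow> nat \<Rightarrow> nat" where
  "step_time I E \<Delta> = 2 * (2 * (40 * (word_bits I E \<Delta> + 1)) + 3) + 1 +
    (1 + (mdim I * (2 * word_bits I E \<Delta> + 3) + usize I) +
      oracle_max I (mdim I * (2 * word_bits I E \<Delta> + 3) + usize I)) + (1 + usize I)"

definition max_steps :: "drso \<Rightarrow> nat \<Rightarrow> nat \<Rightarrow> nat" where
  "max_steps I E \<Delta> = ticks (loop_bound I E \<Delta> (oracle_bits I E)) main_prog * step_time I E \<Delta>"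

lemma oracle_max_ge: "b \<le> n \<Longrightarrow> orc_time I b \<le> oracle_max I n"
  unfolding oracle_max_def by (intro Max_ge) auto

lemma oracle_max_attained: "\<exists>b\<le>n. oracle_max I n = orc_time I b"
proof -
  have "oracle_max I n \<in> orc_time I ` {..n}" unfolding oracle_max_def by (intro Max_in) auto
  then show ?thesis by auto
qed

context drso_run
begin

lemma fits_top_value_oracle_max: "fits (oracle_max I (3 * m + usize I)) (top_value I)"
proof (rule fits_mono[OF fits_rat_size])
  have "vec_size (0\<^sub>v m) \<le> 3 * m"
    using sum_bounded_above[of "{..<m}" "\<lambda>i. rat_size (0\<^sub>v m $ i)" 3] rat_size_le[OF fits_0[of 0]]
    by (simp add: vec_size_def)
  then have "orc_time I (vec_size (0\<^sub>v m) + usize I) \<le> oracle_max I (3 * m + usize I)"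
    by (intro oracle_max_ge) simp
  moreover have "rat_size (top_value I) \<le> orc_time I (vec_size (0\<^sub>v m) + usize I)"
    unfolding top_value_def using zero_queryable full_scenario[of I] efficient(2)
    unfolding queryable_def efficient_convex_recourse_def by blast
  ultimately show "rat_size (top_value I) \<le> oracle_max I (3 * m + usize I)" by linarith
qed

lemma n_top_le: "real K \<le> 1 / r + 1"
proof -
  have "of_nat K \<le> 1 / radius I + 1" using radius by (simp add: n_top_def)
  then have "real_of_rat (of_nat K) \<le> real_of_rat (1 / radius I + 1)" by (simp only: of_rat_less_eq)
  then show ?thesis by (simp add: of_rat_add of_rat_divide)
qed

lemma n_samples_le: "real N \<le>
  16 * real E ^ 2 * (1 / r) ^ 4 * (real (usize I) + real (log_points I E) + 2 + real \<Delta>) + 1"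
proof -
  let ?q = "16 * (of_nat E * of_nat E) / ((radius I * radius I) * (radius I * radius I)) *
    ((of_nat (usize I) + of_nat (log_points I E)) + (2 + of_nat \<Delta>)) :: rat"
  have "0 \<le> ?q" using radius by simp
  then have "of_nat N \<le> ?q + 1" unfolding n_samples_def by simp
  then have "real_of_rat (of_nat N) \<le> real_of_rat (?q + 1)" by (simp only: of_rat_less_eq)
  then show ?thesis
    by (simp add: of_rat_divide of_rat_mult of_rat_add power2_eq_square power4_eq_xxxx power_divide add_ac mult_ac)
qed

end

abbreviation "accuracy \<epsilon> \<equiv> nat \<lceil>1 / \<epsilon>\<rceil>"
abbreviation "confidence \<delta> \<equiv> nat \<lceil>log 2 (1 / \<delta>)\<rceil>"

definition input_scale :: "drso \<Rightarrow> real \<Rightarrow> real \<Rightarrow> real" where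
  "input_scale I \<epsilon> \<delta> = real (isize I) + real_of_rat (lam I) / (\<epsilon> * real_of_rat (radius I)) + ln (1 / \<delta>)"

locale drso_query =
  fixes \<pi> :: "real poly" and I :: drso and \<epsilon> \<delta> :: real
  assumes assumptions: "standing_assumptions \<pi> I" "monotone_recourse I"
    and eps: "0 < \<epsilon>" "\<epsilon> \<le> 1 / 3" and delta: "0 < \<delta>" "\<delta> < 1"
begin

abbreviation "E \<equiv> accuracy \<epsilon>"
abbreviation "\<Delta> \<equiv> confidence \<delta>"

lemma accuracy_bounds: "1 / \<epsilon> \<le> real E" "real E \<le> 1 / \<epsilon> + 1" "1 \<le> E"
  and accuracy_rat: "of_int \<lceil>1 / \<epsilon>\<rceil> = (of_nat E :: rat)"
proof -
  have "3 \<le> 1 / \<epsilon>" using eps by (simp add: field_simps)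
  then have real: "real E = of_int \<lceil>1 / \<epsilon>\<rceil>" and rat: "of_int \<lceil>1 / \<epsilon>\<rceil> = (of_nat E :: rat)" by simp_all
  show lower: "1 / \<epsilon> \<le> real E" unfolding real by (rule le_of_int_ceiling)
  show "real E \<le> 1 / \<epsilon> + 1" unfolding real by (rule of_int_ceiling_le_add_one)
  have "0 < E" using eps(1) by simp
  then show "1 \<le> E" by (simp only: One_nat_def Suc_le_eq)
  show "of_int \<lceil>1 / \<epsilon>\<rceil> = (of_nat E :: rat)" by (rule rat)
qed

lemma confidence_bounds: "log 2 (1 / \<delta>) \<le> real \<Delta>" "real \<Delta> \<le> 2 * ln (1 / \<delta>) + 1"
  and confidence_rat: "of_int \<lceil>log 2 (1 / \<delta>)\<rceil> = (of_nat \<Delta> :: rat)"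
proof -
  have "0 < log 2 (1 / \<delta>)" using delta by (subst zero_less_log_cancel_iff) auto
  then have nat: "real \<Delta> = of_int \<lceil>log 2 (1 / \<delta>)\<rceil>" and rat: "of_int \<lceil>log 2 (1 / \<delta>)\<rceil> = (of_nat \<Delta> :: rat)"
    by simp_all
  show "log 2 (1 / \<delta>) \<le> real \<Delta>" unfolding nat by (rule le_of_int_ceiling)
  show "of_int \<lceil>log 2 (1 / \<delta>)\<rceil> = (of_nat \<Delta> :: rat)" by (rule rat)
  have "ln (1 / \<delta>) / ln 2 \<le> ln (1 / \<delta>) / (1 / 2)"
    using delta ln2_ge_two_thirds by (intro divide_left_mono ln_ge_zero mult_pos_pos) auto
  then show "real \<Delta> \<le> 2 * ln (1 / \<delta>) + 1"
    unfolding nat by (intro order_trans[OF of_int_ceiling_le_add_one]) (simp add: log_def)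
qed

sublocale drso_run I "word_bits I E \<Delta>" "loop_bound I E \<Delta> (oracle_bits I E)"
  "step_time I E \<Delta>" E \<Delta> \<pi> "oracle_bits I E"
proof
  let ?B = "word_bits I E \<Delta>"
  show "loop_bound I E \<Delta> (oracle_bits I E) \<le> 2 ^ ?B" by (rule le_two_power) (simp add: word_bits_def)
  show "2 * (2 * (40 * (?B + 1)) + 3) + 1 \<le> step_time I E \<Delta>" "1 + usize I \<le> step_time I E \<Delta>"
    unfolding step_time_def by linarith+
  show "oracle_cost I b \<le> step_time I E \<Delta>" if "b \<le> mdim I * (2 * ?B + 3) + usize I" for b
    using oracle_max_ge[OF that, of I] that unfolding step_time_def oracle_cost_def by linarith
qed (use assumptions accuracy_bounds(3) oracle_max_ge in \<open>auto simp: word_bits_def oracle_bits_def\<close>)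

abbreviation "params \<equiv> [of_nat m, of_nat
  (usize I), lam I, radius I, outer_rad I, inner_rad I, of_nat E, of_nat \<Delta>] :: rat list"
abbreviation "start \<equiv> fst (initial_config I \<epsilon> \<delta>)"

lemma start_apply:
  "start a i = (if a = costs_r then if i < m then cost1 I $ i else 0 else if a = input_r \<and>
    i < 8 then params ! i else 0)"
  using cost_dim accuracy_rat confidence_rat
  by (auto simp: initial_config_def set_vec_def input_params_def vec_of_list_index simp del: vec_of_list_Cons)

lemma start_inputs: "inputs start" "get_vec answer_r m start = 0\<^sub>v m"
  by (auto simp: inputs_def get_vec_def start_apply)

lemma start_fits: "mem_fits (word_bits I E \<Delta>) start"
proof -
  have "fits (word_bits I E \<Delta>) q" if "q \<in> set params" for q
    using that fits_input[THEN fits_mono] small_le_B dims_le fits_params(12) by (auto intro: fits_of_nat_le)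
  then have "fits (word_bits I E \<Delta>) (params ! i)" if "i < 8" for i using that nth_mem[of i params] by simp
  moreover have "fits (word_bits I E \<Delta>) (cost1 I $ i)" if "i < m" for i
    using fits_mono[OF fits_cost[OF that] small_le_B(1)] .
  ultimately show ?thesis by (simp only: mem_fits_def start_apply) (simp del: nth_Cons_numeral)
qed

lemma input_scale_ge:
  "real (isize I) \<le> input_scale I \<epsilon> \<delta>" "1 / \<epsilon> \<le> input_scale I \<epsilon> \<delta>" "1 / r \<le> input_scale I \<epsilon> \<delta>"
    "ln (1 / \<delta>) \<le> input_scale I \<epsilon> \<delta>"
proof -
  let ?q = "real_of_rat (lam I) / (\<epsilon> * r)"
  have "\<epsilon> * r \<le> \<epsilon> * 1" "\<epsilon> * r \<le> 1 * r" using eps r_pos by (intro mult_left_mono mult_right_mono; simp)+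
  then have "1 / \<epsilon> \<le> ?q" "1 / r \<le> ?q" using eps r_pos lam by (intro frac_le; simp)+
  moreover have "0 \<le> ln (1 / \<delta>)" "0 < 1 / \<epsilon>" "0 < 1 / r" using delta eps r_pos by simp_all
  ultimately show "real (isize I) \<le> input_scale I \<epsilon> \<delta>" "1 / \<epsilon> \<le> input_scale I \<epsilon> \<delta>" "1 / r \<le> input_scale I \<epsilon> \<delta>"
    "ln (1 / \<delta>) \<le> input_scale I \<epsilon> \<delta>"
    unfolding input_scale_def by linarith+
qed

lemma oracle_time_le: "real (orc_time I b) \<le> poly \<pi> (real (isize I + b))"
  using efficient(1) by (simp add: efficient_feas_def)

lemmas mdim_le = dims_le(1) and usize_le = dims_le(2) and n_top_bound = n_top_le and n_samples_bound = n_samples_le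
  and log_ratio_bound = log_ratio_le[OF fits_top_value_oracle_max]

lemma failure_le: "(1 / 2) ^ \<Delta> \<le> \<delta>"
proof -
  have "1 / \<delta> = 2 powr log 2 (1 / \<delta>)" using delta by simp
  also have "\<dots> \<le> 2 powr real \<Delta>" using confidence_bounds(1) by (intro powr_mono) auto
  finally have "1 / \<delta> \<le> 2 ^ \<Delta>" by (simp add: powr_realpow)
  then show ?thesis using delta by (simp add: field_simps)
qed

lemma factor_le: "2 * (1 + 1 / real E) ^ 3 \<le> 2 + 10 * \<epsilon>"
proof -
  have "1 / real E \<le> 1 / (1 / \<epsilon>)" using accuracy_bounds(1,3) eps by (intro divide_left_mono) auto
  then have "1 / real E \<le> \<epsilon>" by simp
  then have "(1 + 1 / real E) ^ 3 \<le> (1 + \<epsilon>) ^ 3" by (intro power_mono) auto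
  also have "\<dots> = 1 + \<epsilon> * (3 + 3 * \<epsilon> + \<epsilon> * \<epsilon>)" by (simp add: power3_eq_cube algebra_simps)
  also have "\<dots> \<le> 1 + \<epsilon> * 5"
  proof -
    have "\<epsilon> * \<epsilon> \<le> 1 * \<epsilon>" using eps by (intro mult_right_mono) auto
    then have "3 + 3 * \<epsilon> + \<epsilon> * \<epsilon> \<le> 5" using eps by linarith
    then show ?thesis using eps by (intro add_left_mono mult_left_mono) auto
  qed
  finally show ?thesis by simp
qed

lemma main_prog_outcome:
  obtains F :: "nat set list \<Rightarrow> config" and k where
    "exec I k main_prog (initial_config I \<epsilon> \<delta>) = map_spmf F (spmf_of_pmf (replicate_pmf N (center I)))"
    "\<And>ws. ws \<in> set_pmf (replicate_pmf N (center I)) \<Longrightarrow> answer I (F ws) \<in> feas I \<and> run_time (F ws) \<le> max_steps I E \<Delta>"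
    "1 - \<delta> \<le> measure_pmf.prob (replicate_pmf N (center I)) {ws. h (answer I (F ws)) \<le> (2 + 10 * \<epsilon>) * opt}"
proof -
  let ?P = "replicate_pmf N (center I)"
  obtain F where F: "runs I main_prog start ?P F"
    "\<And>ws. ws \<in> set_pmf ?P \<Longrightarrow> run_time (F ws) \<le> max_steps I E \<Delta> \<and> answer I (F ws) \<in> feas I"
    "1 - (1 / 2) ^ \<Delta> \<le> measure_pmf.prob ?P {ws. h (answer I (F ws)) \<le> 2 * (1 + 1 / real E) ^ 3 * opt}"
    using main_run[OF start_fits start_inputs] unfolding max_steps_def answer_def run_time_def by blast
  obtain k where "\<forall>t. exec I k main_prog (start, t) = map_spmf
    (\<lambda>ws. (fst (F ws), t + snd (F ws))) (spmf_of_pmf ?P)"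
    using F(1) unfolding runs_def by blast
  then have run: "exec I k main_prog (initial_config I \<epsilon> \<delta>) = map_spmf F (spmf_of_pmf ?P)"
    using spec[of _ 0] by (fastforce simp: initial_config_def)
  have "1 - \<delta> \<le> measure_pmf.prob ?P {ws. h (answer I (F ws)) \<le> 2 * (1 + 1 / real E) ^ 3 * opt}"
    using F(3) failure_le by linarith
  also have "\<dots> \<le> measure_pmf.prob ?P {ws. h (answer I (F ws)) \<le> (2 + 10 * \<epsilon>) * opt}"
    using mult_right_mono[OF factor_le opt_nonneg] by (intro measure_pmf.finite_measure_mono) auto
  finally show thesis using F(2) by (intro that[OF run]) auto
qed

end

abbreviation "polynomial \<pi> f \<equiv>
  poly_bounded {q. drso_query \<pi> (fst q) (fst (snd q)) (snd (snd q))}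
    (\<lambda>q. input_scale (fst q) (fst (snd q)) (snd (snd q)))
    (\<lambda>q. f (fst q) (accuracy (fst (snd q))) (confidence (snd (snd q))))"

lemma polynomial_mono:
  assumes "polynomial \<pi> g"
    "\<And>I \<epsilon> \<delta>. drso_query \<pi> I \<epsilon> \<delta> \<Longrightarrow> \<bar>f I (accuracy \<epsilon>) (confidence \<delta>)\<bar> \<le> g I (accuracy \<epsilon>) (confidence \<delta>)"
  shows "polynomial \<pi> f"
  using assms by (elim poly_bounded_mono) auto

lemma polynomial_of_linear:
  assumes "\<And>I \<epsilon> \<delta>. drso_query \<pi> I \<epsilon> \<delta> \<Longrightarrow> \<bar>f I (accuracy \<epsilon>) (confidence \<delta>)\<bar> \<le> b * input_scale I \<epsilon> \<delta> + a"
  shows "polynomial \<pi> f"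
  unfolding poly_bounded_def using assms by (intro exI[of _ "[:a, b:]"]) (auto simp: mult.commute add.commute)

lemma polynomial_isize: "polynomial \<pi> (\<lambda>I E \<Delta>. real (isize I))"
  by (rule polynomial_of_linear[where b = 1 and a = 0]) (use drso_query.input_scale_ge(1) in simp)

lemma polynomial_accuracy: "polynomial \<pi> (\<lambda>I E \<Delta>. real E)"
proof (rule polynomial_of_linear[where b = 1 and a = 1])
  fix I \<epsilon> \<delta> assume "drso_query \<pi> I \<epsilon> \<delta>"
  from drso_query.accuracy_bounds(2)[OF this] drso_query.input_scale_ge(2)[OF this]
  show "\<bar>real (accuracy \<epsilon>)\<bar> \<le> 1 * input_scale I \<epsilon> \<delta> + 1" by linarith
qed

lemma polynomial_confidence: "polynomial \<pi> (\<lambda>I E \<Delta>. real \<Delta>)"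
proof (rule polynomial_of_linear[where b = 2 and a = 1])
  fix I \<epsilon> \<delta> assume "drso_query \<pi> I \<epsilon> \<delta>"
  from drso_query.confidence_bounds(2)[OF this] drso_query.input_scale_ge(4)[OF this]
  show "\<bar>real (confidence \<delta>)\<bar> \<le> 2 * input_scale I \<epsilon> \<delta> + 1" by linarith
qed

lemma polynomial_inverse_radius: "polynomial \<pi> (\<lambda>I E \<Delta>. 1 / real_of_rat (radius I))"
proof (rule polynomial_of_linear[where b = 1 and a = 0])
  fix I \<epsilon> \<delta> assume "drso_query \<pi> I \<epsilon> \<delta>"
  then interpret drso_query \<pi> I \<epsilon> \<delta> .
  show "\<bar>1 / real_of_rat (radius I)\<bar> \<le> 1 * input_scale I \<epsilon> \<delta> + 0" using input_scale_ge(3) r_pos(1) by simp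
qed

lemma polynomial_mdim: "polynomial \<pi> (\<lambda>I E \<Delta>. real (mdim I))"
  by (rule polynomial_mono[OF polynomial_isize]) (use drso_query.mdim_le in simp)

lemma polynomial_usize: "polynomial \<pi> (\<lambda>I E \<Delta>. real (usize I))"
  by (rule polynomial_mono[OF polynomial_isize]) (use drso_query.usize_le in simp)

lemmas polynomial_inputs = polynomial_isize polynomial_accuracy polynomial_confidence polynomial_mdim
  polynomial_usize
lemmas real_simps = of_nat_add of_nat_mult of_nat_numeral of_nat_1

lemma polynomial_oracle_max:
  assumes "polynomial \<pi> (\<lambda>I E \<Delta>. real (n I E \<Delta>))"
  shows "polynomial \<pi> (\<lambda>I E \<Delta>. real (oracle_max I (n I E \<Delta>)))"
proof (rule polynomial_mono)
  show "polynomial \<pi> (\<lambda>I E \<Delta>. poly (map_poly abs \<pi>) (real (isize I) + real (n I E \<Delta>)))"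
    by (intro poly_bounded_poly poly_bounded_add polynomial_isize assms)
  fix I \<epsilon> \<delta> assume query: "drso_query \<pi> I \<epsilon> \<delta>"
  let ?n = "n I (accuracy \<epsilon>) (confidence \<delta>)"
  obtain b where b: "b \<le> ?n" "oracle_max I ?n = orc_time I b" using oracle_max_attained by blast
  have "real (orc_time I b) \<le> poly \<pi> (real (isize I + b))" by (rule drso_query.oracle_time_le[OF query])
  also have "\<dots> \<le> poly (map_poly abs \<pi>) (real (isize I) + real ?n)"
    using abs_poly_le_poly_abs[of "real (isize I + b)" "real (isize I) + real ?n" \<pi>] b(1) by simp
  finally show "\<bar>real (oracle_max I ?n)\<bar> \<le> poly (map_poly abs \<pi>) (real (isize I) + real ?n)" using b(2) by simp
qed

lemma polynomial_ratio_bits: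
  assumes "polynomial \<pi> (\<lambda>I E \<Delta>. real (n I E \<Delta>))"
  shows "polynomial \<pi> (\<lambda>I E \<Delta>. real (ratio_bits I E (n I E \<Delta>)))"
  unfolding ratio_bits_def real_simps by (intro poly_bounded_intros polynomial_inputs assms)

lemma polynomial_log_ratio: "polynomial \<pi> (\<lambda>I E \<Delta>. real (log_ratio I E))"
proof (rule polynomial_mono)
  show "polynomial \<pi> (\<lambda>I E \<Delta>. real (ratio_bits I E (oracle_max I (3 * mdim I + usize I))))"
    by (intro polynomial_ratio_bits polynomial_oracle_max) (unfold real_simps, intro poly_bounded_intros polynomial_inputs)
qed (use drso_query.log_ratio_bound in simp)

lemma polynomial_n_cuts: "polynomial \<pi> (\<lambda>I E \<Delta>. real (n_cuts I E))"
  unfolding n_cuts_def grid_den_def real_simps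
  by (intro poly_bounded_intros polynomial_inputs polynomial_log_ratio)

lemma polynomial_log_points: "polynomial \<pi> (\<lambda>I E \<Delta>. real (log_points I E))"
  unfolding log_points_def grid_den_def real_simps
  by (intro poly_bounded_intros polynomial_inputs polynomial_log_ratio polynomial_n_cuts)

lemma polynomial_n_top: "polynomial \<pi> (\<lambda>I E \<Delta>. real (n_top I))"
proof (rule polynomial_mono)
  show "polynomial \<pi> (\<lambda>I E \<Delta>. 1 / real_of_rat (radius I) + 1)"
    by (intro poly_bounded_intros polynomial_inverse_radius)
qed (use drso_query.n_top_bound in simp)

lemma polynomial_n_samples: "polynomial \<pi> (\<lambda>I E \<Delta>. real (n_samples I E \<Delta>))"
proof (rule polynomial_mono)
  show "polynomial \<pi> (\<lambda>I E \<Delta>. 16 * real E ^ 2 * (1 / real_of_rat (radius I)) ^ 4 *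
    (real (usize I) + real (log_points I E) + 2 + real \<Delta>) + 1)"
    by (intro poly_bounded_intros poly_bounded_power polynomial_inputs polynomial_inverse_radius polynomial_log_points)
qed (use drso_query.n_samples_bound in simp)

lemmas polynomial_counts = polynomial_n_cuts polynomial_log_points polynomial_n_top polynomial_n_samples

lemma polynomial_vertex_bits: "polynomial \<pi> (\<lambda>I E \<Delta>. real (vertex_bits I E))"
  unfolding vertex_bits_def grid_den_def real_simps
  by (intro poly_bounded_intros polynomial_inputs polynomial_counts)

lemma polynomial_point_bits: "polynomial \<pi> (\<lambda>I E \<Delta>. real (point_bits I E))"
  unfolding point_bits_def grid_den_def real_simps
  by (intro poly_bounded_intros polynomial_inputs polynomial_counts)

lemma polynomial_oracle_bits: "polynomial \<pi> (\<lambda>I E \<Delta>. real (oracle_bits I E))"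
  unfolding oracle_bits_def
  by (rule polynomial_oracle_max) (unfold real_simps, intro poly_bounded_intros polynomial_inputs polynomial_point_bits)

lemma polynomial_weight_bits: "polynomial \<pi> (\<lambda>I E \<Delta>. real (weight_bits I E \<Delta>))"
  unfolding weight_bits_def real_simps by (intro poly_bounded_intros polynomial_inputs polynomial_counts)

lemma polynomial_term_bits: "polynomial \<pi> (\<lambda>I E \<Delta>. real (term_bits I E \<Delta> (oracle_bits I E)))"
  unfolding term_bits_def real_simps
  by (intro poly_bounded_intros polynomial_counts polynomial_weight_bits polynomial_oracle_bits)

lemma polynomial_normal_bits: "polynomial \<pi> (\<lambda>I E \<Delta>. real (normal_bits I E \<Delta> (oracle_bits I E)))"
  unfolding normal_bits_def real_simps
  by (intro poly_bounded_intros polynomial_inputs polynomial_term_bits polynomial_oracle_bits)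

lemma polynomial_loop_bound: "polynomial \<pi> (\<lambda>I E \<Delta>. real (loop_bound I E \<Delta> (oracle_bits I E)))"
  unfolding loop_bound_def real_simps
  by (intro poly_bounded_intros polynomial_inputs polynomial_counts polynomial_ratio_bits polynomial_oracle_bits)

lemma polynomial_word_bits: "polynomial \<pi> (\<lambda>I E \<Delta>. real (word_bits I E \<Delta>))"
  unfolding word_bits_def cell_bits_def grid_den_def real_simps
  by (intro poly_bounded_intros polynomial_inputs polynomial_counts polynomial_ratio_bits polynomial_oracle_bits polynomial_loop_bound
    polynomial_point_bits polynomial_vertex_bits polynomial_weight_bits polynomial_term_bits polynomial_normal_bits)

lemma polynomial_step_time: "polynomial \<pi> (\<lambda>I E \<Delta>. real (step_time I E \<Delta>))"
  unfolding step_time_def real_simps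
  by (intro poly_bounded_intros polynomial_inputs polynomial_word_bits polynomial_oracle_max)
    (unfold real_simps, intro poly_bounded_intros polynomial_inputs polynomial_word_bits)

lemma polynomial_max_steps: "polynomial \<pi> (\<lambda>I E \<Delta>. real (max_steps I E \<Delta>))"
  unfolding max_steps_def real_simps
  by (intro poly_bounded_mult poly_bounded_ticks polynomial_loop_bound polynomial_step_time)

theorem theorem4p1:
  shows "\<exists>(C::real) (prog::com). \<forall>\<pi>::real poly. \<exists>Q::real poly.
    \<forall>(I::drso) (\<epsilon>::real) (\<delta>::real).
      standing_assumptions \<pi> I \<and> monotone_recourse I \<and>
      0 < \<epsilon> \<and> \<epsilon> \<le> 1 / 3 \<and> 0 < \<delta> \<and> \<delta> < 1 \<longrightarrow>
      (\<exists>k. let D = exec I k prog (initial_config I \<epsilon> \<delta>) in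
         lossless_spmf D \<and>
         (\<forall>s\<in>set_spmf D.
            answer I s \<in> feas I \<and>
            real (run_time s)
              \<le> poly Q (real (isize I) + real_of_rat (lam I) / (\<epsilon> * real_of_rat (radius I))
                         + ln (1 / \<delta>))) \<and>
         measure (measure_spmf D)
           {s. robust_cost I (answer I s) \<le> (2 + C * \<epsilon>) * (INF x\<in>feas I. robust_cost I x)}
           \<ge> 1 - \<delta>)"
proof (intro exI[of _ "10::real"] exI[of _ main_prog] allI, goal_cases)
  case (1 \<pi>)
  obtain Q where time: "real (max_steps I (accuracy \<epsilon>) (confidence \<delta>)) \<le> poly Q (input_scale I \<epsilon> \<delta>)"
    if "drso_query \<pi> I \<epsilon> \<delta>" for I \<epsilon> \<delta>
    using polynomial_max_steps[of \<pi>] unfolding poly_bounded_def by auto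
  show ?case
  proof (intro exI[of _ Q] allI impI, goal_cases)
    case (1 I \<epsilon> \<delta>)
    then interpret drso_query \<pi> I \<epsilon> \<delta> by unfold_locales auto
    let ?P = "replicate_pmf N (center I)"
    obtain F k where F: "exec I k main_prog (initial_config I \<epsilon> \<delta>) = map_spmf F (spmf_of_pmf ?P)"
      "\<And>ws. ws \<in> set_pmf ?P \<Longrightarrow> answer I (F ws) \<in> feas I \<and> run_time (F ws) \<le> max_steps I E \<Delta>"
      "1 - \<delta> \<le> measure_pmf.prob ?P {ws. h (answer I (F ws)) \<le> (2 + 10 * \<epsilon>) * opt}"
      using main_prog_outcome by blast
    have "real (run_time (F ws)) \<le> poly Q (input_scale I \<epsilon> \<delta>)" if "ws \<in> set_pmf ?P" for ws
      using F(2)[OF that] time[OF drso_query_axioms] by linarith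
    then show ?case using F unfolding Let_def input_scale_def
      by (intro exI[of _ k]) (auto simp: measure_map_spmf measure_spmf_spmf_of_pmf vimage_def)
  qed
qed

end
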